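(* Let $k$ be an algebraically closed field of characteristic $p>0$, $A=k[[\pi]]$, $K=\mathrm{Frac}(A)$, $S=\mathrm{Spec}(A)$, $\overline{K}$ an algebraic closure of $K$, $I$ the absolute Galois group of $K$ and $I_t$ its tame quotient. Let $G$ be a connected HW-cyclic Barsotti-Tate group over $S$ with Hasse invariant $h(G)=1$, put $c=\dim(G^\vee)$, and let $G(1)$ be the kernel of multiplication by $p$ on $G$. Then the action of $I$ on $G(1)(\overline{K})$ is tame; moreover, $G(1)(\overline{K})$ is an $\mathbb{F}_{p^c}$-vector space of dimension $1$ on which the induced action of $I_t$ is given by the surjective character $\theta_{p^c-1}:I_t\to\mathbb{F}_{p^c}^\times$.
   Context: $\mathtt{v}$ is the valuation on $K$ with $\mathtt{v}(\pi)=1$. $K^{\mathrm{sep}}$ is the separable closure of $K$ in $\overline{K}$, $I=\mathrm{Gal}(K^{\mathrm{sep}}/K)$, $I_p\subset I$ is the wild inertia subgroup, $I_t=I/I_p$ is the tame inertia group. An action of $I$ is tame if $I_p$ acts trivially. There is a canonical isomorphism $\theta:I_t\simeq\varprojlim_{(d,p)=1}\mu_d(k)$, and $\theta_d:I_t\to\mu_d(k)$ denotes its component at $d$ (given by $g\mapsto g(\pi^{1/d})/\pi^{1/d}$). For $q$ a power of $p$, $\mathbb{F}_q\subset k$ is the subfield with $q$ elements, $\mu_{q-1}(k)=\mathbb{F}_q^\times$, and $\theta_{q-1}:I_t\to\mathbb{F}_q^\times$ is a surjective character. For a BT-group $G$ over $S$, $G^\vee$ is its Serre dual. The Hasse-Witt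 map $\varphi_G:\mathrm{Lie}(G^\vee)\to\mathrm{Lie}(G^\vee)$ is the Frobenius-semilinear endomorphism induced by the Frobenius of $\mathbb{G}_a$ under $\mathrm{Lie}(G^\vee)\simeq\mathcal{H}om_{\mathrm{fppf}}(G(1),\mathbb{G}_a)$ (equivalently by the Frobenius of $G$, or the Verschiebung of $G^\vee$). $G$ is HW-cyclic if $c=\dim(G^\vee)\ge1$ and there is $v\in\mathrm{Lie}(G^\vee)$ such that $v,\varphi_G(v),\dots,\varphi_G^{c-1}(v)$ generate $\mathrm{Lie}(G^\vee)$ over $A$. The Hasse invariant $h(G)$ is the valuation of the determinant of a matrix of $\varphi_G$ (independent of the choice of basis). *)

theory Defs
  imports
    "HOL-Algebra.Algebra"
    "HOL-Algebra.Algebraic_Closure_Type"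
    "HOL-Analysis.Abstract_Topology"
    "HOL-Computational_Algebra.Formal_Laurent_Series"
    "HOL-Library.Extended_Nat"
    "Jordan_Normal_Form.Determinant"
    "Jordan_Normal_Form.Missing_VectorSpace"
begin

section \<open>Finite free commutative group schemes\<close>

text \<open>
  A finite locally free group scheme over a local ring \<open>A\<close> is affine, and its coordinate ring is a
  Hopf algebra which is free of finite rank over \<open>A\<close>. After the choice of a basis
  \<open>e\<^sub>0, \<dots>, e\<^sub>n\<^sub>-\<^sub>1\<close> such a bialgebra is given by its structure constants:
  \<open>e\<^sub>i e\<^sub>j = \<Sum>\<^sub>k mlt i j k e\<^sub>k\<close>, \<open>1 = \<Sum>\<^sub>k unt k e\<^sub>k\<close>,
  \<open>\<Delta> e\<^sub>k = \<Sum>\<^sub>i\<^sub>,\<^sub>j cml k i j (e\<^sub>i \<otimes> e\<^sub>j)\<close> and \<open>\<epsilon> e\<^sub>k = cnt k\<close>.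
  Elements of the coordinate ring are coordinate vectors, and elements of its tensor square are
  \<open>n \<times> n\<close> matrices, the matrix unit at \<open>(i, j)\<close> being \<open>e\<^sub>i \<otimes> e\<^sub>j\<close>.
\<close>

record 'a bialg =
  rnk :: nat
  mlt :: "nat \<Rightarrow> nat \<Rightarrow> nat \<Rightarrow> 'a"
  unt :: "nat \<Rightarrow> 'a"
  cml :: "nat \<Rightarrow> nat \<Rightarrow> nat \<Rightarrow> 'a"
  cnt :: "nat \<Rightarrow> 'a"

abbreviation elts :: "'a bialg \<Rightarrow> 'a vec set" where
  "elts H \<equiv> carrier_vec (rnk H)"

definition tensor :: "'a::comm_ring_1 bialg \<Rightarrow> 'a vec \<Rightarrow> 'a vec \<Rightarrow> 'a mat" where
  "tensor H x y = mat (rnk H) (rnk H) (\<lambda>(i, j). x $ i * y $ j)"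

text \<open>The multiplication as a linear map on the tensor square.\<close>

definition mu :: "'a::comm_ring_1 bialg \<Rightarrow> 'a mat \<Rightarrow> 'a vec" where
  "mu H t = vec (rnk H) (\<lambda>k. \<Sum>i<rnk H. \<Sum>j<rnk H. t $$ (i, j) * mlt H i j k)"

definition coord_ring :: "'a::comm_ring_1 bialg \<Rightarrow> 'a vec ring" where
  "coord_ring H =
    \<lparr>carrier = elts H, monoid.mult = (\<lambda>x y. mu H (tensor H x y)), one = vec (rnk H) (unt H),
     ring.zero = 0\<^sub>v (rnk H), add = (+)\<rparr>"

definition tensor_square_ring :: "'a::comm_ring_1 bialg \<Rightarrow> 'a mat ring" where
  "tensor_square_ring H =
    \<lparr>carrier = carrier_mat (rnk H) (rnk H),
     monoid.mult = (\<lambda>s t. mat (rnk H) (rnk H) (\<lambda>(k, l).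
       \<Sum>a<rnk H. \<Sum>b<rnk H. \<Sum>c<rnk H. \<Sum>d<rnk H.
         s $$ (a, b) * t $$ (c, d) * (mlt H a c k * mlt H b d l))),
     one = mat (rnk H) (rnk H) (\<lambda>(i, j). unt H i * unt H j),
     ring.zero = 0\<^sub>m (rnk H) (rnk H), add = (+)\<rparr>"

definition comul :: "'a::comm_ring_1 bialg \<Rightarrow> 'a vec \<Rightarrow> 'a mat" where
  "comul H x = mat (rnk H) (rnk H) (\<lambda>(i, j). \<Sum>k<rnk H. x $ k * cml H k i j)"

definition counit :: "'a::comm_ring_1 bialg \<Rightarrow> 'a vec \<Rightarrow> 'a" where
  "counit H x = (\<Sum>k<rnk H. x $ k * cnt H k)"

text \<open>
  For matrices \<open>E\<close>, \<open>F\<close> of linear maps the map \<open>E \<otimes> F\<close> on the tensor square is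
  \<open>t \<mapsto> E t F\<^sup>T\<close>; thus \<open>S * comul H x\<close> in the antipode axiom is \<open>(S \<otimes> id) (\<Delta> x)\<close>.
\<close>

definition comm_group_scheme :: "'a::comm_ring_1 bialg \<Rightarrow> bool" where
  "comm_group_scheme H \<longleftrightarrow>
    cring (coord_ring H) \<and>
    comul H \<in> Ring.ring_hom (coord_ring H) (tensor_square_ring H) \<and>
    counit H \<in> Ring.ring_hom (coord_ring H) ring_of_type_algebra \<and>
    (\<forall>k<rnk H. \<forall>a<rnk H. \<forall>b<rnk H. \<forall>c<rnk H.
      (\<Sum>i<rnk H. cml H k i c * cml H i a b) = (\<Sum>i<rnk H. cml H k a i * cml H i b c)) \<and>
    (\<forall>k<rnk H. \<forall>i<rnk H. \<forall>j<rnk H. cml H k i j = cml H k j i) \<and>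
    (\<forall>k<rnk H. \<forall>j<rnk H. (\<Sum>i<rnk H. cnt H i * cml H k i j) = (if j = k then 1 else 0)) \<and>
    (\<exists>S\<in>carrier_mat (rnk H) (rnk H). \<forall>x\<in>elts H.
      mu H (S * comul H x) = counit H x \<cdot>\<^sub>v \<one>\<^bsub>coord_ring H\<^esub>)"

text \<open>
  \<open>F\<close> is the matrix of the homomorphism of coordinate rings, so this is a homomorphism of group
  schemes from \<open>H'\<close> to \<open>H\<close>.
\<close>

definition bialg_hom :: "'a::comm_ring_1 bialg \<Rightarrow> 'a bialg \<Rightarrow> 'a mat \<Rightarrow> bool" where
  "bialg_hom H H' F \<longleftrightarrow>
    F \<in> carrier_mat (rnk H') (rnk H) \<and>
    (\<lambda>x. F *\<^sub>v x) \<in> Ring.ring_hom (coord_ring H) (coord_ring H') \<and>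
    (\<forall>x\<in>elts H. comul H' (F *\<^sub>v x) = F * comul H x * transpose_mat F)"

text \<open>The matrix of the endomorphism of the coordinate ring induced by multiplication by \<open>m\<close>.\<close>

primrec mult_by :: "'a::comm_ring_1 bialg \<Rightarrow> nat \<Rightarrow> 'a mat" where
  "mult_by H 0 = mat (rnk H) (rnk H) (\<lambda>(k, l). unt H k * cnt H l)"
| "mult_by H (Suc m) = mat (rnk H) (rnk H) (\<lambda>(k, l).
     mu H (comul H (unit_vec (rnk H) l) * transpose_mat (mult_by H m)) $ k)"

text \<open>The coordinate ring of the Cartier dual is the linear dual, with the dual basis.\<close>

definition cartier_dual :: "'a bialg \<Rightarrow> 'a bialg" where
  "cartier_dual H =
    \<lparr>rnk = rnk H, mlt = (\<lambda>i j k. cml H k i j), unt = cnt H,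
     cml = (\<lambda>k i j. mlt H i j k), cnt = unt H\<rparr>"

text \<open>
  The Lie algebra: derivations of the coordinate ring into the base ring at the unit section. The
  functional with values \<open>D $ i\<close> on the basis is written as the vector \<open>D\<close>.
\<close>

definition lie :: "'a::comm_ring_1 bialg \<Rightarrow> 'a vec set" where
  "lie H = {D \<in> elts H. \<forall>x\<in>elts H. \<forall>y\<in>elts H.
     D \<bullet> (x \<otimes>\<^bsub>coord_ring H\<^esub> y) = counit H x * (D \<bullet> y) + counit H y * (D \<bullet> x)}"

text \<open>
  A functional on the linear dual is, in coordinates, an element of the coordinate ring itself.
  Hence the isomorphism between the Lie algebra of the Cartier dual and the homomorphisms into the
  additive group (which are the primitive elements of the coordinate ring) is an equality here.
\<close>

lemma lie_cartier_dual:
  fixes H :: "'a::comm_ring_1 bialg"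
  shows "lie (cartier_dual H) =
    {x \<in> elts H. comul H x = tensor H x \<one>\<^bsub>coord_ring H\<^esub> + tensor H \<one>\<^bsub>coord_ring H\<^esub> x}"
proof -
  define n where "n = rnk H"
  let ?D = "cartier_dual H"
  have n: "rnk H = n" "rnk ?D = n"
    by (simp_all add: n_def cartier_dual_def)
  have mult: "x \<otimes>\<^bsub>coord_ring ?D\<^esub> y =
      vec n (\<lambda>k. \<Sum>i<n. \<Sum>j<n. x $ i * y $ j * cml H k i j)" for x y
    by (auto simp: coord_ring_def mu_def tensor_def cartier_dual_def n intro!: eq_vecI sum.cong)
  have counit: "counit ?D x = (\<Sum>k<n. x $ k * unt H k)" for x
    by (simp add: counit_def n cartier_dual_def)
  have dot: "v \<bullet> w = (\<Sum>k<n. v $ k * w $ k)" if "w \<in> carrier_vec n" for v w :: "'a vec"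
    using that by (simp add: scalar_prod_def atLeast0LessThan)
  have prod: "d \<bullet> (x \<otimes>\<^bsub>coord_ring ?D\<^esub> y) =
      (\<Sum>i<n. \<Sum>j<n. x $ i * y $ j * (\<Sum>k<n. d $ k * cml H k i j))" for d x y
  proof -
    have "d \<bullet> (x \<otimes>\<^bsub>coord_ring ?D\<^esub> y) =
        (\<Sum>k<n. \<Sum>i<n. \<Sum>j<n. x $ i * y $ j * (d $ k * cml H k i j))"
      by (subst dot) (auto simp: mult sum_distrib_left mult_ac intro!: sum.cong)
    also have "\<dots> = (\<Sum>i<n. \<Sum>k<n. \<Sum>j<n. x $ i * y $ j * (d $ k * cml H k i j))"
      by (rule sum.swap)
    also have "\<dots> = (\<Sum>i<n. \<Sum>j<n. \<Sum>k<n. x $ i * y $ j * (d $ k * cml H k i j))"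
      by (intro sum.cong refl sum.swap)
    finally show ?thesis by (simp add: sum_distrib_left)
  qed
  have rhs: "counit ?D x * (d \<bullet> y) + counit ?D y * (d \<bullet> x) =
      (\<Sum>i<n. \<Sum>j<n. x $ i * y $ j * (d $ i * unt H j + unt H i * d $ j))"
    if "x \<in> carrier_vec n" "y \<in> carrier_vec n" for d x y
    unfolding counit dot[OF that(1)] dot[OF that(2)] sum_product
    by (subst (2) sum.swap) (simp add: sum.distrib[symmetric] algebra_simps)
  have prim: "comul H d = tensor H d \<one>\<^bsub>coord_ring H\<^esub> + tensor H \<one>\<^bsub>coord_ring H\<^esub> d \<longleftrightarrow>
      (\<forall>i<n. \<forall>j<n. (\<Sum>k<n. d $ k * cml H k i j) = d $ i * unt H j + unt H i * d $ j)" for d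
    by (auto simp: comul_def tensor_def coord_ring_def n mat_eq_iff)
  have "(\<forall>x\<in>carrier_vec n. \<forall>y\<in>carrier_vec n. d \<bullet> (x \<otimes>\<^bsub>coord_ring ?D\<^esub> y) =
          counit ?D x * (d \<bullet> y) + counit ?D y * (d \<bullet> x)) \<longleftrightarrow>
        (\<forall>i<n. \<forall>j<n. (\<Sum>k<n. d $ k * cml H k i j) = d $ i * unt H j + unt H i * d $ j)"
    (is "?A \<longleftrightarrow> ?B") for d
  proof
    assume A: ?A
    show ?B
    proof (intro allI impI)
      fix a b assume ab: "a < n" "b < n"
      have pick: "(\<Sum>i<n. \<Sum>j<n. unit_vec n a $ i * unit_vec n b $ j * f i j) = f a b"
        for f :: "nat \<Rightarrow> nat \<Rightarrow> 'a"
      proof -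
        have "(\<Sum>i<n. \<Sum>j<n. unit_vec n a $ i * unit_vec n b $ j * f i j) =
            (\<Sum>i<n. \<Sum>j<n. if i = a then (if j = b then f i j else 0) else 0)"
          using ab by (intro sum.cong refl) auto
        also have "\<dots> = (\<Sum>i<n. if i = a then (\<Sum>j<n. if j = b then f i j else 0) else 0)"
          by (intro sum.cong refl) auto
        also have "\<dots> = f a b" using ab by simp
        finally show ?thesis .
      qed
      have "unit_vec n a \<in> carrier_vec n" "unit_vec n b \<in> carrier_vec n" by simp_all
      with A have "d \<bullet> (unit_vec n a \<otimes>\<^bsub>coord_ring ?D\<^esub> unit_vec n b) =
          counit ?D (unit_vec n a) * (d \<bullet> unit_vec n b) +
          counit ?D (unit_vec n b) * (d \<bullet> unit_vec n a)" by blast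
      then show "(\<Sum>k<n. d $ k * cml H k a b) = d $ a * unt H b + unt H a * d $ b"
        unfolding prod rhs[OF unit_vec_carrier unit_vec_carrier] pick .
    qed
  next
    assume ?B
    then show ?A
      by (auto simp: prod rhs intro!: sum.cong)
  qed
  then show ?thesis
    unfolding lie_def n prim by auto
qed

section \<open>The Zariski topology on the spectrum\<close>

definition zariski :: "('a, 'b) ring_scheme \<Rightarrow> 'a set topology" where
  "zariski R = topology_generated_by ((\<lambda>f. {P. primeideal P R \<and> f \<notin> P}) ` carrier R)"

section \<open>Barsotti--Tate groups\<close>

text \<open>
  A Barsotti--Tate group is given by its truncations \<open>G(n)\<close> and the homomorphisms of coordinate
  rings of the inclusions of \<open>G(n)\<close> into \<open>G(n+1)\<close>.
\<close>

record 'a bt =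
  lvl :: "nat \<Rightarrow> 'a bialg"
  trn :: "nat \<Rightarrow> 'a mat"

text \<open>
  The last two conditions say that \<open>G(n)\<close> is embedded in \<open>G(n+1)\<close> as the kernel of multiplication
  by \<open>p\<^sup>n\<close>, whose ideal is generated by the image of the augmentation ideal.
\<close>

definition barsotti_tate :: "nat \<Rightarrow> 'a::comm_ring_1 bt \<Rightarrow> bool" where
  "barsotti_tate p G \<longleftrightarrow>
    (\<exists>h. \<forall>n. rnk (lvl G n) = p ^ (h * n)) \<and>
    (\<forall>n. comm_group_scheme (lvl G n) \<and>
      bialg_hom (lvl G (Suc n)) (lvl G n) (trn G n) \<and>
      (\<lambda>x. trn G n *\<^sub>v x) ` elts (lvl G (Suc n)) = elts (lvl G n) \<and>
      {x \<in> elts (lvl G (Suc n)). trn G n *\<^sub>v x = 0\<^sub>v (rnk (lvl G n))} =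
        genideal (coord_ring (lvl G (Suc n)))
          ((\<lambda>x. mult_by (lvl G (Suc n)) (p ^ n) *\<^sub>v x) `
            {x \<in> elts (lvl G (Suc n)). counit (lvl G (Suc n)) x = 0}))"

definition connected_bt :: "'a::comm_ring_1 bt \<Rightarrow> bool" where
  "connected_bt G \<longleftrightarrow> (\<forall>n. connected_space (zariski (coord_ring (lvl G n))))"

text \<open>
  The transition maps of the Serre dual are dual to the homomorphisms from \<open>G(n+1)\<close> to \<open>G(n)\<close>
  induced by multiplication by \<open>p\<close>; \<open>J\<close> below is the matrix of such a homomorphism on coordinate
  rings.
\<close>

definition serre_dual :: "nat \<Rightarrow> 'a::comm_ring_1 bt \<Rightarrow> 'a bt" where
  "serre_dual p G =
    \<lparr>lvl = (\<lambda>n. cartier_dual (lvl G n)),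
     trn = (\<lambda>n. transpose_mat (THE J. J \<in> carrier_mat (rnk (lvl G (Suc n))) (rnk (lvl G n)) \<and>
              J * trn G n = mult_by (lvl G (Suc n)) p))\<rparr>"

text \<open>Over a base ring of characteristic \<open>p\<close> the Lie algebras of \<open>G\<close> and \<open>G(1)\<close> agree.\<close>

definition bt_lie :: "'a::comm_ring_1 bt \<Rightarrow> 'a vec set" where
  "bt_lie G = lie (lvl G 1)"

section \<open>Submodules of a finite free module\<close>

definition lin_span :: "nat \<Rightarrow> 'a::comm_ring_1 vec list \<Rightarrow> 'a vec set" where
  "lin_span n bs = (\<lambda>a. mat_of_cols n bs *\<^sub>v a) ` carrier_vec (length bs)"

definition is_basis :: "nat \<Rightarrow> 'a::comm_ring_1 vec set \<Rightarrow> 'a vec list \<Rightarrow> bool" where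
  "is_basis n M bs \<longleftrightarrow> set bs \<subseteq> carrier_vec n \<and>
    bij_betw (\<lambda>a. mat_of_cols n bs *\<^sub>v a) (carrier_vec (length bs)) M"

definition free_rank :: "nat \<Rightarrow> 'a::comm_ring_1 vec set \<Rightarrow> nat" where
  "free_rank n M = (THE r. \<exists>bs. is_basis n M bs \<and> length bs = r)"

definition bt_dim :: "'a::comm_ring_1 bt \<Rightarrow> nat" where
  "bt_dim G = free_rank (rnk (lvl G 1)) (bt_lie G)"

section \<open>The Hasse--Witt map\<close>

text \<open>
  On a homomorphism from \<open>G(1)\<close> to the additive group, that is, on a primitive element of the
  coordinate ring of \<open>G(1)\<close>, the Frobenius of the additive group acts by raising to the power \<open>p\<close>
  (see \<open>lie_cartier_dual\<close>).
\<close>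

definition hasse_witt :: "nat \<Rightarrow> 'a::comm_ring_1 bt \<Rightarrow> 'a vec \<Rightarrow> 'a vec" where
  "hasse_witt p G x = x [^]\<^bsub>coord_ring (lvl G 1)\<^esub> p"

definition hw_cyclic :: "nat \<Rightarrow> 'a::comm_ring_1 bt \<Rightarrow> bool" where
  "hw_cyclic p G \<longleftrightarrow>
    bt_dim (serre_dual p G) \<ge> 1 \<and>
    (\<exists>v\<in>bt_lie (serre_dual p G).
      lin_span (rnk (lvl G 1)) (map (\<lambda>i. (hasse_witt p G ^^ i) v) [0..<bt_dim (serre_dual p G)])
        = bt_lie (serre_dual p G))"

definition fps_val :: "'k::zero fps \<Rightarrow> enat" where
  "fps_val f = (if f = 0 then \<infinity> else enat (subdegree f))"

definition is_hasse_witt_matrix ::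
  "nat \<Rightarrow> 'a::comm_ring_1 bt \<Rightarrow> 'a vec list \<Rightarrow> 'a mat \<Rightarrow> bool" where
  "is_hasse_witt_matrix p G bs M \<longleftrightarrow>
    M \<in> carrier_mat (length bs) (length bs) \<and>
    (\<forall>j<length bs. hasse_witt p G (bs ! j) = mat_of_cols (rnk (lvl G 1)) bs *\<^sub>v col M j)"

definition hasse_invariant :: "nat \<Rightarrow> 'k::field fps bt \<Rightarrow> enat" where
  "hasse_invariant p G = (THE h. \<exists>bs M.
     is_basis (rnk (lvl G 1)) (bt_lie (serre_dual p G)) bs \<and>
     is_hasse_witt_matrix p G bs M \<and> h = fps_val (det M))"


section \<open>Geometric points\<close>

text \<open>The points with values in a ring \<open>'l\<close> which is an algebra over \<open>'a\<close> by means of \<open>j\<close>.\<close>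

definition points :: "('a::comm_ring_1 \<Rightarrow> 'l::comm_ring_1) \<Rightarrow> 'a bialg \<Rightarrow> ('a vec \<Rightarrow> 'l) monoid" where
  "points j H =
    \<lparr>carrier = {f \<in> extensional (elts H). f \<in> Ring.ring_hom (coord_ring H) ring_of_type_algebra \<and>
                 (\<forall>a. \<forall>x\<in>elts H. f (a \<cdot>\<^sub>v x) = j a * f x)},
     monoid.mult = (\<lambda>f g. \<lambda>x\<in>elts H. \<Sum>i<rnk H. \<Sum>l<rnk H.
       j (comul H x $$ (i, l)) * (f (unit_vec (rnk H) i) * g (unit_vec (rnk H) l))),
     one = (\<lambda>x\<in>elts H. j (counit H x))\<rparr>"

text \<open>A commutative group, written additively, with a scalar multiplication.\<close>

definition with_smult :: "'b monoid \<Rightarrow> ('s \<Rightarrow> 'b \<Rightarrow> 'b) \<Rightarrow> ('s, 'b) module" where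
  "with_smult M s =
    \<lparr>carrier = carrier M, monoid.mult = undefined, one = undefined,
     ring.zero = \<one>\<^bsub>M\<^esub>, add = monoid.mult M, module.smult = s\<rparr>"

section \<open>The absolute Galois group of the field of Laurent series\<close>

definition is_alg_closure :: "('a::field \<Rightarrow> 'l::alg_closed_field) \<Rightarrow> bool" where
  "is_alg_closure \<iota> \<longleftrightarrow>
    field_hom \<iota> \<and>
    (\<forall>x. \<exists>q. q \<noteq> 0 \<and> poly (map_poly \<iota> q) x = 0)"

definition sep_closure :: "('a::field \<Rightarrow> 'l::field) \<Rightarrow> 'l set" where
  "sep_closure \<iota> = {x. \<exists>q. comm_semiring_1_class.irreducible q \<and>
     rsquarefree (map_poly \<iota> q) \<and> poly (map_poly \<iota> q) x = 0}"

definition abs_galois :: "('a::field \<Rightarrow> 'l::field) \<Rightarrow> ('l \<Rightarrow> 'l) monoid" where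
  "abs_galois \<iota> = (BijGroup (sep_closure \<iota>))
    \<lparr>carrier := {g \<in> Bij (sep_closure \<iota>).
      (\<forall>x\<in>sep_closure \<iota>. \<forall>y\<in>sep_closure \<iota>. g (x + y) = g x + g y \<and> g (x * y) = g x * g y) \<and>
      (\<forall>a. g (\<iota> a) = \<iota> a)}\<rparr>"

text \<open>
  The algebraic closure is purely inseparable over the separable closure, so every element of the
  Galois group extends uniquely to an automorphism of the algebraic closure.
\<close>

definition galois_ext :: "('a::field \<Rightarrow> 'l::field) \<Rightarrow> ('l \<Rightarrow> 'l) \<Rightarrow> 'l \<Rightarrow> 'l" where
  "galois_ext \<iota> g = (THE h. bij h \<and> (\<forall>x y. h (x + y) = h x + h y \<and> h (x * y) = h x * h y) \<and>
     (\<forall>x\<in>sep_closure \<iota>. h x = g x))"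

definition galois_act ::
  "('c::field \<Rightarrow> 'l::field) \<Rightarrow> 'a bialg \<Rightarrow> ('l \<Rightarrow> 'l) \<Rightarrow> ('a vec \<Rightarrow> 'l) \<Rightarrow> 'a vec \<Rightarrow> 'l" where
  "galois_act \<iota> H g P = compose (elts H) (galois_ext \<iota> g) P"

text \<open>
  The ring of integers of an algebraic extension of \<open>K = k((\<pi>))\<close> is the integral closure of
  \<open>A = k[[\<pi>]]\<close>. Therefore \<open>x\<close> has positive valuation if and only if \<open>x\<^sup>n / \<pi>\<close> is integral over \<open>A\<close>
  for some \<open>n > 0\<close>.
\<close>

definition integral_elt :: "('k::field fls \<Rightarrow> 'l::field) \<Rightarrow> 'l \<Rightarrow> bool" where
  "integral_elt \<iota> x \<longleftrightarrow>
    (\<exists>q :: 'k fps poly. lead_coeff q = 1 \<and> poly (map_poly (\<lambda>a. \<iota> (fps_to_fls a)) q) x = 0)"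

definition pos_val :: "('k::field fls \<Rightarrow> 'l::field) \<Rightarrow> 'l \<Rightarrow> bool" where
  "pos_val \<iota> x \<longleftrightarrow> (\<exists>n>0. integral_elt \<iota> (x ^ n / \<iota> fls_X))"

text \<open>
  The wild inertia (ramification) group: all \<open>g\<close> such that \<open>g x / x - 1\<close> lies in the maximal ideal
  of the valuation ring for all nonzero \<open>x\<close>. As the residue field is algebraically closed, the
  inertia group is the whole Galois group.
\<close>

definition wild_inertia :: "('k::field fls \<Rightarrow> 'l::field) \<Rightarrow> ('l \<Rightarrow> 'l) set" where
  "wild_inertia \<iota> =
    {g \<in> carrier (abs_galois \<iota>). \<forall>x\<in>sep_closure \<iota>. x \<noteq> 0 \<longrightarrow> pos_val \<iota> (g x / x - 1)}"

definition tame_inertia :: "('k::field fls \<Rightarrow> 'l::field) \<Rightarrow> ('l \<Rightarrow> 'l) set monoid" where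
  "tame_inertia \<iota> = abs_galois \<iota> Mod wild_inertia \<iota>"

text \<open>
  For \<open>d\<close> prime to \<open>p\<close> the root of unity \<open>g(\<pi>\<^sup>1\<^sup>/\<^sup>d) / \<pi>\<^sup>1\<^sup>/\<^sup>d\<close> lies in \<open>k\<close> and depends
  neither on the representative \<open>g\<close> of the class \<open>\<tau>\<close> nor on the choice of the root \<open>r\<close> of \<open>\<pi>\<close>.
\<close>

definition theta :: "('k::field fls \<Rightarrow> 'l::field) \<Rightarrow> nat \<Rightarrow> ('l \<Rightarrow> 'l) set \<Rightarrow> 'k" where
  "theta \<iota> d \<tau> = (THE z. \<forall>g\<in>\<tau>. \<forall>r\<in>sep_closure \<iota>. r ^ d = \<iota> fls_X \<longrightarrow> g r / r = \<iota> (fls_const z))"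

text \<open>The subfield with \<open>q\<close> elements, for a power \<open>q\<close> of the characteristic.\<close>

definition finite_subfield :: "nat \<Rightarrow> 'k::field ring" where
  "finite_subfield q = ring_of_type_algebra\<lparr>carrier := {x. x ^ q = x}\<rparr>"

end

(*
  Over the algebraic closure, Hom(G(1), G_a) is spanned by Lie(G^vee) and separates the geometric
  points: a character from G(1) to F_p that is nontrivial at a given point lifts to a function on
  G(1), and a large Frobenius power of that function is primitive.  Let v be a cyclic vector, with
  phi^c v = sum a_i phi^i v.  Evaluation at v is therefore an injective homomorphism from the points
  to the roots of Q = X^q - sum a_i X^(p^i), where q = p^c.  The matrix of phi in the basis phi^i v
  is a companion matrix with determinant +-a_0, so h(G) = 1 means that a_0 has valuation 1.  If some
  a_i were a unit, phi would have a nonzero fixed vector z, and z^(p-1) would be a nontrivial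
  idempotent, against connectedness; so every a_i is divisible by pi.

  Put d = q - 1 and w = pi^(1/d).  Substituting X = w u and dividing by w^q turns Q into an equation
  for u which reduces to u^q = b u with b = (a_0 / pi)(0), b nonzero, and Hensel's lemma gives all
  q roots as power series in w.  The leading coefficient u(0) is additive and injective on the
  roots.  An automorphism sending w to zeta w multiplies it by zeta.  As these automorphisms are
  transitive on the nonzero roots, evaluation at v is also surjective; dividing u(0) by a fixed d-th
  root of b identifies the points with F_q, and the Galois group acts through
  theta_d.
*)
theory Submission
  imports Defs "Jordan_Normal_Form.Char_Poly"
begin

section \<open>Frobenius and structure constants\<close>

text \<open>Points live over an algebraically closed field L, whereas \<open>Lie\<close>, the
  Hasse-Witt map and connectedness live over A. Three devices bridge the gap. The bialgebra axioms
  are turned into identities between structure constants, which survive every base change. A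
  primitive element over L is cut into slices along a K-basis of L; each slice lies in
  \<open>Lie\<close> once denominators are cleared, so evaluation at v controls all primitive
  elements. Connectedness is tested on the kernels, in the coordinate ring over A, of two L-valued
  points: an idempotent with value 1 at one of them and 0 at the unit section separates two primes.
  That characters to F_p separate points requires exponent p, which comes from G(1) being the kernel
  of p in G(2). Nontrivial points exist because a_0 is nonzero: phi is injective on
  \<open>Lie\<close>, so v is not nilpotent and some point does not vanish at it. The exponent d = q
  - 1 is the one for which X^q and pi X both acquire the factor w^q under X = w u; since pi divides
  every a_i, the remaining terms then carry positive powers of w.\<close>

lemma (in cring) binomial_expansion:
  assumes x: "x \<in> carrier R" and y: "y \<in> carrier R"
  shows "(x \<oplus> y) [^] n = (\<Oplus>k\<in>{..n::nat}. add_pow R (n choose k) (x [^] k \<otimes> y [^] (n - k)))"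
proof (induction n)
  case 0
  show ?case using x y by (simp add: Pi_def)
next
  case (Suc n)
  define T where "T m k = add_pow R (n choose k) (x [^] k \<otimes> y [^] (m - k))" for m k :: nat
  define U where "U k = add_pow R (n choose k) (x [^] Suc k \<otimes> y [^] (n - k))" for k
  have [simp]: "T m k \<in> carrier R" "U k \<in> carrier R" for m k
    using x y by (auto simp: T_def U_def)
  have A: "(\<Oplus>k\<in>{..n}. T n k) \<otimes> x = (\<Oplus>k\<in>{..n}. U k)"
    using x y by (subst finsum_ldistr)
      (auto intro!: finsum_cong' simp: T_def U_def m_ac add_pow_ldistr add_pow_rdistr)
  have B: "(\<Oplus>k\<in>{..n}. T n k) \<otimes> y = (\<Oplus>k\<in>{..n}. T (Suc n) k)"
    using x y by (subst finsum_ldistr)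
      (auto intro!: finsum_cong' simp: T_def m_ac add_pow_ldistr add_pow_rdistr Suc_diff_le)
  have T0: "(\<Oplus>k\<in>{..Suc n}. T (Suc n) k) = (\<Oplus>k\<in>{..n}. T (Suc n) k)"
    using x y by (subst finsum_Suc) (auto simp: T_def[of "Suc n" "Suc n"] binomial_eq_0)
  have "(\<Oplus>k\<in>{..Suc n}. add_pow R (Suc n choose k) (x [^] k \<otimes> y [^] (Suc n - k))) =
     (\<Oplus>k\<in>{..n}. add_pow R (Suc n choose Suc k) (x [^] Suc k \<otimes> y [^] (n - k))) \<oplus> T (Suc n) 0"
    using x y by (subst finsum_Suc2) (auto simp: T_def)
  also have "(\<Oplus>k\<in>{..n}. add_pow R (Suc n choose Suc k) (x [^] Suc k \<otimes> y [^] (n - k))) =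
      (\<Oplus>k\<in>{..n}. U k \<oplus> T (Suc n) (Suc k))"
    using x y by (intro finsum_cong')
      (auto simp: T_def U_def add.nat_pow_mult add.nat_pow_closed)
  also have "\<dots> = (\<Oplus>k\<in>{..n}. U k) \<oplus> (\<Oplus>k\<in>{..n}. T (Suc n) (Suc k))"
    by (subst finsum_addf) auto
  also have "\<dots> \<oplus> T (Suc n) 0 = (\<Oplus>k\<in>{..n}. U k) \<oplus> (\<Oplus>k\<in>{..Suc n}. T (Suc n) k)"
    by (subst finsum_Suc2) (auto simp: a_ac)
  also have "\<dots> = (x \<oplus> y) [^] Suc n"
    unfolding T0 A[symmetric] B[symmetric]
    using x y Suc by (simp add: T_def[symmetric] r_distr)
  finally show ?case ..
qed

lemma (in cring) freshman:
  assumes p: "Factorial_Ring.prime p" and char: "\<And>z. z \<in> carrier R \<Longrightarrow> add_pow R (p) z = \<zero>"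
    and x: "x \<in> carrier R" and y: "y \<in> carrier R"
  shows "(x \<oplus> y) [^] (p::nat) = x [^] p \<oplus> y [^] p"
proof -
  define T where "T k = add_pow R (p choose k) (x [^] k \<otimes> y [^] (p - k))" for k
  have T: "T k \<in> carrier R" for k using x y by (auto simp: T_def)
  have p0: "p > 0" using p prime_gt_0_nat by blast
  obtain m where m: "p = Suc m" using p0 gr0_implies_Suc by blast
  have 0: "T (Suc k) = \<zero>" if "Suc k < p" for k
  proof -
    have "p dvd (p choose Suc k)"
      by (rule dvd_choose_prime) (use p that in auto)
    then obtain l where l: "p choose Suc k = p * l" by blast
    then show ?thesis
      unfolding T_def l using x y
      by (subst add.nat_pow_pow[symmetric]) (simp_all add: char)
  qed
  have "(x \<oplus> y) [^] p = (\<Oplus>k\<in>{..Suc m}. T k)"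
    using binomial_expansion[OF x y, of p] by (simp add: T_def m)
  also have "\<dots> = T (Suc m) \<oplus> (\<Oplus>k\<in>{..m}. T k)"
    using T by (subst finsum_Suc) auto
  also have "(\<Oplus>k\<in>{..m}. T k) = T 0"
  proof (cases m)
    case 0 then show ?thesis using T by (simp add: Pi_def)
  next
    case (Suc m')
    have "(\<Oplus>k\<in>{..m'}. T (Suc k)) = (\<Oplus>k\<in>{..m'}. \<zero>)"
      using 0 m Suc by (intro finsum_cong') auto
    then show ?thesis unfolding Suc using T by (subst finsum_Suc2) auto
  qed
  also have "T (Suc m) = x [^] p" using x y by (simp add: T_def m)
  also have "T 0 = y [^] p" using x y by (simp add: T_def)
  finally show ?thesis .
qed

lemma (in cring) freshman_power:
  assumes p: "Factorial_Ring.prime p" and char: "\<And>z. z \<in> carrier R \<Longrightarrow> add_pow R (p) z = \<zero>"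
    and x: "x \<in> carrier R" and y: "y \<in> carrier R"
  shows "(x \<oplus> y) [^] (p ^ N :: nat) = x [^] (p ^ N) \<oplus> y [^] (p ^ N)"
proof (induction N)
  case (Suc N)
  then show ?case using x y freshman[OF p char]
    by (simp add: nat_pow_pow[symmetric] mult.commute[of p])
qed (use x y in simp)

lemma (in cring) freshman_finsum:
  assumes p: "Factorial_Ring.prime p" and char: "\<And>z. z \<in> carrier R \<Longrightarrow> add_pow R (p) z = \<zero>"
    and A: "finite A" and f: "f \<in> A \<rightarrow> carrier R"
  shows "(\<Oplus>a\<in>A. f a) [^] (p ^ N :: nat) = (\<Oplus>a\<in>A. f a [^] (p ^ N))"
  using A f
proof (induction A)
  case empty
  then show ?case using p prime_gt_0_nat[of p] by (simp add: nat_pow_zero)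
next
  case (insert a A)
  then show ?case
    by (subst (1 2) finsum_insert) (auto simp: freshman_power[OF p char] Pi_def)
qed

text \<open>Covers two cases at once: the coordinate ring, with indices \<open>{..<n}\<close>, and
  its tensor square, with pairs of indices. The ring axioms are not assumed but derived from
  identities between the structure constants \<open>M\<close> and \<open>u\<close>, so that the same
  argument serves after base change, where no ring structure is given in advance.\<close>

locale coord_alg =
  fixes R :: "('x, 'm) ring_scheme" (structure)
    and sm :: "'a::comm_ring_1 \<Rightarrow> 'x \<Rightarrow> 'x" and co :: "'x \<Rightarrow> 'i \<Rightarrow> 'a"
    and I :: "'i set" and M :: "'i \<Rightarrow> 'i \<Rightarrow> 'i \<Rightarrow> 'a" and u :: "'i \<Rightarrow> 'a"
  assumes fin: "finite I"
    and mult_closed: "\<And>x y. x \<in> carrier R \<Longrightarrow> y \<in> carrier R \<Longrightarrow> x \<otimes> y \<in> carrier R"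
    and add_closed: "\<And>x y. x \<in> carrier R \<Longrightarrow> y \<in> carrier R \<Longrightarrow> x \<oplus> y \<in> carrier R"
    and zero_closed': "\<zero> \<in> carrier R" and one_closed': "\<one> \<in> carrier R"
    and sm_closed: "\<And>a x. x \<in> carrier R \<Longrightarrow> sm a x \<in> carrier R"
    and co_inj: "\<And>x y. x \<in> carrier R \<Longrightarrow> y \<in> carrier R \<Longrightarrow> (\<And>i. i \<in> I \<Longrightarrow> co x i = co y i) \<Longrightarrow> x = y"
    and co_mult: "\<And>x y k. x \<in> carrier R \<Longrightarrow> y \<in> carrier R \<Longrightarrow> k \<in> I \<Longrightarrow>
       co (x \<otimes> y) k = (\<Sum>i\<in>I. \<Sum>j\<in>I. co x i * co y j * M i j k)"
    and co_add: "\<And>x y k. x \<in> carrier R \<Longrightarrow> y \<in> carrier R \<Longrightarrow> k \<in> I \<Longrightarrow> co (x \<oplus> y) k = co x k + co y k"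
    and co_zero: "\<And>k. k \<in> I \<Longrightarrow> co \<zero> k = 0"
    and co_one: "\<And>k. k \<in> I \<Longrightarrow> co \<one> k = u k"
    and co_sm: "\<And>a x k. x \<in> carrier R \<Longrightarrow> k \<in> I \<Longrightarrow> co (sm a x) k = a * co x k"
    and M_comm: "\<And>i j k. i \<in> I \<Longrightarrow> j \<in> I \<Longrightarrow> k \<in> I \<Longrightarrow> M i j k = M j i k"
    and M_assoc: "\<And>i j k l. i \<in> I \<Longrightarrow> j \<in> I \<Longrightarrow> k \<in> I \<Longrightarrow> l \<in> I \<Longrightarrow>
       (\<Sum>s\<in>I. M i j s * M s k l) = (\<Sum>s\<in>I. M j k s * M i s l)"
    and M_unit: "\<And>j k. j \<in> I \<Longrightarrow> k \<in> I \<Longrightarrow> (\<Sum>i\<in>I. u i * M i j k) = (if j = k then 1 else 0)"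
begin

lemma alg_assoc:
  assumes [simp]: "x \<in> carrier R" "y \<in> carrier R" "z \<in> carrier R"
  shows "(x \<otimes> y) \<otimes> z = x \<otimes> (y \<otimes> z)"
proof (rule co_inj)
  fix l assume l: "l \<in> I"
  have "co ((x \<otimes> y) \<otimes> z) l = (\<Sum>s\<in>I. \<Sum>k\<in>I. \<Sum>i\<in>I. \<Sum>j\<in>I. co x i * co y j * co z k * (M i j s * M s k l))"
    using l by (simp add: co_mult mult_closed sum_distrib_left sum_distrib_right mult_ac)
  also have "\<dots> = (\<Sum>k\<in>I. \<Sum>i\<in>I. \<Sum>j\<in>I. \<Sum>s\<in>I. co x i * co y j * co z k * (M i j s * M s k l))"
    apply (rule trans[OF sum.swap]) apply (rule sum.cong[OF refl])
    apply (rule trans[OF sum.swap]) apply (rule sum.cong[OF refl]) by (rule sum.swap)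
  also have "\<dots> = (\<Sum>k\<in>I. \<Sum>i\<in>I. \<Sum>j\<in>I. \<Sum>s\<in>I. co x i * co y j * co z k * (M j k s * M i s l))"
    using l by (rule_tac sum.cong[OF refl], rule_tac sum.cong[OF refl], rule_tac sum.cong[OF refl])
      (simp add: sum_distrib_left[symmetric] M_assoc)
  also have "\<dots> = (\<Sum>i\<in>I. \<Sum>j\<in>I. \<Sum>k\<in>I. \<Sum>s\<in>I. co x i * co y j * co z k * (M j k s * M i s l))"
    apply (rule trans[OF sum.swap]) apply (rule sum.cong[OF refl]) by (rule sum.swap)
  also have "\<dots> = (\<Sum>i\<in>I. \<Sum>s\<in>I. \<Sum>j\<in>I. \<Sum>k\<in>I. co x i * co y j * co z k * (M j k s * M i s l))"
    apply (rule sum.cong[OF refl])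
    apply (rule trans[OF sum.cong[OF refl sum.swap]]) by (rule sum.swap)
  also have "\<dots> = co (x \<otimes> (y \<otimes> z)) l"
    using l by (simp add: co_mult mult_closed sum_distrib_left sum_distrib_right mult_ac)
  finally show "co ((x \<otimes> y) \<otimes> z) l = co (x \<otimes> (y \<otimes> z)) l" .
qed (simp_all add: mult_closed)

lemma alg_comm:
  assumes [simp]: "x \<in> carrier R" "y \<in> carrier R"
  shows "x \<otimes> y = y \<otimes> x"
proof (rule co_inj)
  fix k assume "k \<in> I"
  then show "co (x \<otimes> y) k = co (y \<otimes> x) k"
    by (simp add: co_mult) (subst sum.swap, auto intro!: sum.cong simp: mult_ac M_comm)
qed (simp_all add: mult_closed)

lemma alg_one:
  assumes [simp]: "x \<in> carrier R"
  shows "\<one> \<otimes> x = x"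
proof (rule co_inj)
  fix k assume k: "k \<in> I"
  then have "co (\<one> \<otimes> x) k = (\<Sum>j\<in>I. co x j * (\<Sum>i\<in>I. u i * M i j k))"
    by (simp add: co_mult one_closed' co_one sum_distrib_left mult_ac)
       (subst sum.swap, simp add: mult_ac)
  also have "\<dots> = co x k" using k fin by (simp add: M_unit if_distrib cong: if_cong)
  finally show "co (\<one> \<otimes> x) k = co x k" .
qed (simp_all add: mult_closed one_closed')

lemma alg_distr:
  assumes [simp]: "x \<in> carrier R" "y \<in> carrier R" "z \<in> carrier R"
  shows "(x \<oplus> y) \<otimes> z = x \<otimes> z \<oplus> y \<otimes> z"
  by (rule co_inj) (auto simp: co_mult co_add mult_closed add_closed algebra_simps sum.distrib)

lemma is_cring: "cring R"
proof (rule cringI)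
  show "abelian_group R"
  proof (rule abelian_groupI)
    fix x assume x: "x \<in> carrier R"
    have "sm (-1) x \<oplus> x = \<zero>"
      by (rule co_inj) (auto simp: x co_add co_sm co_zero sm_closed add_closed zero_closed')
    with x show "\<exists>y\<in>carrier R. y \<oplus> x = \<zero>" using sm_closed by blast
  qed (auto intro!: co_inj simp: co_add co_zero add_closed zero_closed' algebra_simps)
  show "comm_monoid R"
    by (rule comm_monoidI) (auto simp: mult_closed one_closed' alg_assoc alg_one intro: alg_comm)
qed (rule alg_distr)

sublocale cring R by (rule is_cring)

lemma sm_mult:
  assumes [simp]: "x \<in> carrier R" "y \<in> carrier R"
  shows "sm a x \<otimes> y = sm a (x \<otimes> y)" "x \<otimes> sm a y = sm a (x \<otimes> y)"
  by (rule co_inj; force simp: co_mult co_sm sm_closed sum_distrib_left mult_ac)+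

lemma sm_assoc: "x \<in> carrier R \<Longrightarrow> sm a (sm b x) = sm (a * b) x"
  by (rule co_inj) (auto simp: co_sm sm_closed mult_ac)

lemma sm_one: "x \<in> carrier R \<Longrightarrow> sm 1 x = x"
  by (rule co_inj) (auto simp: co_sm sm_closed)

lemma sm_zero: "x \<in> carrier R \<Longrightarrow> sm 0 x = \<zero>"
  by (rule co_inj) (auto simp: co_sm sm_closed co_zero)

lemma sm_pow: "x \<in> carrier R \<Longrightarrow> sm a x [^] (m::nat) = sm (a ^ m) (x [^] m)"
  by (induction m) (auto simp: sm_one sm_mult sm_assoc sm_closed mult_ac)

lemma co_finsum:
  assumes "finite A" "f \<in> A \<rightarrow> carrier R" "k \<in> I"
  shows "co (\<Oplus>a\<in>A. f a) k = (\<Sum>a\<in>A. co (f a) k)"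
  using assms by (induction A) (auto simp: co_zero co_add Pi_def)

lemma co_add_pow: "x \<in> carrier R \<Longrightarrow> k \<in> I \<Longrightarrow> co (add_pow R (m::nat) x) k = of_nat m * co x k"
  by (induction m) (auto simp: co_zero co_add algebra_simps)

text \<open>Multiples are computed coordinate by coordinate, so the characteristic of the scalars
  kills the whole algebra. This feeds the Frobenius identities for coordinate rings and tensor
  squares alike.\<close>

lemma char_zero:
  assumes "x \<in> carrier R" shows "add_pow R (CHAR('a)) x = \<zero>"
  by (rule co_inj) (use assms in \<open>auto simp: co_add_pow co_zero\<close>)

lemma frob_add:
  assumes "Factorial_Ring.prime CHAR('a)" "x \<in> carrier R" "y \<in> carrier R"
  shows "(x \<oplus> y) [^] (CHAR('a) ^ N) = x [^] (CHAR('a) ^ N) \<oplus> y [^] (CHAR('a) ^ N)"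
  by (rule freshman_power) (use assms char_zero in auto)

lemma frob_finsum:
  assumes "Factorial_Ring.prime CHAR('a)" "finite A" "f \<in> A \<rightarrow> carrier R"
  shows "(\<Oplus>a\<in>A. f a) [^] (CHAR('a) ^ N) = (\<Oplus>a\<in>A. f a [^] (CHAR('a) ^ N))"
  by (rule freshman_finsum) (use assms char_zero in auto)

end

text \<open>A commutative and cocommutative bialgebra written without reference to elements, as
  polynomial identities in the structure constants. In this form the axioms pass along every ring
  homomorphism, in particular from A to the algebraic closure of K.\<close>

locale bialg_ids =
  fixes H :: "'a::comm_ring_1 bialg"
  assumes mlt_comm: "\<And>i j k. i < rnk H \<Longrightarrow> j < rnk H \<Longrightarrow> k < rnk H \<Longrightarrow> mlt H i j k = mlt H j i k"
    and mlt_assoc: "\<And>i j k l. i < rnk H \<Longrightarrow> j < rnk H \<Longrightarrow> k < rnk H \<Longrightarrow> l < rnk H \<Longrightarrow>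
      (\<Sum>s<rnk H. mlt H i j s * mlt H s k l) = (\<Sum>s<rnk H. mlt H j k s * mlt H i s l)"
    and mlt_unt: "\<And>j k. j < rnk H \<Longrightarrow> k < rnk H \<Longrightarrow>
      (\<Sum>i<rnk H. unt H i * mlt H i j k) = (if j = k then 1 else 0)"
    and mlt_cml: "\<And>i j k l. i < rnk H \<Longrightarrow> j < rnk H \<Longrightarrow> k < rnk H \<Longrightarrow> l < rnk H \<Longrightarrow>
      (\<Sum>s<rnk H. mlt H i j s * cml H s k l) =
      (\<Sum>a<rnk H. \<Sum>b<rnk H. \<Sum>c<rnk H. \<Sum>d<rnk H.
         cml H i a b * cml H j c d * (mlt H a c k * mlt H b d l))"
    and unt_cml: "\<And>i j. i < rnk H \<Longrightarrow> j < rnk H \<Longrightarrow>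
      (\<Sum>k<rnk H. unt H k * cml H k i j) = unt H i * unt H j"
    and mlt_cnt: "\<And>i j. i < rnk H \<Longrightarrow> j < rnk H \<Longrightarrow>
      (\<Sum>k<rnk H. mlt H i j k * cnt H k) = cnt H i * cnt H j"
    and unt_cnt: "(\<Sum>k<rnk H. unt H k * cnt H k) = 1"
    and cml_assoc: "\<And>k a b c. k < rnk H \<Longrightarrow> a < rnk H \<Longrightarrow> b < rnk H \<Longrightarrow> c < rnk H \<Longrightarrow>
      (\<Sum>i<rnk H. cml H k i c * cml H i a b) = (\<Sum>i<rnk H. cml H k a i * cml H i b c)"
    and cml_comm: "\<And>k i j. k < rnk H \<Longrightarrow> i < rnk H \<Longrightarrow> j < rnk H \<Longrightarrow> cml H k i j = cml H k j i"
    and cml_cnt: "\<And>k j. k < rnk H \<Longrightarrow> j < rnk H \<Longrightarrow>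
      (\<Sum>i<rnk H. cnt H i * cml H k i j) = (if j = k then 1 else 0)"

lemmas bialg_idsD = bialg_ids.mlt_comm bialg_ids.mlt_assoc bialg_ids.mlt_unt bialg_ids.mlt_cml
  bialg_ids.unt_cml bialg_ids.mlt_cnt bialg_ids.unt_cnt bialg_ids.cml_assoc bialg_ids.cml_comm
  bialg_ids.cml_cnt

text \<open>Base change of the group scheme along \<open>J\<close>.\<close>

definition map_bialg :: "('a \<Rightarrow> 'b) \<Rightarrow> 'a bialg \<Rightarrow> 'b bialg" where
  "map_bialg J H = \<lparr>rnk = rnk H, mlt = (\<lambda>i j k. J (mlt H i j k)), unt = (\<lambda>i. J (unt H i)),
     cml = (\<lambda>k i j. J (cml H k i j)), cnt = (\<lambda>i. J (cnt H i))\<rparr>"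

lemma map_bialg_simps [simp]:
  "rnk (map_bialg J H) = rnk H" "mlt (map_bialg J H) i j k = J (mlt H i j k)"
  "unt (map_bialg J H) i = J (unt H i)" "cml (map_bialg J H) k i j = J (cml H k i j)"
  "cnt (map_bialg J H) i = J (cnt H i)"
  by (simp_all add: map_bialg_def)

lemma bialg_ids_map:
  assumes J: "comm_ring_hom J" and H: "bialg_ids H"
  shows "bialg_ids (map_bialg J H)"
proof -
  interpret comm_ring_hom J by (rule J)
  note D = bialg_idsD[OF H]
  show ?thesis
    apply (rule bialg_ids.intro)
    unfolding map_bialg_simps
    subgoal using D(1) by simp
    subgoal premises p using p arg_cong[OF D(2)[OF p], of J] by (simp add: hom_distribs)
    subgoal premises p using p arg_cong[OF D(3)[OF p], of J] by (simp add: hom_distribs split: if_splits)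
    subgoal premises p using p arg_cong[OF D(4)[OF p], of J] by (simp add: hom_distribs)
    subgoal premises p using p arg_cong[OF D(5)[OF p], of J] by (simp add: hom_distribs)
    subgoal premises p using p arg_cong[OF D(6)[OF p], of J] by (simp add: hom_distribs)
    subgoal premises p using p arg_cong[OF D(7), of J] by (simp add: hom_distribs)
    subgoal premises p using p arg_cong[OF D(8)[OF p], of J] by (simp add: hom_distribs)
    subgoal using D(9) by simp
    subgoal premises p using p arg_cong[OF D(10)[OF p], of J] by (simp add: hom_distribs split: if_splits)
    done
qed

lemma coord_ring_simps [simp]:
  "carrier (coord_ring H) = elts H"
  "x \<otimes>\<^bsub>coord_ring H\<^esub> y = mu H (tensor H x y)"
  "\<one>\<^bsub>coord_ring H\<^esub> = vec (rnk H) (unt H)"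
  "\<zero>\<^bsub>coord_ring H\<^esub> = 0\<^sub>v (rnk H)"
  "x \<oplus>\<^bsub>coord_ring H\<^esub> y = x + y"
  by (simp_all add: coord_ring_def)

lemma mult_coord: "k < rnk H \<Longrightarrow>
   mu H (tensor H x y) $ k = (\<Sum>i<rnk H. \<Sum>j<rnk H. x $ i * y $ j * mlt H i j k)"
  by (simp add: mu_def tensor_def)

lemma pick_sum: "a < n \<Longrightarrow> (\<Sum>i<n. unit_vec n a $ i * f i) = (f a :: 'a::comm_ring_1)"
proof -
  assume a: "a < n"
  have "(\<Sum>i<n. unit_vec n a $ i * f i) = (\<Sum>i<n. if i = a then f i else 0)"
    using a by (intro sum.cong) auto
  then show ?thesis using a by simp
qed

lemma mult_unit_right: "b < rnk H \<Longrightarrow> k < rnk H \<Longrightarrow>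
   mu H (tensor H x (unit_vec (rnk H) b)) $ k = (\<Sum>i<rnk H. x $ i * mlt H i b k)"
  unfolding mult_coord mult.assoc sum_distrib_left[symmetric] by (subst pick_sum) auto

lemma mult_unit_left: "a < rnk H \<Longrightarrow> k < rnk H \<Longrightarrow>
   mu H (tensor H (unit_vec (rnk H) a) y) $ k = (\<Sum>j<rnk H. y $ j * mlt H a j k)"
  unfolding mult_coord mult.assoc sum_distrib_left[symmetric] by (subst pick_sum) auto

lemma mult_unit_coord: "a < rnk H \<Longrightarrow> b < rnk H \<Longrightarrow> k < rnk H \<Longrightarrow>
   mu H (tensor H (unit_vec (rnk H) a) (unit_vec (rnk H) b)) $ k = mlt H a b k"
  unfolding mult_unit_right by (subst pick_sum) auto

lemma tensor_square_simps [simp]: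
  "carrier (tensor_square_ring H) = carrier_mat (rnk H) (rnk H)"
  "s \<otimes>\<^bsub>tensor_square_ring H\<^esub> t = mat (rnk H) (rnk H) (\<lambda>(k, l).
       \<Sum>a<rnk H. \<Sum>b<rnk H. \<Sum>c<rnk H. \<Sum>d<rnk H.
         s $$ (a, b) * t $$ (c, d) * (mlt H a c k * mlt H b d l))"
  "\<one>\<^bsub>tensor_square_ring H\<^esub> = mat (rnk H) (rnk H) (\<lambda>(i, j). unt H i * unt H j)"
  "\<zero>\<^bsub>tensor_square_ring H\<^esub> = 0\<^sub>m (rnk H) (rnk H)"
  "s \<oplus>\<^bsub>tensor_square_ring H\<^esub> t = s + t"
  by (simp_all add: tensor_square_ring_def)

lemma comul_unit: "k < rnk H \<Longrightarrow> i < rnk H \<Longrightarrow> j < rnk H \<Longrightarrow>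
   comul H (unit_vec (rnk H) k) $$ (i, j) = cml H k i j"
  using pick_sum[of k "rnk H" "\<lambda>k. cml H k i j"] by (simp add: comul_def)

lemma comul_carrier [simp]: "comul H x \<in> carrier_mat (rnk H) (rnk H)"
  by (simp add: comul_def)

lemma counit_unit: "k < rnk H \<Longrightarrow> counit H (unit_vec (rnk H) k) = cnt H k"
  using pick_sum[of k "rnk H" "cnt H"] by (simp add: counit_def)

lemma mu_carrier [simp]: "mu H t \<in> elts H"
  by (simp add: mu_def)

text \<open>Each axiom about elements is evaluated at basis vectors and compared coordinate by
  coordinate.\<close>

lemma bialg_ids_group_scheme:
  assumes "comm_group_scheme H"
  shows "bialg_ids H"
proof -
  let ?n = "rnk H" and ?e = "unit_vec (rnk H)"
  have cr: "cring (coord_ring H)"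
    and cm: "comul H \<in> Ring.ring_hom (coord_ring H) (tensor_square_ring H)"
    and cn: "counit H \<in> Ring.ring_hom (coord_ring H) ring_of_type_algebra"
    using assms by (auto simp: comm_group_scheme_def)
  interpret cring "coord_ring H" by (rule cr)
  have e: "?e i \<in> carrier (coord_ring H)" for i by simp
  have 1: "mlt H i j k = mlt H j i k" if "i < ?n" "j < ?n" "k < ?n" for i j k
    using that arg_cong[OF m_comm[OF e e, of i j], of "\<lambda>v. vec_index v k"] by (simp add: mult_unit_coord)
  have 2: "(\<Sum>s<?n. mlt H i j s * mlt H s k l) = (\<Sum>s<?n. mlt H j k s * mlt H i s l)"
    if "i < ?n" "j < ?n" "k < ?n" "l < ?n" for i j k l
    using that arg_cong[OF m_assoc[OF e e e, of i j k], of "\<lambda>v. vec_index v l"]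
    by (simp add: mult_unit_left[of i H l] mult_unit_right[of k H l] mult_unit_coord)
  have 3: "(\<Sum>i<?n. unt H i * mlt H i j k) = (if j = k then 1 else 0)" if "j < ?n" "k < ?n" for j k
    using that arg_cong[OF l_one[OF e, of j], of "\<lambda>v. vec_index v k"]
    by (simp add: mult_unit_right[of j H k] split: if_splits)
  have 4: "(\<Sum>s<?n. mlt H i j s * cml H s k l) =
      (\<Sum>a<?n. \<Sum>b<?n. \<Sum>c<?n. \<Sum>d<?n. cml H i a b * cml H j c d * (mlt H a c k * mlt H b d l))"
    if "i < ?n" "j < ?n" "k < ?n" "l < ?n" for i j k l
    using that arg_cong[OF ring_hom_mult[OF cm e e, of i j], of "\<lambda>v. index_mat v (k, l)"]
    by (simp add: comul_unit) (simp add: comul_def mult_unit_coord)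
  have 5: "(\<Sum>k<?n. unt H k * cml H k i j) = unt H i * unt H j" if "i < ?n" "j < ?n" for i j
    using that arg_cong[OF ring_hom_one[OF cm], of "\<lambda>v. index_mat v (i, j)"]
    by (simp add: comul_def)
  have 6: "(\<Sum>k<?n. mlt H i j k * cnt H k) = cnt H i * cnt H j" if "i < ?n" "j < ?n" for i j
    using that ring_hom_mult[OF cn e e, of i j]
    by (simp add: counit_unit) (simp add: counit_def mult_unit_coord ring_of_type_algebra_def)
  have 7: "(\<Sum>k<?n. unt H k * cnt H k) = 1"
    using ring_hom_one[OF cn] by (simp add: counit_def ring_of_type_algebra_def)
  have 8: "\<forall>k<?n. \<forall>a<?n. \<forall>b<?n. \<forall>c<?n.
      (\<Sum>i<?n. cml H k i c * cml H i a b) = (\<Sum>i<?n. cml H k a i * cml H i b c)"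
    using assms unfolding comm_group_scheme_def by (elim conjE)
  have 9: "\<forall>k<?n. \<forall>i<?n. \<forall>j<?n. cml H k i j = cml H k j i"
    using assms unfolding comm_group_scheme_def by (elim conjE)
  have 10: "\<forall>k<?n. \<forall>j<?n. (\<Sum>i<?n. cnt H i * cml H k i j) = (if j = k then 1 else 0)"
    using assms unfolding comm_group_scheme_def by (elim conjE)
  show ?thesis
    by (rule bialg_ids.intro; rule 1 2 3 4 5 6 7 8[rule_format] 9[rule_format] 10[rule_format]; assumption)
qed

lemma coord_alg_coord_ring:
  assumes "bialg_ids H"
  shows "coord_alg (coord_ring H) (\<cdot>\<^sub>v) vec_index {..<rnk H} (mlt H) (unt H)"
  using bialg_idsD(1-3)[OF assms] by unfold_locales (auto simp: mult_coord)

lemma sum_pairs: "(\<Sum>i\<in>{..<n}\<times>{..<n}. f i) = (\<Sum>a<n. \<Sum>b<n. f (a, b))" for n :: nat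
  by (simp add: sum.cartesian_product)

text \<open>A sum over pairs of indices whose terms separate is a product of two sums, so
  associativity and the unit law reduce to those of \<open>H\<close> in each tensor factor.\<close>

lemma coord_alg_tensor_square:
  assumes "bialg_ids H"
  shows "coord_alg (tensor_square_ring H) (\<cdot>\<^sub>m) index_mat ({..<rnk H} \<times> {..<rnk H})
    (\<lambda>i j k. mlt H (fst i) (fst j) (fst k) * mlt H (snd i) (snd j) (snd k))
    (\<lambda>i. unt H (fst i) * unt H (snd i))"
proof (unfold_locales, goal_cases)
  case (13 i j k)
  then show ?case using bialg_idsD(1)[OF assms] by auto
next
  case (14 i j k l)
  define n where "n = rnk H"
  obtain i1 i2 j1 j2 k1 k2 l1 l2 where ij: "i = (i1,i2)" "j = (j1,j2)" "k = (k1,k2)" "l = (l1,l2)"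
    by (metis surj_pair)
  have prod: "(\<Sum>s\<in>{..<n}\<times>{..<n}. f1 (fst s) * f2 (snd s) * (g1 (fst s) * g2 (snd s))) =
      (\<Sum>s<n. f1 s * g1 s) * (\<Sum>s<n. f2 s * g2 s)" for f1 f2 g1 g2 :: "nat \<Rightarrow> 'a"
    by (simp add: sum_pairs sum_product mult_ac)
  show ?case unfolding n_def[symmetric] ij fst_conv snd_conv
      prod[of "mlt H i1 j1" "mlt H i2 j2" "\<lambda>s. mlt H s k1 l1" "\<lambda>s. mlt H s k2 l2"]
      prod[of "mlt H j1 k1" "mlt H j2 k2" "\<lambda>s. mlt H i1 s l1" "\<lambda>s. mlt H i2 s l2"]
    using 14 bialg_idsD(2)[OF assms, of i1 j1 k1 l1] bialg_idsD(2)[OF assms, of i2 j2 k2 l2]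
    by (simp add: ij n_def)
next
  case (15 j k)
  define n where "n = rnk H"
  obtain j1 j2 k1 k2 where ij: "j = (j1,j2)" "k = (k1,k2)"
    by (metis surj_pair)
  have prod: "(\<Sum>s\<in>{..<n}\<times>{..<n}. f1 (fst s) * f2 (snd s) * (g1 (fst s) * g2 (snd s))) =
      (\<Sum>s<n. f1 s * g1 s) * (\<Sum>s<n. f2 s * g2 s)" for f1 f2 g1 g2 :: "nat \<Rightarrow> 'a"
    by (simp add: sum_pairs sum_product mult_ac)
  show ?case unfolding n_def[symmetric] ij fst_conv snd_conv
      prod[of "unt H" "unt H" "\<lambda>s. mlt H s j1 k1" "\<lambda>s. mlt H s j2 k2"]
    using 15 bialg_idsD(3)[OF assms, of j1 k1] bialg_idsD(3)[OF assms, of j2 k2]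
    by (auto simp: ij n_def)
qed (auto simp: sum_pairs intro!: eq_matI)

section \<open>Points of finite algebras over an algebraically closed field\<close>

lemma underdetermined_system:
  fixes f :: "nat \<Rightarrow> nat \<Rightarrow> 'a::field"
  shows "\<exists>c. (\<exists>j\<le>n. c j \<noteq> 0) \<and> (\<forall>i<n. (\<Sum>j\<le>n. f i j * c j) = 0)"
proof -
  define A where "A = mat (Suc n) (Suc n) (\<lambda>(i, j). if i < n then f i j else 0)"
  have A: "A \<in> carrier_mat (Suc n) (Suc n)" by (simp add: A_def)
  \<comment> \<open>The last row of the padded matrix is zero, so scaling it by 0 changes nothing,
    while the determinant is multiplied by 0.\<close>
  have "multrow n 0 A = A" by (intro eq_matI) (auto simp: A_def)
  then have "det A = 0" using det_multrow[of n "Suc n" A 0] A by simp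
  then obtain v where v: "v \<in> carrier_vec (Suc n)" "v \<noteq> 0\<^sub>v (Suc n)" "A *\<^sub>v v = 0\<^sub>v (Suc n)"
    using det_0_iff_vec_prod_zero_field[OF A] by auto
  have "\<exists>j\<le>n. v $ j \<noteq> 0" using v(1,2) by (auto simp: vec_eq_iff less_Suc_eq_le)
  moreover have "(\<Sum>j\<le>n. f i j * v $ j) = 0" if "i < n" for i
  proof -
    have "(A *\<^sub>v v) $ i = (\<Sum>j<Suc n. f i j * v $ j)"
      using that v(1) by (simp add: A_def scalar_prod_def atLeast0LessThan)
    then show ?thesis using v(3) that by (simp add: lessThan_Suc_atMost)
  qed
  ultimately show ?thesis by (intro exI[of _ "\<lambda>j. v $ j"]) auto
qed

locale fin_alg = bialg_ids H for H :: "'l::field bialg"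
begin

abbreviation B where "B \<equiv> coord_ring H"
abbreviation n where "n \<equiv> rnk H"

sublocale B: coord_alg B "(\<cdot>\<^sub>v)" vec_index "{..<rnk H}" "mlt H" "unt H"
  rewrites "carrier B \<equiv> carrier_vec n" and "ring.zero B \<equiv> 0\<^sub>v n" and "add B \<equiv> (+)"
  by (rule coord_alg_coord_ring, unfold_locales) (simp_all add: coord_ring_def)

declare coord_ring_simps(2,3) [simp del]

text \<open>This is r(y) w, computed by Horner's rule: the polynomial ring acts on the algebra
  through multiplication by y.\<close>

definition pact :: "'l vec \<Rightarrow> 'l vec \<Rightarrow> 'l poly \<Rightarrow> 'l vec" where
  "pact y w r = fold_coeffs (\<lambda>a acc. a \<cdot>\<^sub>v w + y \<otimes>\<^bsub>B\<^esub> acc) r (0\<^sub>v n)"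

lemma pact_0 [simp]: "pact y w 0 = 0\<^sub>v n"
  by (simp add: pact_def)

lemma pact_pCons:
  assumes [simp]: "y \<in> carrier_vec n" "w \<in> carrier_vec n"
  shows "pact y w (pCons a r) = a \<cdot>\<^sub>v w + y \<otimes>\<^bsub>B\<^esub> pact y w r"
  by (cases "r = 0 \<and> a = 0") (auto simp: pact_def B.sm_zero)

lemma pact_closed [simp]:
  assumes [simp]: "y \<in> carrier_vec n" "w \<in> carrier_vec n"
  shows "pact y w r \<in> carrier_vec n"
  by (induction r) (auto simp: pact_pCons)

lemma pact_add:
  assumes [simp]: "y \<in> carrier_vec n" "w \<in> carrier_vec n"
  shows "pact y w (r + s) = pact y w r + pact y w s"
proof (induction r s rule: poly_induct2)
  case (pCons a r b s)
  have "pact y w (pCons a r + pCons b s) = (a + b) \<cdot>\<^sub>v w + y \<otimes>\<^bsub>B\<^esub> (pact y w r + pact y w s)"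
    using pCons by (simp add: pact_pCons)
  also have "\<dots> = pact y w (pCons a r) + pact y w (pCons b s)"
    by (simp add: pact_pCons B.r_distr add_smult_distrib_vec B.add.m_ac)
  finally show ?case .
qed simp

lemma pact_smult:
  assumes [simp]: "y \<in> carrier_vec n" "w \<in> carrier_vec n"
  shows "pact y w (smult c r) = c \<cdot>\<^sub>v pact y w r"
  by (induction r) (auto simp: pact_pCons B.sm_mult smult_add_distrib_vec[where n=n] smult_smult_assoc)

lemma pact_factor:
  assumes [simp]: "y \<in> carrier_vec n" "w \<in> carrier_vec n"
  shows "pact y w ([:- z, 1:] * q) = y \<otimes>\<^bsub>B\<^esub> pact y w q + (- z) \<cdot>\<^sub>v pact y w q"
proof -
  have "[:- z, 1:] * q = pCons 0 q + smult (- z) q" by simp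
  then show ?thesis by (simp only: pact_add pact_smult assms pact_pCons) (simp add: B.sm_zero)
qed

lemma pact_monom:
  assumes [simp]: "y \<in> carrier_vec n" "w \<in> carrier_vec n"
  shows "pact y w (monom c j) = c \<cdot>\<^sub>v (y [^]\<^bsub>B\<^esub> j \<otimes>\<^bsub>B\<^esub> w)"
proof (induction j)
  case 0
  then show ?case by (simp add: monom_0 pact_pCons)
next
  case (Suc j)
  then show ?case by (simp add: monom_Suc pact_pCons B.sm_mult B.m_ac B.sm_zero)
qed

lemma pact_sum_monom:
  assumes [simp]: "y \<in> carrier_vec n" "w \<in> carrier_vec n" and "finite J" "k < n"
  shows "pact y w (\<Sum>j\<in>J. monom (c j) j) $ k = (\<Sum>j\<in>J. c j * (y [^]\<^bsub>B\<^esub> j \<otimes>\<^bsub>B\<^esub> w) $ k)"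
  using assms(3) by induction (auto simp: pact_add pact_monom \<open>k < n\<close> B.co_add B.co_sm)

text \<open>The n + 1 vectors w, y w, ..., y^n w lie in an n-dimensional space and are
  dependent.\<close>

lemma pact_relation:
  assumes [simp]: "y \<in> carrier_vec n" "w \<in> carrier_vec n"
  obtains r where "r \<noteq> 0" "pact y w r = 0\<^sub>v n"
proof -
  obtain c where c: "\<exists>j\<le>n. c j \<noteq> 0" "\<forall>i<n. (\<Sum>j\<le>n. (y [^]\<^bsub>B\<^esub> j \<otimes>\<^bsub>B\<^esub> w) $ i * c j) = 0"
    using underdetermined_system[of n "\<lambda>i j. (y [^]\<^bsub>B\<^esub> j \<otimes>\<^bsub>B\<^esub> w) $ i"] by blast
  define r where "r = (\<Sum>j\<le>n. monom (c j) j)"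
  have "coeff r j = (if j \<le> n then c j else 0)" for j
    by (simp add: r_def coeff_sum)
  then have "r \<noteq> 0" using c(1) by (metis coeff_0)
  moreover have "pact y w r = 0\<^sub>v n"
    using c(2) by (intro eq_vecI) (auto simp: r_def pact_sum_monom mult.commute)
  ultimately show ?thesis by (rule that)
qed

lemma pact_mult_left:
  assumes [simp]: "y \<in> carrier_vec n" "w \<in> carrier_vec n"
  shows "pact y w r = w \<otimes>\<^bsub>B\<^esub> pact y \<one>\<^bsub>B\<^esub> r"
proof (induction r)
  case (pCons a r)
  have "w \<otimes>\<^bsub>B\<^esub> (a \<cdot>\<^sub>v \<one>\<^bsub>B\<^esub> + y \<otimes>\<^bsub>B\<^esub> pact y \<one>\<^bsub>B\<^esub> r) = a \<cdot>\<^sub>v w + y \<otimes>\<^bsub>B\<^esub> (w \<otimes>\<^bsub>B\<^esub> pact y \<one>\<^bsub>B\<^esub> r)"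
    by (simp add: B.r_distr B.sm_mult B.m_lcomm)
  with pCons show ?case by (simp add: pact_pCons)
qed simp

text \<open>Linear factors are stripped from \<open>r\<close> until the rest no longer kills
  \<open>w\<close>; the rest applied to \<open>w\<close> is an eigenvector for the factor removed
  last. Two features matter later: the eigenvalue is a root of \<open>r\<close>, and the eigenvector
  is a multiple of \<open>w\<close>, so it inherits the eigenvalues that \<open>w\<close> has for
  other elements.\<close>

lemma eigenvector_in_ideal:
  fixes y w
  assumes ac: "\<And>q :: 'l poly. degree q > 0 \<Longrightarrow> \<exists>z. poly q z = 0"
    and [simp]: "y \<in> carrier_vec n" "w \<in> carrier_vec n" and w: "w \<noteq> 0\<^sub>v n"
    and r: "r \<noteq> 0" "pact y w r = 0\<^sub>v n"
  shows "\<exists>z s. poly r z = 0 \<and> pact y w s \<noteq> 0\<^sub>v n \<and> y \<otimes>\<^bsub>B\<^esub> pact y w s = z \<cdot>\<^sub>v pact y w s"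
  using r
proof (induction "degree r" arbitrary: r rule: less_induct)
  case less
  show ?case
  proof (cases "degree r = 0")
    case True
    then obtain c where c: "r = [:c:]" by (metis degree_eq_zeroE)
    with less.prems have "c \<noteq> 0" "c \<cdot>\<^sub>v w = 0\<^sub>v n" by (simp_all add: pact_pCons)
    then have "inverse c \<cdot>\<^sub>v (c \<cdot>\<^sub>v w) = 0\<^sub>v n" by (auto intro!: eq_vecI)
    with \<open>c \<noteq> 0\<close> w show ?thesis by (simp add: smult_smult_assoc)
  next
    case False
    then obtain z where z: "poly r z = 0" using ac by blast
    then obtain q where q: "r = [:- z, 1:] * q" unfolding poly_eq_0_iff_dvd by blast
    with less.prems have q0: "q \<noteq> 0" by auto
    then have deg: "degree q < degree r" by (simp add: q degree_mult_eq del: mult_pCons_left)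
    show ?thesis
    proof (cases "pact y w q = 0\<^sub>v n")
      case True
      from less.hyps[OF deg q0 True] show ?thesis by (auto simp: q)
    next
      case False
      have "y \<otimes>\<^bsub>B\<^esub> pact y w q + (- z) \<cdot>\<^sub>v pact y w q = 0\<^sub>v n"
        using less.prems(2) pact_factor[of y w z q] by (simp add: q del: mult_pCons_left)
      note eq = this
      have "y \<otimes>\<^bsub>B\<^esub> pact y w q = z \<cdot>\<^sub>v pact y w q"
      proof (rule B.co_inj)
        fix i assume i: "i \<in> {..<n}"
        have "(y \<otimes>\<^bsub>B\<^esub> pact y w q + (- z) \<cdot>\<^sub>v pact y w q) $ i = 0"
          unfolding eq using i by simp
        then show "(y \<otimes>\<^bsub>B\<^esub> pact y w q) $ i = (z \<cdot>\<^sub>v pact y w q) $ i"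
          using i by (simp add: B.co_add B.co_sm)
      qed auto
      with False z show ?thesis by blast
    qed
  qed
qed


text \<open>An algebra homomorphism to the field, recorded by its values on the basis;
  \<open>ev F\<close> is the homomorphism itself.\<close>

definition is_point :: "'l vec \<Rightarrow> bool" where
  "is_point F \<longleftrightarrow> F \<in> carrier_vec n \<and>
     (\<forall>i<n. \<forall>j<n. (\<Sum>k<n. mlt H i j k * F $ k) = F $ i * F $ j) \<and> (\<Sum>k<n. unt H k * F $ k) = 1"

definition ev :: "'l vec \<Rightarrow> 'l vec \<Rightarrow> 'l" where
  "ev F x = (\<Sum>k<n. x $ k * F $ k)"

lemma is_point_carrier [simp]: "is_point F \<Longrightarrow> F \<in> carrier_vec n"
  by (simp add: is_point_def)

lemma ev_unit: "k < n \<Longrightarrow> ev F (unit_vec n k) = F $ k"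
  unfolding ev_def by (rule pick_sum)

lemma ev_add: "x \<in> carrier_vec n \<Longrightarrow> y \<in> carrier_vec n \<Longrightarrow> ev F (x + y) = ev F x + ev F y"
  by (auto simp: ev_def sum.distrib algebra_simps)

lemma ev_smult: "x \<in> carrier_vec n \<Longrightarrow> ev F (a \<cdot>\<^sub>v x) = a * ev F x"
  by (auto simp: ev_def sum_distrib_left algebra_simps)

lemma ev_zero: "ev F (0\<^sub>v n) = 0"
  by (simp add: ev_def)

lemma ev_one: "is_point F \<Longrightarrow> ev F \<one>\<^bsub>B\<^esub> = 1"
  by (simp add: ev_def is_point_def B.co_one)

lemma ev_mult:
  assumes F: "is_point F" and x: "x \<in> carrier_vec n" and y: "y \<in> carrier_vec n"
  shows "ev F (x \<otimes>\<^bsub>B\<^esub> y) = ev F x * ev F y"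
proof -
  have "ev F (x \<otimes>\<^bsub>B\<^esub> y) = (\<Sum>k<n. \<Sum>i<n. \<Sum>j<n. x $ i * y $ j * (mlt H i j k * F $ k))"
    using x y by (simp add: ev_def B.co_mult sum_distrib_right sum_distrib_left mult_ac)
  also have "\<dots> = (\<Sum>i<n. \<Sum>j<n. \<Sum>k<n. x $ i * y $ j * (mlt H i j k * F $ k))"
    by (rule trans[OF sum.swap sum.cong[OF refl sum.swap]])
  also have "\<dots> = (\<Sum>i<n. \<Sum>j<n. x $ i * y $ j * (F $ i * F $ j))"
    using F by (simp add: is_point_def flip: sum_distrib_left)
  also have "\<dots> = ev F x * ev F y"
    by (simp add: ev_def sum_product mult_ac)
  finally show ?thesis .
qed

lemma ev_pow: "is_point F \<Longrightarrow> x \<in> carrier_vec n \<Longrightarrow> ev F (x [^]\<^bsub>B\<^esub> (m::nat)) = ev F x ^ m"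
  by (induction m) (auto simp: ev_one ev_mult)

lemma ev_finsum:
  assumes "finite A" "f \<in> A \<rightarrow> carrier_vec n"
  shows "ev F (finsum B f A) = (\<Sum>a\<in>A. ev F (f a))"
  using assms by (induction A) (auto simp: ev_zero ev_add Pi_def)

lemma unit_expansion:
  assumes x: "x \<in> carrier_vec n"
  shows "x = (\<Oplus>\<^bsub>B\<^esub>i\<in>{..<n}. x $ i \<cdot>\<^sub>v unit_vec n i)"
proof (rule B.co_inj[OF x])
  fix k assume k: "k \<in> {..<n}"
  show "x $ k = (\<Oplus>\<^bsub>B\<^esub>i\<in>{..<n}. x $ i \<cdot>\<^sub>v unit_vec n i) $ k"
    using k by (subst B.co_finsum) (auto simp: if_distrib cong: if_cong)
qed (auto intro!: B.finsum_closed)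

text \<open>A common eigenvector of all multiplications defines a character: the nonzero vector
  \<open>w\<close> can be cancelled, which makes the eigenvalue multiplicative.\<close>

lemma eigenvector_point:
  fixes F w :: "'l vec"
  assumes w: "w \<in> carrier_vec n" "w \<noteq> 0\<^sub>v n"
    and eig: "\<And>a. a < n \<Longrightarrow> unit_vec n a \<otimes>\<^bsub>B\<^esub> w = F $ a \<cdot>\<^sub>v w" and F: "F \<in> carrier_vec n"
  shows "x \<in> carrier_vec n \<Longrightarrow> x \<otimes>\<^bsub>B\<^esub> w = ev F x \<cdot>\<^sub>v w" and "is_point F"
proof -
  have *: "x \<otimes>\<^bsub>B\<^esub> w = ev F x \<cdot>\<^sub>v w" if x: "x \<in> carrier_vec n" for x
  proof (rule B.co_inj)
    fix k assume k: "k \<in> {..<n}"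
    have "(x \<otimes>\<^bsub>B\<^esub> w) $ k = ((\<Oplus>\<^bsub>B\<^esub>i\<in>{..<n}. x $ i \<cdot>\<^sub>v unit_vec n i) \<otimes>\<^bsub>B\<^esub> w) $ k"
      using unit_expansion[OF x] by simp
    also have "\<dots> = (\<Sum>i<n. x $ i * (F $ i * w $ k))"
      using k w by (subst B.finsum_ldistr) (auto simp: B.co_finsum B.sm_mult eig)
    also have "\<dots> = (ev F x \<cdot>\<^sub>v w) $ k"
      using k w by (simp add: ev_def sum_distrib_right sum_distrib_left mult_ac)
    finally show "(x \<otimes>\<^bsub>B\<^esub> w) $ k = (ev F x \<cdot>\<^sub>v w) $ k" .
  qed (use x w in auto)
  show "x \<in> carrier_vec n \<Longrightarrow> x \<otimes>\<^bsub>B\<^esub> w = ev F x \<cdot>\<^sub>v w" by (rule *)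
  have canc: "a = b" if "a \<cdot>\<^sub>v w = b \<cdot>\<^sub>v w" for a b
  proof -
    obtain k where "k < n" "w $ k \<noteq> 0" using w by (auto simp: vec_eq_iff)
    with arg_cong[OF that, of "\<lambda>v. vec_index v k"] w show ?thesis by simp
  qed
  have "ev F \<one>\<^bsub>B\<^esub> = 1"
    using *[of "\<one>\<^bsub>B\<^esub>"] w by (intro canc) simp
  moreover have "ev F (unit_vec n i \<otimes>\<^bsub>B\<^esub> unit_vec n j) = F $ i * F $ j" if "i < n" "j < n" for i j
  proof (rule canc)
    have "ev F (unit_vec n i \<otimes>\<^bsub>B\<^esub> unit_vec n j) \<cdot>\<^sub>v w = unit_vec n i \<otimes>\<^bsub>B\<^esub> (unit_vec n j \<otimes>\<^bsub>B\<^esub> w)"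
      using w by (simp add: *[symmetric] B.m_assoc)
    also have "\<dots> = (F $ i * F $ j) \<cdot>\<^sub>v w"
      using w that by (simp add: eig B.sm_mult smult_smult_assoc mult.commute)
    finally show "ev F (unit_vec n i \<otimes>\<^bsub>B\<^esub> unit_vec n j) \<cdot>\<^sub>v w = (F $ i * F $ j) \<cdot>\<^sub>v w" .
  qed
  ultimately show "is_point F"
    using F by (simp add: is_point_def ev_def mult_unit_coord coord_ring_simps(2) B.co_one)
qed

text \<open>Let x satisfy a relation X^m q with q(0) nonzero. Then x^m is nonzero and killed by
  q(x), so its ideal contains an eigenvector of x whose eigenvalue is a root of q, hence nonzero.
  Passing to eigenvectors of the basis elements one at a time, always inside the ideal of the
  previous vector, gives a character with that value at x.\<close>

lemma nullstellensatz:
  assumes ac: "\<And>q :: 'l poly. degree q > 0 \<Longrightarrow> \<exists>z. poly q z = 0"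
    and x [simp]: "x \<in> carrier_vec n" and nil: "\<And>m::nat. x [^]\<^bsub>B\<^esub> m \<noteq> 0\<^sub>v n"
  shows "\<exists>F. is_point F \<and> ev F x \<noteq> 0"
proof -
  obtain r where r: "r \<noteq> 0" "pact x \<one>\<^bsub>B\<^esub> r = 0\<^sub>v n" using pact_relation[of x "\<one>\<^bsub>B\<^esub>"] by auto
  obtain m q where q: "r = [:- 0, 1:] ^ m * q" "\<not> [:- 0, 1:] dvd q" using order_decomp[OF r(1)] by metis
  define w where "w = x [^]\<^bsub>B\<^esub> m"
  have [simp]: "w \<in> carrier_vec n" by (simp add: w_def)
  have w0: "w \<noteq> 0\<^sub>v n" using nil by (simp add: w_def)
  have "pact x \<one>\<^bsub>B\<^esub> ([:- 0, 1:] ^ j * s) = x [^]\<^bsub>B\<^esub> j \<otimes>\<^bsub>B\<^esub> pact x \<one>\<^bsub>B\<^esub> s" for j s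
  proof (induction j)
    case (Suc j)
    have "pact x \<one>\<^bsub>B\<^esub> ([:- 0, 1:] * ([:- 0, 1:] ^ j * s)) = x \<otimes>\<^bsub>B\<^esub> pact x \<one>\<^bsub>B\<^esub> ([:- 0, 1:] ^ j * s)"
      by (subst pact_factor) (auto simp: B.sm_zero)
    with Suc show ?case by (simp add: B.m_ac mult.assoc)
  qed simp
  with r q have "w \<otimes>\<^bsub>B\<^esub> pact x \<one>\<^bsub>B\<^esub> q = 0\<^sub>v n" by (simp add: w_def)
  then have "pact x w q = 0\<^sub>v n" by (simp add: pact_mult_left[of x w])
  moreover have "q \<noteq> 0" using q by auto
  ultimately obtain z s where zs: "poly q z = 0" "pact x w s \<noteq> 0\<^sub>v n" "x \<otimes>\<^bsub>B\<^esub> pact x w s = z \<cdot>\<^sub>v pact x w s"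
    using eigenvector_in_ideal[OF ac, of x w q] w0 by auto
  have z0: "z \<noteq> 0" using q(2) zs(1) by (auto simp: poly_eq_0_iff_dvd)
  have "\<exists>u F. u \<in> carrier_vec n \<and> u \<noteq> 0\<^sub>v n \<and> x \<otimes>\<^bsub>B\<^esub> u = z \<cdot>\<^sub>v u \<and>
      (\<forall>a<m. unit_vec n a \<otimes>\<^bsub>B\<^esub> u = F a \<cdot>\<^sub>v u)" for m
  proof (induction m)
    case 0
    show ?case by (rule exI[of _ "pact x w s"]) (use zs in auto)
  next
    case (Suc m)
    then obtain u F where u [simp]: "u \<in> carrier_vec n" and u': "u \<noteq> 0\<^sub>v n" "x \<otimes>\<^bsub>B\<^esub> u = z \<cdot>\<^sub>v u"
      "\<forall>a<m. unit_vec n a \<otimes>\<^bsub>B\<^esub> u = F a \<cdot>\<^sub>v u" by blast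
    obtain r where "r \<noteq> 0" "pact (unit_vec n m) u r = 0\<^sub>v n"
      by (rule pact_relation[of "unit_vec n m" u]) auto
    then obtain y s where s: "pact (unit_vec n m) u s \<noteq> 0\<^sub>v n"
        "unit_vec n m \<otimes>\<^bsub>B\<^esub> pact (unit_vec n m) u s = y \<cdot>\<^sub>v pact (unit_vec n m) u s"
      using eigenvector_in_ideal[OF ac, of "unit_vec n m" u r] u' by auto
    define u2 where "u2 = pact (unit_vec n m) u s"
    have [simp]: "u2 \<in> carrier_vec n" by (simp add: u2_def)
    \<comment> \<open>\<open>u2\<close> is \<open>u\<close> times a ring element, so it keeps every
      eigenvalue already obtained.\<close>
    have keep: "b \<otimes>\<^bsub>B\<^esub> u2 = c \<cdot>\<^sub>v u2" if "b \<in> carrier_vec n" "b \<otimes>\<^bsub>B\<^esub> u = c \<cdot>\<^sub>v u" for b c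
    proof -
      define g where "g = pact (unit_vec n m) \<one>\<^bsub>B\<^esub> s"
      have [simp]: "g \<in> carrier_vec n" by (simp add: g_def)
      have u2: "u2 = u \<otimes>\<^bsub>B\<^esub> g" by (simp add: u2_def g_def pact_mult_left[of "unit_vec n m" u])
      have "b \<otimes>\<^bsub>B\<^esub> (u \<otimes>\<^bsub>B\<^esub> g) = (b \<otimes>\<^bsub>B\<^esub> u) \<otimes>\<^bsub>B\<^esub> g" 
        using that(1) by (intro B.m_assoc[symmetric]) auto
      then show ?thesis using that by (simp add: u2 B.sm_mult)
    qed
    have "u2 \<in> carrier_vec n \<and> u2 \<noteq> 0\<^sub>v n \<and> x \<otimes>\<^bsub>B\<^esub> u2 = z \<cdot>\<^sub>v u2 \<and>
      (\<forall>a<Suc m. unit_vec n a \<otimes>\<^bsub>B\<^esub> u2 = (F(m := y)) a \<cdot>\<^sub>v u2)"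
      using s u' keep by (auto simp: less_Suc_eq u2_def[symmetric])
    then show ?case by blast
  qed
  then obtain u F where u: "u \<in> carrier_vec n" "u \<noteq> 0\<^sub>v n" "x \<otimes>\<^bsub>B\<^esub> u = z \<cdot>\<^sub>v u"
      "\<forall>a<n. unit_vec n a \<otimes>\<^bsub>B\<^esub> u = F a \<cdot>\<^sub>v u" by blast
  have eig: "unit_vec n a \<otimes>\<^bsub>B\<^esub> u = vec n F $ a \<cdot>\<^sub>v u" if "a < n" for a using u that by simp
  have "is_point (vec n F)" by (rule eigenvector_point(2)[OF u(1,2) eig]) auto
  moreover have "ev (vec n F) x \<cdot>\<^sub>v u = z \<cdot>\<^sub>v u"
    using eigenvector_point(1)[OF u(1,2) eig _ x] u by simp
  then have "ev (vec n F) x \<noteq> 0"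
  proof (rule contrapos_pn)
    assume 0: "ev (vec n F) x = 0"
    obtain k where "k < n" "u $ k \<noteq> 0" using u by (auto simp: vec_eq_iff)
    then show "ev (vec n F) x \<cdot>\<^sub>v u \<noteq> z \<cdot>\<^sub>v u" using 0 z0 u(1) by (auto simp: vec_eq_iff intro!: exI[of _ k])
  qed
  ultimately show ?thesis by blast
qed

end

section \<open>Primitive elements separate the points\<close>

lemma of_nat_pow_CHAR:
  fixes p :: nat
  assumes "CHAR('l::field) = p" "Factorial_Ring.prime p"
  shows "(of_nat i :: 'l) ^ p = of_nat i"
proof (induction i)
  case 0
  then show ?case using assms prime_gt_0_nat[of p] by (simp add: zero_power)
next
  case (Suc i)
  have "(1 + of_nat i :: 'l) ^ p = 1 ^ p + of_nat i ^ p"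
    by (rule freshmans_dream) (use assms in auto)
  with Suc show ?case by simp
qed

text \<open>In a finite commutative group of exponent \<open>p\<close> a subgroup which is maximal among those avoiding
  \<open>h\<close> is a complement of the subgroup generated by \<open>h\<close>.\<close>

lemma (in comm_group) separating_character:
  assumes fin: "finite (carrier G)" and p: "Factorial_Ring.prime p"
    and ex: "\<And>x. x \<in> carrier G \<Longrightarrow> x [^] (p::nat) = \<one>"
    and h: "h \<in> carrier G" "h \<noteq> \<one>" and char: "CHAR('l::field) = p"
  shows "\<exists>\<chi> :: 'a \<Rightarrow> 'l. (\<forall>x\<in>carrier G. \<forall>y\<in>carrier G. \<chi> (x \<otimes> y) = \<chi> x + \<chi> y) \<and>
    (\<forall>x\<in>carrier G. \<chi> x ^ p = \<chi> x) \<and> \<chi> h \<noteq> 0"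
proof -
  define S where "S = {W. subgroup W G \<and> h \<notin> W}"
  have "{\<one>} \<in> S" using h triv_subgroup by (auto simp: S_def)
  moreover have "finite S"
    by (rule finite_subset[of _ "Pow (carrier G)"]) (use fin in \<open>auto simp: S_def dest: subgroup.subset\<close>)
  ultimately obtain W where W: "W \<in> S" and max: "\<And>W'. W' \<in> S \<Longrightarrow> W \<subseteq> W' \<Longrightarrow> W = W'"
    using finite_has_maximal[of S] by blast
  have sW: "subgroup W G" and hW: "h \<notin> W" using W by (auto simp: S_def)
  interpret W: subgroup W G by (rule sW)
  have WG [simp]: "w \<in> W \<Longrightarrow> w \<in> carrier G" for w using W.subset by blast
  have Wpow: "w \<in> W \<Longrightarrow> w [^] (i::nat) \<in> W" for w i by (induction i) auto
  \<comment> \<open>An exponent prime to p is invertible modulo the exponent p of the group, so x is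
    a power of its own i-th power.\<close>
  have coprime_pow: "\<exists>j. x [^] (i * j) = x" if "x \<in> carrier G" "\<not> p dvd i" for x and i :: nat
  proof -
    have "coprime i p" using that p prime_imp_coprime coprime_commute by blast
    moreover have "i \<noteq> 0" using that(2) by (intro notI) simp
    ultimately obtain j m where j: "i * j = p * m + 1"
      using bezout_nat[of i p] by auto
    then have "x [^] (i * j) = (x [^] p) [^] m \<otimes> x"
      using that by (simp add: nat_pow_mult[symmetric] nat_pow_pow)
    then show ?thesis using that ex by auto
  qed
  \<comment> \<open>If x has no such form, then W and x generate a subgroup strictly larger than W,
    which contains h = w x^i by maximality. Since h is not in W, i is prime to p, and the equation
    can be solved for x.\<close>
  have decomp: "\<exists>w\<in>W. \<exists>i::nat. x = w \<otimes> h [^] i" if x: "x \<in> carrier G" for x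
  proof (rule ccontr)
    assume none: "\<not> ?thesis"
    define W' where "W' = {w \<otimes> x [^] i |w i. w \<in> W \<and> i \<in> (UNIV :: nat set)}"
    have "subgroup W' G"
    proof (rule subgroupI)
      show "W' \<subseteq> carrier G" using x by (auto simp: W'_def)
      show "W' \<noteq> {}" using W.one_closed unfolding W'_def by blast
      fix a assume "a \<in> W'"
      then obtain w i where a: "a = w \<otimes> x [^] (i::nat)" "w \<in> W" by (auto simp: W'_def)
      have "x [^] i \<otimes> x [^] ((p - 1) * i) = x [^] (p * i)"
        using x prime_gt_0_nat[OF p] by (simp add: nat_pow_mult algebra_simps)
      also have "\<dots> = \<one>" using x ex by (simp add: nat_pow_pow[symmetric])
      finally have inv: "inv (x [^] i) = x [^] ((p - 1) * i)"
        using x by (metis inv_equality m_comm nat_pow_closed)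
      have "inv a = inv w \<otimes> x [^] ((p - 1) * i)"
        using a x by (simp add: inv_mult inv)
      then show "inv a \<in> W'" using a(2) unfolding W'_def by blast
      fix b assume "b \<in> W'"
      then obtain w' i' where b: "b = w' \<otimes> x [^] (i'::nat)" "w' \<in> W" by (auto simp: W'_def)
      have "a \<otimes> b = (w \<otimes> w') \<otimes> x [^] (i + i')" using a b x by (simp add: nat_pow_mult[symmetric] m_ac)
      then show "a \<otimes> b \<in> W'" using a(2) b(2) W.m_closed unfolding W'_def by blast
    qed
    moreover have "W \<subseteq> W'"
    proof
      fix w assume "w \<in> W"
      then have "w = w \<otimes> x [^] (0::nat)" by simp
      with \<open>w \<in> W\<close> show "w \<in> W'" unfolding W'_def by blast
    qed
    moreover have "x \<in> W'"
    proof -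
      have "x = \<one> \<otimes> x [^] (1::nat)" using x by simp
      then show ?thesis unfolding W'_def using W.one_closed by blast
    qed
    moreover have "x \<notin> W"
    proof
      assume "x \<in> W"
      moreover have "x = x \<otimes> h [^] (0::nat)" using x by simp
      ultimately show False using none by blast
    qed
    ultimately have "h \<in> W'" using max[of W'] by (auto simp: S_def)
    then obtain w i where hw: "h = w \<otimes> x [^] (i::nat)" "w \<in> W" by (auto simp: W'_def)
    have "\<not> p dvd i"
    proof
      assume "p dvd i"
      then obtain m where "i = p * m" by blast
      then have "h = w" using hw x ex by (simp add: nat_pow_pow[symmetric])
      with hw hW show False by simp
    qed
    then obtain j where j: "x [^] (i * j) = x" using coprime_pow[OF x] by blast
    have "h [^] j = w [^] j \<otimes> x"
      using hw x j by (simp add: nat_pow_distrib nat_pow_pow)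
    then have "x = inv (w [^] j) \<otimes> h [^] j" using hw x by (simp add: m_assoc[symmetric])
    with none hw(2) Wpow show False by blast
  qed
  \<comment> \<open>The exponent of h is determined modulo p: otherwise some power of h with
    exponent prime to p would lie in W, and with it h.\<close>
  have uniq: "(of_nat i :: 'l) = of_nat i'" if "w \<otimes> h [^] i = w' \<otimes> h [^] i'" "w \<in> W" "w' \<in> W" "i \<le> i'"
    for w w' i i'
  proof -
    define d where "d = i' - i"
    have i': "i' = i + d" using that by (simp add: d_def)
    have "w \<otimes> h [^] i = (w' \<otimes> h [^] d) \<otimes> h [^] i"
      using that h by (simp add: i' nat_pow_mult[symmetric] m_ac)
    then have "w = w' \<otimes> h [^] d" using that h by (metis WG m_closed nat_pow_closed r_cancel)
    then have hd: "h [^] d = inv w' \<otimes> w" using that h by (simp add: m_assoc[symmetric])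
    have "p dvd d"
    proof (rule ccontr)
      assume "\<not> p dvd d"
      then obtain j where "h [^] (d * j) = h" using coprime_pow h by blast
      moreover have "h [^] (d * j) = (inv w' \<otimes> w) [^] j" using h by (simp add: nat_pow_pow[symmetric] hd)
      ultimately show False using hW Wpow[of "inv w' \<otimes> w" j] that by auto
    qed
    then show ?thesis by (simp add: i' of_nat_eq_0_iff_char_dvd char)
  qed
  define P where "P x i \<longleftrightarrow> (\<exists>w\<in>W. x = w \<otimes> h [^] i)" for x and i :: nat
  \<comment> \<open>The exponent is unique only modulo p; in the field, where p is 0, its image no
    longer depends on the choice.\<close>
  define \<chi> where "\<chi> x = (of_nat (SOME i. P x i) :: 'l)" for x
  have \<chi>: "\<chi> x = of_nat i" if "P x i" for x i
  proof -
    define m where "m = (SOME i. P x i)"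
    have "P x m" unfolding m_def using that by (rule someI)
    with that obtain w w' where w: "w \<in> W" "w' \<in> W" "x = w \<otimes> h [^] i" "x = w' \<otimes> h [^] m"
      unfolding P_def by blast
    have "(of_nat i :: 'l) = of_nat m"
    proof (cases "i \<le> m")
      case True
      with w show ?thesis using uniq[of w i w' m] by simp
    next
      case False
      with w show ?thesis using uniq[of w' m w i] by simp
    qed
    then show ?thesis by (simp add: \<chi>_def m_def)
  qed
  have exP: "\<exists>i. P x i" if "x \<in> carrier G" for x using decomp[OF that] unfolding P_def by blast
  have "\<chi> (x \<otimes> y) = \<chi> x + \<chi> y" if xy: "x \<in> carrier G" "y \<in> carrier G" for x y
  proof -
    obtain i where i: "P x i" using exP[OF xy(1)] ..
    obtain i' where i': "P y i'" using exP[OF xy(2)] ..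
    obtain w where w: "w \<in> W" "x = w \<otimes> h [^] i" using i unfolding P_def by (elim bexE)
    obtain w' where w': "w' \<in> W" "y = w' \<otimes> h [^] i'" using i' unfolding P_def by (elim bexE)
    have "x \<otimes> y = (w \<otimes> w') \<otimes> h [^] (i + i')" using w w' h by (simp add: nat_pow_mult[symmetric] m_ac)
    then have "P (x \<otimes> y) (i + i')" unfolding P_def using w(1) w'(1) W.m_closed by (intro bexI[of _ "w \<otimes> w'"]) auto
    from \<chi>[OF this] \<chi>[OF i] \<chi>[OF i'] show ?thesis by simp
  qed
  moreover have "\<chi> x ^ p = \<chi> x" for x
    unfolding \<chi>_def by (rule of_nat_pow_CHAR[OF char p])
  moreover have "P h 1" using h unfolding P_def by (intro bexI[of _ \<one>]) auto
  then have "\<chi> h = 1" by (simp add: \<chi>)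
  ultimately show ?thesis by (intro exI[of _ \<chi>]) auto
qed

lemma sum_rotate5:
  "(\<Sum>a\<in>A. \<Sum>b\<in>B. \<Sum>c\<in>C. \<Sum>d\<in>D. \<Sum>e\<in>E. f a b c d e) =
   (\<Sum>b\<in>B. \<Sum>c\<in>C. \<Sum>d\<in>D. \<Sum>e\<in>E. \<Sum>a\<in>A. f a b c d e)"
proof -
  have "(\<Sum>a\<in>A. \<Sum>b\<in>B. \<Sum>c\<in>C. \<Sum>d\<in>D. \<Sum>e\<in>E. f a b c d e) =
      (\<Sum>b\<in>B. \<Sum>a\<in>A. \<Sum>c\<in>C. \<Sum>d\<in>D. \<Sum>e\<in>E. f a b c d e)"
    by (rule sum.swap)
  also have "\<dots> = (\<Sum>b\<in>B. \<Sum>c\<in>C. \<Sum>a\<in>A. \<Sum>d\<in>D. \<Sum>e\<in>E. f a b c d e)"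
    by (rule sum.cong[OF refl], rule sum.swap)
  also have "\<dots> = (\<Sum>b\<in>B. \<Sum>c\<in>C. \<Sum>d\<in>D. \<Sum>a\<in>A. \<Sum>e\<in>E. f a b c d e)"
    by (rule sum.cong[OF refl], rule sum.cong[OF refl], rule sum.swap)
  also have "\<dots> = (\<Sum>b\<in>B. \<Sum>c\<in>C. \<Sum>d\<in>D. \<Sum>e\<in>E. \<Sum>a\<in>A. f a b c d e)"
    by (rule sum.cong[OF refl], rule sum.cong[OF refl], rule sum.cong[OF refl], rule sum.swap)
  finally show ?thesis .
qed

lemma sum_rotate4:
  "(\<Sum>b\<in>B. \<Sum>c\<in>C. \<Sum>d\<in>D. \<Sum>e\<in>E. f b c d e) =
   (\<Sum>c\<in>C. \<Sum>d\<in>D. \<Sum>e\<in>E. \<Sum>b\<in>B. f b c d e)"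
  using sum_rotate5[where f = "\<lambda>b c d e (_::unit). f b c d e" and A = B and B = C and C = D
    and D = E and E = "{()}"]
  by simp

section \<open>The group of points and its relation to primitive elements\<close>

context fin_alg
begin

text \<open>The group law on points: the tensor product of two points composed with the
  comultiplication.\<close>

definition conv :: "'l vec \<Rightarrow> 'l vec \<Rightarrow> 'l vec" where
  "conv F G = vec n (\<lambda>k. \<Sum>i<n. \<Sum>j<n. cml H k i j * (F $ i * G $ j))"

definition pts :: "'l vec monoid" where
  "pts = \<lparr>carrier = {F. is_point F}, monoid.mult = conv, one = vec n (cnt H)\<rparr>"

definition prim :: "'l vec \<Rightarrow> bool" where
  "prim y \<longleftrightarrow> y \<in> carrier_vec n \<and> comul H y = tensor H y \<one>\<^bsub>B\<^esub> + tensor H \<one>\<^bsub>B\<^esub> y"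

lemma ev_conv: "ev (conv F G) x = (\<Sum>i<n. \<Sum>j<n. comul H x $$ (i, j) * (F $ i * G $ j))"
proof -
  have "ev (conv F G) x = (\<Sum>k<n. \<Sum>i<n. \<Sum>j<n. x $ k * cml H k i j * (F $ i * G $ j))"
    by (simp add: ev_def conv_def sum_distrib_left mult_ac)
  also have "\<dots> = (\<Sum>i<n. \<Sum>j<n. \<Sum>k<n. x $ k * cml H k i j * (F $ i * G $ j))"
    by (rule trans[OF sum.swap sum.cong[OF refl sum.swap]])
  finally show ?thesis by (simp add: comul_def sum_distrib_right)
qed

text \<open>A primitive element is a homomorphism to the additive group; the two mixed terms are
  values at 1, which are 1.\<close>

lemma conv_prim:
  assumes "prim y" "is_point F" "is_point G"
  shows "ev (conv F G) y = ev F y + ev G y"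
proof -
  have "ev (conv F G) y = (\<Sum>i<n. \<Sum>j<n. (y $ i * \<one>\<^bsub>B\<^esub> $ j + \<one>\<^bsub>B\<^esub> $ i * y $ j) * (F $ i * G $ j))"
    using assms(1) unfolding ev_conv prim_def by (simp add: tensor_def)
  also have "\<dots> = ev F y * ev G \<one>\<^bsub>B\<^esub> + ev F \<one>\<^bsub>B\<^esub> * ev G y"
    unfolding ev_def sum_product sum.distrib[symmetric]
    by (intro sum.cong refl) (simp add: algebra_simps)
  finally show ?thesis using assms by (simp add: ev_one)
qed

text \<open>The comultiplication is a ring homomorphism, which is \<open>mlt_cml\<close> on products
  and \<open>unt_cml\<close> on the unit. The multiple sum is reordered until each point meets the
  structure constants of its own tensor factor.\<close>

lemma conv_point:
  assumes F: "is_point F" and G: "is_point G"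
  shows "is_point (conv F G)"
proof -
  have m: "(\<Sum>k<n. mlt H i j k * F $ k) = F $ i * F $ j" "(\<Sum>k<n. mlt H i j k * G $ k) = G $ i * G $ j"
    if "i < n" "j < n" for i j
    using F G that by (auto simp: is_point_def)
  have 1: "(\<Sum>k<n. mlt H i j k * conv F G $ k) = conv F G $ i * conv F G $ j" if ij: "i < n" "j < n" for i j
  proof -
    have "(\<Sum>k<n. mlt H i j k * conv F G $ k) =
        (\<Sum>k<n. \<Sum>a<n. \<Sum>b<n. mlt H i j k * cml H k a b * (F $ a * G $ b))"
      by (simp add: conv_def sum_distrib_left mult_ac)
    also have "\<dots> = (\<Sum>a<n. \<Sum>b<n. \<Sum>k<n. mlt H i j k * cml H k a b * (F $ a * G $ b))"
      by (rule trans[OF sum.swap sum.cong[OF refl sum.swap]])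
    also have "\<dots> = (\<Sum>a<n. \<Sum>b<n. (\<Sum>a1<n. \<Sum>b1<n. \<Sum>c<n. \<Sum>d<n.
         cml H i a1 b1 * cml H j c d * (mlt H a1 c a * mlt H b1 d b)) * (F $ a * G $ b))"
    proof (rule sum.cong[OF refl], rule sum.cong[OF refl], goal_cases)
      case (1 a b)
      then show ?case
        unfolding sum_distrib_right[symmetric, of "\<lambda>k. mlt H i j k * cml H k a b"]
        by (subst mlt_cml) (use ij in auto)
    qed
    also have "\<dots> = (\<Sum>a<n. \<Sum>a1<n. \<Sum>b1<n. \<Sum>c<n. \<Sum>d<n. \<Sum>b<n.
         cml H i a1 b1 * cml H j c d * (mlt H a1 c a * mlt H b1 d b) * (F $ a * G $ b))"
      unfolding sum_distrib_right
      by (rule sum.cong[OF refl], rule sum_rotate5)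
    also have "\<dots> = (\<Sum>a1<n. \<Sum>b1<n. \<Sum>c<n. \<Sum>d<n. \<Sum>a<n. \<Sum>b<n.
         cml H i a1 b1 * cml H j c d * (mlt H a1 c a * mlt H b1 d b) * (F $ a * G $ b))"
      by (rule sum_rotate5)
    also have "\<dots> = (\<Sum>a1<n. \<Sum>b1<n. \<Sum>c<n. \<Sum>d<n. cml H i a1 b1 * cml H j c d *
        ((\<Sum>a<n. mlt H a1 c a * F $ a) * (\<Sum>b<n. mlt H b1 d b * G $ b)))"
      unfolding sum_product unfolding sum_distrib_left by (intro sum.cong refl) (simp add: mult_ac)
    also have "\<dots> = (\<Sum>a1<n. \<Sum>b1<n. \<Sum>c<n. \<Sum>d<n. cml H i a1 b1 * cml H j c d *
        ((F $ a1 * F $ c) * (G $ b1 * G $ d)))"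
      by (simp add: m)
    also have "\<dots> = (\<Sum>a<n. \<Sum>b<n. cml H i a b * (F $ a * G $ b) *
        (\<Sum>c<n. \<Sum>d<n. cml H j c d * (F $ c * G $ d)))"
      unfolding sum_distrib_left by (intro sum.cong refl) (simp add: mult_ac)
    also have "\<dots> = conv F G $ i * conv F G $ j"
      using ij by (simp only: sum_distrib_right[symmetric]) (simp add: conv_def)
    finally show ?thesis .
  qed
  have 2: "(\<Sum>k<n. unt H k * conv F G $ k) = 1"
  proof -
    have "(\<Sum>k<n. unt H k * conv F G $ k) = (\<Sum>k<n. \<Sum>a<n. \<Sum>b<n. unt H k * cml H k a b * (F $ a * G $ b))"
      by (simp add: conv_def sum_distrib_left mult_ac)
    also have "\<dots> = (\<Sum>a<n. \<Sum>b<n. \<Sum>k<n. unt H k * cml H k a b * (F $ a * G $ b))"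
      by (rule trans[OF sum.swap sum.cong[OF refl sum.swap]])
    also have "\<dots> = (\<Sum>a<n. \<Sum>b<n. (unt H a * unt H b) * (F $ a * G $ b))"
    proof (rule sum.cong[OF refl], rule sum.cong[OF refl], goal_cases)
      case (1 a b)
      then show ?case
        unfolding sum_distrib_right[symmetric, of "\<lambda>k. unt H k * cml H k a b"]
        by (subst unt_cml) auto
    qed
    also have "\<dots> = (\<Sum>a<n. unt H a * F $ a) * (\<Sum>b<n. unt H b * G $ b)"
      by (simp add: sum_product mult_ac)
    finally show ?thesis using F G by (simp add: is_point_def)
  qed
  have 3: "conv F G \<in> carrier_vec n" by (simp add: conv_def)
  show ?thesis unfolding is_point_def using 1 2 3 by (intro conjI allI impI)
qed

lemma cnt_point: "is_point (vec n (cnt H))"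
  by (simp add: is_point_def mlt_cnt unt_cnt)

lemma conv_comm: "conv F G = conv G F"
proof (intro eq_vecI)
  fix k assume "k < dim_vec (conv G F)"
  then have k: "k < n" by (simp add: conv_def)
  have "(\<Sum>i<n. \<Sum>j<n. cml H k i j * (F $ i * G $ j)) = (\<Sum>j<n. \<Sum>i<n. cml H k i j * (F $ i * G $ j))"
    by (rule sum.swap)
  also have "\<dots> = (\<Sum>j<n. \<Sum>i<n. cml H k j i * (G $ j * F $ i))"
  proof (rule sum.cong[OF refl], rule sum.cong[OF refl], goal_cases)
    case (1 j i)
    then show ?case using cml_comm[of k i j] k by (simp add: mult.commute)
  qed
  finally show "conv F G $ k = conv G F $ k" using k by (simp add: conv_def)
qed (simp add: conv_def)

lemma conv_one: "F \<in> carrier_vec n \<Longrightarrow> conv (vec n (cnt H)) F = F"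
proof (intro eq_vecI)
  fix k assume "F \<in> carrier_vec n" "k < dim_vec F"
  then have k: "k < n" by auto
  have "conv (vec n (cnt H)) F $ k = (\<Sum>j<n. \<Sum>i<n. cnt H i * cml H k i j * F $ j)"
    using k unfolding conv_def by (simp add: mult_ac) (rule sum.swap)
  also have "\<dots> = (\<Sum>j<n. if j = k then F $ j else 0)"
    using k by (intro sum.cong refl) (simp add: sum_distrib_right[symmetric] cml_cnt)
  finally show "conv (vec n (cnt H)) F $ k = F $ k" using k by simp
qed (simp add: conv_def)

lemma conv_assoc: "conv (conv F G) K = conv F (conv G K)"
proof (intro eq_vecI)
  fix k assume "k < dim_vec (conv F (conv G K))"
  then have k: "k < n" by (simp add: conv_def)
  have "conv (conv F G) K $ k = (\<Sum>i<n. \<Sum>c<n. \<Sum>a<n. \<Sum>b<n. cml H k i c * cml H i a b * (F $ a * G $ b * K $ c))"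
    using k by (simp add: conv_def sum_distrib_left sum_distrib_right mult_ac)
  also have "\<dots> = (\<Sum>c<n. \<Sum>a<n. \<Sum>b<n. \<Sum>i<n. cml H k i c * cml H i a b * (F $ a * G $ b * K $ c))"
    by (rule sum_rotate4)
  also have "\<dots> = (\<Sum>c<n. \<Sum>a<n. \<Sum>b<n. \<Sum>i<n. cml H k a i * cml H i b c * (F $ a * G $ b * K $ c))"
  proof (rule sum.cong[OF refl], rule sum.cong[OF refl], rule sum.cong[OF refl], goal_cases)
    case (1 c a b)
    with k cml_assoc[of k a b c] show ?case by (simp add: sum_distrib_right[symmetric])
  qed
  also have "\<dots> = (\<Sum>a<n. \<Sum>c<n. \<Sum>i<n. \<Sum>b<n. cml H k a i * cml H i b c * (F $ a * G $ b * K $ c))"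
    by (rule trans[OF sum.swap]) (rule sum.cong[OF refl], rule sum.cong[OF refl], rule sum.swap)
  also have "\<dots> = (\<Sum>a<n. \<Sum>i<n. \<Sum>b<n. \<Sum>c<n. cml H k a i * cml H i b c * (F $ a * G $ b * K $ c))"
    by (rule sum.cong[OF refl], rule trans[OF sum.swap], rule sum.cong[OF refl], rule sum.swap)
  also have "\<dots> = conv F (conv G K) $ k"
    using k by (simp add: conv_def sum_distrib_left sum_distrib_right mult_ac)
  finally show "conv (conv F G) K $ k = conv F (conv G K) $ k" .
qed (simp add: conv_def)

lemma pts_comm_monoid: "comm_monoid pts"
  by (rule comm_monoidI) (auto simp: pts_def conv_point cnt_point conv_assoc conv_one intro: conv_comm)

text \<open>The exponent supplies the inverses: the inverse of F is its power with exponent p -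
  1.\<close>

lemma pts_comm_group:
  assumes p: "p > 0" and ex: "\<And>F. is_point F \<Longrightarrow> F [^]\<^bsub>pts\<^esub> (p::nat) = \<one>\<^bsub>pts\<^esub>"
  shows "comm_group pts"
proof -
  interpret comm_monoid pts by (rule pts_comm_monoid)
  show ?thesis
  proof (rule comm_groupI)
    fix F assume F: "F \<in> carrier pts"
    have "F [^]\<^bsub>pts\<^esub> (p - 1) \<otimes>\<^bsub>pts\<^esub> F = F [^]\<^bsub>pts\<^esub> p"
      using p F by (metis Suc_diff_1 nat_pow_Suc)
    also have "\<dots> = \<one>\<^bsub>pts\<^esub>" using F by (intro ex) (simp add: pts_def)
    finally show "\<exists>G\<in>carrier pts. G \<otimes>\<^bsub>pts\<^esub> F = \<one>\<^bsub>pts\<^esub>" using F nat_pow_closed by blast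
  qed (auto simp: m_ac)
qed

end

section \<open>Interpolation at the points and large Frobenius powers\<close>

locale fin_alg_char = fin_alg H for H :: "'l::alg_closed_field bialg" +
  fixes p :: nat
  assumes char: "CHAR('l) = p" and p: "Factorial_Ring.prime p"
begin

lemma ac: "degree (q :: 'l poly) > 0 \<Longrightarrow> \<exists>z. poly q z = 0"
  by (rule alg_closed_imp_poly_has_root)

lemma frob_add: "x \<in> carrier_vec n \<Longrightarrow> y \<in> carrier_vec n \<Longrightarrow>
    (x + y) [^]\<^bsub>B\<^esub> (p ^ N) = x [^]\<^bsub>B\<^esub> (p ^ N) + y [^]\<^bsub>B\<^esub> (p ^ N)"
  using B.frob_add[of x y N] char p by simp

lemma frob_finsum: "finite A \<Longrightarrow> f \<in> A \<rightarrow> carrier_vec n \<Longrightarrow>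
    finsum B f A [^]\<^bsub>B\<^esub> (p ^ N) = finsum B (\<lambda>a. f a [^]\<^bsub>B\<^esub> (p ^ N)) A"
  using B.frob_finsum[of A f N] char p by simp

lemma frob_add_field: "(a + b :: 'l) ^ (p ^ N) = a ^ (p ^ N) + b ^ (p ^ N)"
  by (rule freshmans_dream') (use char p in auto)

lemma frob_sum_field: "(sum f A :: 'l) ^ (p ^ N) = (\<Sum>a\<in>A. f a ^ (p ^ N))"
  by (rule freshmans_dream_sum') (use char p in auto)

lemma separating_element:
  assumes "finite A" "\<And>g. g \<in> A \<Longrightarrow> is_point g" and f: "is_point f" "f \<notin> A"
  shows "\<exists>x\<in>carrier_vec n. ev f x = 1 \<and> (\<forall>g\<in>A. ev g x = 0)"
  using assms(1,2) f(2)
proof (induction A)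
  case empty
  show ?case by (rule bexI[of _ "\<one>\<^bsub>B\<^esub>"]) (use f ev_one in auto)
next
  case (insert g A)
  then obtain x where x: "x \<in> carrier_vec n" "ev f x = 1" "\<forall>g\<in>A. ev g x = 0" by auto
  have g: "is_point g" using insert.prems by auto
  have "f \<noteq> g" using insert.prems by auto
  then obtain i where i: "i < n" "f $ i \<noteq> g $ i"
    using is_point_carrier[OF f(1)] is_point_carrier[OF g] by (auto simp: vec_eq_iff)
  \<comment> \<open>The Lagrange factor, with value 1 at \<open>f\<close> and 0 at
    \<open>g\<close>.\<close>
  define y where "y = inverse (f $ i - g $ i) \<cdot>\<^sub>v (unit_vec n i + (- (g $ i)) \<cdot>\<^sub>v \<one>\<^bsub>B\<^esub>)"
  have y: "y \<in> carrier_vec n" by (simp add: y_def)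
  have ey: "ev F y = inverse (f $ i - g $ i) * (F $ i - g $ i)" if "is_point F" for F
    using that i by (simp add: y_def ev_smult ev_add ev_unit ev_one)
  have "ev f (x \<otimes>\<^bsub>B\<^esub> y) = 1" using x y f i by (simp add: ev_mult ey)
  moreover have "ev g' (x \<otimes>\<^bsub>B\<^esub> y) = 0" if "g' \<in> insert g A" for g'
    using that x y insert.prems g by (auto simp: ev_mult ey)
  ultimately show ?case using x y by (intro bexI[of _ "x \<otimes>\<^bsub>B\<^esub> y"]) auto
qed

text \<open>Separating elements for n + 1 distinct points would form a family dual to them, hence n
  + 1 independent vectors in an n-dimensional space.\<close>

lemma finite_points: "finite {F. is_point F}"
proof (rule ccontr)
  assume "infinite {F. is_point F}"
  then obtain A where A: "A \<subseteq> {F. is_point F}" "finite A" "card A = Suc n"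
    using infinite_arbitrarily_large by metis
  from A(2,3) obtain h where h: "bij_betw h {0..<Suc n} A"
    using ex_bij_betw_nat_finite by metis
  have hp: "is_point (h j)" if "j \<le> n" for j
    using A(1) bij_betwE[OF h] that by (auto simp: less_Suc_eq_le)
  have "\<exists>x\<in>carrier_vec n. ev (h j) x = 1 \<and> (\<forall>g\<in>A - {h j}. ev g x = 0)" if "j \<le> n" for j
    by (rule separating_element) (use A hp[OF that] in auto)
  then obtain e where e: "\<And>j. j \<le> n \<Longrightarrow> e j \<in> carrier_vec n" "\<And>j. j \<le> n \<Longrightarrow> ev (h j) (e j) = 1"
     "\<And>j g. j \<le> n \<Longrightarrow> g \<in> A - {h j} \<Longrightarrow> ev g (e j) = 0" by metis
  obtain c where c: "\<exists>j\<le>n. c j \<noteq> 0" "\<forall>i<n. (\<Sum>j\<le>n. e j $ i * c j) = 0"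
    using underdetermined_system[of n "\<lambda>i j. e j $ i"] by blast
  have "c j = 0" if j: "j \<le> n" for j
  proof -
    have "0 = ev (h j) (finsum B (\<lambda>j. c j \<cdot>\<^sub>v e j) {..n})"
      using c(2) e(1) by (subst arg_cong[of _ "0\<^sub>v n" "ev (h j)"])
        (auto intro!: B.co_inj B.finsum_closed simp: B.co_finsum B.co_sm ev_zero mult.commute)
    also have "\<dots> = (\<Sum>i\<le>n. c i * ev (h j) (e i))"
      using e(1) by (subst ev_finsum) (auto simp: ev_smult)
    also have "\<dots> = (\<Sum>i\<le>n. if i = j then c i else 0)"
    proof (rule sum.cong[OF refl])
      fix i assume i: "i \<in> {..n}"
      have "h j \<in> A - {h i}" if "i \<noteq> j"
        using that i j h by (auto simp: bij_betw_def inj_on_def less_Suc_eq_le)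
      then show "c i * ev (h j) (e i) = (if i = j then c i else 0)"
        using e(2,3) i j by auto
    qed
    finally show "c j = 0" using j by simp
  qed
  with c(1) show False by blast
qed

lemma dual_basis:
  obtains e where "\<And>f. is_point f \<Longrightarrow> e f \<in> carrier_vec n"
    "\<And>f g. is_point f \<Longrightarrow> is_point g \<Longrightarrow> ev g (e f) = (if f = g then 1 else 0)"
proof -
  have "\<exists>x. x \<in> carrier_vec n \<and> (\<forall>g. is_point g \<longrightarrow> ev g x = (if f = g then 1 else 0))" if "is_point f" for f
  proof -
    have "\<exists>x\<in>carrier_vec n. ev f x = 1 \<and> (\<forall>g\<in>{F. is_point F} - {f}. ev g x = 0)"
      by (rule separating_element) (use finite_points that in auto)
    then show ?thesis by auto
  qed
  then have "\<exists>e. \<forall>f. is_point f \<longrightarrow> e f \<in> carrier_vec n \<and> (\<forall>g. is_point g \<longrightarrow> ev g (e f) = (if f = g then 1 else 0))"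
    by (intro choice) auto
  then show ?thesis using that by auto
qed

lemma eventually_nilpotent:
  assumes x: "x \<in> carrier_vec n" and 0: "\<And>f. is_point f \<Longrightarrow> ev f x = 0"
  shows "\<exists>N0. \<forall>N\<ge>N0. x [^]\<^bsub>B\<^esub> (p ^ N) = 0\<^sub>v n"
proof -
  obtain m where m: "x [^]\<^bsub>B\<^esub> (m::nat) = 0\<^sub>v n" using nullstellensatz[OF ac x] 0 by blast
  have "x [^]\<^bsub>B\<^esub> (p ^ N) = 0\<^sub>v n" if "N \<ge> m" for N
  proof -
    have "m \<le> N" using that .
    also have "N \<le> p ^ N" using prime_gt_1_nat[OF p] by (simp add: less_imp_le power_gt_expt)
    finally obtain d where "p ^ N = m + d" using le_Suc_ex by blast
    then show ?thesis using x m by (simp add: B.nat_pow_mult[symmetric])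
  qed
  then show ?thesis by blast
qed

text \<open>Each basis vector differs from the interpolation of its values by an element vanishing
  at all points. Such an element is nilpotent and is killed by a large Frobenius power. One N serves
  the finitely many basis vectors, and additivity of Frobenius extends the formula to every x. The
  \<open>E f\<close> are the Frobenius powers of the dual elements.\<close>

lemma frobenius_idempotents:
  "\<exists>N E. (\<forall>f. is_point f \<longrightarrow> E f \<in> carrier_vec n) \<and>
    (\<forall>x\<in>carrier_vec n.
      x [^]\<^bsub>B\<^esub> (p ^ N) = finsum B (\<lambda>f. ev f x ^ (p ^ N) \<cdot>\<^sub>v E f) {f. is_point f})"
proof -
  obtain e where e: "\<And>f. is_point f \<Longrightarrow> e f \<in> carrier_vec n"
    and ee: "\<And>f g. is_point f \<Longrightarrow> is_point g \<Longrightarrow> ev g (e f) = (if f = g then 1 else 0)"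
    by (rule dual_basis) blast
  define Xs where "Xs = {f. is_point f}"
  have Xs: "finite Xs" "\<And>f. f \<in> Xs \<Longrightarrow> is_point f" using finite_points by (auto simp: Xs_def)
  define s where "s x = finsum B (\<lambda>f. ev f x \<cdot>\<^sub>v e f) Xs" for x
  have s: "s x \<in> carrier_vec n" for x using Xs e by (auto simp: s_def intro!: B.finsum_closed)
  have es: "ev g (s x) = ev g x" if "is_point g" for g x
  proof -
    have "ev g (s x) = (\<Sum>f\<in>Xs. ev f x * ev g (e f))"
      unfolding s_def using Xs e by (subst ev_finsum) (auto simp: ev_smult)
    also have "\<dots> = (\<Sum>f\<in>Xs. if f = g then ev f x else 0)"
    proof (rule sum.cong[OF refl])
      fix f assume "f \<in> Xs"
      from ee[OF Xs(2)[OF this] that]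
      show "ev f x * ev g (e f) = (if f = g then ev f x else 0)" by simp
    qed
    finally show ?thesis using Xs(1) that by (simp add: Xs_def)
  qed
  have "\<exists>N0. \<forall>N\<ge>N0. (unit_vec n i + (- 1) \<cdot>\<^sub>v s (unit_vec n i)) [^]\<^bsub>B\<^esub> (p ^ N) = 0\<^sub>v n" for i
    by (rule eventually_nilpotent) (use s in \<open>auto simp: ev_add ev_smult es\<close>)
  then obtain N0 where N0: "\<And>i N. N \<ge> N0 i \<Longrightarrow>
      (unit_vec n i + (- 1) \<cdot>\<^sub>v s (unit_vec n i)) [^]\<^bsub>B\<^esub> (p ^ N) = 0\<^sub>v n" by metis
  \<comment> \<open>The inserted 0 keeps the maximum defined when there are no basis
    vectors.\<close>
  define N where "N = Max (insert 0 (N0 ` {..<n}))"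
  have N: "N0 i \<le> N" if "i < n" for i unfolding N_def using that by (intro Max_ge) auto
  define E where "E f = e f [^]\<^bsub>B\<^esub> (p ^ N)" for f
  have E: "is_point f \<Longrightarrow> E f \<in> carrier_vec n" for f using e by (simp add: E_def)
  have unit: "unit_vec n i [^]\<^bsub>B\<^esub> (p ^ N) = finsum B (\<lambda>f. (f $ i) ^ (p ^ N) \<cdot>\<^sub>v E f) Xs" if i: "i < n" for i
  proof -
    have "unit_vec n i = (unit_vec n i + (- 1) \<cdot>\<^sub>v s (unit_vec n i)) + s (unit_vec n i)"
      using s by (intro B.co_inj) (auto simp: B.co_add B.co_sm)
    then have "unit_vec n i [^]\<^bsub>B\<^esub> (p ^ N) = (unit_vec n i + (- 1) \<cdot>\<^sub>v s (unit_vec n i)) [^]\<^bsub>B\<^esub> (p ^ N) +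
        s (unit_vec n i) [^]\<^bsub>B\<^esub> (p ^ N)"
      using s frob_add by (metis B.add.m_closed B.sm_closed unit_vec_carrier)
    also have "\<dots> = s (unit_vec n i) [^]\<^bsub>B\<^esub> (p ^ N)" using N0[OF N[OF i]] s by simp
    also have "\<dots> = finsum B (\<lambda>f. (ev f (unit_vec n i) \<cdot>\<^sub>v e f) [^]\<^bsub>B\<^esub> (p ^ N)) Xs"
      unfolding s_def using Xs e by (subst frob_finsum) auto
    also have "\<dots> = finsum B (\<lambda>f. (f $ i) ^ (p ^ N) \<cdot>\<^sub>v E f) Xs"
      using Xs e i by (intro B.finsum_cong') (auto simp: B.sm_pow E_def ev_unit)
    finally show ?thesis .
  qed
  have "x [^]\<^bsub>B\<^esub> (p ^ N) = finsum B (\<lambda>f. ev f x ^ (p ^ N) \<cdot>\<^sub>v E f) Xs" if x: "x \<in> carrier_vec n" for x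
  proof (rule B.co_inj)
    fix k assume k: "k \<in> {..<n}"
    have "x [^]\<^bsub>B\<^esub> (p ^ N) = finsum B (\<lambda>i. x $ i \<cdot>\<^sub>v unit_vec n i) {..<n} [^]\<^bsub>B\<^esub> (p ^ N)"
      using unit_expansion[OF x] by simp
    also have "\<dots> = finsum B (\<lambda>i. (x $ i \<cdot>\<^sub>v unit_vec n i) [^]\<^bsub>B\<^esub> (p ^ N)) {..<n}"
      by (rule frob_finsum) auto
    also have "\<dots> $ k = (\<Sum>i<n. (x $ i) ^ (p ^ N) * (\<Sum>f\<in>Xs. (f $ i) ^ (p ^ N) * E f $ k))"
      using k Xs E by (subst B.co_finsum) (auto simp: B.sm_pow B.co_sm unit B.co_finsum)
    also have "\<dots> = (\<Sum>f\<in>Xs. \<Sum>i<n. (x $ i * f $ i) ^ (p ^ N) * E f $ k)"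
      unfolding sum_distrib_left by (subst sum.swap) (simp add: power_mult_distrib mult.assoc)
    also have "\<dots> = (\<Sum>f\<in>Xs. ev f x ^ (p ^ N) * E f $ k)"
      by (simp add: ev_def frob_sum_field sum_distrib_right)
    also have "\<dots> = finsum B (\<lambda>f. ev f x ^ (p ^ N) \<cdot>\<^sub>v E f) Xs $ k"
      using k Xs E by (subst B.co_finsum) (auto simp: B.co_sm)
    finally show "(x [^]\<^bsub>B\<^esub> (p ^ N)) $ k = finsum B (\<lambda>f. ev f x ^ (p ^ N) \<cdot>\<^sub>v E f) Xs $ k" .
  qed (use x Xs E in \<open>auto intro!: B.finsum_closed\<close>)
  note frob = this
  show ?thesis
    by (intro exI[of _ N] exI[of _ E] conjI allI impI ballI E frob[unfolded Xs_def])
qed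

lemma interpolation: "\<exists>x\<in>carrier_vec n. \<forall>f. is_point f \<longrightarrow> ev f x = \<phi> f"
proof -
  obtain e where e: "\<And>f. is_point f \<Longrightarrow> e f \<in> carrier_vec n"
    and ee: "\<And>f g. is_point f \<Longrightarrow> is_point g \<Longrightarrow> ev g (e f) = (if f = g then 1 else 0)"
    by (rule dual_basis) blast
  define Xs where "Xs = {f. is_point f}"
  have Xs: "finite Xs" "\<And>f. f \<in> Xs \<Longrightarrow> is_point f" using finite_points by (auto simp: Xs_def)
  have "ev g (finsum B (\<lambda>f. \<phi> f \<cdot>\<^sub>v e f) Xs) = \<phi> g" if "is_point g" for g
  proof -
    have "ev g (finsum B (\<lambda>f. \<phi> f \<cdot>\<^sub>v e f) Xs) = (\<Sum>f\<in>Xs. \<phi> f * ev g (e f))"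
      using Xs e by (subst ev_finsum) (auto simp: ev_smult)
    also have "\<dots> = (\<Sum>f\<in>Xs. if f = g then \<phi> f else 0)"
    proof (rule sum.cong[OF refl])
      fix f assume "f \<in> Xs"
      from ee[OF Xs(2)[OF this] that]
      show "\<phi> f * ev g (e f) = (if f = g then \<phi> f else 0)" by simp
    qed
    finally show ?thesis using Xs(1) that by (simp add: Xs_def)
  qed
  then show ?thesis
    by (intro bexI[of _ "finsum B (\<lambda>f. \<phi> f \<cdot>\<^sub>v e f) Xs"]) (use Xs e in \<open>auto intro!: B.finsum_closed\<close>)
qed

section \<open>Frobenius and comultiplication in the tensor square\<close>

sublocale T: coord_alg "tensor_square_ring H" "(\<cdot>\<^sub>m)" index_mat "{..<rnk H} \<times> {..<rnk H}"
    "\<lambda>i j k. mlt H (fst i) (fst j) (fst k) * mlt H (snd i) (snd j) (snd k)"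
    "\<lambda>i. unt H (fst i) * unt H (snd i)"
  rewrites "carrier (tensor_square_ring H) \<equiv> carrier_mat n n"
    and "ring.zero (tensor_square_ring H) \<equiv> 0\<^sub>m n n" and "add (tensor_square_ring H) \<equiv> (+)"
  by (rule coord_alg_tensor_square, unfold_locales) (simp_all add: tensor_square_ring_def)


declare tensor_square_simps(2,3) [simp del]

lemma tensor_carrier [simp]: "tensor H x y \<in> carrier_mat n n"
  by (simp add: tensor_def)

lemma tensor_index: "a < n \<Longrightarrow> b < n \<Longrightarrow> tensor H x y $$ (a, b) = x $ a * y $ b"
  by (simp add: tensor_def)

lemma comul_mult:
  assumes x: "x \<in> carrier_vec n" and y: "y \<in> carrier_vec n"
  shows "comul H (x \<otimes>\<^bsub>B\<^esub> y) = comul H x \<otimes>\<^bsub>tensor_square_ring H\<^esub> comul H y"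
proof (rule eq_matI)
  fix k l assume "k < dim_row (comul H x \<otimes>\<^bsub>tensor_square_ring H\<^esub> comul H y)"
    "l < dim_col (comul H x \<otimes>\<^bsub>tensor_square_ring H\<^esub> comul H y)"
  then have kl: "k < n" "l < n" by (simp_all add: tensor_square_simps(2))
  define Xs where "Xs a b c d = mlt H a c k * mlt H b d l" for a b c d
  have "comul H (x \<otimes>\<^bsub>B\<^esub> y) $$ (k, l) = (\<Sum>s<n. \<Sum>i<n. \<Sum>j<n. x $ i * y $ j * (mlt H i j s * cml H s k l))"
    using kl x y by (simp add: comul_def B.co_mult sum_distrib_left sum_distrib_right mult_ac)
  also have "\<dots> = (\<Sum>i<n. \<Sum>j<n. \<Sum>s<n. x $ i * y $ j * (mlt H i j s * cml H s k l))"
    by (rule trans[OF sum.swap sum.cong[OF refl sum.swap]])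
  also have "\<dots> = (\<Sum>i<n. \<Sum>j<n. x $ i * y $ j * (\<Sum>a<n. \<Sum>b<n. \<Sum>c<n. \<Sum>d<n.
      cml H i a b * cml H j c d * Xs a b c d))"
  proof (rule sum.cong[OF refl], rule sum.cong[OF refl], goal_cases)
    case (1 i j)
    then show ?case unfolding Xs_def sum_distrib_left[symmetric] using kl by (subst mlt_cml) auto
  qed
  also have "\<dots> = (\<Sum>i<n. \<Sum>j<n. \<Sum>a<n. \<Sum>b<n. \<Sum>c<n. \<Sum>d<n.
      x $ i * cml H i a b * (y $ j * cml H j c d) * Xs a b c d)"
    unfolding sum_distrib_left by (intro sum.cong refl) (simp add: mult_ac)
  also have "\<dots> = (\<Sum>i<n. \<Sum>a<n. \<Sum>b<n. \<Sum>c<n. \<Sum>d<n. \<Sum>j<n.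
      x $ i * cml H i a b * (y $ j * cml H j c d) * Xs a b c d)"
    by (rule sum.cong[OF refl], rule sum_rotate5)
  also have "\<dots> = (\<Sum>a<n. \<Sum>b<n. \<Sum>c<n. \<Sum>d<n. \<Sum>i<n. \<Sum>j<n.
      x $ i * cml H i a b * (y $ j * cml H j c d) * Xs a b c d)"
    by (rule sum_rotate5)
  also have "\<dots> = (\<Sum>a<n. \<Sum>b<n. \<Sum>c<n. \<Sum>d<n.
      (\<Sum>i<n. x $ i * cml H i a b) * (\<Sum>j<n. y $ j * cml H j c d) * Xs a b c d)"
    unfolding sum_product unfolding sum_distrib_right ..
  also have "\<dots> = (comul H x \<otimes>\<^bsub>tensor_square_ring H\<^esub> comul H y) $$ (k, l)"
    using kl by (simp add: tensor_square_simps(2) comul_def Xs_def)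
  finally show "comul H (x \<otimes>\<^bsub>B\<^esub> y) $$ (k, l) = (comul H x \<otimes>\<^bsub>tensor_square_ring H\<^esub> comul H y) $$ (k, l)" .
qed (simp_all add: comul_def tensor_square_simps(2))

lemma comul_one: "comul H \<one>\<^bsub>B\<^esub> = \<one>\<^bsub>tensor_square_ring H\<^esub>"
  by (rule eq_matI) (auto simp: comul_def tensor_square_simps(3) B.co_one unt_cml)

lemma comul_pow: "x \<in> carrier_vec n \<Longrightarrow> comul H (x [^]\<^bsub>B\<^esub> (m::nat)) = comul H x [^]\<^bsub>tensor_square_ring H\<^esub> m"
  by (induction m) (simp_all add: comul_one comul_mult)

lemma tensor_mult:
  assumes "a \<in> carrier_vec n" "b \<in> carrier_vec n" "c \<in> carrier_vec n" "d \<in> carrier_vec n"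
  shows "tensor H a b \<otimes>\<^bsub>tensor_square_ring H\<^esub> tensor H c d = tensor H (a \<otimes>\<^bsub>B\<^esub> c) (b \<otimes>\<^bsub>B\<^esub> d)"
proof (rule eq_matI)
  fix k l assume "k < dim_row (tensor H (a \<otimes>\<^bsub>B\<^esub> c) (b \<otimes>\<^bsub>B\<^esub> d))" "l < dim_col (tensor H (a \<otimes>\<^bsub>B\<^esub> c) (b \<otimes>\<^bsub>B\<^esub> d))"
  then have kl: "k < n" "l < n" by (simp_all add: tensor_def)
  have "(tensor H a b \<otimes>\<^bsub>tensor_square_ring H\<^esub> tensor H c d) $$ (k, l) =
     (\<Sum>i<n. \<Sum>i'<n. \<Sum>j<n. \<Sum>j'<n. (a $ i * b $ i') * (c $ j * d $ j') * (mlt H i j k * mlt H i' j' l))"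
    using kl by (simp add: tensor_square_simps(2) tensor_def)
  also have "\<dots> = (\<Sum>i<n. \<Sum>j<n. \<Sum>i'<n. \<Sum>j'<n. (a $ i * b $ i') * (c $ j * d $ j') * (mlt H i j k * mlt H i' j' l))"
    by (rule sum.cong[OF refl], rule sum.swap)
  also have "\<dots> = (\<Sum>i<n. \<Sum>j<n. a $ i * c $ j * mlt H i j k) * (\<Sum>i'<n. \<Sum>j'<n. b $ i' * d $ j' * mlt H i' j' l)"
    unfolding sum_distrib_right unfolding sum_distrib_left by (intro sum.cong refl) (simp add: mult_ac)
  also have "\<dots> = tensor H (a \<otimes>\<^bsub>B\<^esub> c) (b \<otimes>\<^bsub>B\<^esub> d) $$ (k, l)"
    using kl assms by (simp add: tensor_index B.co_mult)
  finally show "(tensor H a b \<otimes>\<^bsub>tensor_square_ring H\<^esub> tensor H c d) $$ (k, l) =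
      tensor H (a \<otimes>\<^bsub>B\<^esub> c) (b \<otimes>\<^bsub>B\<^esub> d) $$ (k, l)" .
qed (simp_all add: tensor_def tensor_square_simps(2))

lemma tensor_one: "tensor H \<one>\<^bsub>B\<^esub> \<one>\<^bsub>B\<^esub> = \<one>\<^bsub>tensor_square_ring H\<^esub>"
  by (rule eq_matI) (auto simp: tensor_def tensor_square_simps(3) B.co_one)

lemma tensor_pow: "a \<in> carrier_vec n \<Longrightarrow> b \<in> carrier_vec n \<Longrightarrow>
    tensor H a b [^]\<^bsub>tensor_square_ring H\<^esub> (m::nat) = tensor H (a [^]\<^bsub>B\<^esub> m) (b [^]\<^bsub>B\<^esub> m)"
  by (induction m) (simp_all add: tensor_one tensor_mult)

text \<open>Comultiplication commutes with powers, and the Frobenius power of a sum of elementary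
  tensors is taken term by term, on the coefficient and on both factors.\<close>

lemma comul_frobenius:
  assumes x: "x \<in> carrier_vec n" and kl: "k < n" "l < n"
  shows "comul H (x [^]\<^bsub>B\<^esub> (p ^ N)) $$ (k, l) =
    (\<Sum>i<n. \<Sum>j<n. (comul H x $$ (i, j)) ^ (p ^ N) *
       ((unit_vec n i [^]\<^bsub>B\<^esub> (p ^ N)) $ k * (unit_vec n j [^]\<^bsub>B\<^esub> (p ^ N)) $ l))"
proof -
  let ?T = "tensor_square_ring H"
  let ?e = "\<lambda>ij. comul H x $$ ij \<cdot>\<^sub>m tensor H (unit_vec n (fst ij)) (unit_vec n (snd ij))"
  have "comul H x = finsum ?T ?e ({..<n} \<times> {..<n})"
  proof (rule T.co_inj)
    fix kl assume kl: "kl \<in> {..<n} \<times> {..<n}"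
    have "finsum ?T ?e ({..<n} \<times> {..<n}) $$ kl = (\<Sum>ij\<in>{..<n} \<times> {..<n}. if ij = kl then comul H x $$ ij else 0)"
      using kl by (subst T.co_finsum) (auto simp: T.co_sm tensor_index prod_eq_iff intro!: sum.cong)
    then show "comul H x $$ kl = finsum ?T ?e ({..<n} \<times> {..<n}) $$ kl" using kl by simp
  qed (auto intro!: T.finsum_closed)
  then have 1: "comul H (x [^]\<^bsub>B\<^esub> (p ^ N)) = finsum ?T ?e ({..<n} \<times> {..<n}) [^]\<^bsub>?T\<^esub> (p ^ N)"
    using x by (simp only: comul_pow)
  have 2: "finsum ?T ?e ({..<n} \<times> {..<n}) [^]\<^bsub>?T\<^esub> (p ^ N) =
      finsum ?T (\<lambda>ij. ?e ij [^]\<^bsub>?T\<^esub> (p ^ N)) ({..<n} \<times> {..<n})"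
    by (rule T.frob_finsum[unfolded char, OF p]) (simp, intro Pi_I T.sm_closed tensor_carrier)
  have 3: "finsum ?T (\<lambda>ij. ?e ij [^]\<^bsub>?T\<^esub> (p ^ N)) ({..<n} \<times> {..<n}) $$ (k, l) =
      (\<Sum>ij\<in>{..<n} \<times> {..<n}. (?e ij [^]\<^bsub>?T\<^esub> (p ^ N)) $$ (k, l))"
    by (rule T.co_finsum) (simp, intro Pi_I T.nat_pow_closed T.sm_closed tensor_carrier, use kl in simp)
  have 4: "(?e ij [^]\<^bsub>?T\<^esub> (p ^ N)) $$ (k, l) = (comul H x $$ ij) ^ (p ^ N) *
       ((unit_vec n (fst ij) [^]\<^bsub>B\<^esub> (p ^ N)) $ k * (unit_vec n (snd ij) [^]\<^bsub>B\<^esub> (p ^ N)) $ l)" for ij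
    unfolding T.sm_pow[OF tensor_carrier] tensor_pow[OF unit_vec_carrier unit_vec_carrier]
    using kl by (subst T.co_sm) (simp_all add: tensor_index)
  show ?thesis unfolding 1 2 3 4 sum_pairs fst_conv snd_conv ..
qed

text \<open>Take x with values \<chi> and y = x^(p^N). Passing to y removes all nilpotent
  contributions, so the comultiplication of y is the sum over pairs of points of \<chi>(f g) times
  \<open>E f\<close> \<otimes> \<open>E g\<close>, and additivity of \<chi> splits it into the two
  terms of primitivity. Because \<chi>^p = \<chi>, the values of y are still those of
  \<chi>.\<close>

lemma primitive_of_character:
  assumes hom: "\<And>f g. is_point f \<Longrightarrow> is_point g \<Longrightarrow> \<chi> (conv f g) = \<chi> f + \<chi> g"
    and fixp: "\<And>f. is_point f \<Longrightarrow> \<chi> f ^ p = \<chi> f"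
  shows "\<exists>y. prim y \<and> (\<forall>f. is_point f \<longrightarrow> ev f y = \<chi> f)"
proof -
  obtain N E where E': "\<forall>f. is_point f \<longrightarrow> E f \<in> carrier_vec n"
    and frob': "\<forall>x\<in>carrier_vec n.
      x [^]\<^bsub>B\<^esub> (p ^ N) = finsum B (\<lambda>f. ev f x ^ (p ^ N) \<cdot>\<^sub>v E f) {f. is_point f}"
    using frobenius_idempotents by (elim exE conjE)
  note E = E'[rule_format] and frob = bspec[OF frob']
  define Xs where "Xs = {f. is_point f}"
  have Xs: "finite Xs" "\<And>f. f \<in> Xs \<Longrightarrow> is_point f" using finite_points by (auto simp: Xs_def)
  have frobk: "(x [^]\<^bsub>B\<^esub> (p ^ N)) $ k = (\<Sum>f\<in>Xs. ev f x ^ (p ^ N) * E f $ k)"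
    if "x \<in> carrier_vec n" "k < n" for x k
    using that Xs E unfolding frob[OF that(1)] Xs_def[symmetric]
    by (subst B.co_finsum) (auto simp: B.co_sm)
  have fixN: "\<chi> f ^ (p ^ N) = \<chi> f" if "is_point f" for f
    by (induction N) (use fixp[OF that] in \<open>simp_all add: power_mult\<close>)
  obtain x where x: "x \<in> carrier_vec n" "\<And>f. is_point f \<Longrightarrow> ev f x = \<chi> f"
    using interpolation[of \<chi>] by blast
  define y where "y = x [^]\<^bsub>B\<^esub> (p ^ N)"
  have y: "y \<in> carrier_vec n" using x by (simp add: y_def)
  have yk: "y $ k = (\<Sum>f\<in>Xs. \<chi> f * E f $ k)" if "k < n" for k
    unfolding y_def frobk[OF x(1) that] using Xs x(2) fixN by (intro sum.cong refl) auto
  have onek: "\<one>\<^bsub>B\<^esub> $ k = (\<Sum>f\<in>Xs. E f $ k)" if "k < n" for k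
    using frobk[OF _ that, of "\<one>\<^bsub>B\<^esub>"] Xs by (simp add: ev_one B.nat_pow_one)
  have "comul H y = tensor H y \<one>\<^bsub>B\<^esub> + tensor H \<one>\<^bsub>B\<^esub> y"
  proof (rule T.co_inj)
    fix kl assume "kl \<in> {..<n} \<times> {..<n}"
    then obtain k l where kl: "kl = (k, l)" "k < n" "l < n" by auto
    have "comul H y $$ (k, l) = (\<Sum>i<n. \<Sum>j<n. (comul H x $$ (i, j)) ^ (p ^ N) *
       ((\<Sum>f\<in>Xs. (f $ i) ^ (p ^ N) * E f $ k) * (\<Sum>g\<in>Xs. (g $ j) ^ (p ^ N) * E g $ l)))"
      unfolding y_def comul_frobenius[OF x(1) kl(2,3)]
      using kl by (intro sum.cong refl) (simp add: frobk ev_unit)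
    also have "\<dots> = (\<Sum>i<n. \<Sum>j<n. \<Sum>f\<in>Xs. \<Sum>g\<in>Xs.
        (comul H x $$ (i, j) * (f $ i * g $ j)) ^ (p ^ N) * (E f $ k * E g $ l))"
      unfolding sum_product unfolding sum_distrib_left
      by (intro sum.cong refl) (simp add: power_mult_distrib mult_ac)
    also have "\<dots> = (\<Sum>f\<in>Xs. \<Sum>g\<in>Xs. \<Sum>i<n. \<Sum>j<n.
        (comul H x $$ (i, j) * (f $ i * g $ j)) ^ (p ^ N) * (E f $ k * E g $ l))"
      by (rule trans[OF sum_rotate4 sum_rotate4])
    also have "\<dots> = (\<Sum>f\<in>Xs. \<Sum>g\<in>Xs. (ev (conv f g) x) ^ (p ^ N) * (E f $ k * E g $ l))"
      by (simp only: ev_conv frob_sum_field sum_distrib_right)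
    also have "\<dots> = (\<Sum>f\<in>Xs. \<Sum>g\<in>Xs. (\<chi> f + \<chi> g) * (E f $ k * E g $ l))"
    proof (rule sum.cong[OF refl], rule sum.cong[OF refl], goal_cases)
      case (1 f g)
      then have fg: "is_point f" "is_point g" using Xs by auto
      then show ?case by (simp add: x(2) conv_point hom frob_add_field fixN)
    qed
    also have "\<dots> = (\<Sum>f\<in>Xs. \<Sum>g\<in>Xs. (\<chi> f * E f $ k) * E g $ l) + (\<Sum>f\<in>Xs. \<Sum>g\<in>Xs. E f $ k * (\<chi> g * E g $ l))"
      unfolding sum.distrib[symmetric] by (intro sum.cong refl) (simp add: algebra_simps)
    also have "\<dots> = y $ k * \<one>\<^bsub>B\<^esub> $ l + \<one>\<^bsub>B\<^esub> $ k * y $ l"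
      unfolding yk[OF kl(2)] yk[OF kl(3)] onek[OF kl(2)] onek[OF kl(3)] sum_product ..
    also have "\<dots> = (tensor H y \<one>\<^bsub>B\<^esub> + tensor H \<one>\<^bsub>B\<^esub> y) $$ (k, l)"
      using kl by (subst T.co_add) (auto simp: tensor_index)
    finally show "comul H y $$ kl = (tensor H y \<one>\<^bsub>B\<^esub> + tensor H \<one>\<^bsub>B\<^esub> y) $$ kl" by (simp add: kl)
  qed auto
  moreover have "ev f y = \<chi> f" if "is_point f" for f
    unfolding y_def ev_pow[OF that x(1)] x(2)[OF that] by (rule fixN[OF that])
  ultimately show ?thesis using y by (intro exI[of _ y]) (auto simp: prim_def)
qed

theorem primitives_separate_points:
  assumes ex: "\<And>F. is_point F \<Longrightarrow> F [^]\<^bsub>pts\<^esub> p = \<one>\<^bsub>pts\<^esub>"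
    and fg: "is_point f" "is_point g" and eq: "\<And>y. prim y \<Longrightarrow> ev f y = ev g y"
  shows "f = g"
proof (rule ccontr)
  assume ne: "f \<noteq> g"
  interpret G: comm_group pts by (rule pts_comm_group[OF _ ex]) (use prime_gt_0_nat[OF p] in auto)
  have fgc: "f \<in> carrier pts" "g \<in> carrier pts" using fg by (auto simp: pts_def)
  \<comment> \<open>A character that is nontrivial at the quotient h takes different values at f = h
    g and at g.\<close>
  define h where "h = f \<otimes>\<^bsub>pts\<^esub> inv\<^bsub>pts\<^esub> g"
  have h: "h \<in> carrier pts" "h \<noteq> \<one>\<^bsub>pts\<^esub>"
    using fgc ne by (auto simp: h_def) (metis G.inv_equality G.inv_inv G.inv_closed)
  have "f = h \<otimes>\<^bsub>pts\<^esub> g" using fgc by (simp add: h_def G.m_assoc)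
  then have fh: "f = conv h g" by (simp add: pts_def)
  have exc: "F [^]\<^bsub>pts\<^esub> p = \<one>\<^bsub>pts\<^esub>" if "F \<in> carrier pts" for F using that ex by (simp add: pts_def)
  have fin: "finite (carrier pts)" using finite_points by (simp add: pts_def)
  obtain \<chi> :: "'l vec \<Rightarrow> 'l" where \<chi>: "\<forall>x\<in>carrier pts. \<forall>y\<in>carrier pts. \<chi> (x \<otimes>\<^bsub>pts\<^esub> y) = \<chi> x + \<chi> y"
    "\<forall>x\<in>carrier pts. \<chi> x ^ p = \<chi> x" "\<chi> h \<noteq> 0"
    using G.separating_character[OF fin p exc h char] by blast
  obtain y where y: "prim y" "\<And>f. is_point f \<Longrightarrow> ev f y = \<chi> f"
    using primitive_of_character[of \<chi>] \<chi>(1,2) by (auto simp: pts_def)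
  have "is_point h" using h(1) by (simp add: pts_def)
  then have "ev f y = ev h y + ev g y" unfolding fh using conv_prim[OF y(1) _ fg(2)] by simp
  with eq[OF y(1)] y(2)[OF \<open>is_point h\<close>] \<chi>(3) show False by simp
qed

end

section \<open>Points of a group scheme over a subring\<close>

locale bialg_points = comm_ring_hom J + bialg_ids H
  for J :: "'a::comm_ring_1 \<Rightarrow> 'l::field" and H :: "'a bialg"
begin

abbreviation HL where "HL \<equiv> map_bialg J H"
abbreviation nn where "nn \<equiv> rnk H"

sublocale L: fin_alg HL
  rewrites "rnk HL \<equiv> rnk H"
  by (intro fin_alg.intro bialg_ids_map comm_ring_hom_axioms bialg_ids_axioms) simp

sublocale A: coord_alg "coord_ring H" "(\<cdot>\<^sub>v)" vec_index "{..<rnk H}" "mlt H" "unt H"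
  rewrites "carrier (coord_ring H) \<equiv> carrier_vec nn" and "ring.zero (coord_ring H) \<equiv> 0\<^sub>v nn"
    and "add (coord_ring H) \<equiv> (+)"
  by (rule coord_alg_coord_ring, unfold_locales) (simp_all add: coord_ring_def)

declare coord_ring_simps(2,3) [simp del]

definition evJ :: "'l vec \<Rightarrow> 'a vec \<Rightarrow> 'l" where
  "evJ F x = L.ev F (map_vec J x)"

lemma evJ_sum: "x \<in> carrier_vec nn \<Longrightarrow> evJ F x = (\<Sum>k<nn. J (x $ k) * F $ k)"
  by (simp add: evJ_def L.ev_def)

lemma map_mult:
  assumes "x \<in> carrier_vec nn" "y \<in> carrier_vec nn"
  shows "map_vec J (x \<otimes>\<^bsub>coord_ring H\<^esub> y) = map_vec J x \<otimes>\<^bsub>coord_ring HL\<^esub> map_vec J y"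
proof (rule L.B.co_inj)
  fix k assume k: "k \<in> {..<nn}"
  then have "map_vec J (x \<otimes>\<^bsub>coord_ring H\<^esub> y) $ k = J ((x \<otimes>\<^bsub>coord_ring H\<^esub> y) $ k)"
    using carrier_vecD[OF A.m_closed[OF assms]] by simp
  also have "\<dots> = (map_vec J x \<otimes>\<^bsub>coord_ring HL\<^esub> map_vec J y) $ k"
    using k assms by (simp add: A.co_mult L.B.co_mult hom_distribs)
  finally show "map_vec J (x \<otimes>\<^bsub>coord_ring H\<^esub> y) $ k = (map_vec J x \<otimes>\<^bsub>coord_ring HL\<^esub> map_vec J y) $ k" .
qed (use assms A.m_closed[OF assms] in auto)

lemma map_one: "map_vec J \<one>\<^bsub>coord_ring H\<^esub> = \<one>\<^bsub>coord_ring HL\<^esub>"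
  by (rule eq_vecI) (auto simp: coord_ring_simps(3))

lemma map_pow: "x \<in> carrier_vec nn \<Longrightarrow>
    map_vec J (x [^]\<^bsub>coord_ring H\<^esub> (m::nat)) = map_vec J x [^]\<^bsub>coord_ring HL\<^esub> m"
  by (induction m) (simp_all add: map_one map_mult)

lemma evJ_mult:
  "L.is_point F \<Longrightarrow> x \<in> carrier_vec nn \<Longrightarrow> y \<in> carrier_vec nn \<Longrightarrow>
    evJ F (x \<otimes>\<^bsub>coord_ring H\<^esub> y) = evJ F x * evJ F y"
  by (simp add: evJ_def map_mult L.ev_mult)

lemma evJ_one: "L.is_point F \<Longrightarrow> evJ F \<one>\<^bsub>coord_ring H\<^esub> = 1"
  by (simp add: evJ_def map_one L.ev_one)

lemma evJ_add: "x \<in> carrier_vec nn \<Longrightarrow> y \<in> carrier_vec nn \<Longrightarrow> evJ F (x + y) = evJ F x + evJ F y"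
  by (simp add: evJ_sum hom_distribs sum.distrib algebra_simps)

lemma evJ_smult: "x \<in> carrier_vec nn \<Longrightarrow> evJ F (a \<cdot>\<^sub>v x) = J a * evJ F x"
  by (simp add: evJ_sum hom_distribs sum_distrib_left mult.assoc)

lemma evJ_unit: "k < nn \<Longrightarrow> evJ F (unit_vec nn k) = F $ k"
proof -
  assume k: "k < nn"
  have "map_vec J (unit_vec nn k) = unit_vec nn k" by (rule eq_vecI) (auto simp: unit_vec_def)
  then show ?thesis using L.ev_unit[of k F] k by (simp add: evJ_def)
qed

lemma evJ_pow: "L.is_point F \<Longrightarrow> x \<in> carrier_vec nn \<Longrightarrow>
   evJ F (x [^]\<^bsub>coord_ring H\<^esub> (m::nat)) = evJ F x ^ m"
  by (induction m) (simp_all add: evJ_one evJ_mult)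

text \<open>\<open>Fv\<close> and \<open>fV\<close> translate between a point as a function on the
  coordinate ring over A, as in \<open>points\<close>, and the vector of its values on the basis, to
  which the theory over the field applies. They are mutually inverse on points.\<close>

definition Fv :: "('a vec \<Rightarrow> 'l) \<Rightarrow> 'l vec" where
  "Fv f = vec nn (\<lambda>i. f (unit_vec nn i))"

definition fV :: "'l vec \<Rightarrow> 'a vec \<Rightarrow> 'l" where
  "fV F = (\<lambda>x\<in>carrier_vec nn. evJ F x)"

abbreviation V where "V \<equiv> points J H"

lemma point_add:
  assumes "f \<in> carrier V" "x \<in> carrier_vec nn" "y \<in> carrier_vec nn"
  shows "f (x + y) = f x + f y"
  using assms ring_hom_add[of f "coord_ring H" ring_of_type_algebra x y]
  by (simp add: points_def ring_of_type_algebra_def)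

lemma point_expand:
  assumes f: "f \<in> carrier V" and x: "x \<in> carrier_vec nn"
  shows "f x = evJ (Fv f) x"
proof -
  have f0: "f (0\<^sub>v nn) = 0" 
  proof -
    have "f (0\<^sub>v nn) = f (0\<^sub>v nn) + f (0\<^sub>v nn)"
      using point_add[OF f, of "0\<^sub>v nn" "0\<^sub>v nn"] by (simp only: zero_carrier_vec left_zero_vec)
    then show ?thesis by (metis add_cancel_right_right)
  qed
  have fs: "f (a \<cdot>\<^sub>v y) = J a * f y" if "y \<in> carrier_vec nn" for a y
    using f that by (simp add: points_def)
  have *: "f (finsum (coord_ring H) g S) = (\<Sum>i\<in>S. f (g i))" if "finite S" "g \<in> S \<rightarrow> carrier_vec nn" for S g
    using that by (induction S) (auto simp: f0 point_add[OF f] Pi_def)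
  have x': "x = finsum (coord_ring H) (\<lambda>i. x $ i \<cdot>\<^sub>v unit_vec nn i) {..<nn}"
  proof (rule A.co_inj[OF x])
    fix k assume k: "k \<in> {..<nn}"
    show "x $ k = finsum (coord_ring H) (\<lambda>i. x $ i \<cdot>\<^sub>v unit_vec nn i) {..<nn} $ k"
      using k by (subst A.co_finsum) (auto simp: if_distrib cong: if_cong)
  qed (auto intro!: A.finsum_closed)
  have "f x = (\<Sum>i<nn. J (x $ i) * f (unit_vec nn i))"
    by (subst x', subst *) (auto simp: fs)
  then show ?thesis using x by (simp add: evJ_sum Fv_def)
qed

lemma Fv_point:
  assumes f: "f \<in> carrier V"
  shows "L.is_point (Fv f)"
proof -
  have fm: "f (x \<otimes>\<^bsub>coord_ring H\<^esub> y) = f x * f y" if "x \<in> carrier_vec nn" "y \<in> carrier_vec nn" for x y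
    using f that ring_hom_mult[of f "coord_ring H" ring_of_type_algebra x y]
    by (simp add: points_def ring_of_type_algebra_def)
  have "f \<one>\<^bsub>coord_ring H\<^esub> = 1"
    using f ring_hom_one[of f "coord_ring H" ring_of_type_algebra]
    by (simp add: points_def ring_of_type_algebra_def)
  then have one: "(\<Sum>k<nn. J (unt H k) * Fv f $ k) = 1"
    using point_expand[OF f, of "\<one>\<^bsub>coord_ring H\<^esub>"] by (simp add: evJ_sum A.co_one)
  have "(\<Sum>k<nn. J (mlt H i j k) * Fv f $ k) = Fv f $ i * Fv f $ j" if "i < nn" "j < nn" for i j
  proof -
    have "(\<Sum>k<nn. J (mlt H i j k) * Fv f $ k) = evJ (Fv f) (unit_vec nn i \<otimes>\<^bsub>coord_ring H\<^esub> unit_vec nn j)"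
      using that by (simp add: evJ_sum) (simp add: coord_ring_simps(2) mult_unit_coord)
    also have "\<dots> = f (unit_vec nn i \<otimes>\<^bsub>coord_ring H\<^esub> unit_vec nn j)" by (rule point_expand[OF f, symmetric]) simp
    also have "\<dots> = Fv f $ i * Fv f $ j" using that by (simp add: fm Fv_def)
    finally show ?thesis .
  qed
  then show ?thesis unfolding L.is_point_def using one by (simp add: Fv_def)
qed

lemma fV_point:
  assumes F: "L.is_point F"
  shows "fV F \<in> carrier V"
proof -
  have "restrict (evJ F) (carrier_vec nn) \<in> Ring.ring_hom (coord_ring H) ring_of_type_algebra"
    by (rule ring_hom_memI)
      (use F in \<open>simp_all add: ring_of_type_algebra_def evJ_mult evJ_one evJ_add\<close>)
  then show ?thesis unfolding points_def fV_def by (simp add: evJ_smult)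
qed

lemma Fv_fV:
  assumes "L.is_point F" shows "Fv (fV F) = F"
proof -
  have "F \<in> carrier_vec nn" using assms by (rule L.is_point_carrier)
  then show ?thesis by (intro eq_vecI) (simp_all add: Fv_def fV_def evJ_unit)
qed

lemma fV_Fv:
  assumes f: "f \<in> carrier V" shows "fV (Fv f) = f"
proof (rule extensionalityI[of _ "carrier_vec nn"])
  show "f \<in> extensional (carrier_vec nn)" using f by (simp add: points_def)
qed (simp_all add: fV_def point_expand[OF f])

lemma Fv_mult:
  assumes "f \<in> carrier V" "g \<in> carrier V"
  shows "f \<otimes>\<^bsub>V\<^esub> g = fV (L.conv (Fv f) (Fv g))"
proof (rule extensionalityI[of _ "carrier_vec nn"])
  fix x :: "'a vec" assume x: "x \<in> carrier_vec nn"
  have c: "comul HL (map_vec J x) $$ (i, j) = J (comul H x $$ (i, j))" if "i < nn" "j < nn" for i j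
    using that x by (simp add: comul_def hom_distribs)
  have "(f \<otimes>\<^bsub>V\<^esub> g) x = (\<Sum>i<nn. \<Sum>j<nn. J (comul H x $$ (i, j)) * (Fv f $ i * Fv g $ j))"
    using x by (simp add: points_def Fv_def)
  also have "\<dots> = L.ev (L.conv (Fv f) (Fv g)) (map_vec J x)"
    unfolding L.ev_conv by (intro sum.cong refl) (simp add: c)
  finally show "(f \<otimes>\<^bsub>V\<^esub> g) x = fV (L.conv (Fv f) (Fv g)) x"
    using x by (simp add: fV_def evJ_def)
qed (auto simp: points_def fV_def)

lemma V_one: "\<one>\<^bsub>V\<^esub> = fV (vec nn (cnt HL))"
  by (rule extensionalityI[of _ "carrier_vec nn"])
    (auto simp: points_def fV_def evJ_sum counit_def hom_distribs)

text \<open>The matrix \<open>mult_by H m\<close> is pullback of functions along multiplication by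
  m, so composing a point with it yields the m-th power of that point. Both sides are linear in x,
  which leaves the values on basis vectors, that is, the columns.\<close>

lemma evJ_mult_by:
  assumes F: "L.is_point F" and x: "x \<in> carrier_vec nn"
  shows "evJ F (mult_by H m *\<^sub>v x) = evJ (F [^]\<^bsub>L.pts\<^esub> m) x"
proof -
  interpret P: comm_monoid L.pts by (rule L.pts_comm_monoid)
  have MC: "mult_by H m \<in> carrier_mat nn nn" for m by (cases m) auto
  have Fc: "F \<in> carrier L.pts" using F by (simp add: L.pts_def)
  have lin: "evJ F (M *\<^sub>v x) = evJ (vec nn (\<lambda>l. \<Sum>k<nn. J (M $$ (k, l)) * F $ k)) x"
    if "M \<in> carrier_mat nn nn" "x \<in> carrier_vec nn" for M x
  proof -
    have "evJ F (M *\<^sub>v x) = (\<Sum>k<nn. \<Sum>l<nn. J (x $ l) * (J (M $$ (k, l)) * F $ k))"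
      using that by (simp add: evJ_sum scalar_prod_def atLeast0LessThan hom_distribs sum_distrib_right mult_ac)
    also have "\<dots> = (\<Sum>l<nn. \<Sum>k<nn. J (x $ l) * (J (M $$ (k, l)) * F $ k))" by (rule sum.swap)
    finally show ?thesis using that by (simp add: evJ_sum sum_distrib_left)
  qed
  \<comment> \<open>The recursion of \<open>mult_by\<close> puts the new factor on the left, the
    power in a monoid puts it on the right; commutativity of \<open>conv\<close> reconciles
    them.\<close>
  have col: "vec nn (\<lambda>l. \<Sum>k<nn. J (mult_by H m $$ (k, l)) * F $ k) = F [^]\<^bsub>L.pts\<^esub> m" for m
  proof (induction m)
    case 0
    have "(\<Sum>k<nn. J (unt H k) * F $ k) = 1" using F by (simp add: L.is_point_def)
    then have "(\<Sum>k<nn. J (unt H k) * J (cnt H l) * F $ k) = J (cnt H l)" for l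
      by (simp add: mult.assoc mult.left_commute[of _ "J (cnt H l)"] flip: sum_distrib_left)
    then show ?case by (intro eq_vecI) (auto simp: L.pts_def hom_distribs)
  next
    case (Suc m)
    define M where "M = mult_by H m"
    have M: "M \<in> carrier_mat nn nn" by (simp add: M_def MC)
    have Fm: "(F [^]\<^bsub>L.pts\<^esub> m) $ s = (\<Sum>j<nn. J (M $$ (j, s)) * F $ j)" if "s < nn" for s
      using that by (simp add: Suc[symmetric] M_def)
    show ?case
    proof (rule eq_vecI)
      fix l assume "l < dim_vec (F [^]\<^bsub>L.pts\<^esub> Suc m)"
      then have l: "l < nn" by (simp add: L.pts_def L.conv_def)
      have dM: "dim_row M = nn" "dim_col M = nn" using M by auto
      have "(\<Sum>k<nn. J (mult_by H (Suc m) $$ (k, l)) * F $ k) =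
         (\<Sum>k<nn. J (mu H (comul H (unit_vec nn l) * transpose_mat M) $ k) * F $ k)"
        using l by (simp add: M_def)
      also have "\<dots> = (\<Sum>k<nn. \<Sum>i<nn. \<Sum>j<nn. (\<Sum>s<nn. J (cml H l i s) * J (M $$ (j, s))) * (J (mlt H i j k) * F $ k))"
        using l dM carrier_matD[OF comul_carrier[of H]] by (simp add: mu_def comul_unit scalar_prod_def atLeast0LessThan hom_distribs
            sum_distrib_right mult.assoc)
      also have "\<dots> = (\<Sum>i<nn. \<Sum>j<nn. \<Sum>k<nn. (\<Sum>s<nn. J (cml H l i s) * J (M $$ (j, s))) * (J (mlt H i j k) * F $ k))"
        by (rule trans[OF sum.swap sum.cong[OF refl sum.swap]])
      also have "\<dots> = (\<Sum>i<nn. \<Sum>j<nn. (\<Sum>s<nn. J (cml H l i s) * J (M $$ (j, s))) * (F $ i * F $ j))"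
      proof (rule sum.cong[OF refl], rule sum.cong[OF refl], goal_cases)
        case (1 i j)
        then have "(\<Sum>k<nn. J (mlt H i j k) * F $ k) = F $ i * F $ j" using F by (simp add: L.is_point_def)
        then show ?case unfolding sum_distrib_left[symmetric] by simp
      qed
      also have "\<dots> = (\<Sum>i<nn. \<Sum>j<nn. \<Sum>s<nn. J (cml H l i s) * (F $ i * (J (M $$ (j, s)) * F $ j)))"
        unfolding sum_distrib_right by (intro sum.cong refl) (simp add: mult_ac)
      also have "\<dots> = (\<Sum>i<nn. \<Sum>s<nn. \<Sum>j<nn. J (cml H l i s) * (F $ i * (J (M $$ (j, s)) * F $ j)))"
        by (rule sum.cong[OF refl], rule sum.swap)
      also have "\<dots> = (\<Sum>i<nn. \<Sum>s<nn. J (cml H l i s) * (F $ i * (F [^]\<^bsub>L.pts\<^esub> m) $ s))"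
        by (intro sum.cong refl) (simp add: Fm sum_distrib_left)
      also have "\<dots> = L.conv F (F [^]\<^bsub>L.pts\<^esub> m) $ l" using l by (simp add: L.conv_def)
      also have "\<dots> = (F [^]\<^bsub>L.pts\<^esub> Suc m) $ l" by (simp add: L.pts_def L.conv_comm[of F])
      finally show "vec nn (\<lambda>l. \<Sum>k<nn. J (mult_by H (Suc m) $$ (k, l)) * F $ k) $ l = (F [^]\<^bsub>L.pts\<^esub> Suc m) $ l"
        using l by simp
    qed (simp add: L.pts_def L.conv_def)
  qed
  show ?thesis unfolding lin[OF MC x] col ..
qed

end

text \<open>Move a point of G(1) into G(2). There it kills the ideal of functions that vanish on
  G(1), which contains the pullbacks, along multiplication by p, of all functions vanishing at the
  unit section. Hence its p-th power in G(2) is the unit. The inclusion of G(1) into G(2) is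
  injective on points because restriction of functions is surjective.\<close>

lemma bt_points_exponent:
  fixes J :: "'a::comm_ring_1 \<Rightarrow> 'l::field"
  assumes J: "comm_ring_hom J" and p: "p > 0" and G: "barsotti_tate p G"
    and F: "fin_alg.is_point (map_bialg J (lvl G 1)) F"
  shows "F [^]\<^bsub>fin_alg.pts (map_bialg J (lvl G 1))\<^esub> p = \<one>\<^bsub>fin_alg.pts (map_bialg J (lvl G 1))\<^esub>"
proof -
  define H1 where "H1 = lvl G 1"
  define H2 where "H2 = lvl G 2"
  define T where "T = trn G 1"
  have gs: "comm_group_scheme H1" "comm_group_scheme H2"
    and hom: "bialg_hom H2 H1 T"
    and surj: "(\<lambda>x. T *\<^sub>v x) ` elts H2 = elts H1"
    and ker: "{x \<in> elts H2. T *\<^sub>v x = 0\<^sub>v (rnk H1)} =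
        genideal (coord_ring H2) ((\<lambda>x. mult_by H2 (p ^ 1) *\<^sub>v x) ` {x \<in> elts H2. counit H2 x = 0})"
    using G unfolding barsotti_tate_def H1_def H2_def T_def by (auto simp: numeral_2_eq_2)
  interpret P1: bialg_points J H1
    by (intro bialg_points.intro J bialg_ids_group_scheme gs)
  interpret P2: bialg_points J H2
    by (intro bialg_points.intro J bialg_ids_group_scheme gs)
  interpret M1: comm_monoid P1.L.pts by (rule P1.L.pts_comm_monoid)
  interpret M2: comm_monoid P2.L.pts by (rule P2.L.pts_comm_monoid)
  let ?n1 = "rnk H1" and ?n2 = "rnk H2"
  have T: "T \<in> carrier_mat ?n1 ?n2"
    and Tr: "(\<lambda>x. T *\<^sub>v x) \<in> Ring.ring_hom (coord_ring H2) (coord_ring H1)"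
    and Tc: "\<And>x. x \<in> elts H2 \<Longrightarrow> comul H1 (T *\<^sub>v x) = T * comul H2 x * transpose_mat T"
    using hom by (auto simp: bialg_hom_def)
  \<comment> \<open>The image in G(2) of a point of G(1): composition with restriction of
    functions.\<close>
  define pb where "pb F = vec ?n2 (\<lambda>l. P1.evJ F (T *\<^sub>v unit_vec ?n2 l))" for F
  have Tx [simp]: "T *\<^sub>v x \<in> carrier_vec ?n1" if "x \<in> carrier_vec ?n2" for x using T that by simp
  have pbe: "P2.evJ (pb F) x = P1.evJ F (T *\<^sub>v x)" if x: "x \<in> carrier_vec ?n2" for F x
  proof -
    have Tl: "(T *\<^sub>v x) $ k = (\<Sum>l<?n2. x $ l * T $$ (k, l))" if "x \<in> carrier_vec ?n2" "k < ?n1" for x k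
      using that T by (simp add: scalar_prod_def atLeast0LessThan mult.commute)
    have Tu: "(T *\<^sub>v unit_vec ?n2 l) $ k = T $$ (k, l)" if "l < ?n2" "k < ?n1" for k l
      unfolding Tl[OF unit_vec_carrier that(2)] by (rule pick_sum[OF that(1)])
    have "P1.evJ F (T *\<^sub>v x) = (\<Sum>k<?n1. \<Sum>l<?n2. J (x $ l) * (J (T $$ (k, l)) * F $ k))"
      using x by (simp add: P1.evJ_sum Tl P1.hom_sum P1.hom_mult sum_distrib_right mult.assoc)
    also have "\<dots> = (\<Sum>l<?n2. \<Sum>k<?n1. J (x $ l) * (J (T $$ (k, l)) * F $ k))" by (rule sum.swap)
    also have "\<dots> = P2.evJ (pb F) x"
      using x by (simp add: P2.evJ_sum pb_def P1.evJ_sum Tu sum_distrib_left)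
    finally show ?thesis ..
  qed
  have pb_point: "P2.L.is_point (pb F)" if F: "P1.L.is_point F" for F
  proof -
    have "(\<Sum>k<?n2. J (mlt H2 i j k) * pb F $ k) = pb F $ i * pb F $ j" if "i < ?n2" "j < ?n2" for i j
    proof -
      have "(\<Sum>k<?n2. J (mlt H2 i j k) * pb F $ k) =
          P2.evJ (pb F) (unit_vec ?n2 i \<otimes>\<^bsub>coord_ring H2\<^esub> unit_vec ?n2 j)"
        using that by (simp add: P2.evJ_sum) (simp add: coord_ring_simps(2) mult_unit_coord)
      also have "\<dots> = P1.evJ F ((T *\<^sub>v unit_vec ?n2 i) \<otimes>\<^bsub>coord_ring H1\<^esub> (T *\<^sub>v unit_vec ?n2 j))"
        using ring_hom_mult[OF Tr, of "unit_vec ?n2 i" "unit_vec ?n2 j"] by (subst pbe) simp_all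
      also have "\<dots> = pb F $ i * pb F $ j" using that F by (simp add: P1.evJ_mult pb_def)
      finally show ?thesis .
    qed
    moreover have "(\<Sum>k<?n2. J (unt H2 k) * pb F $ k) = 1"
    proof -
      have "(\<Sum>k<?n2. J (unt H2 k) * pb F $ k) = P2.evJ (pb F) \<one>\<^bsub>coord_ring H2\<^esub>"
        by (simp add: P2.evJ_sum P2.A.co_one)
      also have "\<dots> = P1.evJ F \<one>\<^bsub>coord_ring H1\<^esub>" using ring_hom_one[OF Tr] by (subst pbe) simp_all
      finally show ?thesis using F by (simp add: P1.evJ_one)
    qed
    ultimately show ?thesis unfolding P2.L.is_point_def by (simp add: pb_def)
  qed
  have evJ_conv1: "P1.evJ (P1.L.conv F F') x = (\<Sum>i<?n1. \<Sum>j<?n1. J (comul H1 x $$ (i, j)) * (F $ i * F' $ j))"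
    if "x \<in> carrier_vec ?n1" for F F' x
    unfolding P1.evJ_def P1.L.ev_conv using that
    by (intro sum.cong refl) (simp add: comul_def P1.hom_sum P1.hom_mult)
  have pb_conv: "P2.L.conv (pb F) (pb F') = pb (P1.L.conv F F')" for F F'
  proof (rule eq_vecI)
    fix l assume "l < dim_vec (pb (P1.L.conv F F'))"
    then have l: "l < ?n2" by (simp add: pb_def)
    define C where "C = comul H2 (unit_vec ?n2 l)"
    have C: "C \<in> carrier_mat ?n2 ?n2" by (simp add: C_def)
    have pbl: "pb F $ a = (\<Sum>i<?n1. J (T $$ (i, a)) * F $ i)" if "a < ?n2" for a F
      using that T by (simp add: pb_def P1.evJ_sum)
    have TCT: "(T * C * transpose_mat T) $$ (i, j) = (\<Sum>a<?n2. T $$ (i, a) * (\<Sum>b<?n2. C $$ (a, b) * T $$ (j, b)))"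
      if "i < ?n1" "j < ?n1" for i j
      using that T C by (simp add: scalar_prod_def atLeast0LessThan)
    have "pb (P1.L.conv F F') $ l = (\<Sum>i<?n1. \<Sum>j<?n1. J ((T * C * transpose_mat T) $$ (i, j)) * (F $ i * F' $ j))"
      using l by (simp add: pb_def evJ_conv1 Tc C_def)
    also have "\<dots> = (\<Sum>i<?n1. \<Sum>j<?n1. \<Sum>a<?n2. \<Sum>b<?n2. J (C $$ (a, b)) * ((J (T $$ (i, a)) * F $ i) * (J (T $$ (j, b)) * F' $ j)))"
      by (intro sum.cong refl) (simp add: TCT P1.hom_sum P1.hom_mult sum_distrib_left sum_distrib_right mult_ac)
    also have "\<dots> = (\<Sum>a<?n2. \<Sum>b<?n2. \<Sum>i<?n1. \<Sum>j<?n1. J (C $$ (a, b)) * ((J (T $$ (i, a)) * F $ i) * (J (T $$ (j, b)) * F' $ j)))"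
      by (rule trans[OF sum_rotate4 sum_rotate4])
    also have "\<dots> = (\<Sum>a<?n2. \<Sum>b<?n2. J (C $$ (a, b)) * (pb F $ a * pb F' $ b))"
    proof (rule sum.cong[OF refl], rule sum.cong[OF refl], goal_cases)
      case (1 a b)
      then have "pb F $ a * pb F' $ b =
          (\<Sum>i<?n1. \<Sum>j<?n1. (J (T $$ (i, a)) * F $ i) * (J (T $$ (j, b)) * F' $ j))"
        by (simp only: pbl lessThan_iff sum_product)
      then show ?case by (simp only: sum_distrib_left)
    qed
    also have "\<dots> = P2.L.conv (pb F) (pb F') $ l"
      using l by (simp add: P2.L.conv_def C_def comul_unit)
    finally show "P2.L.conv (pb F) (pb F') $ l = pb (P1.L.conv F F') $ l" ..
  qed (simp_all add: pb_def P2.L.conv_def)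
  have F1: "P1.L.is_point F" using F by (simp add: H1_def)
  \<comment> \<open>Stated for positive exponents, so that multiplicativity of \<open>pb\<close>
    suffices and its value at the unit does not enter.\<close>
  have pb_pow: "pb (F [^]\<^bsub>P1.L.pts\<^esub> Suc m) = pb F [^]\<^bsub>P2.L.pts\<^esub> Suc m" if F: "P1.L.is_point F" for F m
  proof (induction m)
    case 0
    have "F \<in> carrier P1.L.pts" "pb F \<in> carrier P2.L.pts"
      using F pb_point by (simp_all add: P1.L.pts_def P2.L.pts_def)
    then show ?case by simp
  next
    case (Suc m)
    have "pb (F [^]\<^bsub>P1.L.pts\<^esub> Suc (Suc m)) = P2.L.conv (pb (F [^]\<^bsub>P1.L.pts\<^esub> Suc m)) (pb F)"
      unfolding pb_conv by (simp add: P1.L.pts_def)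
    also have "\<dots> = pb F [^]\<^bsub>P2.L.pts\<^esub> Suc (Suc m)" unfolding Suc by (simp add: P2.L.pts_def)
    finally show ?case .
  qed
  have trivial: "pb (F [^]\<^bsub>P1.L.pts\<^esub> p) = vec ?n2 (cnt (map_bialg J H2))" if F: "P1.L.is_point F" for F
  proof (rule eq_vecI)
    let ?Fp = "pb F [^]\<^bsub>P2.L.pts\<^esub> p"
    have pb_p: "pb (F [^]\<^bsub>P1.L.pts\<^esub> p) = ?Fp" using pb_pow[OF F, of "p - 1"] p by simp
    have "pb F \<in> carrier P2.L.pts" using pb_point[OF F] by (simp add: P2.L.pts_def)
    then have "?Fp \<in> carrier P2.L.pts" by (rule M2.nat_pow_closed)
    then have Fp: "P2.L.is_point ?Fp" by (simp add: P2.L.pts_def)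
    fix l assume "l < dim_vec (vec ?n2 (cnt (map_bialg J H2)))"
    then have l: "l < ?n2" by simp
    \<comment> \<open>The basis vector shifted by a constant into the augmentation ideal; evaluation
      at it reads off coordinate l.\<close>
    define x where "x = unit_vec ?n2 l + (- cnt H2 l) \<cdot>\<^sub>v \<one>\<^bsub>coord_ring H2\<^esub>"
    have x: "x \<in> carrier_vec ?n2" unfolding x_def by (intro P2.A.add_closed P2.A.sm_closed) simp_all
    have "counit H2 x = (\<Sum>k<?n2. unit_vec ?n2 l $ k * cnt H2 k) - cnt H2 l * (\<Sum>k<?n2. unt H2 k * cnt H2 k)"
      unfolding counit_def x_def by (simp add: P2.A.co_one P2.A.co_add P2.A.co_sm algebra_simps
        sum.distrib sum_subtractf sum_distrib_left)
    then have "counit H2 x = 0" using pick_sum[OF l, of "cnt H2"] by (simp add: P2.unt_cnt)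
    then have "mult_by H2 p *\<^sub>v x \<in> (\<lambda>x. mult_by H2 (p ^ 1) *\<^sub>v x) ` {x \<in> elts H2. counit H2 x = 0}"
      using x by auto
    moreover have "(\<lambda>x. mult_by H2 (p ^ 1) *\<^sub>v x) ` {x \<in> elts H2. counit H2 x = 0} \<subseteq> elts H2"
    proof -
      have "mult_by H2 p \<in> carrier_mat ?n2 ?n2" by (cases p) auto
      then show ?thesis by auto
    qed
    ultimately have "mult_by H2 p *\<^sub>v x \<in> {x \<in> elts H2. T *\<^sub>v x = 0\<^sub>v (rnk H1)}"
      unfolding ker using P2.A.genideal_self by blast
    then have "P2.evJ (pb F) (mult_by H2 p *\<^sub>v x) = 0"
      by (simp add: pbe P1.evJ_sum)
    then have "0 = P2.evJ ?Fp x" using P2.evJ_mult_by[OF pb_point[OF F] x] by simp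
    also have "\<dots> = ?Fp $ l - J (cnt H2 l)"
      unfolding x_def using l Fp
      by (subst P2.evJ_add, simp, simp) (simp add: P2.evJ_unit P2.evJ_smult P2.evJ_one P1.hom_uminus)
    finally show "pb (F [^]\<^bsub>P1.L.pts\<^esub> p) $ l = vec ?n2 (cnt (map_bialg J H2)) $ l"
      using l pb_p by simp
  qed (simp add: pb_def)
  \<comment> \<open>Every coordinate function of G(1) is the restriction of a function on G(2),
    where the two points agree.\<close>
  have same: "f = g" if fg: "pb f = pb g" "f \<in> carrier_vec ?n1" "g \<in> carrier_vec ?n1" for f g
  proof (rule eq_vecI)
    fix k assume "k < dim_vec g"
    then have k: "k < ?n1" using fg by simp
    have "unit_vec ?n1 k \<in> (\<lambda>x. T *\<^sub>v x) ` elts H2" unfolding surj by simp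
    then obtain x where x: "x \<in> elts H2" "unit_vec ?n1 k = T *\<^sub>v x" by blast
    have "P1.evJ f (T *\<^sub>v x) = P1.evJ g (T *\<^sub>v x)"
      unfolding pbe[OF x(1), symmetric] fg(1) ..
    then show "f $ k = g $ k" using k by (simp add: x(2)[symmetric] P1.evJ_unit)
  qed (use fg in simp)
  have pt: "P1.L.is_point (f [^]\<^bsub>P1.L.pts\<^esub> p)" if "P1.L.is_point f" for f
    using M1.nat_pow_closed[of f p] that by (simp add: P1.L.pts_def)
  have one: "P1.L.is_point \<one>\<^bsub>P1.L.pts\<^esub>" using P1.L.cnt_point by (simp add: P1.L.pts_def)
  \<comment> \<open>The p-th powers of \<open>F\<close> and of the unit have the same image in G(2),
    and the latter power is the unit.\<close>
  have "F [^]\<^bsub>P1.L.pts\<^esub> p = \<one>\<^bsub>P1.L.pts\<^esub> [^]\<^bsub>P1.L.pts\<^esub> p"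
    by (rule same) (simp_all only: trivial[OF F1] trivial[OF one] P1.L.is_point_carrier[OF pt[OF F1]]
      P1.L.is_point_carrier[OF pt[OF one]])
  also have "\<dots> = \<one>\<^bsub>P1.L.pts\<^esub>" by (rule M1.nat_pow_one)
  finally show ?thesis unfolding H1_def .
qed

section \<open>Separable closure and Galois group\<close>

lemma rsquarefree_dvd:
  fixes q :: "'a::idom poly"
  assumes "rsquarefree q" "r dvd q" shows "rsquarefree r"
proof -
  have "q \<noteq> 0" "r \<noteq> 0" using assms by (auto simp: rsquarefree_def)
  then have "order a r \<le> order a q" for a using assms(2) by (simp add: dvd_imp_order_le)
  then show ?thesis using assms(1) \<open>r \<noteq> 0\<close> unfolding rsquarefree_def
    by (metis le_zero_eq le_Suc_eq One_nat_def)
qed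

lemma rsquarefree_pderiv_one:
  fixes q :: "'a::field poly"
  assumes "pderiv q = 1" shows "rsquarefree q"
proof -
  have q0: "q \<noteq> 0" using assms by auto
  have "order a q \<le> 1" for a
  proof (rule ccontr)
    assume "\<not> order a q \<le> 1"
    then have "[:- a, 1:] ^ 2 dvd q" using order_divides[of a 2 q] by simp
    then obtain r where r: "q = [:- a, 1:] ^ 2 * r" ..
    define l where "l = [:- a, 1:]"
    have "pderiv l = 1" by (simp add: l_def pderiv_pCons)
    moreover have "q = l * (l * r)" using r by (simp only: l_def power2_eq_square mult.assoc)
    ultimately have "pderiv q = l * pderiv (l * r) + l * r" by (simp add: pderiv_mult)
    then have "poly (pderiv q) a = 0" by (simp add: l_def)
    then show False using assms by simp
  qed
  then show ?thesis using q0 unfolding rsquarefree_def by (metis le_Suc_eq le_zero_eq One_nat_def)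
qed

lemma card_roots_rsquarefree:
  fixes q :: "'a::alg_closed_field poly"
  assumes "rsquarefree q" shows "card {x. poly q x = 0} = degree q"
proof -
  have "q \<noteq> 0" using assms by (simp add: rsquarefree_def)
  then obtain A where A: "size A = degree q" "q = smult (lead_coeff q) (\<Prod>x\<in>#A. [:- x, 1:])"
    using alg_closed_imp_factorization by blast
  have "proots q = proots (\<Prod>x\<in>#A. [:- x, 1:])"
    using \<open>q \<noteq> 0\<close> by (subst A(2)) simp
  also have "\<dots> = A"
  proof (induction A)
    case (add x A)
    have "(\<Prod>x\<in>#A. [:- x, 1:]) \<noteq> 0" by (auto simp: prod_mset_zero_iff)
    with add show ?case by (simp add: proots_mult del: mult_pCons_left)
  qed simp
  finally have pr: "proots q = A" .
  have "count A x = 1" if "x \<in># A" for x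
  proof -
    have "order x q = count A x" using \<open>q \<noteq> 0\<close> by (simp add: pr[symmetric])
    moreover have "order x q \<le> 1" using assms unfolding rsquarefree_def by (metis le_refl zero_le_one)
    moreover have "count A x > 0" using that by simp
    ultimately show ?thesis by linarith
  qed
  then have "size A = card (set_mset A)" by (simp add: size_multiset_overloaded_eq)
  moreover have "set_mset A = {x. poly q x = 0}" using \<open>q \<noteq> 0\<close> by (simp flip: pr)
  ultimately show ?thesis using A(1) by simp
qed

section \<open>Simple extensions as finite-dimensional vector spaces, and separability\<close>

locale alg_clo = fixes \<iota> :: "'a::field \<Rightarrow> 'l::alg_closed_field" and p :: nat
  assumes clo: "is_alg_closure \<iota>" and char: "CHAR('l) = p" and p: "Factorial_Ring.prime p"
begin

sublocale field_hom \<iota> using clo by (simp add: is_alg_closure_def)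

sublocale mp: map_poly_inj_idom_hom \<iota> ..

sublocale vs: vector_space "\<lambda>a x. \<iota> a * x"
  by unfold_locales (simp_all add: algebra_simps hom_distribs)

abbreviation pl :: "'a poly \<Rightarrow> 'l \<Rightarrow> 'l" where "pl P x \<equiv> poly (map_poly \<iota> P) x"

text \<open>The ring K[x] over the base field K; since x is algebraic it is finite-dimensional, and
  even a field.\<close>

definition adj :: "'l \<Rightarrow> 'l set" where "adj x = range (\<lambda>P. pl P x)"

text \<open>Separability in the form K[x] = K[x^p]. This criterion speaks of subspaces only, which
  opens sums and products of separable elements to dimension counts.\<close>

definition sep :: "'l \<Rightarrow> bool" where "sep x \<longleftrightarrow> x \<in> adj (x ^ p)"

lemma pl_add: "pl (P + Q) x = pl P x + pl Q x" by (simp add: hom_distribs mp.hom_add mp.hom_mult poly_monom)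
lemma pl_mult: "pl (P * Q) x = pl P x * pl Q x" by (simp add: hom_distribs mp.hom_add mp.hom_mult poly_monom)
lemma pl_smult: "pl (smult a P) x = \<iota> a * pl P x" by (simp add: hom_distribs mp.hom_add mp.hom_mult poly_monom)
lemma pl_monom: "pl (monom a i) x = \<iota> a * x ^ i" by (simp add: hom_distribs mp.hom_add mp.hom_mult poly_monom)

lemma pl_sum: "pl P x = (\<Sum>i\<le>degree P. \<iota> (coeff P i) * x ^ i)"
  by (simp add: poly_altdef)

lemma adj_subspace: "vs.subspace (adj x)"
  unfolding vs.subspace_def adj_def
  by (auto intro: range_eqI[of _ _ 0] simp flip: pl_add pl_smult)

lemma adj_mult: "a \<in> adj x \<Longrightarrow> b \<in> adj x \<Longrightarrow> a * b \<in> adj x"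
  unfolding adj_def by (auto simp flip: pl_mult)

lemma adj_const: "\<iota> a \<in> adj x"
  unfolding adj_def by (rule range_eqI[of _ _ "[:a:]"]) (simp add: hom_distribs)

lemma adj_self: "x \<in> adj x"
  unfolding adj_def by (rule range_eqI[of _ _ "[:0, 1:]"]) (simp add: hom_distribs)

lemma adj_pow: "a \<in> adj x \<Longrightarrow> a ^ m \<in> adj x"
  by (induction m) (use adj_const[of 1] adj_mult in auto)

lemma adj_subset: "y \<in> adj x \<Longrightarrow> adj y \<subseteq> adj x"
proof
  fix z assume y: "y \<in> adj x" and "z \<in> adj y"
  then obtain P where z: "z = pl P y" by (auto simp: adj_def)
  show "z \<in> adj x" unfolding z pl_sum
    by (intro vs.subspace_sum[OF adj_subspace] vs.subspace_scale[OF adj_subspace] adj_pow y)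
qed

lemma adj_span: "adj x = vs.span (range (\<lambda>i. x ^ i))"
proof
  show "adj x \<subseteq> vs.span (range (\<lambda>i. x ^ i))"
  proof
    fix z assume "z \<in> adj x"
    then obtain P where z: "z = pl P x" by (auto simp: adj_def)
    show "z \<in> vs.span (range (\<lambda>i. x ^ i))"
      unfolding z pl_sum by (intro vs.span_sum vs.span_scale vs.span_base rangeI)
  qed
  show "vs.span (range (\<lambda>i. x ^ i)) \<subseteq> adj x"
    by (rule vs.span_minimal) (auto intro: adj_pow adj_self adj_subspace)
qed

text \<open>Division by q with remainder. This bounds the dimension of K[x] by the degree of
  q.\<close>

lemma reduce_degree:
  assumes "q \<noteq> 0" "pl q x = 0"
  shows "adj x = vs.span ((\<lambda>i. x ^ i) ` {..<degree q})"
proof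
  show "vs.span ((\<lambda>i. x ^ i) ` {..<degree q}) \<subseteq> adj x"
    by (rule vs.span_minimal) (auto intro: adj_pow adj_self adj_subspace)
  show "adj x \<subseteq> vs.span ((\<lambda>i. x ^ i) ` {..<degree q})"
  proof
    fix z assume "z \<in> adj x"
    then obtain P where z: "z = pl P x" by (auto simp: adj_def)
    have "pl P x = pl (P div q * q + P mod q) x" by simp
    also have "\<dots> = pl (P mod q) x" unfolding pl_add pl_mult assms(2) by simp
    finally have z': "z = pl (P mod q) x" by (simp add: z)
    show "z \<in> vs.span ((\<lambda>i. x ^ i) ` {..<degree q})"
    proof (cases "P mod q = 0")
      case False
      then have "degree (P mod q) < degree q" using degree_mod_less[OF assms(1)] by blast
      then show ?thesis unfolding z' pl_sum
        by (intro vs.span_sum vs.span_scale vs.span_base) auto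
    qed (simp add: z' vs.span_zero)
  qed
qed

lemma algebraic: "\<exists>q. q \<noteq> 0 \<and> pl q x = 0"
  using clo by (simp add: is_alg_closure_def)

lemma frob_inj: "(a::'l) ^ (p ^ m) = b ^ (p ^ m) \<Longrightarrow> a = b"
proof -
  assume eq: "a ^ (p ^ m) = b ^ (p ^ m)"
  have "(a - b + b) ^ (p ^ m) = (a - b) ^ (p ^ m) + b ^ (p ^ m)"
    by (rule freshmans_dream') (use char p in auto)
  with eq have "(a - b) ^ (p ^ m) = 0" by simp
  then show "a = b" by simp
qed

lemma frob_add: "(a + b :: 'l) ^ (p ^ m) = a ^ (p ^ m) + b ^ (p ^ m)"
  by (rule freshmans_dream') (use char p in auto)

lemma frob_sum: "(sum f A :: 'l) ^ (p ^ m) = (\<Sum>a\<in>A. f a ^ (p ^ m))"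
  by (rule freshmans_dream_sum') (use char p in auto)

lemma relation_of_dependence:
  assumes "x ^ m \<in> vs.span ((\<lambda>i. x ^ i) ` {..<m})"
  shows "\<exists>r. r \<noteq> 0 \<and> degree r = m \<and> pl r x = 0"
proof -
  have "\<exists>r. (r = 0 \<or> degree r < m) \<and> pl r x = z" if "z \<in> vs.span ((\<lambda>i. x ^ i) ` {..<m})" for z
    using that
  proof (induction rule: vs.span_induct_alt)
    case base show ?case by (intro exI[of _ 0]) simp
  next
    case (step c y z)
    then obtain r i where r: "r = 0 \<or> degree r < m" "pl r x = z" "y = x ^ i" "i < m" by auto
    have "degree (monom c i + r) < m" 
      by (rule degree_add_less) (use r in \<open>auto intro: le_less_trans[OF degree_monom_le]\<close>)
    then show ?case using r by (intro exI[of _ "monom c i + r"]) (simp add: pl_add pl_monom poly_monom)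
  qed
  from this[OF assms] obtain r where r: "r = 0 \<or> degree r < m" "pl r x = x ^ m" by blast
  have d: "degree (monom 1 m - r) = m" 
  proof (cases "r = 0 \<or> m = 0")
    case True then show ?thesis using r by (auto simp: degree_monom_eq)
  next
    case False
    then have "degree (- r + monom 1 m) = degree (monom (1::'a) m)"
      by (intro degree_add_eq_right) (use r in \<open>simp add: degree_monom_eq\<close>)
    then show ?thesis by (simp add: degree_monom_eq)
  qed
  have "coeff (monom 1 m - r) m = 1" using r by (auto simp: coeff_eq_0)
  then have "monom 1 m - r \<noteq> 0" by (metis coeff_0 zero_neq_one)
  moreover have "pl (monom 1 m - r) x = 0" using r(2) by (simp add: hom_distribs poly_monom)
  ultimately show ?thesis using d by blast
qed


lemma adj_dim_le:
  assumes "q \<noteq> 0" "pl q x = 0" shows "vs.dim (adj x) \<le> degree q"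
proof -
  have "vs.dim (adj x) \<le> card ((\<lambda>i. x ^ i) ` {..<degree q})"
    by (rule vs.dim_le_card) (simp_all add: reduce_degree[OF assms])
  also have "\<dots> \<le> degree q" using card_image_le[of "{..<degree q}"] by simp
  finally show ?thesis .
qed

lemma fin_basis:
  assumes "finite T"
  obtains C where "C \<subseteq> vs.span T" "vs.independent C" "vs.span T \<subseteq> vs.span C" "finite C"
    "card C = vs.dim (vs.span T)"
proof -
  obtain C where C: "C \<subseteq> vs.span T" "vs.independent C" "vs.span T \<subseteq> vs.span C"
    "card C = vs.dim (vs.span T)" using vs.basis_exists[of "vs.span T"] by blast
  moreover have "finite C" using vs.independent_span_bound[OF assms C(2,1)] by simp
  ultimately show ?thesis using that by blast
qed

lemma adj_fin_span: obtains T where "finite T" "adj x = vs.span T"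
proof -
  obtain q where "q \<noteq> 0" "pl q x = 0" using algebraic by blast
  from reduce_degree[OF this] show ?thesis by (intro that[of "(\<lambda>i. x ^ i) ` {..<degree q}"]) auto
qed

lemma independent_card_le:
  assumes "finite T" "vs.independent C" "C \<subseteq> vs.span T" shows "finite C \<and> card C \<le> vs.dim (vs.span T)"
proof -
  obtain D where D: "vs.span T \<subseteq> vs.span D" "finite D" "card D = vs.dim (vs.span T)"
    using fin_basis[OF assms(1)] by metis
  show ?thesis using vs.independent_span_bound[OF D(2) assms(2)] D assms(3) by auto
qed

lemma span_dim_eq:
  assumes "finite T" "finite T'" "vs.span T \<subseteq> vs.span T'" "vs.dim (vs.span T') \<le> vs.dim (vs.span T)"
  shows "vs.span T' \<subseteq> vs.span T"
proof
  fix z assume z: "z \<in> vs.span T'"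
  obtain C where C: "C \<subseteq> vs.span T" "vs.independent C" "vs.span T \<subseteq> vs.span C" "finite C"
    "card C = vs.dim (vs.span T)" using fin_basis[OF assms(1)] by metis
  show "z \<in> vs.span T"
  proof (rule ccontr)
    assume "z \<notin> vs.span T"
    then have zC: "z \<notin> vs.span C" using vs.span_minimal[OF C(1) vs.subspace_span] by blast
    then have "vs.independent (insert z C)" using C(2) by (simp add: vs.independent_insert vs.span_base)
    moreover have "insert z C \<subseteq> vs.span T'" using z C(1) assms(3) by auto
    ultimately have "card (insert z C) \<le> vs.dim (vs.span T')"
      using independent_card_le[OF assms(2)] by blast
    moreover have "z \<notin> C" using zC vs.span_base by blast
    ultimately show False using C(4,5) assms(4) by simp
  qed
qed

lemma adj_dim_eq:
  assumes "adj y \<subseteq> adj x" "vs.dim (adj x) \<le> vs.dim (adj y)" shows "adj x \<subseteq> adj y"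
  by (metis adj_fin_span assms span_dim_eq)

text \<open>Let m be the first exponent for which x^m lies in the span of the lower powers. The
  lower powers are independent, so the resulting relation of degree m has degree exactly dim
  K[x].\<close>

lemma min_poly: "\<exists>r. r \<noteq> 0 \<and> degree r = vs.dim (adj x) \<and> pl r x = 0"
proof -
  define Q where "Q m \<longleftrightarrow> x ^ m \<in> vs.span ((\<lambda>i. x ^ i) ` {..<m})" for m
  obtain q where q: "q \<noteq> 0" "pl q x = 0" using algebraic by blast
  have "Q (degree q)" unfolding Q_def reduce_degree[OF q, symmetric] by (intro adj_pow adj_self)
  define m where "m = (LEAST m. Q m)"
  have Qm: "Q m" unfolding m_def by (rule LeastI[of Q]) fact
  have least: "\<not> Q k" if "k < m" for k using that unfolding m_def by (rule not_less_Least)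
  have "vs.independent ((\<lambda>i. x ^ i) ` {..<k}) \<and> card ((\<lambda>i. x ^ i) ` {..<k}) = k" if "k \<le> m" for k
    using that
  proof (induction k)
    case (Suc k)
    have nk: "x ^ k \<notin> vs.span ((\<lambda>i. x ^ i) ` {..<k})" using least[of k] Suc.prems by (simp add: Q_def)
    have nk': "x ^ k \<notin> (\<lambda>i. x ^ i) ` {..<k}" by (rule notI, drule vs.span_base) (use nk in contradiction)
    have IH: "vs.independent ((\<lambda>i. x ^ i) ` {..<k})" "card ((\<lambda>i. x ^ i) ` {..<k}) = k"
      using Suc.IH Suc.prems by auto
    have "(\<lambda>i. x ^ i) ` {..<Suc k} = insert (x ^ k) ((\<lambda>i. x ^ i) ` {..<k})"
      by (simp add: lessThan_Suc)
    moreover have "vs.independent (insert (x ^ k) ((\<lambda>i. x ^ i) ` {..<k}))"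
      using nk nk' IH(1) by (subst vs.independent_insert) simp
    moreover have "card (insert (x ^ k) ((\<lambda>i. x ^ i) ` {..<k})) = Suc k"
      using nk' IH(2) by (subst card_insert_disjoint) simp_all
    ultimately show ?case by (simp only: simp_thms)
  qed (simp add: vs.independent_empty)
  then have m: "vs.independent ((\<lambda>i. x ^ i) ` {..<m})" "card ((\<lambda>i. x ^ i) ` {..<m}) = m" by auto
  obtain T where T: "finite T" "adj x = vs.span T" by (rule adj_fin_span)
  have "(\<lambda>i. x ^ i) ` {..<m} \<subseteq> vs.span T" unfolding T(2)[symmetric] by (auto intro: adj_pow adj_self)
  from independent_card_le[OF T(1) m(1) this] have "m \<le> vs.dim (adj x)" by (simp add: T(2) m(2))
  moreover obtain r where r: "r \<noteq> 0" "degree r = m" "pl r x = 0"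
    using relation_of_dependence Qm unfolding Q_def by blast
  ultimately show ?thesis using adj_dim_le[OF r(1,3)] by (intro exI[of _ r]) auto
qed

text \<open>A nonzero remainder would vanish at x and have degree below dim K[x], which
  \<open>adj_dim_le\<close> excludes.\<close>

lemma min_poly_dvd:
  assumes r: "r \<noteq> 0" "degree r = vs.dim (adj x)" "pl r x = 0" and P: "pl P x = 0"
  shows "r dvd P"
proof -
  have "pl (P mod r) x = pl (P div r * r + P mod r) x" unfolding pl_add pl_mult r(3) by simp
  then have "pl (P mod r) x = 0" using P by simp
  moreover have "P mod r = 0 \<or> degree (P mod r) < degree r" by (rule degree_mod_less[OF r(1)])
  ultimately have "P mod r = 0"
    using adj_dim_le[of "P mod r" x] r(2) by (metis leD)
  then show ?thesis by blast
qed

lemma pl_unit: "r dvd 1 \<Longrightarrow> pl r x \<noteq> 0"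
  by (metis dvdE mult_zero_left pl_mult mp.hom_one poly_1 zero_neq_one)

lemma irreducible_min_poly:
  assumes r: "r \<noteq> 0" "degree r = vs.dim (adj x)" "pl r x = 0"
  shows "comm_semiring_1_class.irreducible r"
proof (rule comm_semiring_1_class.irreducibleI)
  show "\<not> r dvd 1" using pl_unit r(3) by blast
  fix a b assume ab: "r = a * b"
  have *: "b' dvd 1" if "r = a' * b'" "pl a' x = 0" for a' b'
  proof -
    have "a' \<noteq> 0" "b' \<noteq> 0" using that r(1) by auto
    then have "degree r = degree a' + degree b'" using that by (simp add: degree_mult_eq)
    moreover have "vs.dim (adj x) \<le> degree a'" by (rule adj_dim_le) fact+
    ultimately have "degree b' = 0" using r(2) by simp
    with \<open>b' \<noteq> 0\<close> show ?thesis by (simp add: is_unit_iff_degree)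
  qed
  have "pl a x = 0 \<or> pl b x = 0" using r(3) unfolding ab pl_mult by simp
  then show "a dvd 1 \<or> b dvd 1" using *[of a b] *[of b a] ab by (auto simp: mult.commute)
qed (rule r(1))

lemma irreducible_dvd:
  assumes q: "comm_semiring_1_class.irreducible q" "pl q x = 0" and P: "pl P x = 0"
  shows "q dvd P"
proof -
  obtain r where r: "r \<noteq> 0" "degree r = vs.dim (adj x)" "pl r x = 0" using min_poly by blast
  have "r dvd q" by (rule min_poly_dvd[OF r q(2)])
  then obtain u where u: "q = r * u" by blast
  have "\<not> r dvd 1" using pl_unit r(3) by blast
  then have "u dvd 1" using comm_semiring_1_class.irreducibleD[OF q(1) u] by blast
  then have "q dvd r" unfolding u by (metis dvd_refl mult_unit_dvd_iff)
  moreover have "r dvd P" by (rule min_poly_dvd[OF r P])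
  ultimately show ?thesis by (rule dvd_trans)
qed

lemma pl_frob: "pl (pcompose P (monom 1 p)) x = pl P (x ^ p)"
  by (simp add: hom_distribs poly_pcompose poly_monom)

lemma adj_pow_subset: "adj (x ^ k) \<subseteq> adj x"
  by (rule adj_subset) (intro adj_pow adj_self)

text \<open>If K[x^p] were smaller than K[x], the minimal polynomial r of x^p would have degree
  below that of q. But q divides r(X^p), so Frobenius maps the deg q distinct roots of q injectively
  into the roots of r.\<close>

lemma sep_if_sep_closure:
  assumes "x \<in> sep_closure \<iota>" shows "sep x"
proof (rule ccontr)
  assume ns: "\<not> sep x"
  obtain q where q: "comm_semiring_1_class.irreducible q" "rsquarefree (map_poly \<iota> q)" "pl q x = 0"
    using assms by (auto simp: sep_closure_def)
  have q0: "q \<noteq> 0" using q(1) by auto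
  have "vs.dim (adj (x ^ p)) < vs.dim (adj x)"
    using adj_dim_eq[OF adj_pow_subset[of x p]] ns adj_self unfolding sep_def by fastforce
  then have lt: "vs.dim (adj (x ^ p)) < degree q" using adj_dim_le[OF q0 q(3)] by simp
  obtain r where r: "r \<noteq> 0" "degree r = vs.dim (adj (x ^ p))" "pl r (x ^ p) = 0" using min_poly by blast
  have dv: "q dvd pcompose r (monom 1 p)" by (rule irreducible_dvd[OF q(1,3)]) (simp add: pl_frob r)
  have "(\<lambda>a. a ^ p) ` {a. pl q a = 0} \<subseteq> {a. pl r a = 0}"
  proof safe
    fix a assume "pl q a = 0"
    with dv have "pl (pcompose r (monom 1 p)) a = 0" by (metis dvdE mult_zero_left pl_mult)
    then show "pl r (a ^ p) = 0" by (simp add: pl_frob)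
  qed
  moreover have fin: "finite {a. pl r a = 0}" using r(1) by (intro poly_roots_finite) simp
  ultimately have "card ((\<lambda>a. a ^ p) ` {a. pl q a = 0}) \<le> card {a. pl r a = 0}" by (intro card_mono)
  moreover have "inj_on (\<lambda>a. a ^ p) {a. pl q a = 0}" using frob_inj[of _ 1] by (auto simp: inj_on_def)
  moreover have "card {a. pl r a = 0} \<le> degree r" using card_poly_roots_bound[of "map_poly \<iota> r"] r(1) by simp
  moreover have "card {a. pl q a = 0} = degree q" using card_roots_rsquarefree[OF q(2)] by simp
  ultimately show False using lt r(2) by (simp add: card_image)
qed

lemma of_nat_p: "(of_nat p :: 'a) = 0"
proof -
  have "\<iota> (of_nat p) = of_nat p" by (simp add: hom_distribs)
  also have "\<dots> = 0" using char by (metis of_nat_CHAR)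
  finally show ?thesis by simp
qed

text \<open>Writing x = P(x^p) exhibits x as a root of X - P(X^p), whose derivative is 1. The
  minimal polynomial of x divides it and so has no multiple roots either.\<close>

lemma sep_closure_if_sep:
  assumes "sep x" shows "x \<in> sep_closure \<iota>"
proof -
  obtain P where P: "x = pl P (x ^ p)" using assms by (auto simp: sep_def adj_def)
  define D where "D = [:0, 1:] - pcompose P (monom 1 p)"
  have "pderiv (monom (1::'a) p) = 0" by (simp add: pderiv_monom of_nat_p)
  then have "pderiv D = 1" by (simp add: D_def pderiv_diff pderiv_pcompose pderiv_pCons)
  then have "pderiv (map_poly \<iota> D) = 1" by (simp add: map_poly_pderiv[symmetric])
  then have rD: "rsquarefree (map_poly \<iota> D)" by (rule rsquarefree_pderiv_one)
  have "pl D x = x - pl P (x ^ p)" unfolding D_def by (simp add: mp.hom_minus hom_distribs poly_pcompose poly_monom)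
  then have Dx: "pl D x = 0" using P by simp
  obtain r where r: "r \<noteq> 0" "degree r = vs.dim (adj x)" "pl r x = 0" using min_poly by blast
  have "r dvd D" by (rule min_poly_dvd[OF r Dx])
  then have "map_poly \<iota> r dvd map_poly \<iota> D" by (rule mp.hom_dvd)
  with rD have "rsquarefree (map_poly \<iota> r)" by (rule rsquarefree_dvd)
  with irreducible_min_poly[OF r] r(3) show ?thesis by (auto simp: sep_closure_def)
qed

lemma sep_closure_eq: "x \<in> sep_closure \<iota> \<longleftrightarrow> sep x"
  using sep_if_sep_closure sep_closure_if_sep by blast

text \<open>As long as x^(p^m) is inseparable, the dimension of K[x^(p^m)] drops strictly at the
  next step.\<close>

lemma eventually_sep: "\<exists>m. sep (x ^ (p ^ m))"
proof (rule ccontr)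
  assume ns: "\<not> ?thesis"
  define d where "d m = vs.dim (adj (x ^ (p ^ m)))" for m
  have "d (Suc m) < d m" for m
  proof -
    have e: "x ^ (p ^ Suc m) = (x ^ (p ^ m)) ^ p" by (simp add: power_mult[symmetric] mult.commute)
    show ?thesis
      using adj_dim_eq[OF adj_pow_subset[of "x ^ (p ^ m)" p]] ns adj_self unfolding sep_def d_def e
      by fastforce
  qed
  then have "d m + m \<le> d 0" for m
    by (induction m) (simp, metis add_Suc_right add_Suc le_trans Suc_le_eq add_le_mono1)
  from this[of "Suc (d 0)"] show False by simp
qed

lemma sep_const: "sep (\<iota> a)"
  unfolding sep_def by (rule adj_const)

text \<open>Extend \<open>C\<close> to a basis of E = \<open>vs.span T\<close>. The p-th powers of
  that basis span all p-th powers, hence E by \<open>M\<close>; being only dim E in number, they are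
  independent. This is the linear algebra behind MacLane's criterion.\<close>

lemma independent_image_frob:
  assumes T: "finite T" and M: "vs.span T \<subseteq> vs.span ((\<lambda>z. z ^ p) ` vs.span T)"
    and C: "vs.independent C" "C \<subseteq> vs.span T"
  shows "vs.independent ((\<lambda>z. z ^ p) ` C)"
proof -
  obtain D where D: "C \<subseteq> D" "D \<subseteq> vs.span T" "vs.independent D" "vs.span T \<subseteq> vs.span D"
    using vs.maximal_independent_subset_extend[OF C(2,1)] by blast
  have fD: "finite D" using independent_card_le[OF T D(3,2)] by blast
  have cD: "card D = vs.dim (vs.span T)" by (rule vs.basis_card_eq_dim[OF D(2,4,3)])
  have inj: "inj_on (\<lambda>z. z ^ p) D" using frob_inj[of _ 1] by (auto simp: inj_on_def)
  let ?F = "(\<lambda>z. z ^ p) ` D"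
  have "vs.subspace {z. z ^ p \<in> vs.span ?F}"
    unfolding vs.subspace_def
  proof (intro conjI ballI allI)
    show "0 \<in> {z. z ^ p \<in> vs.span ?F}" using prime_gt_0_nat[OF p] by (simp add: vs.span_zero zero_power)
    fix x assume x: "x \<in> {z. z ^ p \<in> vs.span ?F}"
    show "\<iota> c * x \<in> {z. z ^ p \<in> vs.span ?F}" for c
      using x vs.span_scale[of "x ^ p" ?F "c ^ p"] by (simp add: power_mult_distrib hom_distribs)
    fix y assume y: "y \<in> {z. z ^ p \<in> vs.span ?F}"
    show "x + y \<in> {z. z ^ p \<in> vs.span ?F}"
      using x y vs.span_add frob_add[of x y 1] by simp
  qed
  moreover have "D \<subseteq> {z. z ^ p \<in> vs.span ?F}" using vs.span_base by auto
  ultimately have "vs.span D \<subseteq> {z. z ^ p \<in> vs.span ?F}" by (intro vs.span_minimal)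
  then have "(\<lambda>z. z ^ p) ` vs.span T \<subseteq> vs.span ?F" using D(4) by auto
  then have "vs.span ((\<lambda>z. z ^ p) ` vs.span T) \<subseteq> vs.span ?F"
    by (intro vs.span_minimal vs.subspace_span)
  then have TF: "vs.span T \<subseteq> vs.span ?F" using M by (rule order_trans[rotated])
  have "vs.independent ?F"
  proof
    assume "vs.dependent ?F"
    then obtain a where a: "a \<in> ?F" "a \<in> vs.span (?F - {a})" unfolding vs.dependent_def by blast
    have "?F \<subseteq> vs.span (?F - {a})"
    proof
      fix b assume "b \<in> ?F"
      then show "b \<in> vs.span (?F - {a})" using a(2) by (cases "b = a") (auto intro: vs.span_base)
    qed
    then have "vs.span ?F \<subseteq> vs.span (?F - {a})" by (intro vs.span_minimal vs.subspace_span)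
    with TF have "vs.dim (vs.span T) \<le> card (?F - {a})" using fD by (intro vs.dim_le_card) auto
    also have "\<dots> < card ?F" using a(1) fD by (intro card_Diff1_less) auto
    also have "\<dots> = card D" by (rule card_image[OF inj])
    finally show False using cD by simp
  qed
  then show ?thesis by (rule vs.independent_mono) (use D(1) in auto)
qed

text \<open>The p-th powers of a basis of K[z] are independent and lie in K[z^p], so K[z^p] is no
  smaller than K[z].\<close>

lemma sep_of_frob_generated:
  assumes T: "finite T" and M: "vs.span T \<subseteq> vs.span ((\<lambda>z. z ^ p) ` vs.span T)"
    and z: "adj z \<subseteq> vs.span T"
  shows "sep z"
proof -
  obtain T1 where T1: "finite T1" "adj z = vs.span T1" by (rule adj_fin_span)
  obtain C where C: "C \<subseteq> adj z" "vs.independent C" "card C = vs.dim (adj z)"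
    unfolding T1(2) using fin_basis[OF T1(1)] by metis
  let ?F = "(\<lambda>z. z ^ p) ` C"
  have inj: "inj_on (\<lambda>z. z ^ p) C" using frob_inj[of _ 1] by (auto simp: inj_on_def)
  have iF: "vs.independent ?F" using independent_image_frob[OF T M C(2)] C(1) z by blast
  have FS: "?F \<subseteq> adj (z ^ p)"
  proof
    fix b assume "b \<in> ?F"
    then obtain P where b: "b = pl P z ^ p" using C(1) by (auto simp: adj_def)
    have "b = (\<Sum>i\<le>degree P. \<iota> (coeff P i ^ p) * (z ^ p) ^ i)"
      unfolding b pl_sum frob_sum[where m = 1, unfolded power_one_right]
      by (simp add: power_mult_distrib hom_distribs power_mult[symmetric] mult.commute)
    also have "\<dots> \<in> adj (z ^ p)"
      by (intro vs.subspace_sum[OF adj_subspace] vs.subspace_scale[OF adj_subspace] adj_pow adj_self)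
    finally show "b \<in> adj (z ^ p)" .
  qed
  obtain T2 where T2: "finite T2" "adj (z ^ p) = vs.span T2" by (rule adj_fin_span)
  have "card ?F \<le> vs.dim (adj (z ^ p))"
    using independent_card_le[OF T2(1) iF] FS by (simp add: T2(2))
  then have "vs.dim (adj z) \<le> vs.dim (adj (z ^ p))" by (simp add: card_image[OF inj] C(3))
  from adj_dim_eq[OF adj_pow_subset this] adj_self show ?thesis by (auto simp: sep_def)
qed

text \<open>Both elements lie in E = K[x] K[y], which is finite-dimensional and closed under
  products. It is spanned by p-th powers because x lies in K[x^p] and y in K[y^p]. Hence every
  element of E is separable.\<close>

lemma sep_closed:
  assumes x: "sep x" and y: "sep y"
  shows "sep (x + y)" "sep (x * y)"
proof -
  obtain T1 where T1: "finite T1" "adj x = vs.span T1" by (rule adj_fin_span)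
  obtain T2 where T2: "finite T2" "adj y = vs.span T2" by (rule adj_fin_span)
  define T where "T = (\<lambda>(a, b). a * b) ` (T1 \<times> T2)"
  have T: "finite T" using T1 T2 by (simp add: T_def)
  \<comment> \<open>Membership of products in a subspace may be tested on spanning sets of the two
    factors.\<close>
  have bil: "a * b \<in> W" if ab: "a \<in> vs.span S1" "b \<in> vs.span S2" and W: "vs.subspace W"
    and SW: "\<And>a b. a \<in> S1 \<Longrightarrow> b \<in> S2 \<Longrightarrow> a * b \<in> W" for a b S1 S2 W
  proof -
    have 1: "a * b \<in> W" if b: "b \<in> S2" and a: "a \<in> vs.span S1" for a b
    proof -
      have "vs.subspace {a. a * b \<in> W}" using W unfolding vs.subspace_def
        by (auto simp: distrib_right mult.assoc)
      then have "vs.span S1 \<subseteq> {a. a * b \<in> W}" by (intro vs.span_minimal) (use SW b in auto)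
      then show ?thesis using a by auto
    qed
    have "vs.subspace {b. a * b \<in> W}" using W unfolding vs.subspace_def
      by (auto simp: distrib_left mult.left_commute[of a "\<iota> c" for c])
    then have "vs.span S2 \<subseteq> {b. a * b \<in> W}" by (intro vs.span_minimal) (use 1 ab(1) in auto)
    then show ?thesis using ab(2) by auto
  qed
  have prod: "a * b \<in> vs.span T" if "a \<in> adj x" "b \<in> adj y" for a b
    by (rule bil[OF that[unfolded T1(2) T2(2)] vs.subspace_span])
      (auto simp: T_def intro!: vs.span_base)
  have TT: "a * b \<in> vs.span T" if "a \<in> vs.span T" "b \<in> vs.span T" for a b
  proof (rule bil[OF that vs.subspace_span])
    fix a b assume "a \<in> T" "b \<in> T"
    then obtain a1 a2 b1 b2 where ab: "a = a1 * a2" "b = b1 * b2" "a1 \<in> T1" "b1 \<in> T1" "a2 \<in> T2" "b2 \<in> T2"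
      by (auto simp: T_def)
    then have "a1 * b1 \<in> adj x" "a2 * b2 \<in> adj y"
      using adj_mult[of a1 x b1] adj_mult[of a2 y b2] by (simp_all add: T1(2) T2(2) vs.span_base)
    from prod[OF this] show "a * b \<in> vs.span T" by (simp add: ab mult_ac)
  qed
  have M: "vs.span T \<subseteq> vs.span ((\<lambda>z. z ^ p) ` vs.span T)"
  proof (rule vs.span_minimal[OF _ vs.subspace_span])
    show "T \<subseteq> vs.span ((\<lambda>z. z ^ p) ` vs.span T)"
    proof
      fix t assume "t \<in> T"
      then obtain a b where t: "t = a * b" "a \<in> adj x" "b \<in> adj y"
        by (auto simp: T_def T1(2) T2(2) vs.span_base)
      have "a \<in> vs.span (range (\<lambda>i. (x ^ p) ^ i))" "b \<in> vs.span (range (\<lambda>i. (y ^ p) ^ i))"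
        using t(2,3) adj_subset[of x "x ^ p"] adj_subset[of y "y ^ p"] x y
        unfolding sep_def adj_span[of "x ^ p"] adj_span[of "y ^ p"] by auto
      then show "t \<in> vs.span ((\<lambda>z. z ^ p) ` vs.span T)" unfolding t(1)
      proof (rule bil[OF _ _ vs.subspace_span], safe)
        fix i j
        have "x ^ i * y ^ j \<in> vs.span T" by (intro prod adj_pow adj_self)
        then have "(x ^ i * y ^ j) ^ p \<in> vs.span ((\<lambda>z. z ^ p) ` vs.span T)"
          by (rule vs.span_base[OF imageI])
        then show "(x ^ p) ^ i * (y ^ p) ^ j \<in> vs.span ((\<lambda>z. z ^ p) ` vs.span T)"
          by (simp add: power_mult_distrib power_mult[symmetric] mult.commute)
      qed
    qed
  qed
  have one: "1 \<in> vs.span T" using prod[OF adj_const[of 1] adj_const[of 1]] by simp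
  have "adj z \<subseteq> vs.span T" if z: "z \<in> vs.span T" for z
  proof -
    have zi: "z ^ i \<in> vs.span T" for i by (induction i) (use one z TT in auto)
    show ?thesis unfolding adj_span by (rule vs.span_minimal) (use zi vs.subspace_span in auto)
  qed
  note * = sep_of_frob_generated[OF T M this]
  have "x \<in> vs.span T" "y \<in> vs.span T"
    using prod[OF adj_self adj_const[of 1]] prod[OF adj_const[of 1] adj_self] by simp_all
  then show "sep (x + y)" "sep (x * y)" using TT by (auto intro!: * vs.span_add)
qed

lemma sep_pow: "sep x \<Longrightarrow> sep (x ^ m)"
  by (induction m) (use sep_const[of 1] sep_closed in auto)

lemma common_sep: "\<exists>m. sep (x ^ (p ^ m)) \<and> sep (y ^ (p ^ m))"
proof -
  obtain a b where ab: "sep (x ^ (p ^ a))" "sep (y ^ (p ^ b))" using eventually_sep by metis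
  have "x ^ (p ^ (a + b)) = (x ^ (p ^ a)) ^ (p ^ b)" "y ^ (p ^ (a + b)) = (y ^ (p ^ b)) ^ (p ^ a)"
    by (simp_all add: power_add power_mult[symmetric] mult.commute)
  then show ?thesis using ab sep_pow by (intro exI[of _ "a + b"]) simp
qed

section \<open>Galois automorphisms and their extensions to the algebraic closure\<close>

abbreviation Gal where "Gal \<equiv> abs_galois \<iota>"
abbreviation SS where "SS \<equiv> sep_closure \<iota>"

lemma GalD:
  assumes "g \<in> carrier Gal"
  shows "bij_betw g SS SS" "g \<in> extensional SS"
    "\<And>x y. x \<in> SS \<Longrightarrow> y \<in> SS \<Longrightarrow> g (x + y) = g x + g y"
    "\<And>x y. x \<in> SS \<Longrightarrow> y \<in> SS \<Longrightarrow> g (x * y) = g x * g y"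
    "\<And>a. g (\<iota> a) = \<iota> a"
  using assms by (auto simp: abs_galois_def Bij_def)

text \<open>The condition under the description operator of \<open>galois_ext\<close>, named so that
  existence and uniqueness can be proved for it.\<close>

definition is_ext :: "('l \<Rightarrow> 'l) \<Rightarrow> ('l \<Rightarrow> 'l) \<Rightarrow> bool" where
  "is_ext g h \<longleftrightarrow> bij h \<and> (\<forall>x y. h (x + y) = h x + h y \<and> h (x * y) = h x * h y) \<and> (\<forall>x\<in>SS. h x = g x)"

lemma hom_pow:
  fixes h :: "'l \<Rightarrow> 'l"
  assumes "\<And>x y. h (x * y) = h x * h y" "h 1 = 1" shows "h (x ^ m) = h x ^ m"
  by (induction m) (simp_all add: assms)

lemma mult_hom_one:
  fixes h :: "'l \<Rightarrow> 'l"
  assumes "bij h" "\<And>x y. h (x * y) = h x * h y" shows "h 1 = 1"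
proof -
  obtain x where "h x = 1" using assms(1) by (metis bij_pointE)
  then show ?thesis using assms(2)[of 1 x] by simp
qed

lemma ext_unique:
  assumes "is_ext g h" "is_ext g h'" shows "h = h'"
proof
  fix x
  obtain m where m: "sep (x ^ (p ^ m))" using eventually_sep by blast
  have 1: "h (x ^ k) = h x ^ k" "h' (x ^ k) = h' x ^ k" for k
    using assms mult_hom_one unfolding is_ext_def by (auto intro!: hom_pow)
  have "h (x ^ (p ^ m)) = h' (x ^ (p ^ m))"
    using assms m unfolding is_ext_def by (simp add: sep_closure_eq)
  then show "h x = h' x" unfolding 1 by (rule frob_inj)
qed

text \<open>Let h(x) be the unique p^m-th root of g(x^(p^m)), with m large enough that x^(p^m) is
  separable. Starting from the least such m and raising to further p-powers shows that m does not
  matter, so any two elements can be treated with a common m.\<close>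

lemma ext_exists:
  assumes g: "g \<in> carrier Gal" shows "\<exists>h. is_ext g h"
proof -
  note g = GalD[OF g]
  have SS1: "1 \<in> SS" using sep_const[of 1] by (simp add: sep_closure_eq)
  have g1: "g 1 = 1" using g(5)[of 1] by simp
  have gpow: "g (x ^ k) = g x ^ k" if "x \<in> SS" for x k
    by (induction k) (use that g(4) g1 sep_pow in \<open>auto simp: sep_closure_eq\<close>)
  have ginj: "x = y" if "g x = g y" "x \<in> SS" "y \<in> SS" for x y
    using that g(1) by (auto simp: bij_betw_def inj_on_def)
  have "\<exists>y. \<forall>m. sep (x ^ (p ^ m)) \<longrightarrow> y ^ (p ^ m) = g (x ^ (p ^ m))" for x
  proof -
    define m where "m = (LEAST m. sep (x ^ (p ^ m)))"
    have m: "sep (x ^ (p ^ m))" unfolding m_def by (rule LeastI_ex[OF eventually_sep])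
    have "p ^ m > 0" using prime_gt_0_nat[OF p] by simp
    then obtain y where y: "y ^ (p ^ m) = g (x ^ (p ^ m))" using nth_root_exists by blast
    have "y ^ (p ^ k) = g (x ^ (p ^ k))" if "sep (x ^ (p ^ k))" for k
    proof -
      have "m \<le> k" unfolding m_def by (rule Least_le[of "\<lambda>m. sep (x ^ (p ^ m))"]) (rule that)
      then obtain d where k: "k = m + d" using le_Suc_ex by blast
      have e: "z ^ (p ^ k) = (z ^ (p ^ m)) ^ (p ^ d)" for z :: 'l by (simp add: k power_add power_mult)
      show ?thesis unfolding e y using m by (subst gpow) (simp_all add: sep_closure_eq)
    qed
    then show ?thesis by blast
  qed
  then obtain h where h: "\<And>x m. sep (x ^ (p ^ m)) \<Longrightarrow> h x ^ (p ^ m) = g (x ^ (p ^ m))" by metis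
  have "h (x + y) = h x + h y \<and> h (x * y) = h x * h y" for x y
  proof -
    obtain m where m: "sep (x ^ (p ^ m))" "sep (y ^ (p ^ m))" using common_sep by blast
    have "sep ((x + y) ^ (p ^ m))" "sep ((x * y) ^ (p ^ m))"
      unfolding frob_add power_mult_distrib using m sep_closed by auto
    from h[OF this(1)] h[OF this(2)] have "h (x + y) ^ (p ^ m) = (h x + h y) ^ (p ^ m)"
      "h (x * y) ^ (p ^ m) = (h x * h y) ^ (p ^ m)"
      using m h[OF m(1)] h[OF m(2)] by (simp_all add: frob_add power_mult_distrib g(3,4) sep_closure_eq)
    then show ?thesis using frob_inj by blast
  qed
  moreover have "h x = g x" if "x \<in> SS" for x
    using h[of x 0] that by (simp add: sep_closure_eq)
  moreover have "bij h"
  proof (rule bijI)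
    show "inj h"
    proof (rule injI)
      fix x y assume eq: "h x = h y"
      obtain m where m: "sep (x ^ (p ^ m))" "sep (y ^ (p ^ m))" using common_sep by blast
      have "g (x ^ (p ^ m)) = g (y ^ (p ^ m))" using h[OF m(1)] h[OF m(2)] eq by simp
      then have "x ^ (p ^ m) = y ^ (p ^ m)" by (rule ginj) (use m in \<open>auto simp: sep_closure_eq\<close>)
      then show "x = y" by (rule frob_inj)
    qed
    show "surj h"
    proof (rule surjI)
      fix y
      \<comment> \<open>A preimage of y is a p^m-th root of the element that g sends to
        y^(p^m).\<close>
      define m where "m = (LEAST m. sep (y ^ (p ^ m)))"
      have m: "sep (y ^ (p ^ m))" unfolding m_def by (rule LeastI_ex[OF eventually_sep])
      have "y ^ (p ^ m) \<in> g ` SS" using g(1) m by (simp add: bij_betw_def sep_closure_eq)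
      then obtain z where z: "z \<in> SS" "g z = y ^ (p ^ m)" by auto
      have "p ^ m > 0" using prime_gt_0_nat[OF p] by simp
      then have "\<exists>x. x ^ (p ^ m) = z" using nth_root_exists by blast
      then have "\<exists>x. h x = y" using h[of _ m] z frob_inj[of _ m y] by (metis sep_closure_eq)
      then show "h (SOME x. h x = y) = y" by (rule someI_ex)
    qed
  qed
  ultimately show ?thesis unfolding is_ext_def by blast
qed

lemma galois_ext_is_ext:
  assumes g: "g \<in> carrier Gal" shows "is_ext g (galois_ext \<iota> g)"
proof -
  have "\<exists>!h. is_ext g h"
    by (rule ex_ex1I) (rule ext_exists[OF g], rule ext_unique)
  then have "is_ext g (THE h. is_ext g h)" by (rule theI')
  moreover have "galois_ext \<iota> g = (THE h. is_ext g h)"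
    by (simp only: galois_ext_def is_ext_def)
  ultimately show ?thesis by simp
qed

lemma galois_ext_hom:
  assumes g: "g \<in> carrier Gal"
  shows "galois_ext \<iota> g (x + y) = galois_ext \<iota> g x + galois_ext \<iota> g y"
    "galois_ext \<iota> g (x * y) = galois_ext \<iota> g x * galois_ext \<iota> g y"
    "galois_ext \<iota> g (\<iota> a) = \<iota> a" "x \<in> SS \<Longrightarrow> galois_ext \<iota> g x = g x"
    "galois_ext \<iota> g (x ^ m) = galois_ext \<iota> g x ^ m"
proof -
  have h: "bij (galois_ext \<iota> g)"
    "\<And>x y. galois_ext \<iota> g (x + y) = galois_ext \<iota> g x + galois_ext \<iota> g y"
    "\<And>x y. galois_ext \<iota> g (x * y) = galois_ext \<iota> g x * galois_ext \<iota> g y"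
    "\<And>x. x \<in> SS \<Longrightarrow> galois_ext \<iota> g x = g x"
    using galois_ext_is_ext[OF g] unfolding is_ext_def by simp_all
  show "galois_ext \<iota> g (x + y) = galois_ext \<iota> g x + galois_ext \<iota> g y"
    "galois_ext \<iota> g (x * y) = galois_ext \<iota> g x * galois_ext \<iota> g y"
    "x \<in> SS \<Longrightarrow> galois_ext \<iota> g x = g x" by (rule h)+
  show "galois_ext \<iota> g (\<iota> a) = \<iota> a"
    using h(4)[of "\<iota> a"] GalD(5)[OF g] sep_const[of a] by (simp add: sep_closure_eq)
  show "galois_ext \<iota> g (x ^ m) = galois_ext \<iota> g x ^ m"
    by (rule hom_pow[OF h(3) mult_hom_one[OF h(1,3)]])
qed

text \<open>An automorphism over the base field permutes the roots of each polynomial over it, so it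
  maps the separable closure onto itself.\<close>

lemma restrict_in_Gal:
  fixes h :: "'l \<Rightarrow> 'l"
  assumes h: "bij h" "\<And>x y. h (x + y) = h x + h y" "\<And>x y. h (x * y) = h x * h y" "\<And>a. h (\<iota> a) = \<iota> a"
  shows "restrict h SS \<in> carrier Gal"
proof -
  have h1: "h 1 = 1" by (rule mult_hom_one) fact+
  have h0: "h 0 = 0" using h(4)[of 0] by simp
  have hs: "h (sum f A) = (\<Sum>a\<in>A. h (f a))" for f :: "nat \<Rightarrow> 'l" and A
    by (induction A rule: infinite_finite_induct) (auto simp: h0 h(2))
  have hpl: "h (pl P x) = pl P (h x)" for P x
    unfolding pl_sum by (simp add: hs h(3,4) hom_pow[of h, OF h(3) h1])
  have inj: "h x = h y \<Longrightarrow> x = y" for x y using h(1) by (meson bij_def injD)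
  have iff: "pl P (h x) = 0 \<longleftrightarrow> pl P x = 0" for P x
    using inj[of "pl P x" 0] h0 by (auto simp: hpl[symmetric])
  have mem: "h x \<in> SS \<longleftrightarrow> x \<in> SS" for x by (simp add: sep_closure_def iff)
  have "bij_betw (restrict h SS) SS SS"
  proof (rule bij_betw_imageI)
    show "inj_on (restrict h SS) SS" using inj by (auto simp: inj_on_def)
    show "restrict h SS ` SS = SS"
    proof
      show "restrict h SS ` SS \<subseteq> SS" using mem by auto
      show "SS \<subseteq> restrict h SS ` SS"
      proof
        fix y assume y: "y \<in> SS"
        obtain x where "y = h x" using h(1) by (metis bij_pointE)
        then show "y \<in> restrict h SS ` SS" using mem y by (intro image_eqI[of _ _ x]) auto
      qed
    qed
  qed
  moreover have "x + y \<in> SS" "x * y \<in> SS" if "x \<in> SS" "y \<in> SS" for x y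
    using that sep_closed by (auto simp: sep_closure_eq)
  ultimately show ?thesis
    using h sep_const by (auto simp: abs_galois_def Bij_def sep_closure_eq)
qed

text \<open>The graph of a homomorphism over the base field from a subring of L to L. As sets of
  pairs such maps can be enlarged and united along chains. In the presence of additivity the last
  clause is single-valuedness.\<close>

definition partial_hom :: "('l \<times> 'l) set \<Rightarrow> bool" where
  "partial_hom M \<longleftrightarrow> (\<forall>a. (\<iota> a, \<iota> a) \<in> M) \<and>
     (\<forall>a b c d. (a, b) \<in> M \<longrightarrow> (c, d) \<in> M \<longrightarrow> (a + c, b + d) \<in> M \<and> (a * c, b * d) \<in> M) \<and>
     (\<forall>b. (0, b) \<in> M \<longrightarrow> b = 0)"

lemma partial_homD:
  assumes "partial_hom M"
  shows "(\<iota> e, \<iota> e) \<in> M" "(a, b) \<in> M \<Longrightarrow> (c, d) \<in> M \<Longrightarrow> (a + c, b + d) \<in> M"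
    "(a, b) \<in> M \<Longrightarrow> (c, d) \<in> M \<Longrightarrow> (a * c, b * d) \<in> M" "(0, b) \<in> M \<Longrightarrow> b = 0"
  using assms unfolding partial_hom_def by auto

lemma partial_hom_uminus: "partial_hom M \<Longrightarrow> (a, b) \<in> M \<Longrightarrow> (- a, - b) \<in> M"
  using partial_homD(3)[of M "\<iota> (- 1)" "\<iota> (- 1)" a b] partial_homD(1)[of M "- 1"] by (simp add: hom_distribs)

lemma partial_hom_unique:
  assumes M: "partial_hom M" and ab: "(a, b) \<in> M" "(a, b') \<in> M" shows "b = b'"
proof -
  have "(a + - a, b + - b') \<in> M" by (rule partial_homD(2)[OF M ab(1) partial_hom_uminus[OF M ab(2)]])
  then show ?thesis using partial_homD(4)[OF M, of "b + - b'"] by simp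
qed

lemma partial_hom_zero: "partial_hom M \<Longrightarrow> (0, 0) \<in> M"
  using partial_homD(1)[of M 0] by simp

lemma partial_hom_one: "partial_hom M \<Longrightarrow> (1, 1) \<in> M"
  using partial_homD(1)[of M 1] by simp

lemma partial_hom_sum:
  assumes M: "partial_hom M" and "\<And>i. i \<in> A \<Longrightarrow> (f i, g i) \<in> M"
  shows "(sum f A, sum g A) \<in> M"
  using assms(2)
  by (induction A rule: infinite_finite_induct)
    (auto simp: partial_hom_zero[OF M] intro!: partial_homD(2)[OF M])

lemma partial_hom_pow: "partial_hom M \<Longrightarrow> (a, b) \<in> M \<Longrightarrow> (a ^ i, b ^ i) \<in> M"
  by (induction i) (auto simp: partial_hom_one intro!: partial_homD(3))

lemma partial_hom_pl: "partial_hom M \<Longrightarrow> (a, b) \<in> M \<Longrightarrow> (pl P a, pl P b) \<in> M"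
  unfolding pl_sum by (intro partial_hom_sum partial_homD(1,3) partial_hom_pow)

text \<open>The inverse of an algebraic element a is a polynomial in a, so the domain of a partial
  homomorphism is a field.\<close>

lemma partial_hom_inverse:
  assumes M: "partial_hom M" and ab: "(a, b) \<in> M" "a \<noteq> 0" shows "\<exists>c. (inverse a, c) \<in> M"
proof -
  obtain r where r: "r \<noteq> 0" "degree r = vs.dim (adj a)" "pl r a = 0" using min_poly by blast
  obtain c s where cs: "r = pCons c s" by (cases r)
  have e: "\<iota> c + a * pl s a = 0" using r(3) unfolding cs by (simp add: hom_distribs)
  \<comment> \<open>With constant term 0 the relation could be divided by a, giving one of degree
    below the minimal one.\<close>
  have "c \<noteq> 0"
  proof
    assume c: "c = 0"
    then have "s \<noteq> 0" "pl s a = 0" using r(1) e ab(2) cs by auto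
    then have "vs.dim (adj a) \<le> degree s" by (rule adj_dim_le)
    then show False using r(2) \<open>s \<noteq> 0\<close> by (simp add: cs)
  qed
  then have "a * pl (smult (- inverse c) s) a = 1"
    using e by (simp add: pl_smult hom_distribs field_simps add_eq_0_iff)
  then have "inverse a = pl (smult (- inverse c) s) a" using ab(2) by (simp add: inverse_unique)
  then show ?thesis using partial_hom_pl[OF M ab(1)] by metis
qed

text \<open>That is, \<open>b\<close> is the image of \<open>a\<close> when the partial homomorphism
  is applied to coefficients.\<close>

definition lifts :: "('l \<times> 'l) set \<Rightarrow> 'l poly \<Rightarrow> 'l poly \<Rightarrow> bool" where
  "lifts M a b \<longleftrightarrow> (\<forall>i. (coeff a i, coeff b i) \<in> M)"

lemma lifts_add: "partial_hom M \<Longrightarrow> lifts M a b \<Longrightarrow> lifts M c d \<Longrightarrow> lifts M (a + c) (b + d)"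
  unfolding lifts_def by (auto intro: partial_homD(2))

lemma lifts_mult: "partial_hom M \<Longrightarrow> lifts M a b \<Longrightarrow> lifts M c d \<Longrightarrow> lifts M (a * c) (b * d)"
  unfolding lifts_def coeff_mult by (auto intro!: partial_hom_sum partial_homD(3))

lemma lifts_const: "partial_hom M \<Longrightarrow> (a, b) \<in> M \<Longrightarrow> lifts M [:a:] [:b:]"
  unfolding lifts_def by (auto simp: coeff_pCons partial_hom_zero split: nat.split)

lemma lifts_monom: "partial_hom M \<Longrightarrow> (a, b) \<in> M \<Longrightarrow> lifts M (monom a k) (monom b k)"
  unfolding lifts_def by (auto simp: partial_hom_zero)

lemma lifts_map: "partial_hom M \<Longrightarrow> lifts M (map_poly \<iota> q) (map_poly \<iota> q)"
  unfolding lifts_def by (auto intro: partial_homD(1))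

text \<open>Transport the minimal monic polynomial m of x over the domain to m', and let y be a root
  of m' in L. Sending x to y is consistent because every polynomial over the domain that vanishes at
  x has an image vanishing at y.\<close>

lemma partial_hom_extend:
  assumes M: "partial_hom M"
  shows "\<exists>M' y. partial_hom M' \<and> M \<subseteq> M' \<and> (x, y) \<in> M'"
proof -
  define Q where "Q d \<longleftrightarrow> (\<exists>m m'. lifts M m m' \<and> lead_coeff m = 1 \<and> degree m = d \<and> poly m x = 0)" for d
  have "\<exists>d. Q d"
  proof -
    obtain q where q: "q \<noteq> 0" "pl q x = 0" using algebraic by blast
    define q1 where "q1 = smult (inverse (lead_coeff q)) q"
    have "pl q1 x = 0" "lead_coeff q1 = 1" using q by (simp_all add: q1_def pl_smult)
    then have "Q (degree q1)" unfolding Q_def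
      by (intro exI[of _ "map_poly \<iota> q1"] conjI lifts_map[OF M]) simp_all
    then show ?thesis ..
  qed
  define d where "d = (LEAST d. Q d)"
  have "Q d" unfolding d_def by (rule LeastI_ex) fact
  then obtain m m' where m: "lifts M m m'" "lead_coeff m = 1" "degree m = d" "poly m x = 0"
    unfolding Q_def by blast
  have least: "\<not> Q k" if "k < d" for k using that unfolding d_def by (rule not_less_Least)
  have m'c: "(coeff m i, coeff m' i) \<in> M" for i using m(1) by (simp add: lifts_def)
  have lead': "coeff m' d = 1"
    using partial_hom_unique[OF M, of 1 "coeff m' d" 1] m'c[of d] m(2,3) partial_hom_one[OF M] by simp
  have deg': "degree m' = d"
  proof (rule antisym)
    show "degree m' \<le> d"
    proof (rule degree_le, safe)
      fix i assume "i > d"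
      then have "coeff m i = 0" using m(3) by (simp add: coeff_eq_0)
      then show "coeff m' i = 0" using m'c[of i] partial_homD(4)[OF M] by simp
    qed
    show "d \<le> degree m'" by (rule le_degree) (simp add: lead')
  qed
  have "d > 0"
  proof (rule ccontr)
    assume "\<not> d > 0"
    then obtain c where "m = [:c:]" using m(3) by (metis degree_eq_zeroE gr0I)
    then show False using m(2,4) by simp
  qed
  then obtain y where y: "poly m' y = 0" using alg_closed_imp_poly_has_root[of m'] deg' by auto
  \<comment> \<open>Division by m, one leading term at a time, carried out in parallel on the
    transported polynomials, where m' vanishes at y.\<close>
  have key: "poly b y = 0" if "lifts M a b" "poly a x = 0" for a b
    using that
  proof (induction "degree a" arbitrary: a b rule: less_induct)
    case less
    have c: "(coeff a i, coeff b i) \<in> M" for i using less.prems(1) by (simp add: lifts_def)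
    show ?case
    proof (cases "a = 0")
      case True
      then have "coeff b i = 0" for i using c[of i] partial_homD(4)[OF M] by simp
      then have "b = 0" by (simp add: poly_eq_iff)
      then show ?thesis by simp
    next
      case False
      define l l' where "l = lead_coeff a" and "l' = coeff b (degree a)"
      have l: "(l, l') \<in> M" "l \<noteq> 0" using c[of "degree a"] False by (simp_all add: l_def l'_def)
      show ?thesis
      proof (cases "degree a < d")
        case True
        \<comment> \<open>Divided by its leading coefficient, \<open>a\<close> would contradict the
          minimality of d.\<close>
        obtain e where e: "(inverse l, e) \<in> M" using partial_hom_inverse[OF M l] by blast
        have "lifts M ([:inverse l:] * a) ([:e:] * b)"
          by (rule lifts_mult[OF M lifts_const[OF M e] less.prems(1)])
        then have "Q (degree a)" unfolding Q_def using l(2) less.prems(2)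
          by (intro exI[of _ "smult (inverse l) a"] exI[of _ "smult e b"]) (simp add: l_def)
        then show ?thesis using least[OF True] by contradiction
      next
        case ge: False
        define k where "k = degree a - d"
        define a2 b2 where "a2 = a + monom (- l) k * m" and "b2 = b + monom (- l') k * m'"
        have lift2: "lifts M a2 b2" unfolding a2_def b2_def
          by (intro lifts_add[OF M] lifts_mult[OF M] lifts_monom[OF M] partial_hom_uminus[OF M] l m(1) less.prems(1))
        have zero2: "poly a2 x = 0" using less.prems(2) m(4) by (simp add: a2_def)
        have "poly b y = poly b2 y" using y by (simp add: b2_def)
        also have "poly b2 y = 0"
        proof (cases "a2 = 0")
          case True
          have "coeff b2 i = 0" for i
            using lift2 partial_homD(4)[OF M] unfolding lifts_def True by simp
          then have "b2 = 0" by (simp add: poly_eq_iff)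
          then show ?thesis by simp
        next
          case a2: False
          have dm: "degree (monom (- l) k * m) = degree a"
            using l(2) ge m(2,3) by (subst degree_mult_eq) (auto simp: degree_monom_eq k_def)
          have "coeff (monom (- l) k * m) (degree a) = - l"
            using ge m(2,3) by (simp add: coeff_monom_mult k_def)
          then have "coeff a2 (degree a) = 0" by (simp add: a2_def l_def)
          moreover have "degree a2 \<le> degree a" unfolding a2_def by (rule degree_add_le) (use dm in auto)
          ultimately have "degree a2 < degree a" using a2 by (metis eq_zero_or_degree_less)
          from less.hyps[OF this lift2 zero2] show ?thesis .
        qed
        finally show ?thesis .
      qed
    qed
  qed
  define M' where "M' = {(poly a x, poly b y) |a b. lifts M a b}"
  have M'I: "(poly a x, poly b y) \<in> M'" if "lifts M a b" for a b using that by (auto simp: M'_def)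
  have "partial_hom M'"
    unfolding partial_hom_def
  proof (intro conjI allI impI)
    show "(\<iota> a, \<iota> a) \<in> M'" for a
      using M'I[OF lifts_const[OF M partial_homD(1)[OF M, of a]]] by simp
    fix a b
    {
      fix c d
      assume "(a, b) \<in> M'" "(c, d) \<in> M'"
      then obtain a1 b1 c1 d1 where 1: "a = poly a1 x" "b = poly b1 y" "lifts M a1 b1"
        "c = poly c1 x" "d = poly d1 y" "lifts M c1 d1" by (auto simp: M'_def)
      show "(a + c, b + d) \<in> M'" using M'I[OF lifts_add[OF M 1(3,6)]] by (simp add: 1)
      show "(a * c, b * d) \<in> M'" using M'I[OF lifts_mult[OF M 1(3,6)]] by (simp add: 1)
    }
    show "b = 0" if "(0, b) \<in> M'" using that key by (auto simp: M'_def)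
  qed
  moreover have "M \<subseteq> M'"
  proof safe
    fix a b assume "(a, b) \<in> M"
    from M'I[OF lifts_const[OF M this]] show "(a, b) \<in> M'" by simp
  qed
  moreover have "(x, y) \<in> M'"
    using M'I[OF lifts_monom[OF M partial_hom_one[OF M], of 1]] by (simp add: poly_monom)
  ultimately show ?thesis by blast
qed

text \<open>Every element lies in the finite root set of a polynomial over the base field. An
  injective homomorphism maps this set into itself, hence onto it.\<close>

lemma surj_of_inj_hom:
  fixes h :: "'l \<Rightarrow> 'l"
  assumes inj: "inj h" and h: "\<And>x y. h (x + y) = h x + h y" "\<And>x y. h (x * y) = h x * h y" "\<And>a. h (\<iota> a) = \<iota> a"
  shows "surj h"
proof (rule surjI)
  fix y
  have h1: "h 1 = 1" "h 0 = 0" using h(3)[of 1] h(3)[of 0] by simp_all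
  have hs: "h (sum f A) = (\<Sum>a\<in>A. h (f a))" for f :: "nat \<Rightarrow> 'l" and A
    by (induction A rule: infinite_finite_induct) (auto simp: h1 h(1))
  have hpl: "h (pl P x) = pl P (h x)" for P x
    unfolding pl_sum by (simp add: hs h(2,3) hom_pow[of h, OF h(2) h1(1)])
  obtain q where q: "q \<noteq> 0" "pl q y = 0" using algebraic by blast
  have fin: "finite {a. pl q a = 0}" using q(1) by (intro poly_roots_finite) simp
  have "h ` {a. pl q a = 0} \<subseteq> {a. pl q a = 0}" by (auto simp: hpl[symmetric] h1)
  then have "h ` {a. pl q a = 0} = {a. pl q a = 0}"
    by (rule endo_inj_surj[OF fin]) (use inj in \<open>auto intro: inj_on_subset\<close>)
  then have "\<exists>x. h x = y" using q(2) by (metis (mono_tags, lifting) imageE mem_Collect_eq)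
  then show "h (SOME x. h x = y) = y" by (rule someI_ex)
qed

text \<open>The hypothesis makes P(x) to P(y) single-valued on K[x]. By Zorn's lemma it is contained
  in a maximal partial homomorphism, which is total by \<open>partial_hom_extend\<close>; a total
  one is injective, L being a field, and surjective by algebraicity.\<close>

theorem extend_automorphism:
  assumes xy: "\<And>P. pl P x = 0 \<Longrightarrow> pl P y = 0"
  shows "\<exists>h. bij h \<and> (\<forall>a b. h (a + b) = h a + h b) \<and> (\<forall>a b. h (a * b) = h a * h b) \<and>
     (\<forall>a. h (\<iota> a) = \<iota> a) \<and> h x = y"
proof -
  define M0 where "M0 = {(pl P x, pl P y) |P. True}"
  have M0I: "(pl P x, pl P y) \<in> M0" for P by (auto simp: M0_def)
  have M0: "partial_hom M0"
    unfolding partial_hom_def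
  proof (intro conjI allI impI)
    show "(\<iota> a, \<iota> a) \<in> M0" for a using M0I[of "[:a:]"] by (simp add: hom_distribs)
    fix a b
    {
      fix c d
      assume "(a, b) \<in> M0" "(c, d) \<in> M0"
      then obtain P1 P2 where 1: "a = pl P1 x" "b = pl P1 y" "c = pl P2 x" "d = pl P2 y" by (auto simp: M0_def)
      show "(a + c, b + d) \<in> M0" using M0I[of "P1 + P2"] by (simp add: 1 pl_add)
      show "(a * c, b * d) \<in> M0" using M0I[of "P1 * P2"] by (simp add: 1 pl_mult)
    }
    show "b = 0" if "(0, b) \<in> M0" using that xy by (auto simp: M0_def)
  qed
  define A where "A = {M. partial_hom M \<and> M0 \<subseteq> M}"
  have "\<exists>M\<in>A. \<forall>N\<in>A. M \<subseteq> N \<longrightarrow> N = M"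
  proof (rule subset_Zorn_nonempty)
    show "A \<noteq> {}" using M0 by (auto simp: A_def)
    fix C assume C: "C \<noteq> {}" "subset.chain A C"
    have CA: "N \<in> C \<Longrightarrow> partial_hom N \<and> M0 \<subseteq> N" for N using C(2) by (auto simp: subset_chain_def A_def)
    \<comment> \<open>In a chain any two pairs lie in a common member, which carries closure under
      sums and products to the union.\<close>
    have two: "\<exists>N\<in>C. u \<in> N \<and> v \<in> N" if uv: "u \<in> \<Union>C" "v \<in> \<Union>C" for u v
    proof -
      obtain N1 N2 where N: "N1 \<in> C" "u \<in> N1" "N2 \<in> C" "v \<in> N2" using uv by auto
      then have "N1 \<subseteq> N2 \<or> N2 \<subseteq> N1" using C(2) by (auto simp: subset_chain_def)
      then show ?thesis using N by blast
    qed
    obtain N0 where N0: "N0 \<in> C" using C(1) by blast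
    have "partial_hom (\<Union>C)"
      unfolding partial_hom_def
    proof (intro conjI allI impI)
      show "(\<iota> a, \<iota> a) \<in> \<Union>C" for a using N0 CA[OF N0] partial_homD(1) by blast
      fix a b
      {
        fix c d
        assume "(a, b) \<in> \<Union>C" "(c, d) \<in> \<Union>C"
        from two[OF this] obtain N where N: "N \<in> C" "(a, b) \<in> N" "(c, d) \<in> N" by auto
        have "partial_hom N" using CA[OF N(1)] by simp
        from partial_homD(2,3)[OF this N(2,3)] N(1)
        show "(a + c, b + d) \<in> \<Union>C" "(a * c, b * d) \<in> \<Union>C" by auto
      }
      show "b = 0" if zb: "(0, b) \<in> \<Union>C"
      proof -
        obtain N where "N \<in> C" "(0, b) \<in> N" using zb by auto
        then show ?thesis using CA partial_homD(4) by blast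
      qed
    qed
    moreover have "M0 \<subseteq> \<Union>C" using N0 CA by blast
    ultimately show "\<Union>C \<in> A" by (simp add: A_def)
  qed
  then obtain M where M: "partial_hom M" "M0 \<subseteq> M" and max: "\<And>N. partial_hom N \<Longrightarrow> M \<subseteq> N \<Longrightarrow> N = M"
    unfolding A_def by (auto intro: order_trans)
  have total: "\<exists>b. (a, b) \<in> M" for a
    using partial_hom_extend[OF M(1), of a] max by metis
  define h where "h a = (THE b. (a, b) \<in> M)" for a
  have hM: "(a, h a) \<in> M" for a
    unfolding h_def by (rule theI') (use total[of a] partial_hom_unique[OF M(1)] in blast)
  have hI: "h a = b" if "(a, b) \<in> M" for a b by (rule partial_hom_unique[OF M(1) hM that])
  have hadd: "h (a + b) = h a + h b" and hmult: "h (a * b) = h a * h b" for a b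
    by (rule hI, rule partial_homD(2,3)[OF M(1) hM hM])+
  have hi: "h (\<iota> a) = \<iota> a" for a by (rule hI[OF partial_homD(1)[OF M(1)]])
  have "inj h"
  proof (rule injI)
    fix a b assume ab: "h a = h b"
    show "a = b"
    proof (rule ccontr)
      assume ne: "a \<noteq> b"
      have "h (a - b) + h b = h a" by (simp add: hadd[symmetric])
      then have "h (a - b) = 0" using ab by simp
      moreover have "h (a - b) * h (inverse (a - b)) = h 1" using ne by (simp add: hmult[symmetric])
      moreover have "h 1 = 1" using hi[of 1] by simp
      ultimately show False by simp
    qed
  qed
  moreover from this have "surj h" by (rule surj_of_inj_hom) (rule hadd hmult hi)+
  moreover have "h x = y" by (rule hI) (use M(2) M0I[of "[:0, 1:]"] in \<open>auto simp: hom_distribs\<close>)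
  ultimately show ?thesis using hadd hmult hi by (intro exI[of _ h]) (auto simp: bij_def)
qed

end

section \<open>The Lie algebra and the Hasse--Witt matrix\<close>

no_notation fps_nth (infixl "$" 75)

lemma underdetermined_system_idom:
  fixes f :: "nat \<Rightarrow> nat \<Rightarrow> 'a::idom"
  assumes "r < s"
  shows "\<exists>c. (\<exists>j<s. c j \<noteq> 0) \<and> (\<forall>i<r. (\<Sum>j<s. f i j * c j) = 0)"
proof -
  define A where "A = mat s s (\<lambda>(i, j). if i < r then f i j else 0)"
  have A: "A \<in> carrier_mat s s" by (simp add: A_def)
  have "multrow r 0 A = A" by (intro eq_matI) (auto simp: A_def)
  then have "det A = 0" using det_multrow[of r s A 0] A assms by simp
  then obtain v where v: "v \<in> carrier_vec s" "v \<noteq> 0\<^sub>v s" "A *\<^sub>v v = 0\<^sub>v s"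
    using det_0_iff_vec_prod_zero[OF A] by auto
  have "\<exists>j<s. v $ j \<noteq> 0" using v(1,2) by (auto simp: vec_eq_iff)
  moreover have "(\<Sum>j<s. f i j * v $ j) = 0" if "i < r" for i
  proof -
    have "(A *\<^sub>v v) $ i = (\<Sum>j<s. f i j * v $ j)"
      using that v(1) assms by (simp add: A_def scalar_prod_def atLeast0LessThan)
    then show ?thesis using v(3) that assms by simp
  qed
  ultimately show ?thesis by (intro exI[of _ "\<lambda>j. v $ j"]) auto
qed

definition lincomb_list :: "nat \<Rightarrow> 'a::comm_ring_1 vec list \<Rightarrow> 'a vec \<Rightarrow> 'a vec" where
  "lincomb_list n bs a = mat_of_cols n bs *\<^sub>v a"

lemma lincomb_list_index:
  assumes "k < n" "a \<in> carrier_vec (length bs)"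
  shows "lincomb_list n bs a $ k = (\<Sum>i<length bs. a $ i * bs ! i $ k)"
  using assms by (simp add: lincomb_list_def scalar_prod_def atLeast0LessThan mat_of_cols_index mult.commute)

lemma lincomb_list_carrier [simp]: "lincomb_list n bs a \<in> carrier_vec n"
  by (simp add: lincomb_list_def carrier_vecI)

lemma dim_lincomb_list [simp]: "dim_vec (lincomb_list n bs a) = n"
  by (simp add: lincomb_list_def)

lemma is_basis_iff:
  "is_basis n M bs \<longleftrightarrow> set bs \<subseteq> carrier_vec n \<and>
    bij_betw (lincomb_list n bs) (carrier_vec (length bs)) M"
  by (simp add: is_basis_def lincomb_list_def[abs_def])

lemma lincomb_list_Cons:
  assumes "m \<in> carrier_vec n" "a \<in> carrier_vec (Suc (length bs))"
  shows "lincomb_list n (m # bs) a = a $ 0 \<cdot>\<^sub>v m + lincomb_list n bs (vec (length bs) (\<lambda>i. a $ Suc i))"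
  by (rule eq_vecI)
    (use assms in \<open>auto simp: lincomb_list_index sum.lessThan_Suc_shift intro!: sum.cong simp del: sum.lessThan_Suc\<close>)

text \<open>Filter by the number of leading zero coordinates. At each proper step choose a vector
  whose next coordinate has least order: it divides that coordinate of all other vectors, so this
  vector completes a basis of the smaller module. Applied to \<open>Lie\<close>, this gives a
  meaning to the rank behind \<open>bt_dim\<close>.\<close>

lemma submodule_has_basis:
  fixes M :: "'k::field fps vec set"
  assumes MC: "M \<subseteq> carrier_vec n" and M0: "0\<^sub>v n \<in> M"
    and Madd: "\<And>x y. x \<in> M \<Longrightarrow> y \<in> M \<Longrightarrow> x + y \<in> M"
    and Msm: "\<And>a x. x \<in> M \<Longrightarrow> a \<cdot>\<^sub>v x \<in> M"
  shows "\<exists>bs. is_basis n M bs"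
proof -
  define N where "N k = {x \<in> M. \<forall>i<k. x $ i = 0}" for k
  have "\<exists>bs. is_basis n (N k) bs" if "k \<le> n" for k
    using that
  proof (induction k rule: inc_induct)
    case base
    have "N n = {0\<^sub>v n}"
    proof safe
      fix x assume "x \<in> N n"
      then show "x = 0\<^sub>v n" using MC by (intro eq_vecI) (auto simp: N_def)
    qed (use M0 in \<open>auto simp: N_def\<close>)
    moreover have "lincomb_list n [] vNil = (0\<^sub>v n :: 'k fps vec)"
      by (rule eq_vecI) (auto simp: lincomb_list_index)
    moreover have "carrier_vec 0 = {vNil :: 'k fps vec}" by auto
    ultimately have "is_basis n (N n) []" by (simp add: is_basis_iff bij_betw_def)
    then show ?case ..
  next
    case (step k)
    obtain bs where bs: "is_basis n (N (Suc k)) bs" using step.IH by blast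
    show ?case
    proof (cases "\<forall>x\<in>N k. x $ k = 0")
      case True
      then have "N k = N (Suc k)" by (auto simp: N_def less_Suc_eq)
      with bs show ?thesis by auto
    next
      case False
      define s where "s = (LEAST s. \<exists>x\<in>N k. x $ k \<noteq> 0 \<and> subdegree (x $ k) = s)"
      have "\<exists>x\<in>N k. x $ k \<noteq> 0 \<and> subdegree (x $ k) = s"
        unfolding s_def by (rule LeastI_ex) (use False in auto)
      then obtain m :: "'k fps vec" where m: "m \<in> N k" "m $ k \<noteq> 0" "subdegree (m $ k) = s" by blast
      have dvd: "m $ k dvd x $ k" if "x \<in> N k" for x
      proof (cases "x $ k = 0")
        case False
        then have "s \<le> subdegree (x $ k)" unfolding s_def by (intro Least_le) (use that in blast)
        then show ?thesis using False m by (simp add: fps_dvd_iff)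
      qed simp
      have mc: "m \<in> carrier_vec n" using m(1) MC by (auto simp: N_def)
      have bsc: "set bs \<subseteq> carrier_vec n"
        and inj: "inj_on (lincomb_list n bs) (carrier_vec (length bs))"
        and img: "lincomb_list n bs ` carrier_vec (length bs) = N (Suc k)"
        using bs by (auto simp: is_basis_iff bij_betw_def)
      let ?tl = "\<lambda>a. vec (length bs) (\<lambda>i. a $ Suc i)"
      have Cons: "lincomb_list n (m # bs) a = a $ 0 \<cdot>\<^sub>v m + lincomb_list n bs (?tl a)"
        if "a \<in> carrier_vec (Suc (length bs))" for a by (rule lincomb_list_Cons[OF mc that])
      have tlN: "lincomb_list n bs (?tl a) \<in> N (Suc k)" for a using img by auto
      have kn: "k < n" using step.hyps by simp
      have "is_basis n (N k) (m # bs)"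
        unfolding is_basis_iff bij_betw_def
      proof (intro conjI)
        show "set (m # bs) \<subseteq> carrier_vec n" using mc bsc by simp
        show "inj_on (lincomb_list n (m # bs)) (carrier_vec (length (m # bs)))"
        proof (rule inj_onI)
          fix a b assume ab: "a \<in> carrier_vec (length (m # bs))" "b \<in> carrier_vec (length (m # bs))"
            and eq: "lincomb_list n (m # bs) a = lincomb_list n (m # bs) b"
          have eq': "a $ 0 \<cdot>\<^sub>v m + lincomb_list n bs (?tl a) = b $ 0 \<cdot>\<^sub>v m + lincomb_list n bs (?tl b)"
            using eq ab by (simp add: Cons)
          have "(a $ 0 \<cdot>\<^sub>v m + lincomb_list n bs (?tl a)) $ k = a $ 0 * m $ k" for a
            using tlN[of a] mc kn MC by (auto simp: N_def)
          with eq' have "a $ 0 * m $ k = b $ 0 * m $ k" by metis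
          then have 0: "a $ 0 = b $ 0" using m(2) by simp
          have "lincomb_list n bs (?tl a) = lincomb_list n bs (?tl b)"
          proof (rule eq_vecI)
            fix l assume "l < dim_vec (lincomb_list n bs (?tl b))"
            then have l: "l < n" using carrier_vecD[OF lincomb_list_carrier[of n bs "?tl b"]] by simp
            have "(a $ 0 \<cdot>\<^sub>v m + lincomb_list n bs (?tl a)) $ l = (b $ 0 \<cdot>\<^sub>v m + lincomb_list n bs (?tl b)) $ l"
              using eq' by simp
            then show "lincomb_list n bs (?tl a) $ l = lincomb_list n bs (?tl b) $ l"
              using l mc carrier_vecD[OF lincomb_list_carrier[of n bs]] by (simp add: 0)
          qed (use carrier_vecD[OF lincomb_list_carrier[of n bs]] in simp)
          then have tl: "?tl a = ?tl b" using inj by (auto simp: inj_on_def)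
          show "a = b"
          proof (rule eq_vecI)
            fix i assume "i < dim_vec b"
            then have i: "i < Suc (length bs)" using ab by simp
            show "a $ i = b $ i"
            proof (cases i)
              case (Suc i')
              with i arg_cong[OF tl, of "\<lambda>v. vec_index v i'"] show ?thesis by simp
            qed (simp add: 0)
          qed (use ab in simp)
        qed
        show "lincomb_list n (m # bs) ` carrier_vec (length (m # bs)) = N k"
        proof safe
          fix a :: "'k fps vec" assume "a \<in> carrier_vec (length (m # bs))"
          then show "lincomb_list n (m # bs) a \<in> N k"
            using tlN[of a] m(1) mc kn Madd Msm 
            by (simp add: Cons) (auto simp: N_def)
        next
          fix x assume x: "x \<in> N k"
          obtain e where e: "x $ k = m $ k * e" using dvd[OF x] ..
          have xc: "x \<in> carrier_vec n" using x MC by (auto simp: N_def)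
          have "x + (- e) \<cdot>\<^sub>v m \<in> N (Suc k)"
            using x m(1) Madd Msm xc mc kn e by (auto simp: N_def less_Suc_eq)
          then obtain b where b: "b \<in> carrier_vec (length bs)" "lincomb_list n bs b = x + (- e) \<cdot>\<^sub>v m"
            using img by (metis imageE)
          define a where "a = vec (Suc (length bs)) (\<lambda>i. case i of 0 \<Rightarrow> e | Suc i \<Rightarrow> b $ i)"
          have a: "a \<in> carrier_vec (Suc (length bs))" by (simp add: a_def)
          have "?tl a = b" using b(1) by (intro eq_vecI) (auto simp: a_def)
          then have "lincomb_list n (m # bs) a = e \<cdot>\<^sub>v m + (x + (- e) \<cdot>\<^sub>v m)"
            unfolding Cons[OF a] by (simp add: b(2) a_def)
          also have "\<dots> = x" using xc mc by (intro eq_vecI) auto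
          finally show "x \<in> lincomb_list n (m # bs) ` carrier_vec (length (m # bs))"
            using a by (metis imageI length_Cons)
        qed
      qed
      then show ?thesis by blast
    qed
  qed
  from this[of 0] show ?thesis by (simp add: N_def)
qed

section \<open>Change of basis in free modules\<close>

lemma basis_expand:
  assumes "is_basis n M bs" "x \<in> M"
  shows "\<exists>a. a \<in> carrier_vec (length bs) \<and> x = lincomb_list n bs a"
  using assms by (auto simp: is_basis_iff bij_betw_def)

lemma lincomb_list_trans:
  assumes cs: "\<And>j. j < length cs \<Longrightarrow> cs ! j = lincomb_list n bs (col P j)"
    and P: "P \<in> carrier_mat (length bs) (length cs)" and a: "a \<in> carrier_vec (length cs)"
  shows "lincomb_list n cs a = lincomb_list n bs (P *\<^sub>v a)"
proof (rule eq_vecI)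
  fix k assume "k < dim_vec (lincomb_list n bs (P *\<^sub>v a))"
  then have k: "k < n" by simp
  have Pa: "P *\<^sub>v a \<in> carrier_vec (length bs)" using P a by simp
  have "lincomb_list n cs a $ k = (\<Sum>j<length cs. \<Sum>i<length bs. a $ j * (P $$ (i, j) * bs ! i $ k))"
    using k a P cs by (simp add: lincomb_list_index sum_distrib_left)
  also have "\<dots> = (\<Sum>i<length bs. \<Sum>j<length cs. a $ j * (P $$ (i, j) * bs ! i $ k))" by (rule sum.swap)
  also have "\<dots> = lincomb_list n bs (P *\<^sub>v a) $ k"
    unfolding lincomb_list_index[OF k Pa] using a P
    by (intro sum.cong refl) (simp add: scalar_prod_def atLeast0LessThan sum_distrib_left mult_ac)
  finally show "lincomb_list n cs a $ k = lincomb_list n bs (P *\<^sub>v a) $ k" .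
qed (use carrier_vecD[OF lincomb_list_carrier[of n]] in simp)

lemma transition_matrix:
  assumes bs: "is_basis n M bs" and cs: "set cs \<subseteq> M"
  shows "\<exists>P \<in> carrier_mat (length bs) (length cs). \<forall>j<length cs. cs ! j = lincomb_list n bs (col P j)"
proof -
  have "\<exists>a. \<forall>j<length cs. a j \<in> carrier_vec (length bs) \<and> cs ! j = lincomb_list n bs (a j)"
    using basis_expand[OF bs] cs nth_mem by (intro choice) blast
  then obtain a where a: "\<And>j. j < length cs \<Longrightarrow> a j \<in> carrier_vec (length bs)"
    "\<And>j. j < length cs \<Longrightarrow> cs ! j = lincomb_list n bs (a j)" by blast
  define P where "P = mat (length bs) (length cs) (\<lambda>(i, j). a j $ i)"
  have "col P j = a j" if "j < length cs" for j
    using a(1)[OF that] that by (intro eq_vecI) (auto simp: P_def)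
  then show ?thesis using a(2) by (intro bexI[of _ P]) (auto simp: P_def)
qed

lemma basis_inj:
  assumes "is_basis n M bs" "a \<in> carrier_vec (length bs)" "b \<in> carrier_vec (length bs)"
    "lincomb_list n bs a = lincomb_list n bs b" shows "a = b"
  using assms by (auto simp: is_basis_iff bij_betw_def inj_on_def)

lemma lincomb_list_unit:
  assumes "j < length bs" "set bs \<subseteq> carrier_vec n" shows "lincomb_list n bs (unit_vec (length bs) j) = bs ! j"
proof (rule eq_vecI)
  have bj: "bs ! j \<in> carrier_vec n" using assms by auto
  then show "dim_vec (lincomb_list n bs (unit_vec (length bs) j)) = dim_vec (bs ! j)"
    using carrier_vecD[OF lincomb_list_carrier[of n bs "unit_vec (length bs) j"]] by simp
  fix k assume "k < dim_vec (bs ! j)"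
  then have k: "k < n" using bj by simp
  show "lincomb_list n bs (unit_vec (length bs) j) $ k = bs ! j $ k"
    unfolding lincomb_list_index[OF k unit_vec_carrier]
    using pick_sum[OF assms(1), of "\<lambda>i. bs ! i $ k"] .
qed

lemma basis_members: "is_basis n M bs \<Longrightarrow> set bs \<subseteq> M"
proof
  fix x assume bs: "is_basis n M bs" and "x \<in> set bs"
  then obtain j where "j < length bs" "x = bs ! j" by (metis in_set_conv_nth)
  then have "x = lincomb_list n bs (unit_vec (length bs) j)" "unit_vec (length bs) j \<in> carrier_vec (length bs)"
    using bs lincomb_list_unit[of j bs n] by (auto simp: is_basis_iff)
  then show "x \<in> M" using bs by (auto simp: is_basis_iff bij_betw_def)
qed

text \<open>More vectors than there are basis elements satisfy a nontrivial linear relation, against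
  injectivity of coordinates.\<close>

lemma basis_length_le:
  fixes bs cs :: "'a::idom vec list"
  assumes bs: "is_basis n M bs" and cs: "is_basis n M cs" shows "length cs \<le> length bs"
proof (rule ccontr)
  assume lt: "\<not> ?thesis"
  obtain P where P: "P \<in> carrier_mat (length bs) (length cs)" "\<forall>j<length cs. cs ! j = lincomb_list n bs (col P j)"
    using transition_matrix[OF bs basis_members[OF cs]] by blast
  obtain c where c: "\<exists>j<length cs. c j \<noteq> 0" "\<forall>i<length bs. (\<Sum>j<length cs. P $$ (i, j) * c j) = 0"
    using underdetermined_system_idom[of "length bs" "length cs" "\<lambda>i j. P $$ (i, j)"] lt by auto
  define a where "a = vec (length cs) c"
  have "P *\<^sub>v a = 0\<^sub>v (length bs)"
    using c(2) P(1) by (intro eq_vecI) (auto simp: a_def scalar_prod_def atLeast0LessThan)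
  moreover have "P *\<^sub>v 0\<^sub>v (length cs) = 0\<^sub>v (length bs)"
    using P(1) by (intro eq_vecI) (auto simp: scalar_prod_def)
  ultimately have "lincomb_list n cs a = lincomb_list n bs (P *\<^sub>v 0\<^sub>v (length cs))"
    using lincomb_list_trans[of cs n bs P a] P by (simp add: a_def)
  also have "\<dots> = lincomb_list n cs (0\<^sub>v (length cs))"
    using lincomb_list_trans[of cs n bs P "0\<^sub>v (length cs)"] P by simp
  finally have "a = 0\<^sub>v (length cs)" by (rule basis_inj[OF cs, rotated 2]) (simp_all add: a_def)
  then show False using c(1) by (metis a_def index_vec index_zero_vec(1))
qed

lemma free_rank_eq:
  fixes bs :: "'a::idom vec list"
  assumes bs: "is_basis n M bs" shows "free_rank n M = length bs"
  unfolding free_rank_def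
proof (rule the_equality)
  fix r assume "\<exists>bs. is_basis n M bs \<and> length bs = r"
  then obtain cs where "is_basis n M cs" "length cs = r" by blast
  then show "r = length bs" using basis_length_le[OF bs, of cs] basis_length_le[of n M cs bs] bs by simp
qed (use bs in blast)

text \<open>Expressing the basis back in the generators gives a right inverse of P, and the
  determinant is multiplicative.\<close>

lemma transition_det_unit:
  fixes bs cs :: "'a::idom vec list"
  assumes bs: "is_basis n M bs" and len: "length cs = length bs"
    and csC: "set cs \<subseteq> carrier_vec n" and span: "lin_span n cs = M"
    and P: "P \<in> carrier_mat (length bs) (length bs)" "\<forall>j<length bs. cs ! j = lincomb_list n bs (col P j)"
  shows "det P dvd 1"
proof -
  let ?r = "length bs"
  have "\<exists>b. \<forall>j<?r. b j \<in> carrier_vec ?r \<and> bs ! j = lincomb_list n cs (b j)"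
  proof (intro choice allI)
    fix j
    show "\<exists>y. j < ?r \<longrightarrow> y \<in> carrier_vec ?r \<and> bs ! j = lincomb_list n cs y"
    proof (cases "j < ?r")
      case True
      then have "bs ! j \<in> M" using basis_members[OF bs] by auto
      then show ?thesis using span len by (auto simp: lin_span_def lincomb_list_def)
    qed simp
  qed
  then obtain b where b: "\<And>j. j < ?r \<Longrightarrow> b j \<in> carrier_vec ?r" "\<And>j. j < ?r \<Longrightarrow> bs ! j = lincomb_list n cs (b j)"
    by blast
  define Q where "Q = mat ?r ?r (\<lambda>(i, j). b j $ i)"
  have Q: "Q \<in> carrier_mat ?r ?r" by (simp add: Q_def)
  have "P * Q = 1\<^sub>m ?r"
  proof (rule mat_col_eqI)
    fix j assume "j < dim_col (1\<^sub>m ?r)"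
    then have j: "j < ?r" by simp
    have cQ: "col Q j = b j" using b(1)[OF j] j by (intro eq_vecI) (auto simp: Q_def)
    have "lincomb_list n bs (P *\<^sub>v b j) = lincomb_list n cs (b j)"
      using lincomb_list_trans[of cs n bs P "b j"] P b(1)[OF j] len by simp
    also have "\<dots> = lincomb_list n bs (unit_vec ?r j)"
      using b(2)[OF j] lincomb_list_unit[OF j] bs by (simp add: is_basis_iff)
    finally have "P *\<^sub>v b j = unit_vec ?r j"
      by (rule basis_inj[OF bs, rotated 2]) (use P(1) b(1)[OF j] in auto)
    then show "col (P * Q) j = col (1\<^sub>m ?r) j" using P(1) Q j cQ by simp
  qed (use P(1) Q in auto)
  then have "det P * det Q = 1" using det_mult[OF P(1) Q] by simp
  then show ?thesis by (metis dvd_triv_left)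
qed

text \<open>The transition matrix has unit determinant and so trivial kernel. The application is to
  v, phi v, ..., phi^(c-1) v, which cyclicity only provides as generators.\<close>

lemma generators_basis:
  fixes bs cs :: "'a::idom vec list"
  assumes bs: "is_basis n M bs" and len: "length cs = length bs"
    and csC: "set cs \<subseteq> carrier_vec n" and span: "lin_span n cs = M"
  shows "is_basis n M cs"
proof -
  let ?r = "length bs"
  have csM: "set cs \<subseteq> M"
  proof
    fix x assume "x \<in> set cs"
    then obtain j where j: "j < length cs" "x = cs ! j" by (metis in_set_conv_nth)
    then show "x \<in> M" unfolding span[symmetric] lin_span_def lincomb_list_def[symmetric]
      using lincomb_list_unit[OF j(1) csC] by (intro image_eqI[of _ _ "unit_vec (length cs) j"]) auto
  qed
  obtain P where P: "P \<in> carrier_mat ?r ?r" "\<forall>j<?r. cs ! j = lincomb_list n bs (col P j)"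
    using transition_matrix[OF bs csM] len by auto
  have d: "det P \<noteq> 0" using transition_det_unit[OF bs len csC span P] by auto
  have tr: "lincomb_list n cs a = lincomb_list n bs (P *\<^sub>v a)" if "a \<in> carrier_vec ?r" for a
  proof (rule lincomb_list_trans)
    show "cs ! j = lincomb_list n bs (col P j)" if "j < length cs" for j using P(2) that len by metis
  qed (use P(1) that len in simp_all)
  have "inj_on (lincomb_list n cs) (carrier_vec (length cs))"
  proof (rule inj_onI)
    fix a b assume ab: "a \<in> carrier_vec (length cs)" "b \<in> carrier_vec (length cs)"
      and eq: "lincomb_list n cs a = lincomb_list n cs b"
    have abr: "a \<in> carrier_vec ?r" "b \<in> carrier_vec ?r" using ab len by simp_all
    have "P *\<^sub>v a = P *\<^sub>v b"
    proof (rule basis_inj[OF bs])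
      show "P *\<^sub>v a \<in> carrier_vec ?r" "P *\<^sub>v b \<in> carrier_vec ?r" using abr P(1) by simp_all
      show "lincomb_list n bs (P *\<^sub>v a) = lincomb_list n bs (P *\<^sub>v b)"
        using eq unfolding tr[OF abr(1)] tr[OF abr(2)] .
    qed
    then have "P *\<^sub>v (a - b) = 0\<^sub>v ?r"
      using abr P(1) by (subst mult_minus_distrib_mat_vec[OF P(1) abr]) simp
    moreover have "a - b \<in> carrier_vec ?r" using abr by simp
    ultimately have "a - b = 0\<^sub>v ?r" using det_0_iff_vec_prod_zero[OF P(1)] d by blast
    show "a = b"
    proof (rule eq_vecI)
      fix i assume "i < dim_vec b"
      then have "(a - b) $ i = 0" "i < ?r" using \<open>a - b = 0\<^sub>v ?r\<close> abr by simp_all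
      then show "a $ i = b $ i" using abr by simp
    qed (use abr in simp)
  qed
  then show ?thesis
    using csC span unfolding is_basis_iff bij_betw_def lin_span_def lincomb_list_def[symmetric] by simp
qed

text \<open>In the first row only the last entry can be nonzero, and deleting its row and column
  leaves the identity matrix.\<close>

lemma det_companion:
  fixes a :: "nat \<Rightarrow> 'a::comm_ring_1"
  assumes "c \<ge> 1"
  shows "det (mat c c (\<lambda>(i, j). if j = c - 1 then a i else if i = Suc j then 1 else 0)) = (- 1) ^ (c - 1) * a 0"
proof -
  define C where "C = mat c c (\<lambda>(i, j). if j = c - 1 then a i else if i = Suc j then 1 else 0)"
  have C: "C \<in> carrier_mat c c" by (simp add: C_def)
  have "det C = (\<Sum>j<c. C $$ (0, j) * cofactor C 0 j)"
    by (rule laplace_expansion_row[OF C]) (use assms in simp)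
  also have "\<dots> = (\<Sum>j<c. if j = c - 1 then a 0 * cofactor C 0 (c - 1) else 0)"
    using assms by (intro sum.cong refl) (auto simp: C_def)
  also have "\<dots> = a 0 * cofactor C 0 (c - 1)" using assms by simp
  also have "mat_delete C 0 (c - 1) = 1\<^sub>m (c - 1)"
    by (rule eq_matI) (auto simp: mat_delete_def C_def)
  then have "cofactor C 0 (c - 1) = (- 1) ^ (c - 1)" by (simp add: cofactor_def)
  finally show ?thesis by (simp add: C_def mult.commute)
qed

lemma fps_val_associated:
  fixes a b u w :: "'k::field fps"
  assumes "a * u = w * b" "u dvd 1" "w dvd 1" shows "fps_val a = fps_val b"
proof -
  have u: "u \<noteq> 0" "subdegree u = 0" and w: "w \<noteq> 0" "subdegree w = 0"
    using assms(2,3) by (auto simp: fps_is_unit_iff subdegree_eq_0_iff)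
  show ?thesis
  proof (cases "a = 0")
    case True
    then show ?thesis using assms(1) w(1) by (auto simp: fps_val_def)
  next
    case False
    then have "a * u \<noteq> 0" using u by simp
    then have b: "b \<noteq> 0" using assms(1) by auto
    have "subdegree (a * u) = subdegree (w * b)" using assms(1) by simp
    then show ?thesis using False b u w by (simp add: fps_val_def)
  qed
qed

section \<open>The Lie algebra over A and the Frobenius map on it\<close>

locale lie_setup = bialg_points J H
  for J :: "'k::field fps \<Rightarrow> 'l::alg_closed_field" and H +
  fixes p :: nat
  assumes charl: "CHAR('l) = p" and prime_p: "Factorial_Ring.prime p"
    and J_inj: "J a = 0 \<Longrightarrow> a = 0"
begin

sublocale LC: fin_alg_char HL p
  rewrites "rnk HL \<equiv> rnk H"
  by (intro fin_alg_char.intro fin_alg_char_axioms.intro L.fin_alg_axioms charl prime_p) simp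

lemma J_eq: "J a = J b \<longleftrightarrow> a = b"
  using J_inj[of "a - b"] by (auto simp: hom_distribs)

lemma char_fps: "CHAR('k fps) = p"
proof (rule CHAR_eqI)
  have iff: "(of_nat m :: 'k fps) = 0 \<longleftrightarrow> (of_nat m :: 'l) = 0" for m
    using J_eq[of "of_nat m" 0] by (simp add: hom_distribs)
  show "(of_nat p :: 'k fps) = 0" unfolding iff by (metis charl of_nat_CHAR)
  show "p dvd m" if "(of_nat m :: 'k fps) = 0" for m
    using that unfolding iff by (simp add: of_nat_eq_0_iff_char_dvd charl)
qed

text \<open>By \<open>lie_cartier_dual\<close> these primitive elements are the Lie algebra of the
  Cartier dual of \<open>H\<close>.\<close>

definition Lie :: "'k fps vec set" where
  "Lie = {x \<in> carrier_vec nn. comul H x = tensor H x \<one>\<^bsub>coord_ring H\<^esub> + tensor H \<one>\<^bsub>coord_ring H\<^esub> x}"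

lemma Lie_entries: "x \<in> Lie \<longleftrightarrow> x \<in> carrier_vec nn \<and>
   (\<forall>i<nn. \<forall>j<nn. (\<Sum>k<nn. x $ k * cml H k i j) = x $ i * unt H j + unt H i * x $ j)"
  unfolding Lie_def by (auto simp: comul_def tensor_def mat_eq_iff A.co_one)

lemma prim_entries: "L.prim x \<longleftrightarrow> x \<in> carrier_vec nn \<and>
   (\<forall>i<nn. \<forall>j<nn. (\<Sum>k<nn. x $ k * J (cml H k i j)) = x $ i * J (unt H j) + J (unt H i) * x $ j)"
  unfolding L.prim_def by (auto simp: comul_def tensor_def mat_eq_iff L.B.co_one)

text \<open>Since \<open>J\<close> is injective, the equations of primitivity may be tested over
  L.\<close>

lemma Lie_iff: "x \<in> Lie \<longleftrightarrow> x \<in> carrier_vec nn \<and> L.prim (map_vec J x)"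
  unfolding Lie_entries prim_entries
proof (rule conj_cong[OF refl])
  assume x: "x \<in> carrier_vec nn"
  have e: "(\<Sum>k<nn. map_vec J x $ k * J (cml H k i j)) = J (\<Sum>k<nn. x $ k * cml H k i j)"
    "map_vec J x $ i * J (unt H j) + J (unt H i) * map_vec J x $ j = J (x $ i * unt H j + unt H i * x $ j)"
    if "i < nn" "j < nn" for i j
    using x that by (simp_all add: hom_distribs)
  have iff: "(\<Sum>k<nn. map_vec J x $ k * J (cml H k i j)) =
      map_vec J x $ i * J (unt H j) + J (unt H i) * map_vec J x $ j \<longleftrightarrow>
      (\<Sum>k<nn. x $ k * cml H k i j) = x $ i * unt H j + unt H i * x $ j" if "i < nn" "j < nn" for i j
    unfolding e[OF that] J_eq ..
  show "(\<forall>i<nn. \<forall>j<nn. (\<Sum>k<nn. x $ k * cml H k i j) = x $ i * unt H j + unt H i * x $ j) \<longleftrightarrow>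
    (map_vec J x \<in> carrier_vec nn \<and> (\<forall>i<nn. \<forall>j<nn. (\<Sum>k<nn. map_vec J x $ k * J (cml H k i j)) =
       map_vec J x $ i * J (unt H j) + J (unt H i) * map_vec J x $ j))"
    using x by (simp add: iff del: index_map_vec(1))
qed

lemma Lie_carrier: "Lie \<subseteq> carrier_vec nn" by (auto simp: Lie_entries)

lemma Lie_zero: "0\<^sub>v nn \<in> Lie" by (simp add: Lie_entries)

lemma Lie_add: "x \<in> Lie \<Longrightarrow> y \<in> Lie \<Longrightarrow> x + y \<in> Lie"
  by (auto simp: Lie_entries distrib_right sum.distrib algebra_simps)

lemma Lie_smult: "x \<in> Lie \<Longrightarrow> a \<cdot>\<^sub>v x \<in> Lie"
proof -
  assume x: "x \<in> Lie"
  have "(\<Sum>k<nn. (a \<cdot>\<^sub>v x) $ k * cml H k i j) = (a \<cdot>\<^sub>v x) $ i * unt H j + unt H i * (a \<cdot>\<^sub>v x) $ j"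
    if "i < nn" "j < nn" for i j
  proof -
    have "(\<Sum>k<nn. (a \<cdot>\<^sub>v x) $ k * cml H k i j) = a * (\<Sum>k<nn. x $ k * cml H k i j)"
      using x by (simp add: Lie_entries A.co_sm sum_distrib_left mult.assoc)
    also have "(\<Sum>k<nn. x $ k * cml H k i j) = x $ i * unt H j + unt H i * x $ j"
      using x that by (simp add: Lie_entries)
    finally show ?thesis using x that by (simp add: Lie_entries A.co_sm algebra_simps)
  qed
  then show ?thesis using x by (simp add: Lie_entries)
qed

lemma prim_frob:
  assumes "L.prim y" shows "L.prim (y [^]\<^bsub>coord_ring HL\<^esub> p)"
proof -
  have y: "y \<in> carrier_vec nn" and c: "comul HL y = tensor HL y \<one>\<^bsub>coord_ring HL\<^esub> + tensor HL \<one>\<^bsub>coord_ring HL\<^esub> y"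
    using assms by (auto simp: L.prim_def)
  have "comul HL (y [^]\<^bsub>coord_ring HL\<^esub> p) = (tensor HL y \<one>\<^bsub>coord_ring HL\<^esub> + tensor HL \<one>\<^bsub>coord_ring HL\<^esub> y) [^]\<^bsub>tensor_square_ring HL\<^esub> p"
    using y by (simp add: LC.comul_pow c)
  also have "\<dots> = tensor HL y \<one>\<^bsub>coord_ring HL\<^esub> [^]\<^bsub>tensor_square_ring HL\<^esub> p + tensor HL \<one>\<^bsub>coord_ring HL\<^esub> y [^]\<^bsub>tensor_square_ring HL\<^esub> p"
    using LC.T.frob_add[of "tensor HL y \<one>\<^bsub>coord_ring HL\<^esub>" "tensor HL \<one>\<^bsub>coord_ring HL\<^esub> y" 1] charl prime_p by simp
  also have "\<dots> = tensor HL (y [^]\<^bsub>coord_ring HL\<^esub> p) \<one>\<^bsub>coord_ring HL\<^esub> + tensor HL \<one>\<^bsub>coord_ring HL\<^esub> (y [^]\<^bsub>coord_ring HL\<^esub> p)"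
    using y by (simp add: LC.tensor_pow)
  finally show ?thesis using y by (simp add: L.prim_def)
qed

abbreviation \<phi> where "\<phi> x \<equiv> x [^]\<^bsub>coord_ring H\<^esub> p"

lemma Lie_frob: "x \<in> Lie \<Longrightarrow> \<phi> x \<in> Lie"
  using prim_frob[of "map_vec J x"] by (auto simp: Lie_iff map_pow)

lemma frob_iter: "x \<in> carrier_vec nn \<Longrightarrow> (\<phi> ^^ i) x = x [^]\<^bsub>coord_ring H\<^esub> (p ^ i)"
  by (induction i) (simp_all add: A.nat_pow_pow mult.commute)

lemma Lie_frob_iter: "x \<in> Lie \<Longrightarrow> x [^]\<^bsub>coord_ring H\<^esub> (p ^ i) \<in> Lie"
proof -
  assume x: "x \<in> Lie"
  have "(\<phi> ^^ i) x \<in> Lie" by (induction i) (use x Lie_frob in auto)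
  then show ?thesis using frob_iter x Lie_carrier by auto
qed

lemma lincomb_frob:
  assumes bs: "set bs \<subseteq> carrier_vec nn" and a: "a \<in> carrier_vec (length bs)"
  shows "\<phi> (lincomb_list nn bs a) = lincomb_list nn (map \<phi> bs) (map_vec (\<lambda>x. x ^ p) a)"
proof -
  let ?r = "length bs"
  have bi: "bs ! i \<in> carrier_vec nn" if "i < ?r" for i using bs that by auto
  have "lincomb_list nn bs a = finsum (coord_ring H) (\<lambda>i. a $ i \<cdot>\<^sub>v bs ! i) {..<?r}"
  proof (rule A.co_inj)
    fix k assume k: "k \<in> {..<nn}"
    show "lincomb_list nn bs a $ k = finsum (coord_ring H) (\<lambda>i. a $ i \<cdot>\<^sub>v bs ! i) {..<?r} $ k"
      using k a bi by (subst A.co_finsum) (auto simp: lincomb_list_index A.co_sm)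
  qed (use bi in \<open>auto intro!: A.finsum_closed\<close>)
  then have "\<phi> (lincomb_list nn bs a) = finsum (coord_ring H) (\<lambda>i. \<phi> (a $ i \<cdot>\<^sub>v bs ! i)) {..<?r}"
    using A.frob_finsum[of "{..<?r}" "\<lambda>i. a $ i \<cdot>\<^sub>v bs ! i" 1, unfolded char_fps power_one_right, OF prime_p] bi
    by (simp add: Pi_def)
  also have "\<dots> = lincomb_list nn (map \<phi> bs) (map_vec (\<lambda>x. x ^ p) a)"
  proof (rule A.co_inj)
    fix k assume k: "k \<in> {..<nn}"
    have "finsum (coord_ring H) (\<lambda>i. \<phi> (a $ i \<cdot>\<^sub>v bs ! i)) {..<?r} $ k = (\<Sum>i<?r. (\<phi> (a $ i \<cdot>\<^sub>v bs ! i)) $ k)"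
      using k bi by (subst A.co_finsum) auto
    also have "\<dots> = (\<Sum>i<?r. (a $ i) ^ p * \<phi> (bs ! i) $ k)"
      using k bi by (intro sum.cong refl) (simp add: A.sm_pow A.co_sm)
    also have "\<dots> = lincomb_list nn (map \<phi> bs) (map_vec (\<lambda>x. x ^ p) a) $ k"
      using k a by (subst lincomb_list_index) auto
    finally show "finsum (coord_ring H) (\<lambda>i. \<phi> (a $ i \<cdot>\<^sub>v bs ! i)) {..<?r} $ k =
      lincomb_list nn (map \<phi> bs) (map_vec (\<lambda>x. x ^ p) a) $ k" .
  qed (use bi in \<open>auto intro!: A.finsum_closed\<close>)
  finally show ?thesis .
qed

definition frob_matrix :: "'k fps vec list \<Rightarrow> 'k fps mat \<Rightarrow> bool" where
  "frob_matrix bs M \<longleftrightarrow> M \<in> carrier_mat (length bs) (length bs) \<and>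
    (\<forall>j<length bs. \<phi> (bs ! j) = lincomb_list nn bs (col M j))"

text \<open>For a semilinear map, a change of basis by P gives Mb P' = P Mc, where P' has the p-th
  powers of the entries of P. As x to x^p is a ring homomorphism, det P' = (det P)^p. Both det P and
  det P' are units, so the valuations agree.\<close>

lemma frob_matrix_val_unique:
  assumes bs: "is_basis nn Lie bs" and cs: "is_basis nn Lie cs"
    and Mb: "frob_matrix bs Mb" and Mc: "frob_matrix cs Mc"
  shows "fps_val (det Mb) = fps_val (det Mc)"
proof -
  let ?r = "length bs"
  have len: "length cs = ?r" using basis_length_le[OF bs cs] basis_length_le[OF cs bs] by simp
  have bsC: "set bs \<subseteq> carrier_vec nn" and csC: "set cs \<subseteq> carrier_vec nn"
    using bs cs by (simp_all add: is_basis_iff)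
  have span: "lin_span nn cs = Lie"
    using cs unfolding is_basis_iff bij_betw_def lin_span_def lincomb_list_def[symmetric] by simp
  obtain P where P: "P \<in> carrier_mat ?r ?r" "\<forall>j<?r. cs ! j = lincomb_list nn bs (col P j)"
    using transition_matrix[OF bs basis_members[OF cs]] len by auto
  have dP: "det P dvd 1" by (rule transition_det_unit[OF bs len csC span P])
  have Mbc: "Mb \<in> carrier_mat ?r ?r" "Mc \<in> carrier_mat ?r ?r"
    using Mb Mc len by (simp_all add: frob_matrix_def)
  define P' where "P' = map_mat (\<lambda>x. x ^ p) P"
  have P': "P' \<in> carrier_mat ?r ?r" using P(1) by (simp add: P'_def)
  have "Mb * P' = P * Mc"
  proof (rule mat_col_eqI)
    fix j assume "j < dim_col (P * Mc)"
    then have j: "j < ?r" using Mbc by simp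
    have colP: "col P j \<in> carrier_vec ?r" "col P' j \<in> carrier_vec ?r" "col Mc j \<in> carrier_vec ?r"
      using P(1) P' Mbc by (auto intro!: carrier_vecI)
    have cp: "map_vec (\<lambda>x. x ^ p) (col P j) = col P' j"
      using P(1) j by (intro eq_vecI) (auto simp: P'_def)
    have "\<phi> (cs ! j) = lincomb_list nn (map \<phi> bs) (col P' j)"
      using lincomb_frob[OF bsC colP(1)] P(2) j by (simp add: cp)
    also have "\<dots> = lincomb_list nn bs (Mb *\<^sub>v col P' j)"
      by (rule lincomb_list_trans) (use Mb colP in \<open>auto simp: frob_matrix_def\<close>)
    finally have 1: "\<phi> (cs ! j) = lincomb_list nn bs (Mb *\<^sub>v col P' j)" .
    have "\<phi> (cs ! j) = lincomb_list nn cs (col Mc j)" using Mc j len by (simp add: frob_matrix_def)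
    also have "\<dots> = lincomb_list nn bs (P *\<^sub>v col Mc j)"
    proof (rule lincomb_list_trans)
      show "cs ! j = lincomb_list nn bs (col P j)" if "j < length cs" for j using P(2) that len by metis
    qed (use P(1) colP len in simp_all)
    finally have 2: "\<phi> (cs ! j) = lincomb_list nn bs (P *\<^sub>v col Mc j)" .
    have "Mb *\<^sub>v col P' j = P *\<^sub>v col Mc j"
      by (rule basis_inj[OF bs mult_mat_vec_carrier[OF Mbc(1) colP(2)] mult_mat_vec_carrier[OF P(1) colP(3)]
        trans[OF 1[symmetric] 2]])
    then show "col (Mb * P') j = col (P * Mc) j" using Mbc P(1) P' j by simp
  qed (use Mbc P(1) P' in auto)
  then have "det Mb * det P' = det P * det Mc"
    using det_mult[OF Mbc(1) P'] det_mult[OF P(1) Mbc(2)] by simp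
  moreover have "det P' = det P ^ p"
  proof -
    interpret F: comm_ring_hom "\<lambda>x :: 'k fps. x ^ p"
    proof
      show "(x + y) ^ p = x ^ p + y ^ p" for x y :: "'k fps"
        by (rule freshmans_dream) (use char_fps prime_p in auto)
    qed (use prime_gt_0_nat[OF prime_p] in \<open>auto simp: power_mult_distrib\<close>)
    show ?thesis unfolding P'_def by (simp add: F.hom_det)
  qed
  moreover have "det P ^ p dvd 1" using dP by (simp add: is_unit_power_iff)
  ultimately show ?thesis using fps_val_associated[OF _ _ dP, of "det Mb" "det P ^ p" "det Mc"] by simp
qed


text \<open>Everything is read off in the basis v, phi v, ..., phi^(c-1) v. Independence of the
  choice of basis is what allows the definite description in \<open>hasse_invariant\<close> to be
  evaluated with the companion matrix found there.\<close>

theorem hasse_normal_form: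
  assumes H: "H = lvl G 1" and cyc: "hw_cyclic p G" and h1: "hasse_invariant p G = 1"
    and c: "c = bt_dim (serre_dual p G)"
  shows "\<exists>v a. v \<in> Lie \<and> c \<ge> 1 \<and>
    (\<forall>x\<in>Lie. \<exists>b. \<forall>k<nn. x $ k = (\<Sum>i<c. b i * (v [^]\<^bsub>coord_ring H\<^esub> (p ^ i)) $ k)) \<and>
    (\<forall>b. (\<forall>k<nn. (\<Sum>i<c. b i * (v [^]\<^bsub>coord_ring H\<^esub> (p ^ i)) $ k) = 0) \<longrightarrow> (\<forall>i<c. b i = 0)) \<and>
    (\<forall>k<nn. (v [^]\<^bsub>coord_ring H\<^esub> (p ^ c)) $ k = (\<Sum>i<c. a i * (v [^]\<^bsub>coord_ring H\<^esub> (p ^ i)) $ k)) \<and>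
    a 0 \<noteq> 0 \<and> subdegree (a 0) = 1"
proof -
  have lvl1: "lvl (serre_dual p G) 1 = cartier_dual H" by (simp add: serre_dual_def H)
  have rnk1: "rnk (lvl (serre_dual p G) 1) = nn" "rnk (lvl G 1) = nn"
    unfolding lvl1 by (simp_all add: cartier_dual_def H)
  have lie: "bt_lie (serre_dual p G) = Lie"
    unfolding bt_lie_def lvl1 lie_cartier_dual Lie_def ..
  have hw: "hasse_witt p G = \<phi>" by (rule ext) (simp add: hasse_witt_def H)
  obtain bs where bs: "is_basis nn Lie bs"
    using submodule_has_basis[OF Lie_carrier Lie_zero Lie_add Lie_smult] by blast
  have lenc: "length bs = c" unfolding c bt_dim_def rnk1 lie by (rule free_rank_eq[OF bs, symmetric])
  have c1: "c \<ge> 1" using cyc by (simp add: hw_cyclic_def c)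
  obtain v where v: "v \<in> Lie"
    and gen: "lin_span nn (map (\<lambda>i. (\<phi> ^^ i) v) [0..<c]) = Lie"
    using cyc unfolding hw_cyclic_def lie rnk1 hw c[symmetric] by blast
  define cs where "cs = map (\<lambda>i. v [^]\<^bsub>coord_ring H\<^esub> (p ^ i)) [0..<c]"
  have vc: "v \<in> carrier_vec nn" using v Lie_carrier by auto
  have cs_eq: "map (\<lambda>i. (\<phi> ^^ i) v) [0..<c] = cs" unfolding cs_def by (simp only: frob_iter[OF vc])
  have lencs: "length cs = c" by (simp add: cs_def)
  have csi: "cs ! i = v [^]\<^bsub>coord_ring H\<^esub> (p ^ i)" if "i < c" for i using that by (simp add: cs_def)
  have csC: "set cs \<subseteq> carrier_vec nn" using vc by (auto simp: cs_def)
  have basis: "is_basis nn Lie cs"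
    by (rule generators_basis[OF bs _ csC]) (use gen lenc lencs cs_eq in simp_all)
  have lc: "lincomb_list nn cs b $ k = (\<Sum>i<c. b $ i * (v [^]\<^bsub>coord_ring H\<^esub> (p ^ i)) $ k)"
    if "k < nn" "b \<in> carrier_vec c" for b k
    using that lencs by (simp add: lincomb_list_index csi)
  have expand: "\<exists>b. \<forall>k<nn. x $ k = (\<Sum>i<c. b i * (v [^]\<^bsub>coord_ring H\<^esub> (p ^ i)) $ k)" if xL: "x \<in> Lie" for x
  proof -
    obtain b where "b \<in> carrier_vec c" "x = lincomb_list nn cs b"
      using basis_expand[OF basis xL] lencs by auto
    then show ?thesis using lc by (intro exI[of _ "\<lambda>i. b $ i"]) simp
  qed
  have indep: "\<forall>i<c. b i = 0" if b: "\<forall>k<nn. (\<Sum>i<c. b i * (v [^]\<^bsub>coord_ring H\<^esub> (p ^ i)) $ k) = 0" for b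
  proof -
    have "lincomb_list nn cs (vec c b) = lincomb_list nn cs (0\<^sub>v c)"
      by (rule eq_vecI) (use b in \<open>simp_all add: lc\<close>)
    then have "vec c b = 0\<^sub>v c" using basis_inj[OF basis, of "vec c b" "0\<^sub>v c"] lencs by simp
    then show ?thesis by (metis index_vec index_zero_vec(1))
  qed
  obtain a where a: "\<forall>k<nn. (v [^]\<^bsub>coord_ring H\<^esub> (p ^ c)) $ k = (\<Sum>i<c. a i * (v [^]\<^bsub>coord_ring H\<^esub> (p ^ i)) $ k)"
    using expand[OF Lie_frob_iter[OF v, of c]] by blast
  \<comment> \<open>The columns before the last shift phi^j v to phi^(j+1) v, and the last one holds
    the relation for phi^c v.\<close>
  define C where "C = mat c c (\<lambda>(i, j). if j = c - 1 then a i else if i = Suc j then 1 else 0)"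
  have C: "C \<in> carrier_mat c c" by (simp add: C_def)
  have colC: "col C j \<in> carrier_vec c" for j using C by (auto intro!: carrier_vecI)
  have fm: "frob_matrix cs C"
    unfolding frob_matrix_def lencs
  proof (intro conjI allI impI C)
    fix j assume j: "j < c"
    have pj: "\<phi> (cs ! j) = v [^]\<^bsub>coord_ring H\<^esub> (p ^ Suc j)"
      using j vc by (simp add: csi A.nat_pow_pow mult.commute)
    show "\<phi> (cs ! j) = lincomb_list nn cs (col C j)"
    proof (rule A.co_inj)
      fix k assume "k \<in> {..<nn}"
      then have k: "k < nn" by simp
      have "(v [^]\<^bsub>coord_ring H\<^esub> (p ^ Suc j)) $ k = (\<Sum>i<c. col C j $ i * (v [^]\<^bsub>coord_ring H\<^esub> (p ^ i)) $ k)"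
      proof (cases "j = c - 1")
        case True
        then have "Suc j = c" using c1 by simp
        moreover have "(\<Sum>i<c. col C j $ i * (v [^]\<^bsub>coord_ring H\<^esub> (p ^ i)) $ k) =
            (\<Sum>i<c. a i * (v [^]\<^bsub>coord_ring H\<^esub> (p ^ i)) $ k)"
          using True j by (intro sum.cong refl) (simp add: C_def)
        ultimately show ?thesis using a k by simp
      next
        case False
        have "(\<Sum>i<c. col C j $ i * (v [^]\<^bsub>coord_ring H\<^esub> (p ^ i)) $ k) =
            (\<Sum>i<c. if i = Suc j then (v [^]\<^bsub>coord_ring H\<^esub> (p ^ i)) $ k else 0)"
          using False j by (intro sum.cong refl) (simp add: C_def)
        also have "\<dots> = (v [^]\<^bsub>coord_ring H\<^esub> (p ^ Suc j)) $ k" using False j by simp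
        finally show ?thesis by simp
      qed
      then show "\<phi> (cs ! j) $ k = lincomb_list nn cs (col C j) $ k"
        unfolding pj lc[OF k colC] .
    qed (use vc j csC lencs in \<open>auto simp: pj\<close>)
  qed
  have detC: "det C = (- 1) ^ (c - 1) * a 0" unfolding C_def by (rule det_companion[OF c1])
  have hwm: "is_hasse_witt_matrix p G ds M \<longleftrightarrow> frob_matrix ds M" for ds M
    unfolding is_hasse_witt_matrix_def frob_matrix_def hw rnk1 lincomb_list_def ..
  have "hasse_invariant p G = fps_val (det C)"
    unfolding hasse_invariant_def rnk1 lie hwm
  proof (rule the_equality)
    show "\<exists>bs M. is_basis nn Lie bs \<and> frob_matrix bs M \<and> fps_val (det C) = fps_val (det M)"
      using basis fm by blast
    fix h assume "\<exists>bs M. is_basis nn Lie bs \<and> frob_matrix bs M \<and> h = fps_val (det M)"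
    then obtain ds M where "is_basis nn Lie ds" "frob_matrix ds M" "h = fps_val (det M)" by blast
    then show "h = fps_val (det C)" using frob_matrix_val_unique[OF _ basis _ fm] by blast
  qed
  then have val: "fps_val (det C) = 1" using h1 by simp
  have "fps_val (a 0) = fps_val (det C)"
    by (rule fps_val_associated[of _ "(- 1) ^ (c - 1)" 1]) (simp_all add: detC mult.commute is_unit_power_iff)
  then have "a 0 \<noteq> 0 \<and> subdegree (a 0) = 1" using val by (auto simp: fps_val_def one_enat_def split: if_splits)
  then show ?thesis using v c1 expand indep a by blast
qed

end

section \<open>Roots of the Hasse polynomial\<close>

lemma fps_cutoff_factor:
  assumes "\<And>l. l < N \<Longrightarrow> fps_nth D l = 0"
  shows "D = fps_X ^ N * fps_shift N (D :: 'k::field fps)"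
  by (rule fps_ext) (use assms in \<open>auto simp: fps_X_power_mult_nth\<close>)

text \<open>Iterate from 0: coefficient l no longer changes after l + 1 steps, since each new
  coefficient depends on lower ones only. The stable coefficients form the fixed point. This is the
  completeness argument that stands behind Hensel's lemma.\<close>

lemma fps_contraction_fixpoint:
  fixes \<Phi> :: "'k::field fps \<Rightarrow> 'k fps"
  assumes contr: "\<And>u v N. (\<And>l. l < N \<Longrightarrow> fps_nth u l = fps_nth v l) \<Longrightarrow> fps_nth (\<Phi> u) N = fps_nth (\<Phi> v) N"
  shows "\<exists>u. \<Phi> u = u"
proof -
  define s where "s k = (\<Phi> ^^ k) 0" for k
  have step: "fps_nth (s (Suc k)) l = fps_nth (s k) l" if "l < k" for k l
    using that
  proof (induction k arbitrary: l)
    case (Suc k)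
    show ?case using contr[of l "s (Suc k)" "s k"] Suc by (simp add: s_def)
  qed simp
  have stable: "fps_nth (s (l + 1 + j)) l = fps_nth (s (l + 1)) l" for l j
    by (induction j) (use step in auto)
  define u where "u = Abs_fps (\<lambda>l. fps_nth (s (l + 1)) l)"
  have "fps_nth (\<Phi> u) N = fps_nth u N" for N
  proof -
    have "fps_nth u l = fps_nth (s N) l" if "l < N" for l
      using stable[of l "N - (l + 1)"] that by (simp add: u_def)
    then have "fps_nth (\<Phi> u) N = fps_nth (\<Phi> (s N)) N" by (rule contr)
    then show ?thesis by (simp add: u_def s_def)
  qed
  then show ?thesis by (intro exI[of _ u] fps_ext) simp
qed

locale laurent = alg_clo \<iota> p for \<iota> :: "'k::alg_closed_field fls \<Rightarrow> 'l::alg_closed_field" and p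
begin

definition J :: "'k fps \<Rightarrow> 'l" where "J a = \<iota> (fps_to_fls a)"

sublocale Jh: comm_ring_hom J
  by unfold_locales (simp_all add: J_def hom_distribs fls_times_fps_to_fls)

lemma J_zero_iff: "J a = 0 \<longleftrightarrow> a = 0"
  by (simp add: J_def)

lemma char_k: "CHAR('k) = p"
proof (rule CHAR_eqI)
  have iff: "(of_nat m :: 'k) = 0 \<longleftrightarrow> (of_nat m :: 'l) = 0" for m
  proof -
    have "(of_nat m :: 'l) = J (of_nat m)" by (simp add: Jh.hom_of_nat)
    also have "\<dots> = J (fps_const (of_nat m))" by (simp add: fps_of_nat)
    finally show ?thesis by (simp add: J_zero_iff)
  qed
  show "(of_nat p :: 'k) = 0" unfolding iff by (metis char of_nat_CHAR)
  show "p dvd m" if "(of_nat m :: 'k) = 0" for m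
    using that unfolding iff by (simp add: of_nat_eq_0_iff_char_dvd char)
qed

lemma fps_frob_add: "(a + b :: 'k fps) ^ (p ^ m) = a ^ (p ^ m) + b ^ (p ^ m)"
  by (rule freshmans_dream') (use char_k p in auto)

lemma fps_frob_diff: "(a - b :: 'k fps) ^ (p ^ m) = a ^ (p ^ m) - b ^ (p ^ m)"
  using fps_frob_add[of "a - b" b m] by (simp add: algebra_simps)

lemma denominator: "\<exists>N q. fls_X ^ N * (a :: 'k fls) = fps_to_fls q"
proof -
  define N where "N = nat (- fls_subdegree a)"
  have "fls_X ^ N * a = fls_shift (- int N) a" by (rule fls_X_power_times_conv_shift)
  moreover have "0 \<le> fls_subdegree (fls_shift (- int N) a)"
    by (rule fls_shift_nonneg_subdegree) (simp add: N_def)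
  ultimately have "fls_X ^ N * a = fps_to_fls (fls_regpart (fls_X ^ N * a))"
    by (simp add: fls_regpart_to_fls_trivial)
  then show ?thesis by blast
qed

lemma common_denominator:
  "finite S \<Longrightarrow> \<exists>N q. \<forall>i\<in>S. fls_X ^ N * (a i :: 'k fls) = fps_to_fls (q i)"
proof (induction S rule: finite_induct)
  case (insert s S)
  then obtain N q where q: "\<forall>i\<in>S. fls_X ^ N * a i = fps_to_fls (q i)" by blast
  obtain M r where r: "fls_X ^ M * a s = fps_to_fls r" using denominator by blast
  have X: "(fls_X :: 'k fls) ^ k = fps_to_fls (fps_X ^ k)" for k by (simp add: fps_to_fls_power)
  have 1: "fls_X ^ (N + M) * a i = fps_to_fls (fps_X ^ M * q i)" if "i \<in> S" for i
    using q that by (simp add: power_add mult_ac X fls_times_fps_to_fls)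
  have 2: "fls_X ^ (N + M) * a s = fps_to_fls (fps_X ^ N * r)"
    using r by (simp add: power_add mult_ac X fls_times_fps_to_fls)
  show ?case
    by (rule exI[of _ "N + M"], rule exI[of _ "\<lambda>i. if i = s then fps_X ^ N * r else fps_X ^ M * q i"])
      (use 1 2 in auto)
qed simp

end

section \<open>Power series in a d-th root of pi\<close>

locale ramified = laurent \<iota> p for \<iota> :: "'k::alg_closed_field fls \<Rightarrow> 'l::alg_closed_field" and p +
  fixes d :: nat
  assumes d: "d > 0"
begin

text \<open>The inclusion of k[[pi]] into k[[w]] with pi = w^d; the variable of the result stands
  for w.\<close>

definition up :: "'k fps \<Rightarrow> 'k fps" where
  "up g = Abs_fps (\<lambda>n. if d dvd n then fps_nth g (n div d) else 0)"

text \<open>The component at w^s of a series in w, when k[[w]] is viewed as a free k[[pi]]-module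
  with basis 1, w, ..., w^(d-1).\<close>

definition dis :: "nat \<Rightarrow> 'k fps \<Rightarrow> 'k fps" where
  "dis s f = Abs_fps (\<lambda>n. fps_nth f (d * n + s))"

definition ramify :: "'l \<Rightarrow> 'k fps \<Rightarrow> 'l" where
  "ramify w f = (\<Sum>s<d. w ^ s * J (dis s f))"

definition root_pi :: "'l \<Rightarrow> bool" where "root_pi w \<longleftrightarrow> w ^ d = \<iota> fls_X"

lemma up_compose: "up g = g oo fps_X ^ d"
proof (rule fps_ext)
  fix n
  have "(g oo fps_X ^ d) = Abs_fps (\<lambda>n. \<Sum>i=0..n. fps_nth g i * fps_nth ((fps_X ^ d) ^ i) n)"
    by (simp add: fps_compose_def)
  then have "fps_nth (g oo fps_X ^ d) n = (\<Sum>i=0..n. if n = d * i then fps_nth g i else 0)"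
    by (simp add: power_mult[symmetric] fps_X_power_nth if_distrib cong: if_cong)
  also have "\<dots> = (if d dvd n then fps_nth g (n div d) else 0)"
  proof (cases "d dvd n")
    case True
    then obtain m where m: "n = d * m" ..
    have "m \<le> n" using d by (simp add: m)
    have "(\<Sum>i=0..n. if n = d * i then fps_nth g i else 0) = (\<Sum>i=0..n. if i = m then fps_nth g i else 0)"
      using d by (intro sum.cong refl) (auto simp: m)
    then show ?thesis using \<open>m \<le> n\<close> d m by simp
  next
    case False
    then show ?thesis by (auto intro!: sum.neutral)
  qed
  finally show "fps_nth (up g) n = fps_nth (g oo fps_X ^ d) n" by (simp add: up_def)
qed

lemma up_mult: "up (f * g) = up f * up g"
  unfolding up_compose by (rule fps_compose_mult_distrib) (use d in \<open>simp add: fps_X_power_nth\<close>)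

lemma up_nth_0: "fps_nth (up g) 0 = fps_nth g 0"
  by (simp add: up_def)

lemma ramify_add: "ramify w (f + g) = ramify w f + ramify w g"
proof -
  have "dis s (f + g) = dis s f + dis s g" for s by (rule fps_ext) (simp add: dis_def)
  then show ?thesis by (simp add: ramify_def Jh.hom_add algebra_simps sum.distrib)
qed

lemma ramify_zero: "ramify w 0 = 0"
proof -
  have "dis s 0 = 0" for s by (rule fps_ext) (simp add: dis_def)
  then show ?thesis by (simp add: ramify_def Jh.hom_zero)
qed

lemma ramify_sum: "ramify w (\<Sum>i\<in>A. f i) = (\<Sum>i\<in>A. ramify w (f i))"
  by (induction A rule: infinite_finite_induct) (auto simp: ramify_zero ramify_add)

text \<open>With m = d e + s0, only the component at s0 is nonzero, and pi^e accounts for the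
  remaining power of w. Multiplicativity of \<open>ramify\<close> is reduced to this case.\<close>

lemma ramify_monom:
  assumes w: "root_pi w"
  shows "ramify w (fps_X ^ m * up g) = w ^ m * J g"
proof -
  define e s0 where "e = m div d" and "s0 = m mod d"
  have m: "m = d * e + s0" by (simp add: e_def s0_def)
  have s0: "s0 < d" using d by (simp add: s0_def)
  have "dis s (fps_X ^ m * up g) = (if s = s0 then fps_X ^ e * g else 0)" if s: "s < d" for s
  proof (rule fps_ext)
    fix n
    have "fps_nth (dis s (fps_X ^ m * up g)) n =
        (if d * n + s < m then 0 else if d dvd (d * n + s - m) then fps_nth g ((d * n + s - m) div d) else 0)"
      by (simp add: dis_def up_def fps_X_power_mult_nth)
    also have "\<dots> = fps_nth (if s = s0 then fps_X ^ e * g else 0) n"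
    proof (cases "d * n + s < m")
      case True
      have "n < e" if "s = s0"
      proof -
        have "d * n < d * e" using True that by (simp add: m)
        then show ?thesis using d by simp
      qed
      then show ?thesis using True by (auto simp: fps_X_power_mult_nth)
    next
      case False
      show ?thesis
      proof (cases "s = s0")
        case True
        have "d * e \<le> d * n" using False True m by linarith
        then have "e \<le> n" using d unfolding mult_le_cancel1 by simp
        have "d * n + s - m = d * (n - e)" by (simp add: m True diff_mult_distrib2)
        then show ?thesis using False True \<open>e \<le> n\<close> d by (simp add: fps_X_power_mult_nth)
      next
        case ne: False
        have "\<not> d dvd (d * n + s - m)"
        proof
          assume "d dvd (d * n + s - m)"
          then obtain j where "d * n + s - m = d * j" ..
          then have "d * n + s = d * j + m" using False by linarith
          then have "(d * n + s) mod d = (d * j + (d * e + s0)) mod d" by (simp add: m)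
          then have "s = s0" using s s0 by (simp add: add.assoc[symmetric] distrib_left[symmetric] del: distrib_left)
          with ne show False by contradiction
        qed
        then show ?thesis using False ne by simp
      qed
    qed
    finally show "fps_nth (dis s (fps_X ^ m * up g)) n = fps_nth (if s = s0 then fps_X ^ e * g else 0) n" .
  qed
  then have "ramify w (fps_X ^ m * up g) = (\<Sum>s<d. if s = s0 then w ^ s * J (fps_X ^ e * g) else 0)"
    unfolding ramify_def by (intro sum.cong refl) (simp add: Jh.hom_zero)
  also have "\<dots> = w ^ s0 * J (fps_X ^ e * g)" using s0 by simp
  also have "J (fps_X ^ e * g) = (w ^ d) ^ e * J g"
    using w by (simp add: Jh.hom_mult Jh.hom_power root_pi_def) (simp add: J_def)
  finally show ?thesis by (simp add: m power_add power_mult mult_ac)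
qed

lemma dissect: "f = (\<Sum>s<d. fps_X ^ s * up (dis s f))"
proof (rule fps_ext)
  fix n
  have "fps_nth (\<Sum>s<d. fps_X ^ s * up (dis s f)) n = (\<Sum>s<d. if s = n mod d then fps_nth f n else 0)"
    unfolding fps_sum_nth
  proof (rule sum.cong[OF refl])
    fix s assume s: "s \<in> {..<d}"
    show "fps_nth (fps_X ^ s * up (dis s f)) n = (if s = n mod d then fps_nth f n else 0)"
    proof (cases "s = n mod d")
      case True
      then have "s \<le> n" "n - s = d * (n div d)" by (simp_all add: minus_mod_eq_mult_div)
      moreover have "d * (n div d) + s = n" using True by simp
      moreover have "\<not> n < n mod d" by (simp add: leD)
      ultimately show ?thesis using True d by (simp add: fps_X_power_mult_nth up_def dis_def)
    next
      case False
      have "n < s \<or> \<not> d dvd (n - s)"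
      proof (rule ccontr)
        assume "\<not> ?thesis"
        then have "s \<le> n" "d dvd (n - s)" by auto
        then obtain j where "n = s + d * j" by (metis dvd_def le_add_diff_inverse)
        then show False using False s by simp
      qed
      then show ?thesis using False by (auto simp: fps_X_power_mult_nth up_def)
    qed
  qed
  also have "\<dots> = fps_nth f n" using d by simp
  finally show "fps_nth f n = fps_nth (\<Sum>s<d. fps_X ^ s * up (dis s f)) n" ..
qed

lemma ramify_mult:
  assumes w: "root_pi w"
  shows "ramify w (f * g) = ramify w f * ramify w g"
proof -
  have "f * g = (\<Sum>s<d. \<Sum>t<d. fps_X ^ (s + t) * up (dis s f * dis t g))"
    by (subst dissect[of f], subst dissect[of g])
      (simp add: sum_product up_mult power_add mult_ac)
  then have "ramify w (f * g) = (\<Sum>s<d. \<Sum>t<d. w ^ (s + t) * J (dis s f * dis t g))"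
    by (simp add: ramify_sum ramify_monom[OF w])
  also have "\<dots> = ramify w f * ramify w g"
    by (simp add: ramify_def sum_product Jh.hom_mult power_add mult_ac)
  finally show ?thesis .
qed

lemma ramify_one: "root_pi w \<Longrightarrow> ramify w 1 = 1"
  using ramify_monom[of w 0 1] by (simp add: up_compose)

lemma ramify_pow: "root_pi w \<Longrightarrow> ramify w (f ^ m) = ramify w f ^ m"
  by (induction m) (simp_all add: ramify_one ramify_mult)

lemma root_pi_nonzero: "root_pi w \<Longrightarrow> w \<noteq> 0"
  using d by (auto simp: root_pi_def power_0_left)

lemma ramify_X: "root_pi w \<Longrightarrow> ramify w fps_X = w"
  using ramify_monom[of w 1 1] by (simp add: up_compose)

text \<open>A nonzero series is a unit times a power of the variable. The unit has invertible image,
  and w is nonzero.\<close>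

lemma ramify_nonzero:
  assumes w: "root_pi w" and f: "f \<noteq> 0" shows "ramify w f \<noteq> 0"
proof -
  define u where "u = fps_shift (subdegree f) f"
  have fu: "f = u * fps_X ^ subdegree f" unfolding u_def by (rule subdegree_decompose)
  have "fps_nth u 0 \<noteq> 0" using f by (simp add: u_def)
  then have "u * inverse u = 1" by (rule inverse_mult_eq_1')
  then have "ramify w u * ramify w (inverse u) = 1"
    using ramify_mult[OF w, of u "inverse u"] ramify_one[OF w] by simp
  then have "ramify w u \<noteq> 0" by auto
  then show ?thesis
    using root_pi_nonzero[OF w] by (subst fu) (simp add: ramify_mult[OF w] ramify_pow[OF w] ramify_X[OF w])
qed

lemma ramify_inj: "root_pi w \<Longrightarrow> ramify w f = ramify w g \<Longrightarrow> f = g"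
proof -
  assume w: "root_pi w" and eq: "ramify w f = ramify w g"
  have "ramify w (f - g) + ramify w g = ramify w f" by (simp add: ramify_add[symmetric])
  then have "ramify w (f - g) = 0" using eq by simp
  then show "f = g" using ramify_nonzero[OF w, of "f - g"] by auto
qed

text \<open>For every d-th root v of pi, a fixed power of pi times P(v) is the value at v of one and
  the same series F. Injectivity at w forces F = 0, and so P vanishes at the other roots too. This
  takes the place of irreducibility of X^d - pi.\<close>

lemma conjugate_roots:
  assumes w: "root_pi w" and w': "root_pi w'" and P: "pl P w = 0"
  shows "pl P w' = 0"
proof -
  obtain N q where q: "\<forall>i\<in>{..degree P}. fls_X ^ N * coeff P i = fps_to_fls (q i)"
    using common_denominator[of "{..degree P}" "coeff P"] by auto
  \<comment> \<open>The polynomial pi^N P with each pi in its coefficients replaced by the d-th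
    power of the variable.\<close>
  define F where "F = (\<Sum>i\<le>degree P. fps_X ^ i * up (q i))"
  have key: "\<iota> fls_X ^ N * pl P v = ramify v F" if v: "root_pi v" for v
  proof -
    have "\<iota> fls_X ^ N * pl P v = (\<Sum>i\<le>degree P. v ^ i * \<iota> (fls_X ^ N * coeff P i))"
      unfolding pl_sum sum_distrib_left by (intro sum.cong refl) (simp add: hom_distribs mult_ac)
    also have "\<dots> = (\<Sum>i\<le>degree P. v ^ i * J (q i))"
      using q by (intro sum.cong refl) (simp add: J_def)
    also have "\<dots> = ramify v F" unfolding F_def by (simp add: ramify_sum ramify_monom[OF v])
    finally show ?thesis .
  qed
  have "ramify w F = 0" using key[OF w] P by simp
  then have "F = 0" using ramify_nonzero[OF w] by blast
  then have "\<iota> fls_X ^ N * pl P w' = 0" using key[OF w'] by (simp add: ramify_zero)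
  then show ?thesis by simp
qed

lemma hom_ramify:
  fixes h :: "'l \<Rightarrow> 'l"
  assumes h: "\<And>x y. h (x + y) = h x + h y" "\<And>x y. h (x * y) = h x * h y" "\<And>a. h (\<iota> a) = \<iota> a"
  shows "h (ramify w f) = ramify (h w) f"
proof -
  have h1: "h 1 = 1" "h 0 = 0" using h(3)[of 1] h(3)[of 0] by simp_all
  have hs: "h (sum g A) = (\<Sum>a\<in>A. h (g a))" for g :: "nat \<Rightarrow> 'l" and A
    by (induction A rule: infinite_finite_induct) (auto simp: h1 h(1))
  show ?thesis unfolding ramify_def by (simp add: hs h(2,3) hom_pow[of h, OF h(2) h1(1)] J_def)
qed

text \<open>As d + 1 = p^c, the product w pi equals w^(p^c), a power of w^p; dividing by pi puts w
  into K[w^p].\<close>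

lemma root_pi_sep:
  assumes w: "root_pi w" and dq: "Suc d = p ^ c" "c \<ge> 1" shows "sep w"
proof -
  obtain c' where c': "c = Suc c'" using dq(2) by (cases c) auto
  have "w * \<iota> fls_X = w ^ Suc d" using w by (simp add: root_pi_def)
  also have "\<dots> = (w ^ p) ^ (p ^ c')" by (simp add: dq c' power_mult)
  finally have eq: "w * \<iota> fls_X = (w ^ p) ^ (p ^ c')" .
  have "\<iota> (fls_X :: 'k fls) \<noteq> 0" by simp
  then have "w = \<iota> (inverse fls_X) * (w ^ p) ^ (p ^ c')"
    unfolding eq[symmetric] by (simp add: hom_distribs)
  also have "\<dots> \<in> adj (w ^ p)"
    by (intro adj_mult adj_const adj_pow adj_self)
  finally show ?thesis by (simp add: sep_def)
qed


text \<open>The factor z^s at component s is the factor z^(d n + s) at each of its coefficients,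
  since z^d = 1.\<close>

lemma ramify_twist:
  assumes z: "z ^ d = 1"
  shows "ramify (\<iota> (fls_const z) * w) f = ramify w (Abs_fps (\<lambda>n. z ^ n * fps_nth f n))"
proof -
  have "dis s (Abs_fps (\<lambda>n. z ^ n * fps_nth f n)) = fps_const (z ^ s) * dis s f" for s
    by (rule fps_ext) (simp add: dis_def power_add power_mult z)
  moreover have "J (fps_const (z ^ s)) = \<iota> (fls_const z) ^ s" for s
    by (simp add: J_def hom_power[symmetric] fls_const_power)
  ultimately show ?thesis
    unfolding ramify_def by (simp add: Jh.hom_mult power_mult_distrib mult_ac)
qed

end

section \<open>The roots of the Hasse polynomial as power series\<close>

locale hasse_roots = ramified \<iota> p d for \<iota> :: "'k::alg_closed_field fls \<Rightarrow> 'l::alg_closed_field" and p d +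
  fixes c :: nat and \<alpha> :: "nat \<Rightarrow> 'k fps" and w :: 'l
  assumes dq: "Suc d = p ^ c" and c1: "c \<ge> 1" and \<alpha>0: "fps_nth (\<alpha> 0) 0 \<noteq> 0" and w: "root_pi w"
begin

abbreviation \<beta> where "\<beta> \<equiv> fps_nth (\<alpha> 0) 0"

text \<open>Here \<open>\<alpha> i\<close> plays the part of a_i / pi, so the equation says Q(x) =
  0.\<close>

definition hasse_root :: "'l \<Rightarrow> bool" where
  "hasse_root x \<longleftrightarrow> x ^ (p ^ c) = (\<Sum>i<c. J (fps_X * \<alpha> i) * x ^ (p ^ i))"

text \<open>The equation Q(w u) = 0 divided by w^q. In term i the factor pi contributes w^d and
  X^(p^i) contributes w^(p^i), and d + p^i - q = p^i - 1; on the right only i = 0 survives modulo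
  w.\<close>

definition series_root :: "'k fps \<Rightarrow> bool" where
  "series_root u \<longleftrightarrow> u ^ (p ^ c) = (\<Sum>i<c. up (\<alpha> i) * fps_X ^ (p ^ i - 1) * u ^ (p ^ i))"

lemma p1: "p > 1" using prime_gt_1_nat[OF p] .

lemma qc: "p ^ c > 1" by (rule one_less_power[OF p1]) (use c1 in simp)

lemma series_root_hasse: assumes u: "series_root u" shows "hasse_root (ramify w (fps_X * u))"
proof -
  have JX: "J (fps_X * \<alpha> i) = ramify w (fps_X ^ d * up (\<alpha> i))" for i
    using w by (simp add: ramify_monom Jh.hom_mult root_pi_def) (simp add: J_def)
  have "(\<Sum>i<c. J (fps_X * \<alpha> i) * ramify w (fps_X * u) ^ (p ^ i)) =
      ramify w (\<Sum>i<c. fps_X ^ d * up (\<alpha> i) * (fps_X * u) ^ (p ^ i))"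
    by (simp add: JX ramify_sum ramify_mult[OF w] ramify_pow[OF w])
  also have "(\<Sum>i<c. fps_X ^ d * up (\<alpha> i) * (fps_X * u) ^ (p ^ i)) =
      (\<Sum>i<c. fps_X ^ Suc d * (up (\<alpha> i) * fps_X ^ (p ^ i - 1) * u ^ (p ^ i)))"
  proof (rule sum.cong[OF refl])
    fix i
    have "p ^ i = Suc (p ^ i - 1)" using p1 by simp
    then have "fps_X ^ (p ^ i) = (fps_X :: 'k fps) * fps_X ^ (p ^ i - 1)" by (metis power_Suc)
    then show "fps_X ^ d * up (\<alpha> i) * (fps_X * u) ^ (p ^ i) =
        fps_X ^ Suc d * (up (\<alpha> i) * fps_X ^ (p ^ i - 1) * u ^ (p ^ i))"
      by (simp add: power_mult_distrib mult_ac)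
  qed
  also have "\<dots> = (fps_X * u) ^ (p ^ c)"
    using u unfolding series_root_def sum_distrib_left[symmetric]
    by (simp only: dq power_mult_distrib)
  finally show ?thesis unfolding hasse_root_def by (simp add: ramify_pow[OF w])
qed

lemma series_root_add:
  assumes "series_root u" "series_root v" shows "series_root (u + v)"
  using assms unfolding series_root_def by (simp add: fps_frob_add distrib_left sum.distrib)

lemma series_root_nth_0:
  assumes "series_root u" shows "fps_nth u 0 ^ (p ^ c) = \<beta> * fps_nth u 0"
proof -
  have pw: "fps_nth (v ^ m) 0 = fps_nth v 0 ^ m" for v :: "'k fps" and m by (induction m) auto
  have "fps_nth u 0 ^ (p ^ c) = (\<Sum>i<c. fps_nth (up (\<alpha> i) * fps_X ^ (p ^ i - 1) * u ^ (p ^ i)) 0)"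
    using arg_cong[OF assms[unfolded series_root_def], of "\<lambda>f. fps_nth f 0"] by (simp add: pw fps_sum_nth)
  also have "\<dots> = (\<Sum>i<c. if i = 0 then \<beta> * fps_nth u 0 else 0)"
  proof (rule sum.cong[OF refl])
    fix i
    have "p ^ i - 1 \<noteq> 0" if "i \<noteq> 0" using p1 that one_less_power[of p i] by simp
    then show "fps_nth (up (\<alpha> i) * fps_X ^ (p ^ i - 1) * u ^ (p ^ i)) 0 = (if i = 0 then \<beta> * fps_nth u 0 else 0)"
      by (simp add: pw up_nth_0 power_0_left)
  qed
  finally show ?thesis using c1 by simp
qed

text \<open>For N > 0 the coefficient u_N enters coefficient N of the right-hand side exactly as
  \<beta> u_N, and that of u^q not at all. Hence u_N + (u^q - R u)_N / \<beta> involves lower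
  coefficients only, and a fixed point of \<Phi> solves the equation in every positive degree. In
  degree 0 it is the assumption on t.\<close>

lemma series_root_exists:
  assumes t: "t ^ (p ^ c) = \<beta> * t" shows "\<exists>u. series_root u \<and> fps_nth u 0 = t"
proof -
  define R where "R u = (\<Sum>i<c. up (\<alpha> i) * fps_X ^ (p ^ i - 1) * u ^ (p ^ i))" for u
  define \<Phi> where "\<Phi> u = Abs_fps (\<lambda>N. if N = 0 then t else
      fps_nth u N + inverse \<beta> * (fps_nth (u ^ (p ^ c)) N - fps_nth (R u) N))" for u
  have "\<exists>u. \<Phi> u = u"
  proof (rule fps_contraction_fixpoint)
    fix u v :: "'k fps" and N
    assume eq: "\<And>l. l < N \<Longrightarrow> fps_nth u l = fps_nth v l"
    show "fps_nth (\<Phi> u) N = fps_nth (\<Phi> v) N"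
    proof (cases "N = 0")
      case False
      define D where "D = u - v"
      define D' where "D' = fps_shift N D"
      have D: "D = fps_X ^ N * D'" unfolding D'_def by (rule fps_cutoff_factor) (simp add: D_def eq)
      \<comment> \<open>An m-th power of a series of order at least N has order at least N m > N;
        this disposes of u^q and of all terms except i = 0.\<close>
      have small: "fps_nth (f * D ^ m) N = 0" if "m > 1" for f m
      proof -
        have e: "f * D ^ m = fps_X ^ (N * m) * (f * D' ^ m)"
          by (subst D) (simp only: power_mult_distrib power_mult mult_ac)
        have "N < N * m" using False that by simp
        then show ?thesis unfolding e by (simp add: fps_X_power_mult_nth)
      qed
      have "u ^ (p ^ c) - v ^ (p ^ c) = 1 * D ^ (p ^ c)" by (simp add: D_def fps_frob_diff)
      then have 1: "fps_nth (u ^ (p ^ c)) N = fps_nth (v ^ (p ^ c)) N"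
        using small[OF qc, of 1] by (metis eq_iff_diff_eq_0 fps_sub_nth)
      have "R u - R v = (\<Sum>i<c. up (\<alpha> i) * fps_X ^ (p ^ i - 1) * D ^ (p ^ i))"
        unfolding R_def sum_subtractf[symmetric] D_def by (simp add: fps_frob_diff algebra_simps)
      from arg_cong[OF this, of "\<lambda>f. fps_nth f N"]
      have "fps_nth (R u) N - fps_nth (R v) N =
          (\<Sum>i<c. fps_nth (up (\<alpha> i) * fps_X ^ (p ^ i - 1) * D ^ (p ^ i)) N)"
        by (simp only: fps_sub_nth fps_sum_nth)
      also have "\<dots> = (\<Sum>i<c. if i = 0 then \<beta> * fps_nth D N else 0)"
      proof (rule sum.cong[OF refl])
        fix i
        show "fps_nth (up (\<alpha> i) * fps_X ^ (p ^ i - 1) * D ^ (p ^ i)) N = (if i = 0 then \<beta> * fps_nth D N else 0)"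
        proof (cases "i = 0")
          case True
          have e: "up (\<alpha> 0) * D = fps_X ^ N * (up (\<alpha> 0) * D')"
            by (subst D) (simp only: mult_ac)
          have "fps_nth (up (\<alpha> 0) * D) N = \<beta> * fps_nth D' 0"
            unfolding e by (simp add: fps_X_power_mult_nth up_nth_0)
          moreover have "fps_nth D' 0 = fps_nth D N" by (simp add: D'_def)
          ultimately show ?thesis using True by simp
        next
          case False
          then have "p ^ i > 1" by (intro one_less_power[OF p1]) simp
          then show ?thesis using small False by simp
        qed
      qed
      also have "\<dots> = \<beta> * fps_nth D N" using c1 by simp
      finally have 2: "fps_nth (R u) N = fps_nth (R v) N + \<beta> * (fps_nth u N - fps_nth v N)"
        by (simp add: D_def algebra_simps)
      show ?thesis using False \<alpha>0 unfolding \<Phi>_def by (simp add: 1 2 field_simps)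
    qed (simp add: \<Phi>_def)
  qed
  then obtain u where u: "\<Phi> u = u" ..
  have u0: "fps_nth u 0 = t" using arg_cong[OF u, of "\<lambda>f. fps_nth f 0"] by (simp add: \<Phi>_def)
  have "fps_nth (u ^ (p ^ c)) N = fps_nth (R u) N" for N
  proof (cases "N = 0")
    case False
    have "fps_nth u N + inverse \<beta> * (fps_nth (u ^ (p ^ c)) N - fps_nth (R u) N) = fps_nth u N"
      using arg_cong[OF u, of "\<lambda>f. fps_nth f N"] False by (simp add: \<Phi>_def)
    then show ?thesis using \<alpha>0 by simp
  next
    case True
    have pw: "fps_nth (v ^ m) 0 = fps_nth v 0 ^ m" for v :: "'k fps" and m by (induction m) auto
    have "fps_nth (R u) 0 = (\<Sum>i<c. if i = 0 then \<beta> * t else 0)"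
      unfolding R_def fps_sum_nth
    proof (rule sum.cong[OF refl])
      fix i
      have "p ^ i - 1 \<noteq> 0" if "i \<noteq> 0" using p1 that one_less_power[of p i] by simp
      then show "fps_nth (up (\<alpha> i) * fps_X ^ (p ^ i - 1) * u ^ (p ^ i)) 0 = (if i = 0 then \<beta> * t else 0)"
        by (simp add: pw up_nth_0 power_0_left u0)
    qed
    then show ?thesis using True c1 t by (simp add: pw u0)
  qed
  then have "u ^ (p ^ c) = R u" by (rule fps_ext)
  then show ?thesis using u0 unfolding series_root_def R_def by blast
qed

text \<open>The equation reads X - X^q / \<beta> = 0, and its left side has derivative 1 in
  characteristic p, hence q simple roots.\<close>

lemma card_residues: "card {t :: 'k. t ^ (p ^ c) = \<beta> * t} = p ^ c"
proof -
  define T where "T = [:0, 1:] + monom (- inverse \<beta>) (p ^ c)"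
  have "(of_nat p :: 'k) = 0" using char_k by (metis of_nat_CHAR)
  then have "(of_nat (p ^ c) :: 'k) = 0" using c1 by (simp add: of_nat_power power_0_left)
  then have "pderiv (monom (- inverse \<beta>) (p ^ c)) = 0" by (simp only: pderiv_monom) simp
  then have "pderiv T = 1" by (simp add: T_def pderiv_add pderiv_pCons one_pCons)
  then have "card {t. poly T t = 0} = degree T"
    by (intro card_roots_rsquarefree rsquarefree_pderiv_one)
  moreover have "degree T = p ^ c"
    unfolding T_def using qc \<alpha>0 by (subst degree_add_eq_right) (simp_all add: degree_monom_eq)
  moreover have "{t. poly T t = 0} = {t. t ^ (p ^ c) = \<beta> * t}"
    using \<alpha>0 by (auto simp: T_def poly_monom field_simps)
  ultimately show ?thesis by simp
qed

lemma roots_finite_card: "finite {x. hasse_root x} \<and> card {x. hasse_root x} \<le> p ^ c"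
proof -
  define Q where "Q = monom 1 (p ^ c) - (\<Sum>i<c. monom (J (fps_X * \<alpha> i)) (p ^ i))"
  have "coeff Q (p ^ c) = 1"
  proof -
    have "p ^ i \<noteq> p ^ c" if "i < c" for i using that p1 by simp
    then show ?thesis by (simp add: Q_def coeff_sum)
  qed
  then have Q0: "Q \<noteq> 0" by (metis coeff_0 zero_neq_one)
  have "degree Q \<le> p ^ c"
  proof (rule degree_le, safe)
    fix n assume n: "p ^ c < n"
    have "n \<noteq> p ^ i" if "i < c" for i using n that power_increasing[of i c p] p1 by auto
    then have "(\<Sum>i<c. if p ^ i = n then J (fps_X * \<alpha> i) else 0) = 0" by (intro sum.neutral) auto
    then show "coeff Q n = 0" using n by (simp add: Q_def coeff_sum)
  qed
  moreover have "{x. hasse_root x} = {x. poly Q x = 0}"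
    by (auto simp: Q_def hasse_root_def poly_monom poly_sum)
  ultimately show ?thesis using poly_roots_finite[OF Q0] card_poly_roots_bound[OF Q0] by simp
qed

lemma series_unique: "ramify w (fps_X * u) = ramify w (fps_X * v) \<Longrightarrow> u = v"
  using ramify_inj[OF w, of "fps_X * u" "fps_X * v"] by simp

text \<open>The q residues lift to series with distinct images, and there are at most q roots, so
  the chosen lifts exhaust them. The same count leaves no room for a second series with the same
  constant term.\<close>

lemma hasse_root_series:
  shows "hasse_root x \<Longrightarrow> \<exists>u. series_root u \<and> x = ramify w (fps_X * u)"
    and "series_root u \<Longrightarrow> series_root v \<Longrightarrow> fps_nth u 0 = fps_nth v 0 \<Longrightarrow> u = v"
proof -
  let ?T = "{t :: 'k. t ^ (p ^ c) = \<beta> * t}"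
  have "\<forall>t\<in>?T. \<exists>u. series_root u \<and> fps_nth u 0 = t" using series_root_exists by simp
  then obtain U where U: "\<And>t. t \<in> ?T \<Longrightarrow> series_root (U t)" "\<And>t. t \<in> ?T \<Longrightarrow> fps_nth (U t) 0 = t"
    by metis
  define \<rho> where "\<rho> t = ramify w (fps_X * U t)" for t
  have inj: "inj_on \<rho> ?T"
  proof (rule inj_onI)
    fix t t' assume t: "t \<in> ?T" "t' \<in> ?T" and "\<rho> t = \<rho> t'"
    then have e: "U t = U t'" unfolding \<rho>_def by (rule_tac series_unique)
    show "t = t'" by (rule trans[OF U(2)[OF t(1), symmetric] U(2)[OF t(2), folded e]])
  qed
  have sub: "\<rho> ` ?T \<subseteq> {x. hasse_root x}" using U(1) series_root_hasse by (auto simp: \<rho>_def)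
  have "card (\<rho> ` ?T) = p ^ c" using card_image[OF inj] card_residues by simp
  then have eq: "\<rho> ` ?T = {x. hasse_root x}"
    using card_seteq[OF _ sub] roots_finite_card by simp
  show 1: "\<exists>u. series_root u \<and> x = ramify w (fps_X * u)" if "hasse_root x" for x
    using that eq U(1) unfolding \<rho>_def by blast
  have U_eq: "u = U (fps_nth u 0)" if u: "series_root u" for u
  proof -
    have "ramify w (fps_X * u) \<in> \<rho> ` ?T" using series_root_hasse[OF u] eq by simp
    then obtain t where t: "t \<in> ?T" "ramify w (fps_X * u) = ramify w (fps_X * U t)" by (auto simp: \<rho>_def)
    then have "u = U t" using series_unique by blast
    then show ?thesis using U(2)[OF t(1)] by simp
  qed
  show "u = v" if "series_root u" "series_root v" "fps_nth u 0 = fps_nth v 0"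
    using U_eq[OF that(1)] U_eq[OF that(2)] that(3) by simp
qed

text \<open>The residue of x / w. The description has a unique solution on roots by
  \<open>series_unique\<close> and \<open>hasse_root_series\<close>.\<close>

definition lead :: "'l \<Rightarrow> 'k" where
  "lead x = fps_nth (THE u. series_root u \<and> x = ramify w (fps_X * u)) 0"

lemma lead_eq: "series_root u \<Longrightarrow> lead (ramify w (fps_X * u)) = fps_nth u 0"
proof -
  assume u: "series_root u"
  have "(THE v. series_root v \<and> ramify w (fps_X * u) = ramify w (fps_X * v)) = u"
    by (rule the_equality) (use u in \<open>auto dest: series_unique\<close>)
  then show ?thesis by (simp add: lead_def)
qed

lemma lead_bij: "bij_betw lead {x. hasse_root x} {t. t ^ (p ^ c) = \<beta> * t}"
proof (rule bij_betw_imageI)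
  show "inj_on lead {x. hasse_root x}"
  proof (rule inj_onI)
    fix x y assume "x \<in> {x. hasse_root x}" "y \<in> {x. hasse_root x}" and eq: "lead x = lead y"
    then have "hasse_root x" "hasse_root y" by simp_all
    from hasse_root_series(1)[OF this(1)] hasse_root_series(1)[OF this(2)]
    obtain u v where uv: "series_root u" "x = ramify w (fps_X * u)" "series_root v" "y = ramify w (fps_X * v)"
      by (elim exE conjE)
    then have "fps_nth u 0 = fps_nth v 0" using eq lead_eq by simp
    then show "x = y" using hasse_root_series(2)[of u v] uv by simp
  qed
  show "lead ` {x. hasse_root x} = {t. t ^ (p ^ c) = \<beta> * t}"
  proof (intro equalityI subsetI)
    fix t assume "t \<in> lead ` {x. hasse_root x}"
    then obtain u where "series_root u" "t = fps_nth u 0" using hasse_root_series(1) lead_eq by auto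
    then show "t \<in> {t. t ^ (p ^ c) = \<beta> * t}" using series_root_nth_0 by simp
  next
    fix t assume "t \<in> {t. t ^ (p ^ c) = \<beta> * t}"
    then obtain u where "series_root u" "fps_nth u 0 = t" using series_root_exists by auto
    then show "t \<in> lead ` {x. hasse_root x}"
      using series_root_hasse lead_eq by (intro image_eqI[of _ _ "ramify w (fps_X * u)"]) auto
  qed
qed

lemma lead_add: "hasse_root x \<Longrightarrow> hasse_root y \<Longrightarrow> lead (x + y) = lead x + lead y"
proof -
  assume "hasse_root x" "hasse_root y"
  from hasse_root_series(1)[OF this(1)] hasse_root_series(1)[OF this(2)]
  obtain u v where uv: "series_root u" "x = ramify w (fps_X * u)" "series_root v" "y = ramify w (fps_X * v)"
    by (elim exE conjE)
  have "x + y = ramify w (fps_X * (u + v))" by (simp add: uv ramify_add distrib_left)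
  then show ?thesis using lead_eq[OF series_root_add[OF uv(1,3)]] lead_eq uv by simp
qed

text \<open>The equation has coefficients in K, so automorphisms over K permute its roots. On w u(w)
  such an automorphism acts only through the image of w, which twists coefficient n by z^n.\<close>

lemma hom_hasse_root:
  fixes h :: "'l \<Rightarrow> 'l"
  assumes h: "\<And>x y. h (x + y) = h x + h y" "\<And>x y. h (x * y) = h x * h y" "\<And>a. h (\<iota> a) = \<iota> a"
    and x: "hasse_root x"
  shows "hasse_root (h x)"
    and "z ^ d = 1 \<Longrightarrow> h w = \<iota> (fls_const z) * w \<Longrightarrow> lead (h x) = z * lead x"
proof -
  have h1: "h 1 = 1" "h 0 = 0" using h(3)[of 1] h(3)[of 0] by simp_all
  have hs: "h (sum g A) = (\<Sum>a\<in>A. h (g a))" for g :: "nat \<Rightarrow> 'l" and A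
    by (induction A rule: infinite_finite_induct) (auto simp: h1 h(1))
  have hp: "h (y ^ m) = h y ^ m" for y m by (rule hom_pow[of h, OF h(2) h1(1)])
  have "h (x ^ (p ^ c)) = h (\<Sum>i<c. J (fps_X * \<alpha> i) * x ^ (p ^ i))" using x by (simp add: hasse_root_def)
  then show hr: "hasse_root (h x)"
    by (simp add: hasse_root_def hs h(2) hp) (simp add: J_def h(3))
  assume z: "z ^ d = 1" and hw: "h w = \<iota> (fls_const z) * w"
  obtain u where u: "series_root u" "x = ramify w (fps_X * u)" using hasse_root_series(1)[OF x] by blast
  obtain v where v: "series_root v" "h x = ramify w (fps_X * v)" using hasse_root_series(1)[OF hr] by blast
  have "ramify w (fps_X * v) = ramify w (Abs_fps (\<lambda>n. z ^ n * fps_nth (fps_X * u) n))"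
    using v(2) unfolding u(2) hom_ramify[OF h] hw ramify_twist[OF z] by simp
  then have "fps_X * v = Abs_fps (\<lambda>n. z ^ n * fps_nth (fps_X * u) n)" by (rule ramify_inj[OF w])
  \<comment> \<open>The constant term of u is coefficient 1 of w u, so it is scaled by the first
    power of z.\<close>
  from arg_cong[OF this, of "\<lambda>f. fps_nth f 1"] have "fps_nth v 0 = z * fps_nth u 0" by simp
  then show "lead (h x) = z * lead x" using lead_eq u v by simp
qed

end

section \<open>Evaluation at the cyclic vector\<close>

text \<open>The open sets where e and 1 - e do not vanish are disjoint and cover the spectrum; the
  primes P and Q show that neither is empty.\<close>

lemma (in cring) connected_spectrum_idempotent:
  assumes conn: "connected_space (zariski R)" and e: "e \<in> carrier R" "e \<otimes> e = e"
    and P: "primeideal P R" "e \<notin> P" and Q: "primeideal Q R" "e \<in> Q"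
  shows False
proof -
  define f where "f = \<one> \<ominus> e"
  have f: "f \<in> carrier R" using e by (simp add: f_def)
  define D where "D x = {P. primeideal P R \<and> x \<notin> P}" for x
  have op: "openin (zariski R) (D x)" if "x \<in> carrier R" for x
    unfolding zariski_def D_def by (rule topology_generated_by_Basis) (use that in blast)
  have "e \<otimes> f = e \<otimes> \<one> \<ominus> e \<otimes> e" unfolding f_def using e(1) by algebra
  then have ef: "e \<otimes> f = \<zero>" using e by (simp add: r_right_minus_eq)
  have sum1: "e \<oplus> f = \<one>" unfolding f_def using e(1) by algebra
  have one_of: "e \<in> I \<or> f \<in> I" if I: "primeideal I R" for I
  proof -
    interpret I: primeideal I R by (rule I)
    have "e \<otimes> f \<in> I" unfolding ef by (rule I.zero_closed)
    then show ?thesis by (rule I.I_prime[OF e(1) f])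
  qed
  have not_both: "e \<notin> I \<or> f \<notin> I" if I: "primeideal I R" for I
  proof (rule ccontr)
    interpret I: primeideal I R by (rule I)
    assume "\<not> (e \<notin> I \<or> f \<notin> I)"
    then have "e \<oplus> f \<in> I" using I.a_closed by blast
    then have "I = carrier R" unfolding sum1 by (rule I.one_imp_carrier)
    then show False using I.I_notcarr by simp
  qed
  have top: "topspace (zariski R) \<subseteq> D e \<union> D f"
  proof
    fix I assume "I \<in> topspace (zariski R)"
    then have I: "primeideal I R" by (auto simp: zariski_def topology_generated_by_topspace)
    then show "I \<in> D e \<union> D f" using not_both[OF I] by (auto simp: D_def)
  qed
  have "D e \<inter> D f = {}" using one_of by (auto simp: D_def)
  moreover have "P \<in> D e" using P by (simp add: D_def)
  moreover have "Q \<in> D f" using Q not_both[OF Q(1)] by (simp add: D_def)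
  ultimately show False
    using conn top op[OF e(1)] op[OF f] unfolding connected_space_def by blast
qed

lemma (in laurent) fps_frob_sum:
  "(\<Sum>i\<in>A. f i :: 'k fps) ^ p = (\<Sum>i\<in>A. f i ^ p)"
proof (induction A rule: infinite_finite_induct)
  case (insert x A)
  then show ?case using fps_frob_add[of "f x" "\<Sum>i\<in>A. f i" 1] by simp
qed (use prime_gt_0_nat[OF p] in \<open>simp_all add: power_0_left\<close>)

text \<open>These are the equations for phi z = z with z the sum of the b_i phi^i v. Solving upwards
  from i = 0 expresses each b_i by y = b_{c'}, and the last equation becomes y = sum of
  a_j^(p^(c'-j)) y^(p^(c'+1-j)). Modulo pi it has a nonzero solution because a_m is a unit, and this
  solution lifts because every exponent of y on the right exceeds 1.\<close>

lemma (in laurent) unit_root_system: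
  fixes a :: "nat \<Rightarrow> 'k fps"
  assumes m: "m \<le> c'" and am: "fps_nth (a m) 0 \<noteq> 0"
  shows "\<exists>b. b c' \<noteq> 0 \<and> (\<forall>i. b c' ^ p * a i + (if i = 0 then 0 else b (i - 1) ^ p) = b i)"
proof -
  have p1: "p > 1" using prime_gt_1_nat[OF p] .
  have pw: "fps_nth (u ^ l) 0 = fps_nth u 0 ^ l" for u :: "'k fps" and l by (induction l) auto
  define al where "al j = fps_nth (a j) 0" for j
  \<comment> \<open>The reduced equation divided by its variable: the constant term -1 excludes the
    root 0, and the term j = m makes R nonconstant.\<close>
  define R where "R = (\<Sum>j\<le>c'. monom (al j ^ (p ^ (c' - j))) (p ^ (Suc c' - j) - 1)) - [:1:]"
  have ex: "p ^ (Suc c' - j) > 1" if "j \<le> c'" for j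
    by (rule one_less_power[OF p1]) (use that in simp)
  have "coeff R (p ^ (Suc c' - m) - 1) = (\<Sum>j\<le>c'. if j = m then al m ^ (p ^ (c' - m)) else 0)"
  proof -
    have nz: "p ^ (Suc c' - m) - 1 \<noteq> 0" using ex[OF m] by simp
    then have c1: "coeff [:1 :: 'k:] (p ^ (Suc c' - m) - 1) = 0" by (cases "p ^ (Suc c' - m) - 1") simp_all
    show ?thesis
      unfolding R_def coeff_diff c1 coeff_sum diff_zero
    proof (rule sum.cong[OF refl])
      fix j assume j: "j \<in> {..c'}"
      have "p ^ (Suc c' - j) - 1 = p ^ (Suc c' - m) - 1 \<longleftrightarrow> p ^ (Suc c' - j) = p ^ (Suc c' - m)"
        using ex[OF m] ex[of j] j by auto
      also have "\<dots> \<longleftrightarrow> Suc c' - j = Suc c' - m" using p1 by simp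
      also have "\<dots> \<longleftrightarrow> j = m" using m j by auto
      finally show "coeff (monom (al j ^ (p ^ (c' - j))) (p ^ (Suc c' - j) - 1)) (p ^ (Suc c' - m) - 1) =
          (if j = m then al m ^ (p ^ (c' - m)) else 0)" by simp
    qed
  qed
  then have "coeff R (p ^ (Suc c' - m) - 1) \<noteq> 0" using m am by (simp add: al_def)
  then have "p ^ (Suc c' - m) - 1 \<le> degree R" by (rule le_degree)
  then have "degree R > 0" using ex[OF m] by simp
  then obtain t where t: "poly R t = 0" using alg_closed_imp_poly_has_root by blast
  have Rt: "poly R x = (\<Sum>j\<le>c'. al j ^ (p ^ (c' - j)) * x ^ (p ^ (Suc c' - j) - 1)) - 1" for x
    by (simp add: R_def poly_sum poly_monom)
  have t0: "t \<noteq> 0"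
  proof
    assume "t = 0"
    moreover have "(\<Sum>j\<le>c'. al j ^ (p ^ (c' - j)) * 0 ^ (p ^ (Suc c' - j) - 1)) = 0"
    proof (rule sum.neutral, safe)
      fix j assume "j \<le> c'"
      then have "p ^ (Suc c' - j) - 1 \<noteq> 0" using ex[of j] by simp
      then show "al j ^ (p ^ (c' - j)) * (0 :: 'k) ^ (p ^ (Suc c' - j) - 1) = 0"
        by (simp only: power_0_left if_False mult_zero_right)
    qed
    ultimately show False using t unfolding Rt by simp
  qed
  have sumt: "(\<Sum>j\<le>c'. al j ^ (p ^ (c' - j)) * t ^ (p ^ (Suc c' - j))) = t"
  proof -
    have "(\<Sum>j\<le>c'. al j ^ (p ^ (c' - j)) * t ^ (p ^ (Suc c' - j))) =
        (\<Sum>j\<le>c'. al j ^ (p ^ (c' - j)) * t ^ (p ^ (Suc c' - j) - 1)) * t"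
      unfolding sum_distrib_right
    proof (rule sum.cong[OF refl])
      fix j assume "j \<in> {..c'}"
      then have "p ^ (Suc c' - j) = Suc (p ^ (Suc c' - j) - 1)" using ex[of j] by simp
      then have "t ^ (p ^ (Suc c' - j)) = t ^ (p ^ (Suc c' - j) - 1) * t" by (metis power_Suc2)
      then show "al j ^ (p ^ (c' - j)) * t ^ (p ^ (Suc c' - j)) =
          al j ^ (p ^ (c' - j)) * t ^ (p ^ (Suc c' - j) - 1) * t" by (simp only: mult.assoc)
    qed
    then show ?thesis using t unfolding Rt by simp
  qed
  \<comment> \<open>The value forced on b_i once b_{c'} = y is given.\<close>
  define B where "B y i = (\<Sum>j\<le>i. a j ^ (p ^ (i - j)) * y ^ (p ^ (Suc i - j)))" for y i
  \<comment> \<open>Pinning the constant term to t makes the fixed point nonzero; zero would be a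
    fixed point of \<open>B\<close> as well.\<close>
  define \<Phi> where "\<Phi> y = Abs_fps (\<lambda>N. if N = 0 then t else fps_nth (B y c') N)" for y
  have "\<exists>y. \<Phi> y = y"
  proof (rule fps_contraction_fixpoint)
    fix y z :: "'k fps" and N
    assume eq: "\<And>l. l < N \<Longrightarrow> fps_nth y l = fps_nth z l"
    show "fps_nth (\<Phi> y) N = fps_nth (\<Phi> z) N"
    proof (cases "N = 0")
      case False
      define D where "D = fps_shift N (y - z)"
      have D: "y - z = fps_X ^ N * D" unfolding D_def by (rule fps_cutoff_factor) (simp add: eq)
      have "B y c' - B z c' = (\<Sum>j\<le>c'. a j ^ (p ^ (c' - j)) * (y - z) ^ (p ^ (Suc c' - j)))"
        by (simp add: B_def fps_frob_diff sum_subtractf right_diff_distrib)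
      also have "fps_nth \<dots> N = 0"
        unfolding fps_sum_nth
      proof (rule sum.neutral, safe)
        fix j assume "j \<le> c'"
        then have lt: "N < N * p ^ (Suc c' - j)" using ex[of j] False by simp
        have "a j ^ (p ^ (c' - j)) * (y - z) ^ (p ^ (Suc c' - j)) =
            fps_X ^ (N * p ^ (Suc c' - j)) * (a j ^ (p ^ (c' - j)) * D ^ (p ^ (Suc c' - j)))"
          unfolding D power_mult_distrib power_mult by (simp only: mult_ac)
        then show "fps_nth (a j ^ (p ^ (c' - j)) * (y - z) ^ (p ^ (Suc c' - j))) N = 0"
          using lt by (simp only: fps_X_power_mult_nth if_True)
      qed
      finally show ?thesis using False by (simp add: \<Phi>_def)
    qed (simp add: \<Phi>_def)
  qed
  then obtain y where y: "\<Phi> y = y" by blast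
  have y0: "fps_nth y 0 = t" by (subst y[symmetric]) (simp add: \<Phi>_def)
  have "fps_nth (B y c') 0 = t"
    by (simp add: B_def fps_sum_nth pw y0 al_def[symmetric] sumt)
  moreover have "fps_nth y N = fps_nth (B y c') N" if "N \<noteq> 0" for N
    using that by (subst y[symmetric]) (simp add: \<Phi>_def)
  ultimately have By: "B y c' = y" using y0 by (intro fps_ext) metis
  have step: "B y (Suc i) = y ^ p * a (Suc i) + B y i ^ p" for i
  proof -
    have "B y i ^ p = (\<Sum>j\<le>i. a j ^ (p ^ (Suc i - j)) * y ^ (p ^ (Suc (Suc i) - j)))"
      unfolding B_def fps_frob_sum
      by (rule sum.cong[OF refl]) (simp add: power_mult_distrib power_mult[symmetric] mult.commute Suc_diff_le)
    then show ?thesis by (simp add: B_def mult.commute)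
  qed
  show ?thesis
  proof (intro exI[of _ "B y"] conjI allI)
    show "B y c' \<noteq> 0" using y0 t0 unfolding By by auto
    fix i show "B y c' ^ p * a i + (if i = 0 then 0 else B y (i - 1) ^ p) = B y i"
      unfolding By by (cases i) (simp_all add: step, simp add: B_def mult.commute)
  qed
qed


section \<open>The Lie algebra in the basis of the cyclic vector, and evaluation of points at
  it\<close>

locale hw_data = laurent \<iota> p + S: lie_setup "laurent.J \<iota>" H p
  for \<iota> :: "'k::alg_closed_field fls \<Rightarrow> 'l::alg_closed_field" and p and H +
  fixes c' :: nat and v :: "'k fps vec" and a :: "nat \<Rightarrow> 'k fps"
  assumes exponent: "\<And>F. S.L.is_point F \<Longrightarrow> F [^]\<^bsub>S.L.pts\<^esub> p = \<one>\<^bsub>S.L.pts\<^esub>"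
    and conn: "connected_space (zariski (coord_ring H))"
    and v: "v \<in> S.Lie"
    and expand: "\<And>x. x \<in> S.Lie \<Longrightarrow>
      \<exists>b. \<forall>k<rnk H. x $ k = (\<Sum>i<Suc c'. b i * (v [^]\<^bsub>coord_ring H\<^esub> (p ^ i)) $ k)"
    and indep: "\<And>b i. \<forall>k<rnk H. (\<Sum>i<Suc c'. b i * (v [^]\<^bsub>coord_ring H\<^esub> (p ^ i)) $ k) = 0 \<Longrightarrow> i < Suc c' \<Longrightarrow> b i = 0"
    and rel: "\<And>k. k < rnk H \<Longrightarrow> (v [^]\<^bsub>coord_ring H\<^esub> (p ^ Suc c')) $ k =
      (\<Sum>i<Suc c'. a i * (v [^]\<^bsub>coord_ring H\<^esub> (p ^ i)) $ k)"
    and a0: "a 0 \<noteq> 0"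
begin

abbreviation nn where "nn \<equiv> rnk H"
abbreviation V where "V i \<equiv> v [^]\<^bsub>coord_ring H\<^esub> (p ^ i)"

lemma vc: "v \<in> carrier_vec nn" using v S.Lie_carrier by auto

lemma Vc: "V i \<in> carrier_vec nn" using vc by simp

lemma VL: "V i \<in> S.Lie" by (rule S.Lie_frob_iter[OF v])

lemma evJ_lincomb:
  assumes "x \<in> carrier_vec nn" "\<forall>k<nn. x $ k = (\<Sum>i<m. b i * V i $ k)"
  shows "S.evJ F x = (\<Sum>i<m. J (b i) * S.evJ F (V i))"
proof -
  have "S.evJ F x = (\<Sum>k<nn. \<Sum>i<m. J (b i) * (J (V i $ k) * F $ k))"
    using assms by (simp add: S.evJ_sum Jh.hom_sum Jh.hom_mult sum_distrib_right mult.assoc)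
  also have "\<dots> = (\<Sum>i<m. \<Sum>k<nn. J (b i) * (J (V i $ k) * F $ k))" by (rule sum.swap)
  also have "\<dots> = (\<Sum>i<m. J (b i) * S.evJ F (V i))"
    by (simp only: S.evJ_sum[OF Vc] sum_distrib_left)
  finally show ?thesis .
qed

lemma evJ_V: "S.L.is_point F \<Longrightarrow> S.evJ F (V i) = S.evJ F v ^ (p ^ i)"
  by (rule S.evJ_pow[OF _ vc])

lemma evJ_root:
  assumes F: "S.L.is_point F"
  shows "S.evJ F v ^ (p ^ Suc c') = (\<Sum>i<Suc c'. J (a i) * S.evJ F v ^ (p ^ i))"
proof -
  have "S.evJ F (V (Suc c')) = (\<Sum>i<Suc c'. J (a i) * S.evJ F (V i))"
    by (rule evJ_lincomb[OF Vc]) (use rel in blast)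
  then show ?thesis by (simp only: evJ_V[OF F])
qed

definition comb :: "(nat \<Rightarrow> 'k fps) \<Rightarrow> nat \<Rightarrow> 'k fps vec" where
  "comb b m = vec nn (\<lambda>k. \<Sum>i<m. b i * V i $ k)"

lemma comb_Lie: "comb b m \<in> S.Lie"
proof (induction m)
  case 0
  have "comb b 0 = 0\<^sub>v nn" by (rule eq_vecI) (auto simp: comb_def)
  then show ?case using S.Lie_zero by simp
next
  case (Suc m)
  have "comb b (Suc m) = comb b m + b m \<cdot>\<^sub>v V m"
    using carrier_vecD[OF Vc[of m]] by (intro eq_vecI) (auto simp: comb_def)
  then show ?case using S.Lie_add[OF Suc S.Lie_smult[OF VL]] by simp
qed

lemma frob_comb:
  assumes k: "k < nn"
  shows "(comb b (Suc c') [^]\<^bsub>coord_ring H\<^esub> p) $ k =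
    (\<Sum>i<Suc c'. (b c' ^ p * a i + (if i = 0 then 0 else b (i - 1) ^ p)) * V i $ k)"
proof -
  let ?bs = "map V [0..<Suc c']"
  have len: "length ?bs = Suc c'" by simp
  have bsC: "set ?bs \<subseteq> carrier_vec nn" using Vc by auto
  have nth: "?bs ! i = V i" if "i < Suc c'" for i using that by (simp del: upt_Suc)
  define bv where "bv = vec (Suc c') b"
  have bv: "bv \<in> carrier_vec (length ?bs)" by (simp add: bv_def)
  have "comb b (Suc c') = lincomb_list nn ?bs bv"
  proof (rule eq_vecI)
    fix l assume "l < dim_vec (lincomb_list nn ?bs bv)"
    then have l: "l < nn" by simp
    show "comb b (Suc c') $ l = lincomb_list nn ?bs bv $ l"
      unfolding lincomb_list_index[OF l bv] len comb_def index_vec[OF l]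
      by (intro sum.cong refl) (simp add: nth bv_def del: upt_Suc)
  qed (simp add: comb_def)
  then have "comb b (Suc c') [^]\<^bsub>coord_ring H\<^esub> p =
      lincomb_list nn (map (\<lambda>x. x [^]\<^bsub>coord_ring H\<^esub> p) ?bs) (map_vec (\<lambda>x. x ^ p) bv)"
    using S.lincomb_frob[OF bsC bv] by simp
  then have "(comb b (Suc c') [^]\<^bsub>coord_ring H\<^esub> p) $ k = (\<Sum>i<Suc c'. b i ^ p * (V i [^]\<^bsub>coord_ring H\<^esub> p) $ k)"
    using k by (simp only:) (subst lincomb_list_index, simp, simp add: bv_def, simp add: bv_def nth del: upt_Suc sum.lessThan_Suc)
  also have "\<dots> = (\<Sum>i<Suc c'. b i ^ p * V (Suc i) $ k)"
    using vc by (simp add: S.A.nat_pow_pow mult.commute)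
  \<comment> \<open>The top term involves phi^c v, which \<open>rel\<close> writes back in the
    basis.\<close>
  also have "\<dots> = (\<Sum>i<c'. b i ^ p * V (Suc i) $ k) + b c' ^ p * (\<Sum>i<Suc c'. a i * V i $ k)"
    using rel[OF k] by simp
  also have "(\<Sum>i<c'. b i ^ p * V (Suc i) $ k) = (\<Sum>i<Suc c'. (if i = 0 then 0 else b (i - 1) ^ p) * V i $ k)"
    by (subst sum.lessThan_Suc_shift) simp
  also have "\<dots> + b c' ^ p * (\<Sum>i<Suc c'. a i * V i $ k) =
      (\<Sum>i<Suc c'. (b c' ^ p * a i + (if i = 0 then 0 else b (i - 1) ^ p)) * V i $ k)"
    unfolding sum_distrib_left sum.distrib[symmetric] by (intro sum.cong refl) (simp add: algebra_simps)
  finally show ?thesis .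
qed

lemma Lie_comb: "x \<in> S.Lie \<Longrightarrow> \<exists>b. x = comb b (Suc c')"
proof -
  assume x: "x \<in> S.Lie"
  obtain b where b: "\<forall>k<nn. x $ k = (\<Sum>i<Suc c'. b i * V i $ k)" using expand[OF x] by blast
  have "x = comb b (Suc c')"
    by (rule eq_vecI) (use b x S.Lie_carrier in \<open>auto simp: comb_def simp del: sum.lessThan_Suc\<close>)
  then show ?thesis by (rule exI[of _ b])
qed

lemma comb_zero: "comb b (Suc c') = 0\<^sub>v nn \<Longrightarrow> i < Suc c' \<Longrightarrow> b i = 0"
proof (rule indep)
  assume z: "comb b (Suc c') = 0\<^sub>v nn"
  show "\<forall>k<nn. (\<Sum>i<Suc c'. b i * V i $ k) = 0"
  proof (intro allI impI)
    fix k assume k: "k < nn"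
    have "comb b (Suc c') $ k = 0" unfolding z using k by simp
    then show "(\<Sum>i<Suc c'. b i * V i $ k) = 0" using k by (simp add: comb_def)
  qed
qed

text \<open>The coefficient of phi x at v is b_{c'}^p a_0. Its vanishing gives b_{c'} = 0, since a_0
  is nonzero, and the other coefficients of phi x reduce to the p-th powers of the remaining
  b_i.\<close>

lemma frob_inj_Lie:
  assumes x: "x \<in> S.Lie" and 0: "x [^]\<^bsub>coord_ring H\<^esub> p = 0\<^sub>v nn"
  shows "x = 0\<^sub>v nn"
proof -
  obtain b where b: "x = comb b (Suc c')" using Lie_comb[OF x] ..
  define e where "e i = b c' ^ p * a i + (if i = 0 then 0 else b (i - 1) ^ p)" for i
  have "comb e (Suc c') = 0\<^sub>v nn"
  proof (rule eq_vecI)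
    fix k assume "k < dim_vec (0\<^sub>v nn :: 'k fps vec)"
    then have k: "k < nn" by simp
    have "comb e (Suc c') $ k = (x [^]\<^bsub>coord_ring H\<^esub> p) $ k"
      using k unfolding b frob_comb[OF k] by (simp add: comb_def e_def)
    then show "comb e (Suc c') $ k = 0\<^sub>v nn $ k" by (simp add: 0)
  qed (simp add: comb_def)
  then have e: "e i = 0" if "i < Suc c'" for i using comb_zero that by blast
  have p0: "p > 0" using prime_gt_0_nat[OF p] .
  have bc: "b c' = 0" using e[of 0] a0 p0 by (simp add: e_def)
  have "b i = 0" if "i < Suc c'" for i
  proof (cases "i = c'")
    case False
    then have "e (Suc i) = 0" using that by (intro e) simp
    then show ?thesis using bc p0 by (simp add: e_def power_0_left)
  qed (simp add: bc)
  then show ?thesis unfolding b by (intro eq_vecI) (simp_all add: comb_def)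
qed

text \<open>By \<open>frob_inj_Lie\<close> the iterated Frobenius powers of x stay nonzero, also
  over L because \<open>J\<close> is injective. So x is not nilpotent there, and the Nullstellensatz
  applies.\<close>

lemma exists_nonzero_point:
  assumes x: "x \<in> S.Lie" "x \<noteq> 0\<^sub>v nn"
  shows "\<exists>F. S.L.is_point F \<and> S.evJ F x \<noteq> 0"
proof -
  have xc: "x \<in> carrier_vec nn" using x(1) S.Lie_carrier by auto
  have nz: "x [^]\<^bsub>coord_ring H\<^esub> (p ^ N) \<noteq> 0\<^sub>v nn" for N
  proof (induction N)
    case (Suc N)
    have "x [^]\<^bsub>coord_ring H\<^esub> (p ^ Suc N) = (x [^]\<^bsub>coord_ring H\<^esub> (p ^ N)) [^]\<^bsub>coord_ring H\<^esub> p"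
      using xc by (simp add: S.A.nat_pow_pow mult.commute)
    then show ?case using Suc frob_inj_Lie[OF S.Lie_frob_iter[OF x(1), of N]] by auto
  qed (use x xc in simp)
  have "map_vec J x [^]\<^bsub>coord_ring S.HL\<^esub> m \<noteq> 0\<^sub>v nn" for m :: nat
  proof
    assume 0: "map_vec J x [^]\<^bsub>coord_ring S.HL\<^esub> m = 0\<^sub>v nn"
    have "m \<le> p ^ m" using prime_gt_1_nat[OF p] by (simp add: less_imp_le power_gt_expt)
    then obtain j where j: "p ^ m = m + j" using le_Suc_ex by blast
    have "map_vec J (x [^]\<^bsub>coord_ring H\<^esub> (p ^ m)) = 0\<^sub>v nn"
      using xc 0 by (simp add: S.map_pow j S.L.B.nat_pow_mult[symmetric])
    moreover have "x [^]\<^bsub>coord_ring H\<^esub> (p ^ m) \<in> carrier_vec nn" using xc by simp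
    ultimately have "x [^]\<^bsub>coord_ring H\<^esub> (p ^ m) = 0\<^sub>v nn"
      by (intro eq_vecI) (auto simp: vec_eq_iff J_zero_iff)
    then show False using nz by blast
  qed
  then show ?thesis
    unfolding S.evJ_def using S.L.nullstellensatz[OF S.LC.ac, of "map_vec J x"] xc by auto
qed

text \<open>On \<open>Lie\<close> a point is determined by its value at v. A primitive element over
  L is a combination of slices along a K-basis of L. The equations of primitivity have coefficients
  in A, so they hold slice by slice, and each slice times a power of pi comes from
  \<open>Lie\<close>. Thus the two points agree on all primitive elements, which separate
  points.\<close>

lemma evJ_injective:
  assumes F: "S.L.is_point F" and F': "S.L.is_point F'" and eq: "S.evJ F v = S.evJ F' v"
  shows "F = F'"
proof (rule S.LC.primitives_separate_points[OF exponent F F'])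
  fix y assume y: "S.L.prim y"
  have Lie_eq: "S.evJ F x = S.evJ F' x" if xL: "x \<in> S.Lie" for x
  proof -
    obtain b where b: "\<forall>k<nn. x $ k = (\<Sum>i<Suc c'. b i * V i $ k)" using expand[OF xL] by blast
    have xc: "x \<in> carrier_vec nn" using xL S.Lie_carrier by auto
    show ?thesis
      unfolding evJ_lincomb[OF xc b] evJ_V[OF F] evJ_V[OF F'] eq ..
  qed
  \<comment> \<open>A basis of L over K; below, \<open>r x b\<close> is the coefficient of x at the
    basis element b.\<close>
  define D where "D = vs.extend_basis {}"
  have D: "vs.independent D" "vs.span D = UNIV"
    unfolding D_def by (simp_all add: vs.independent_extend_basis vs.independent_empty vs.span_extend_basis)
  define r where "r x = vs.representation D x" for x
  have rfin: "finite {b. r x b \<noteq> 0}" for x unfolding r_def by (rule vs.finite_representation)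
  have rsum: "(\<Sum>b | r x b \<noteq> 0. \<iota> (r x b) * b) = x" for x
    unfolding r_def by (rule vs.sum_nonzero_representation_eq[OF D(1)]) (simp add: D(2))
  have radd: "r (x + x') b = r x b + r x' b" for x x' b
    unfolding r_def using vs.representation_add[OF D(1), of x x'] D(2) by (simp add: add.commute)
  have rsc: "r (\<iota> s * x) b = s * r x b" for s x b
    unfolding r_def using vs.representation_scale[OF D(1), of x s] D(2) by simp
  have rsums: "r (sum f A) b = (\<Sum>i\<in>A. r (f i) b)" for f :: "nat \<Rightarrow> 'l" and A b
  proof (induction A rule: infinite_finite_induct)
    case (infinite A)
    then show ?case using rsc[of 0 0 b] by simp
  next
    case empty
    then show ?case using rsc[of 0 0 b] by simp
  qed (simp add: radd)
  have yc: "y \<in> carrier_vec nn"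
    and ye: "(\<Sum>k<nn. y $ k * J (cml H k i j)) = y $ i * J (unt H j) + J (unt H i) * y $ j"
    if "i < nn" "j < nn" for i j
    using y that by (auto simp: S.prim_entries)
  have ycar: "y \<in> carrier_vec nn" using y by (simp add: S.prim_entries)
  have rJ: "r (x * J s) b = fps_to_fls s * r x b" "r (J s * x) b = fps_to_fls s * r x b" for x s b
    unfolding J_def using rsc[of "fps_to_fls s" x b] by (simp_all add: mult.commute)
  \<comment> \<open>Multiplied by the common denominator pi^N the slice becomes an element of
    \<open>Lie\<close>; the nonzero factor is cancelled afterwards.\<close>
  have slice: "(\<Sum>k<nn. \<iota> (r (y $ k) b) * F $ k) = (\<Sum>k<nn. \<iota> (r (y $ k) b) * F' $ k)" for b
  proof -
    obtain N q where q: "\<forall>k\<in>{..<nn}. fls_X ^ N * r (y $ k) b = fps_to_fls (q k)"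
      using common_denominator[of "{..<nn}" "\<lambda>k. r (y $ k) b"] by auto
    have "vec nn q \<in> S.Lie"
      unfolding S.Lie_entries
    proof (intro conjI allI impI)
      fix i j assume ij: "i < nn" "j < nn"
      have "(\<Sum>k<nn. fps_to_fls (cml H k i j) * r (y $ k) b) =
          fps_to_fls (unt H j) * r (y $ i) b + fps_to_fls (unt H i) * r (y $ j) b"
        using arg_cong[OF ye[OF ij], of "\<lambda>x. r x b"] by (simp add: rsums radd rJ)
      then have "fls_X ^ N * (\<Sum>k<nn. fps_to_fls (cml H k i j) * r (y $ k) b) =
          fls_X ^ N * (fps_to_fls (unt H j) * r (y $ i) b + fps_to_fls (unt H i) * r (y $ j) b)" by simp
      then have e: "(\<Sum>k<nn. fps_to_fls (cml H k i j) * (fls_X ^ N * r (y $ k) b)) =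
          fps_to_fls (unt H j) * (fls_X ^ N * r (y $ i) b) + fps_to_fls (unt H i) * (fls_X ^ N * r (y $ j) b)"
        by (simp only: sum_distrib_left distrib_left mult.left_commute)
      have "J (\<Sum>k<nn. cml H k i j * q k) = J (unt H j * q i + unt H i * q j)"
        using arg_cong[OF e, of \<iota>] q ij
        by (simp add: hom_distribs Jh.hom_sum Jh.hom_mult Jh.hom_add) (simp add: J_def hom_distribs)
      then have "(\<Sum>k<nn. cml H k i j * q k) = unt H j * q i + unt H i * q j" by (simp only: S.J_eq)
      then show "(\<Sum>k<nn. vec nn q $ k * cml H k i j) = vec nn q $ i * unt H j + unt H i * vec nn q $ j"
        using ij by (simp add: mult.commute)
    qed simp
    from Lie_eq[OF this] have "(\<Sum>k<nn. J (q k) * F $ k) = (\<Sum>k<nn. J (q k) * F' $ k)"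
      by (simp add: S.evJ_sum)
    moreover have "J (q k) = \<iota> fls_X ^ N * \<iota> (r (y $ k) b)" if "k < nn" for k
      using q that by (metis J_def hom_mult hom_power lessThan_iff)
    ultimately have "\<iota> fls_X ^ N * (\<Sum>k<nn. \<iota> (r (y $ k) b) * F $ k) =
        \<iota> fls_X ^ N * (\<Sum>k<nn. \<iota> (r (y $ k) b) * F' $ k)"
      by (simp add: sum_distrib_left mult.assoc)
    then show ?thesis by simp
  qed
  define T where "T = (\<Union>k<nn. {b. r (y $ k) b \<noteq> 0})"
  have T: "finite T" unfolding T_def using rfin by auto
  have yk: "y $ k = (\<Sum>b\<in>T. \<iota> (r (y $ k) b) * b)" if "k < nn" for k
    by (subst rsum[symmetric], rule sum.mono_neutral_left) (use T that in \<open>auto simp: T_def\<close>)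
  have "S.L.ev F'' y = (\<Sum>b\<in>T. b * (\<Sum>k<nn. \<iota> (r (y $ k) b) * F'' $ k))" for F''
  proof -
    have "S.L.ev F'' y = (\<Sum>k<nn. y $ k * F'' $ k)" by (simp add: S.L.ev_def)
    also have "\<dots> = (\<Sum>k<nn. \<Sum>b\<in>T. b * (\<iota> (r (y $ k) b) * F'' $ k))"
    proof (rule sum.cong[OF refl])
      fix k assume "k \<in> {..<nn}"
      then have "y $ k * F'' $ k = (\<Sum>b\<in>T. \<iota> (r (y $ k) b) * b) * F'' $ k"
        using arg_cong[OF yk[of k], of "\<lambda>u. u * F'' $ k"] by simp
      then show "y $ k * F'' $ k = (\<Sum>b\<in>T. b * (\<iota> (r (y $ k) b) * F'' $ k))"
        by (simp only: sum_distrib_right) (simp only: mult_ac)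
    qed
    also have "\<dots> = (\<Sum>b\<in>T. \<Sum>k<nn. b * (\<iota> (r (y $ k) b) * F'' $ k))" by (rule sum.swap)
    finally show ?thesis by (simp add: sum_distrib_left)
  qed
  then show "S.L.ev F y = S.L.ev F' y" by (simp add: slice)
qed

lemma point_kernel_prime:
  assumes F: "S.L.is_point F"
  shows "primeideal {x \<in> carrier_vec nn. S.evJ F x = 0} (coord_ring H)" (is "primeideal ?I _")
proof (rule primeidealI)
  have ev0: "S.evJ F (0\<^sub>v nn) = 0" by (simp add: S.evJ_sum)
  have sub: "subgroup ?I (add_monoid (coord_ring H))"
  proof (rule subgroup.intro)
    show "?I \<subseteq> carrier (add_monoid (coord_ring H))" by auto
    show "x \<otimes>\<^bsub>add_monoid (coord_ring H)\<^esub> y \<in> ?I" if "x \<in> ?I" "y \<in> ?I" for x y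
      using that S.evJ_add[of x y F] by simp
    show "\<one>\<^bsub>add_monoid (coord_ring H)\<^esub> \<in> ?I" using ev0 by simp
    show "inv\<^bsub>add_monoid (coord_ring H)\<^esub> x \<in> ?I" if x: "x \<in> ?I" for x
      unfolding a_inv_def[symmetric]
    proof -
      have xc: "x \<in> carrier_vec nn" and x0: "S.evJ F x = 0" using x by auto
      have mc: "\<ominus>\<^bsub>coord_ring H\<^esub> x \<in> carrier_vec nn" using S.A.a_inv_closed[of x] xc by simp
      have "x + (\<ominus>\<^bsub>coord_ring H\<^esub> x) = 0\<^sub>v nn" using S.A.r_neg[of x] xc by simp
      then have "S.evJ F (x + (\<ominus>\<^bsub>coord_ring H\<^esub> x)) = 0" using ev0 by simp
      then have "S.evJ F (\<ominus>\<^bsub>coord_ring H\<^esub> x) = 0" using S.evJ_add[OF xc mc, of F] x0 by simp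
      then show "\<ominus>\<^bsub>coord_ring H\<^esub> x \<in> ?I" using mc by simp
    qed
  qed
  show "ideal ?I (coord_ring H)"
  proof (rule idealI[OF S.A.ring_axioms sub])
    fix a x assume a: "a \<in> ?I" and x: "x \<in> carrier (coord_ring H)"
    have xc: "x \<in> carrier_vec nn" and ac: "a \<in> carrier_vec nn" using a x by auto
    show "x \<otimes>\<^bsub>coord_ring H\<^esub> a \<in> ?I" using S.A.m_closed[of x a] S.evJ_mult[OF F xc ac] a xc by simp
    show "a \<otimes>\<^bsub>coord_ring H\<^esub> x \<in> ?I" using S.A.m_closed[of a x] S.evJ_mult[OF F ac xc] a xc by simp
  qed
  show "cring (coord_ring H)" by (rule S.A.cring_axioms)
  show "carrier (coord_ring H) \<noteq> ?I"
  proof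
    assume "carrier (coord_ring H) = ?I"
    then have "\<one>\<^bsub>coord_ring H\<^esub> \<in> ?I" using S.A.one_closed by simp
    then show False using S.evJ_one[OF F] by simp
  qed
  fix x y assume x: "x \<in> carrier (coord_ring H)" and y: "y \<in> carrier (coord_ring H)"
    and xy: "x \<otimes>\<^bsub>coord_ring H\<^esub> y \<in> ?I"
  have xc: "x \<in> carrier_vec nn" and yc: "y \<in> carrier_vec nn" using x y by auto
  show "x \<in> ?I \<or> y \<in> ?I" using xy S.evJ_mult[OF F xc yc] xc yc by simp
qed

lemma coefficients_vanish:
  assumes m: "m < Suc c'" shows "fps_nth (a m) 0 = 0"
proof (rule ccontr)
  assume am: "fps_nth (a m) 0 \<noteq> 0"
  have p2: "p \<ge> 2" using prime_ge_2_nat[OF p] .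
  obtain b where b: "b c' \<noteq> 0"
    "\<And>i. b c' ^ p * a i + (if i = 0 then 0 else b (i - 1) ^ p) = b i"
    using unit_root_system[of m c' a] m am by auto
  define z where "z = comb b (Suc c')"
  have zL: "z \<in> S.Lie" unfolding z_def by (rule comb_Lie)
  then have zc: "z \<in> carrier_vec nn" using S.Lie_carrier by auto
  have zp: "z [^]\<^bsub>coord_ring H\<^esub> p = z"
  proof (rule eq_vecI)
    have zpc: "z [^]\<^bsub>coord_ring H\<^esub> p \<in> carrier_vec nn" using zc by simp
    show "dim_vec (z [^]\<^bsub>coord_ring H\<^esub> p) = dim_vec z" using zpc zc by auto
    fix k assume "k < dim_vec z"
    then have k: "k < nn" using zc by auto
    show "(z [^]\<^bsub>coord_ring H\<^esub> p) $ k = z $ k"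
      unfolding z_def frob_comb[OF k] b(2) using k by (simp add: comb_def del: sum.lessThan_Suc)
  qed
  have "z \<noteq> 0\<^sub>v nn" using comb_zero[of b c'] b(1) by (auto simp: z_def)
  then obtain F where F: "S.L.is_point F" and t: "S.evJ F z \<noteq> 0" using exists_nonzero_point[OF zL] by blast
  \<comment> \<open>Idempotent because z^p = z. At \<open>F\<close> the value t of z is nonzero with
    t^p = t, so e has value 1 there.\<close>
  define e where "e = z [^]\<^bsub>coord_ring H\<^esub> (p - 1)"
  have ec: "e \<in> carrier_vec nn" using zc by (simp add: e_def)
  have tp: "S.evJ F z ^ p = S.evJ F z" using S.evJ_pow[OF F zc, of p] zp by simp
  have "S.evJ F z ^ (p - 1) * S.evJ F z = S.evJ F z ^ p"
    using p2 by (metis One_nat_def Suc_diff_1 less_le_trans pos2 power_Suc2)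
  then have "S.evJ F z ^ (p - 1) = 1" using tp t by simp
  then have eF: "S.evJ F e = 1" unfolding e_def S.evJ_pow[OF F zc] .
  have ee: "e \<otimes>\<^bsub>coord_ring H\<^esub> e = e"
  proof -
    have "e \<otimes>\<^bsub>coord_ring H\<^esub> e = z [^]\<^bsub>coord_ring H\<^esub> ((p - 1) + (p - 1))"
      unfolding e_def by (rule S.A.nat_pow_mult) (use zc in simp)
    also have "(p - 1) + (p - 1) = p + (p - 2)" using p2 by simp
    also have "z [^]\<^bsub>coord_ring H\<^esub> (p + (p - 2)) = z [^]\<^bsub>coord_ring H\<^esub> p \<otimes>\<^bsub>coord_ring H\<^esub> z [^]\<^bsub>coord_ring H\<^esub> (p - 2)"
      by (rule S.A.nat_pow_mult[symmetric]) (use zc in simp)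
    also have "\<dots> = z [^]\<^bsub>coord_ring H\<^esub> Suc 0 \<otimes>\<^bsub>coord_ring H\<^esub> z [^]\<^bsub>coord_ring H\<^esub> (p - 2)"
      unfolding zp using zc by simp
    also have "\<dots> = z [^]\<^bsub>coord_ring H\<^esub> (Suc 0 + (p - 2))"
      by (rule S.A.nat_pow_mult) (use zc in simp)
    also have "Suc 0 + (p - 2) = p - 1" using p2 by simp
    finally show ?thesis by (simp add: e_def)
  qed
  \<comment> \<open>The unit section. A primitive element is additive on points, hence vanishes
    here, and so does e.\<close>
  define F0 where "F0 = vec nn (cnt S.HL)"
  have F0: "S.L.is_point F0" unfolding F0_def using S.L.cnt_point by simp
  have "S.L.prim (map_vec J z)" using zL S.Lie_iff by blast
  note c = S.L.conv_prim[OF this F0 F0]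
  have "S.L.conv F0 F0 = F0"
    by (subst F0_def) (rule S.L.conv_one[OF S.L.is_point_carrier[OF F0]])
  then have "S.evJ F0 z = S.evJ F0 z + S.evJ F0 z" using c by (simp only: S.evJ_def)
  then have z0: "S.evJ F0 z = 0" by (metis add_cancel_right_right)
  have e0: "S.evJ F0 e = 0"
    unfolding e_def S.evJ_pow[OF F0 zc] z0 using p2 by (simp add: power_0_left)
  show False
    by (rule S.A.connected_spectrum_idempotent[OF conn _ ee point_kernel_prime[OF F] _ point_kernel_prime[OF F0]])
      (use ec eF e0 in simp_all)
qed

end

section \<open>The tame character\<close>

text \<open>P splits into linear factors over the algebraically closed field, so there are no roots
  in the larger field besides the images of these.\<close>

lemma root_of_mapped_poly:
  fixes \<kappa> :: "'k::alg_closed_field \<Rightarrow> 'l::field"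
  assumes \<kappa>: "field_hom \<kappa>" and "P \<noteq> 0" "poly (map_poly \<kappa> P) y = 0"
  shows "\<exists>z. poly P z = 0 \<and> y = \<kappa> z"
proof -
  interpret field_hom \<kappa> by (rule \<kappa>)
  interpret mp: map_poly_inj_idom_hom \<kappa> ..
  show ?thesis
    using assms(2,3)
  proof (induction "degree P" arbitrary: P rule: less_induct)
    case less
    show ?case
    proof (cases "degree P = 0")
      case True
      then obtain a where "P = [:a:]" by (rule degree_eq_zeroE)
      then show ?thesis using less.prems by (simp add: hom_distribs)
    next
      case False
      then obtain z where z: "poly P z = 0" using alg_closed_imp_poly_has_root by blast
      then obtain Q where Q: "P = [:- z, 1:] * Q" using poly_eq_0_iff_dvd by blast
      have Q0: "Q \<noteq> 0" using Q less.prems(1) by auto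
      have deg: "degree Q < degree P" unfolding Q using Q0 by (subst degree_mult_eq) auto
      have "map_poly \<kappa> P = [:- \<kappa> z, 1:] * map_poly \<kappa> Q" unfolding Q mp.hom_mult by (simp add: hom_distribs)
      then have "y = \<kappa> z \<or> poly (map_poly \<kappa> Q) y = 0" using less.prems(2) by auto
      then show ?thesis
      proof
        assume "poly (map_poly \<kappa> Q) y = 0"
        from less.hyps[OF deg Q0 this] show ?thesis unfolding Q by auto
      qed (use z in blast)
    qed
  qed
qed

context laurent begin

abbreviation \<kappa> where "\<kappa> z \<equiv> \<iota> (fls_const z)"

lemma kappa_J: "\<kappa> z = J (fps_const z)" by (simp add: J_def)

lemma kappa_hom: "field_hom (\<lambda>z. \<kappa> z)"
  unfolding kappa_J
  by unfold_locales (simp_all add: Jh.hom_mult[symmetric] Jh.hom_add[symmetric])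

lemma root_of_unity: "d > 0 \<Longrightarrow> y ^ d = 1 \<Longrightarrow> \<exists>z. z ^ d = 1 \<and> y = \<kappa> z"
proof -
  assume d: "d > 0" and y: "y ^ d = 1"
  interpret kh: field_hom "\<lambda>z. \<kappa> z" by (rule kappa_hom)
  interpret kp: map_poly_inj_idom_hom "\<lambda>z. \<kappa> z" ..
  let ?P = "monom 1 d - [:1:] :: 'k poly"
  have "coeff ?P d = 1" using d by (cases d) simp_all
  then have P0: "?P \<noteq> 0" by (metis coeff_0 zero_neq_one)
  have "poly (map_poly (\<lambda>z. \<kappa> z) ?P) y = 0"
    by (simp add: kp.hom_minus kh.map_poly_hom_monom poly_monom y hom_distribs)
  from root_of_mapped_poly[OF kappa_hom P0 this] show ?thesis by (auto simp: poly_monom)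
qed

text \<open>Multiply a monic equation of degree m for u / pi by pi^m and reduce modulo pi: only the
  leading term u^m remains.\<close>

lemma not_integral:
  assumes u: "u \<noteq> 0" shows "\<not> integral_elt \<iota> (\<kappa> u / \<iota> fls_X)"
proof
  assume "integral_elt \<iota> (\<kappa> u / \<iota> fls_X)"
  then obtain q :: "'k fps poly" where q: "lead_coeff q = 1" "poly (map_poly J q) (\<kappa> u / \<iota> fls_X) = 0"
    by (auto simp: integral_elt_def J_def[abs_def])
  let ?m = "degree q" and ?x = "\<kappa> u / \<iota> fls_X"
  have x0: "\<iota> (fls_X :: 'k fls) \<noteq> 0" by simp
  have "poly (map_poly J q) ?x = (\<Sum>i\<le>?m. J (coeff q i) * ?x ^ i)"
  proof -
    have "degree (map_poly J q) = ?m" by (rule degree_map_poly) (simp add: J_zero_iff)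
    then show ?thesis by (simp add: poly_altdef coeff_map_poly)
  qed
  then have "\<iota> fls_X ^ ?m * (\<Sum>i\<le>?m. J (coeff q i) * ?x ^ i) = 0" using q(2) by simp
  moreover have "\<iota> fls_X ^ ?m * (\<Sum>i\<le>?m. J (coeff q i) * ?x ^ i) =
      (\<Sum>i\<le>?m. J (fps_X ^ (?m - i) * (fps_const u ^ i * coeff q i)))"
    unfolding sum_distrib_left
  proof (rule sum.cong[OF refl])
    fix i assume "i \<in> {..?m}"
    then have "\<iota> fls_X ^ ?m = \<iota> fls_X ^ (?m - i) * \<iota> fls_X ^ i" by (simp add: power_add[symmetric])
    then have A: "\<iota> fls_X ^ ?m * ?x ^ i = \<iota> fls_X ^ (?m - i) * \<kappa> u ^ i"
      using x0 by (simp add: power_divide)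
    have JX: "J fps_X = \<iota> fls_X" by (simp add: J_def)
    have "\<iota> fls_X ^ ?m * (J (coeff q i) * ?x ^ i) = J (coeff q i) * (\<iota> fls_X ^ ?m * ?x ^ i)"
      by (rule mult.left_commute)
    also have "\<dots> = J (coeff q i) * (\<iota> fls_X ^ (?m - i) * \<kappa> u ^ i)" by (simp only: A)
    also have "\<dots> = J (fps_X ^ (?m - i) * (fps_const u ^ i * coeff q i))"
      unfolding kappa_J by (simp only: Jh.hom_mult Jh.hom_power JX mult_ac)
    finally show "\<iota> fls_X ^ ?m * (J (coeff q i) * ?x ^ i) = J (fps_X ^ (?m - i) * (fps_const u ^ i * coeff q i))" .
  qed
  ultimately have "J (\<Sum>i\<le>?m. fps_X ^ (?m - i) * (fps_const u ^ i * coeff q i)) = 0"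
    by (simp only: Jh.hom_sum)
  then have "fps_nth (\<Sum>i\<le>?m. fps_X ^ (?m - i) * (fps_const u ^ i * coeff q i)) 0 = 0"
    by (simp only: J_zero_iff fps_zero_nth)
  moreover have "fps_nth (\<Sum>i\<le>?m. fps_X ^ (?m - i) * (fps_const u ^ i * coeff q i)) 0 =
      (\<Sum>i\<le>?m. if i = ?m then u ^ ?m else 0)"
    unfolding fps_sum_nth
    by (rule sum.cong[OF refl]) (use q(1) in \<open>auto simp: fps_X_power_mult_nth fps_const_power\<close>)
  ultimately show False using u by simp
qed

end

section \<open>The tame character on a fixed root of pi\<close>

locale tame_setup = ramified \<iota> p d for \<iota> :: "'k::alg_closed_field fls \<Rightarrow> 'l::alg_closed_field" and p d +
  fixes c :: nat and w :: 'l
  assumes dq: "Suc d = p ^ c" and c1: "c \<ge> 1" and w: "root_pi w"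
begin

lemma w_SS: "w \<in> SS" using root_pi_sep[OF w dq c1] by (simp add: sep_closure_eq)

lemma w0: "w \<noteq> 0" by (rule root_pi_nonzero[OF w])

lemma kappa_inj: "\<kappa> z = \<kappa> z' \<Longrightarrow> z = z'" by (metis eq_iff fls_const_nth)

text \<open>The value of the character of g, computed on the fixed root w. As a relation for single
  automorphisms it is available before \<open>theta\<close>, a description over a whole coset, is
  known to be well defined.\<close>

definition tame_char :: "('l \<Rightarrow> 'l) \<Rightarrow> 'k \<Rightarrow> bool" where
  "tame_char g z \<longleftrightarrow> g \<in> carrier Gal \<and> z ^ d = 1 \<and> g w = \<kappa> z * w"

lemma tame_char_exists: "g \<in> carrier Gal \<Longrightarrow> \<exists>z. tame_char g z"
proof -
  assume g: "g \<in> carrier Gal"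
  have "g w ^ d = \<iota> fls_X"
    using galois_ext_hom(5)[OF g, of w d] galois_ext_hom(4)[OF g w_SS] galois_ext_hom(3)[OF g] w
    by (simp add: root_pi_def)
  then have "(g w / w) ^ d = 1" using w by (simp add: root_pi_def power_divide)
  then obtain z where "z ^ d = 1" "g w / w = \<kappa> z" using root_of_unity d by blast
  then show ?thesis using g w0 by (auto simp: tame_char_def field_simps)
qed

text \<open>Two d-th roots of pi differ by a root of unity, which lies in k and is therefore fixed
  by g.\<close>

lemma tame_char_root:
  assumes g: "tame_char g z" and r: "r \<in> SS" "r ^ d = \<iota> fls_X" shows "g r / r = \<kappa> z"
proof -
  have gG: "g \<in> carrier Gal" using g by (simp add: tame_char_def)
  have "(r / w) ^ d = 1" using r w by (simp add: root_pi_def power_divide)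
  then obtain y where y: "r / w = \<kappa> y" using root_of_unity d by blast
  then have ry: "r = \<kappa> y * w" using w0 by (simp add: field_simps)
  have "\<kappa> y \<in> SS" using sep_const by (simp add: sep_closure_eq)
  then have "g r = \<kappa> y * (\<kappa> z * w)"
    unfolding ry using g GalD(4)[OF gG _ w_SS] GalD(5)[OF gG] by (simp add: tame_char_def)
  moreover have "r \<noteq> 0" using r(2) d by (auto simp: power_0_left)
  ultimately show ?thesis by (simp add: ry field_simps)
qed

lemma Gal_mult: "g \<in> carrier Gal \<Longrightarrow> g' \<in> carrier Gal \<Longrightarrow> g \<otimes>\<^bsub>Gal\<^esub> g' = compose SS g g'"
  by (simp add: abs_galois_def BijGroup_def)

text \<open>The value of g' is a constant fixed by g, so the factors picked up by w
  multiply.\<close>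

lemma tame_char_mult:
  assumes g: "tame_char g z" and g': "tame_char g' z'"
  shows "tame_char (g \<otimes>\<^bsub>Gal\<^esub> g') (z * z')"
proof -
  have G: "g \<in> carrier Gal" "g' \<in> carrier Gal" using g g' by (simp_all add: tame_char_def)
  note D = GalD[OF G(1)] and D' = GalD[OF G(2)]
  have SSI: "g' x \<in> SS" if "x \<in> SS" for x using D'(1) that by (auto simp: bij_betw_def)
  have cl: "x + y \<in> SS" "x * y \<in> SS" if "x \<in> SS" "y \<in> SS" for x y
    using that sep_closed by (auto simp: sep_closure_eq)
  have k: "\<iota> a \<in> SS" for a using sep_const by (simp add: sep_closure_eq)
  have "compose SS g g' \<in> carrier Gal"
    using bij_betw_compose[OF D'(1) D(1)] k
    by (simp add: abs_galois_def Bij_def compose_eq cl SSI D(3-5) D'(3-5))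
  moreover have "compose SS g g' w = \<kappa> (z * z') * w"
  proof -
    interpret kh: field_hom "\<lambda>z. \<kappa> z" by (rule kappa_hom)
    have "compose SS g g' w = g (g' w)" by (simp only: compose_eq[OF w_SS])
    also have "g' w = \<kappa> z' * w" using g' by (simp only: tame_char_def)
    also have "g (\<kappa> z' * w) = \<kappa> z' * g w" by (simp only: D(4)[OF k w_SS] D(5))
    also have "g w = \<kappa> z * w" using g by (simp only: tame_char_def)
    finally show ?thesis by (simp only: kh.hom_mult mult_ac)
  qed
  ultimately show ?thesis
    using g g' by (simp add: Gal_mult[OF G] tame_char_def power_mult_distrib)
qed

text \<open>Here g w / w - 1 is the constant z - 1, and by \<open>not_integral\<close> a nonzero
  constant does not have positive valuation.\<close>

lemma wild_tame_char: assumes g: "g \<in> wild_inertia \<iota>" shows "tame_char g 1"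
proof -
  have G: "g \<in> carrier Gal" using g by (simp add: wild_inertia_def)
  obtain z where z: "tame_char g z" using tame_char_exists[OF G] by blast
  have "pos_val \<iota> (g w / w - 1)" using g w_SS w0 by (simp add: wild_inertia_def)
  moreover have "g w / w - 1 = \<kappa> (z - 1)"
    using tame_char_root[OF z w_SS] w by (simp add: root_pi_def hom_distribs flip: fls_minus_const)
  ultimately obtain n where n: "n > 0" "integral_elt \<iota> (\<kappa> (z - 1) ^ n / \<iota> fls_X)" by (auto simp: pos_val_def)
  then have "integral_elt \<iota> (\<kappa> ((z - 1) ^ n) / \<iota> fls_X)" by (simp add: hom_power[symmetric] fls_const_power)
  then have "(z - 1) ^ n = 0" using not_integral by blast
  then show ?thesis using z by simp
qed

text \<open>It makes the cosets of the wild inertia group nonempty, as uniqueness in the description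
  of \<open>theta\<close> requires.\<close>

lemma one_wild: "restrict id SS \<in> wild_inertia \<iota>"
proof -
  have "restrict id SS \<in> carrier Gal" by (rule restrict_in_Gal) simp_all
  moreover have "pos_val \<iota> (0 :: 'l)"
    unfolding pos_val_def integral_elt_def
    by (intro exI[of _ 1] conjI exI[of _ "[:0, 1:]"]) (simp_all add: map_poly_pCons)
  ultimately show ?thesis by (simp add: wild_inertia_def)
qed

lemma coset_char:
  assumes g: "tame_char g z"
  shows "wild_inertia \<iota> #>\<^bsub>Gal\<^esub> g \<in> carrier (tame_inertia \<iota>)"
    and "wild_inertia \<iota> #>\<^bsub>Gal\<^esub> g \<noteq> {}"
    and "g' \<in> wild_inertia \<iota> #>\<^bsub>Gal\<^esub> g \<Longrightarrow> tame_char g' z"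
proof -
  have G: "g \<in> carrier Gal" using g by (simp add: tame_char_def)
  show "wild_inertia \<iota> #>\<^bsub>Gal\<^esub> g \<in> carrier (tame_inertia \<iota>)"
    using G by (auto simp: tame_inertia_def FactGroup_def RCOSETS_def)
  show "wild_inertia \<iota> #>\<^bsub>Gal\<^esub> g \<noteq> {}" using one_wild by (auto simp: r_coset_def)
  assume "g' \<in> wild_inertia \<iota> #>\<^bsub>Gal\<^esub> g"
  then obtain h where h: "h \<in> wild_inertia \<iota>" "g' = h \<otimes>\<^bsub>Gal\<^esub> g" by (auto simp: r_coset_def)
  show "tame_char g' z" using tame_char_mult[OF wild_tame_char[OF h(1)] g] h(2) by simp
qed

lemma tame_inertia_char:
  assumes "\<tau> \<in> carrier (tame_inertia \<iota>)"
  shows "\<exists>z. z ^ d = 1 \<and> \<tau> \<noteq> {} \<and> (\<forall>g\<in>\<tau>. tame_char g z)"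
proof -
  obtain g where g: "g \<in> carrier Gal" "\<tau> = wild_inertia \<iota> #>\<^bsub>Gal\<^esub> g"
    using assms by (auto simp: tame_inertia_def FactGroup_def RCOSETS_def)
  obtain z where z: "tame_char g z" using tame_char_exists[OF g(1)] by blast
  show ?thesis
    using coset_char(2,3)[OF z] z unfolding g(2) tame_char_def by blast
qed

lemma theta_eq:
  assumes "\<tau> \<noteq> {}" and ch: "\<And>g. g \<in> \<tau> \<Longrightarrow> tame_char g z"
  shows "theta \<iota> d \<tau> = z"
  unfolding theta_def
proof (rule the_equality)
  show "\<forall>g\<in>\<tau>. \<forall>r\<in>SS. r ^ d = \<iota> fls_X \<longrightarrow> g r / r = \<kappa> z" using ch tame_char_root by blast
  fix z' assume z': "\<forall>g\<in>\<tau>. \<forall>r\<in>SS. r ^ d = \<iota> fls_X \<longrightarrow> g r / r = \<kappa> z'"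
  obtain g where g: "g \<in> \<tau>" using assms(1) by blast
  have "g w / w = \<kappa> z'" using z' g w_SS w by (simp add: root_pi_def)
  moreover have "g w / w = \<kappa> z" using tame_char_root[OF ch[OF g] w_SS] w by (simp add: root_pi_def)
  ultimately show "z' = z" using kappa_inj by metis
qed

lemma theta_tame_char:
  assumes "\<tau> \<in> carrier (tame_inertia \<iota>)" "g \<in> \<tau>" shows "tame_char g (theta \<iota> d \<tau>)"
  using tame_inertia_char[OF assms(1)] theta_eq assms(2) by metis

lemma root_iff: "z ^ d = 1 \<longleftrightarrow> z \<noteq> 0 \<and> z ^ (p ^ c) = (z :: 'k)"
  using d unfolding dq[symmetric] by (auto simp: power_0_left)

lemma units_finite_subfield:
  "carrier (units_of (finite_subfield (p ^ c))) = {z :: 'k. z ^ d = 1}"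
proof -
  have "\<exists>y. y ^ (p ^ c) = y \<and> y * z = 1 \<and> z * y = 1" if "z \<noteq> 0" "z ^ (p ^ c) = z" for z :: 'k
    by (rule exI[of _ "inverse z"]) (use that in \<open>simp add: power_inverse\<close>)
  then show ?thesis
    by (auto simp: root_iff units_of_def Units_def finite_subfield_def ring_of_type_algebra_def)
qed

text \<open>The element z w is again a d-th root of pi, hence conjugate to w by
  \<open>conjugate_roots\<close>.\<close>

lemma tame_automorphism:
  assumes z: "z ^ d = 1"
  shows "\<exists>h. bij h \<and> (\<forall>x y. h (x + y) = h x + h y) \<and> (\<forall>x y. h (x * y) = h x * h y) \<and>
    (\<forall>a. h (\<iota> a) = \<iota> a) \<and> h w = \<kappa> z * w"
proof (rule extend_automorphism)
  have "\<kappa> z ^ d = 1" using z by (simp add: fls_const_power[symmetric] flip: hom_power)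
  then have "root_pi (\<kappa> z * w)" using w by (simp add: root_pi_def power_mult_distrib)
  then show "pl P w = 0 \<Longrightarrow> pl P (\<kappa> z * w) = 0" for P by (rule conjugate_roots[OF w])
qed

text \<open>Multiplicativity comes from \<open>tame_char_mult\<close> on representatives. For
  surjectivity, an automorphism moving w to z w restricts to the separable closure, and its coset
  has value z.\<close>

lemma theta_epi: "theta \<iota> d \<in> epi (tame_inertia \<iota>) (units_of (finite_subfield (p ^ c)))"
proof -
  have im: "theta \<iota> d \<tau> ^ d = 1" if "\<tau> \<in> carrier (tame_inertia \<iota>)" for \<tau>
    using theta_tame_char[OF that] tame_inertia_char[OF that] unfolding tame_char_def by blast
  have mult: "theta \<iota> d (\<tau> <#>\<^bsub>Gal\<^esub> \<tau>') = theta \<iota> d \<tau> * theta \<iota> d \<tau>'"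
    if t: "\<tau> \<in> carrier (tame_inertia \<iota>)" "\<tau>' \<in> carrier (tame_inertia \<iota>)" for \<tau> \<tau>'
  proof (rule theta_eq)
    show "\<tau> <#>\<^bsub>Gal\<^esub> \<tau>' \<noteq> {}" using tame_inertia_char[OF t(1)] tame_inertia_char[OF t(2)]
      by (auto simp: set_mult_def)
    fix g assume "g \<in> \<tau> <#>\<^bsub>Gal\<^esub> \<tau>'"
    then obtain h k where hk: "h \<in> \<tau>" "k \<in> \<tau>'" "g = h \<otimes>\<^bsub>Gal\<^esub> k" by (auto simp: set_mult_def)
    show "tame_char g (theta \<iota> d \<tau> * theta \<iota> d \<tau>')"
      unfolding hk(3) by (rule tame_char_mult[OF theta_tame_char[OF t(1) hk(1)] theta_tame_char[OF t(2) hk(2)]])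
  qed
  have sur: "\<exists>\<tau>\<in>carrier (tame_inertia \<iota>). theta \<iota> d \<tau> = z" if z: "z ^ d = 1" for z
  proof -
    obtain h where h: "bij h"
      "\<And>x y. h (x + y) = h x + h y" "\<And>x y. h (x * y) = h x * h y" "\<And>a. h (\<iota> a) = \<iota> a"
      "h w = \<kappa> z * w" using tame_automorphism[OF z] by blast
    have "restrict h SS \<in> carrier Gal" by (rule restrict_in_Gal[OF h(1-4)])
    then have g: "tame_char (restrict h SS) z" using h(5) z w_SS by (simp add: tame_char_def)
    show ?thesis
      using coset_char[OF g] theta_eq by blast
  qed
  have "theta \<iota> d \<in> hom (tame_inertia \<iota>) (units_of (finite_subfield (p ^ c)))"
  proof (rule homI)
    show "theta \<iota> d \<tau> \<in> carrier (units_of (finite_subfield (p ^ c)))" if "\<tau> \<in> carrier (tame_inertia \<iota>)" for \<tau>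
      unfolding units_finite_subfield using im[OF that] by blast
    show "theta \<iota> d (\<tau> \<otimes>\<^bsub>tame_inertia \<iota>\<^esub> \<tau>') = theta \<iota> d \<tau> \<otimes>\<^bsub>units_of (finite_subfield (p ^ c))\<^esub> theta \<iota> d \<tau>'"
      if "\<tau> \<in> carrier (tame_inertia \<iota>)" "\<tau>' \<in> carrier (tame_inertia \<iota>)" for \<tau> \<tau>'
      using mult[OF that]
      by (simp add: tame_inertia_def FactGroup_def units_of_def finite_subfield_def ring_of_type_algebra_def)
  qed
  moreover have "theta \<iota> d ` carrier (tame_inertia \<iota>) = {z. z ^ d = 1}" using im sur by blast
  ultimately show ?thesis by (simp add: epi_def units_finite_subfield)
qed

end


section \<open>Lines over the finite subfield\<close>

lemma finite_subfield_field:
  assumes ch: "CHAR('k::field) = p" and p: "Factorial_Ring.prime p"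
  shows "field (finite_subfield (p ^ c) :: 'k ring)"
proof -
  let ?F = "finite_subfield (p ^ c) :: 'k ring"
  have add: "(x + y) ^ (p ^ c) = x ^ (p ^ c) + y ^ (p ^ c)" for x y :: 'k
    by (rule freshmans_dream') (use ch p in auto)
  have q: "p ^ c > 0" using prime_gt_0_nat[OF p] by simp
  have neg: "(- x) ^ (p ^ c) = - x" if "x ^ (p ^ c) = x" for x :: 'k
    using add[of x "- x"] that prime_gt_0_nat[OF p] by (simp add: power_0_left eq_neg_iff_add_eq_0 add.commute)
  have sm: "carrier ?F = {x. x ^ (p ^ c) = x}" "x \<oplus>\<^bsub>?F\<^esub> y = x + y" "x \<otimes>\<^bsub>?F\<^esub> y = x * y" "\<zero>\<^bsub>?F\<^esub> = 0" "\<one>\<^bsub>?F\<^esub> = 1"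
    for x y by (simp_all add: finite_subfield_def ring_of_type_algebra_def)
  have "cring ?F"
  proof (rule cringI)
    show "abelian_group ?F"
    proof (rule abelian_groupI)
      show "\<exists>y\<in>carrier ?F. y \<oplus>\<^bsub>?F\<^esub> x = \<zero>\<^bsub>?F\<^esub>" if "x \<in> carrier ?F" for x
        by (rule bexI[of _ "- x"]) (use neg that in \<open>simp_all add: sm\<close>)
    qed (use q in \<open>simp_all add: sm add power_0_left ac_simps\<close>)
    show "comm_monoid ?F"
      by (rule comm_monoidI) (simp_all add: sm power_mult_distrib ac_simps)
  qed (simp add: sm distrib_right)
  then interpret cring ?F .
  show ?thesis
  proof (rule cring_fieldI2)
    show "\<exists>b\<in>carrier ?F. a \<otimes>\<^bsub>?F\<^esub> b = \<one>\<^bsub>?F\<^esub>" if "a \<in> carrier ?F" "a \<noteq> \<zero>\<^bsub>?F\<^esub>" for a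
      by (rule bexI[of _ "inverse a"]) (use that in \<open>simp_all add: sm power_inverse\<close>)
  qed (simp add: sm)
qed

text \<open>Each axiom is checked after applying the injective map l, where it becomes an identity
  in k. The element with image 1 spans and is not zero, so the dimension is 1.\<close>

lemma transported_line:
  fixes M :: "'b monoid" and l :: "'b \<Rightarrow> 'k::field"
  assumes ch: "CHAR('k) = p" and p: "Factorial_Ring.prime p"
    and bij: "bij_betw l (carrier M) {t. t ^ (p ^ c) = t}"
    and cl: "\<And>x y. x \<in> carrier M \<Longrightarrow> y \<in> carrier M \<Longrightarrow> x \<otimes>\<^bsub>M\<^esub> y \<in> carrier M"
    and add: "\<And>x y. x \<in> carrier M \<Longrightarrow> y \<in> carrier M \<Longrightarrow> l (x \<otimes>\<^bsub>M\<^esub> y) = l x + l y"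
    and one: "\<one>\<^bsub>M\<^esub> \<in> carrier M" "l \<one>\<^bsub>M\<^esub> = 0"
    and s: "\<And>a x. a ^ (p ^ c) = a \<Longrightarrow> x \<in> carrier M \<Longrightarrow> s a x \<in> carrier M"
      "\<And>a x. a ^ (p ^ c) = a \<Longrightarrow> x \<in> carrier M \<Longrightarrow> l (s a x) = a * l x"
  shows "vectorspace (finite_subfield (p ^ c)) (with_smult M s)"
    and "vectorspace.fin_dim (finite_subfield (p ^ c)) (with_smult M s)"
    and "vectorspace.dim (finite_subfield (p ^ c)) (with_smult M s) = 1"
proof -
  let ?F = "finite_subfield (p ^ c) :: 'k ring" and ?V = "with_smult M s"
  have sm: "carrier ?F = {x. x ^ (p ^ c) = x}" "x \<oplus>\<^bsub>?F\<^esub> y = x + y" "x \<otimes>\<^bsub>?F\<^esub> y = x * y" "\<zero>\<^bsub>?F\<^esub> = 0" "\<one>\<^bsub>?F\<^esub> = 1"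
    for x y by (simp_all add: finite_subfield_def ring_of_type_algebra_def)
  have vm: "carrier ?V = carrier M" "u \<oplus>\<^bsub>?V\<^esub> v = u \<otimes>\<^bsub>M\<^esub> v" "\<zero>\<^bsub>?V\<^esub> = \<one>\<^bsub>M\<^esub>" "a \<odot>\<^bsub>?V\<^esub> u = s a u" for u v a
    by (simp_all add: with_smult_def)
  have inj: "x = y" if "x \<in> carrier M" "y \<in> carrier M" "l x = l y" for x y
    using bij that by (auto simp: bij_betw_def inj_on_def)
  have lq: "l x ^ (p ^ c) = l x" if "x \<in> carrier M" for x using bij that by (auto simp: bij_betw_def)
  have sur: "\<exists>x\<in>carrier M. l x = t" if "t ^ (p ^ c) = t" for t using bij that by (force simp: bij_betw_def)
  interpret F: field ?F by (rule finite_subfield_field[OF ch p])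
  have addF: "(a + b) ^ (p ^ c) = a + b" if "a ^ (p ^ c) = a" "b ^ (p ^ c) = b" for a b :: 'k
    using F.a_closed[of a b] that by (simp add: sm)
  have negF: "(- a) ^ (p ^ c) = - a" if a: "a ^ (p ^ c) = a" for a :: 'k
  proof -
    have aF: "a \<in> carrier ?F" using a by (simp add: sm)
    have "\<ominus>\<^bsub>?F\<^esub> a \<in> carrier ?F" "a \<oplus>\<^bsub>?F\<^esub> (\<ominus>\<^bsub>?F\<^esub> a) = \<zero>\<^bsub>?F\<^esub>" by (rule F.a_inv_closed[OF aF], rule F.r_neg[OF aF])
    then show ?thesis by (simp add: sm add_eq_0_iff)
  qed
  have "abelian_group ?V"
  proof (rule abelian_groupI)
    show "\<exists>y\<in>carrier ?V. y \<oplus>\<^bsub>?V\<^esub> x = \<zero>\<^bsub>?V\<^esub>" if x: "x \<in> carrier ?V" for x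
    proof -
      have xM: "x \<in> carrier M" using x by (simp add: vm)
      obtain y where y: "y \<in> carrier M" "l y = - l x" using sur[OF negF[OF lq[OF xM]]] by blast
      have "y \<otimes>\<^bsub>M\<^esub> x = \<one>\<^bsub>M\<^esub>" by (rule inj) (use xM y in \<open>simp_all add: cl add one\<close>)
      then show ?thesis using y(1) by (auto simp: vm)
    qed
  qed (auto simp: vm cl one add ac_simps intro!: inj)
  moreover have "l (s a x) = a * l x \<and> s a x \<in> carrier M" if "a ^ (p ^ c) = a" "x \<in> carrier M" for a x
    using s that by blast
  ultimately have "module ?F ?V"
    using F.is_cring
    by (intro moduleI) (auto simp: vm sm cl one add s addF power_mult_distrib algebra_simps intro!: inj)
  then show vs: "vectorspace ?F ?V" by (intro vectorspace.intro F.field_axioms)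
  interpret VS: vectorspace ?F ?V by (rule vs)
  obtain x1 where x1: "x1 \<in> carrier M" "l x1 = 1" using sur[of 1] by auto
  have gen: "VS.gen_set {x1}"
  proof
    show "VS.span {x1} \<subseteq> carrier ?V" by (rule VS.span_is_subset2) (use x1 in \<open>simp add: vm\<close>)
    show "carrier ?V \<subseteq> VS.span {x1}"
    proof
      fix x assume "x \<in> carrier ?V"
      then have x: "x \<in> carrier M" by (simp add: vm)
      have sx: "s (l x) x1 \<in> carrier M" using s(1) lq[OF x] x1 by blast
      have "s (l x) x1 = x" by (rule inj) (use sx x x1 s(2) lq[OF x] in simp_all)
      then have "VS.lincomb (\<lambda>_. l x) {x1} = x"
        unfolding VS.lincomb_def using sx x VS.M.r_zero[of x] by (simp add: vm)
      then show "x \<in> VS.span {x1}"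
        unfolding VS.span_def using lq[OF x] by (intro CollectI exI[of _ "\<lambda>_. l x"] exI[of _ "{x1}"]) (simp add: sm)
    qed
  qed
  have A: "finite {x1} \<and> {x1} \<subseteq> carrier ?V \<and> VS.gen_set {x1}" using gen x1 by (simp add: vm)
  then show "VS.fin_dim" unfolding VS.fin_dim_def by blast
  have ng: "\<not> VS.gen_set {}"
  proof
    assume "VS.gen_set {}"
    then have "x1 \<in> VS.span {}" using x1 by (simp add: vm)
    then have "x1 = \<zero>\<^bsub>?V\<^esub>" by (auto simp: VS.span_def VS.lincomb_def)
    then show False using x1 one by (simp add: vm)
  qed
  show "VS.dim = 1"
    unfolding VS.dim_def
  proof (rule Least_equality)
    show "\<exists>A. finite A \<and> card A = 1 \<and> A \<subseteq> carrier ?V \<and> VS.gen_set A" using A by (intro exI[of _ "{x1}"]) simp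
    fix n assume "\<exists>A. finite A \<and> card A = n \<and> A \<subseteq> carrier ?V \<and> VS.gen_set A"
    then obtain A where A: "finite A" "card A = n" "VS.gen_set A" by blast
    then have "A \<noteq> {}" using ng by auto
    then show "1 \<le> n" using A by (metis One_nat_def Suc_leI card_gt_0_iff)
  qed
qed

sublocale hasse_roots \<subseteq> tame_setup \<iota> p d c w
  by unfold_locales (rule dq c1 w)+

section \<open>The Galois action on the points\<close>

locale hw_points = hw_data \<iota> p H c' v a + hasse_roots \<iota> p d "Suc c'" \<alpha> w
  for \<iota> :: "'k::alg_closed_field fls \<Rightarrow> 'l::alg_closed_field" and p and H and c' and v and a and d and \<alpha> and w +
  assumes a\<alpha>: "\<And>i. i < Suc c' \<Longrightarrow> a i = fps_X * \<alpha> i"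
begin

lemma point_eval: "f \<in> carrier S.V \<Longrightarrow> f v = S.evJ (S.Fv f) v"
  by (rule S.point_expand[OF _ vc])

lemma point_hasse_root: assumes f: "f \<in> carrier S.V" shows "hasse_root (f v)"
  unfolding hasse_root_def point_eval[OF f] evJ_root[OF S.Fv_point[OF f]]
  by (rule sum.cong[OF refl]) (simp add: a\<alpha>)

lemma point_inj: "f \<in> carrier S.V \<Longrightarrow> g \<in> carrier S.V \<Longrightarrow> f v = g v \<Longrightarrow> f = g"
proof -
  assume f: "f \<in> carrier S.V" and g: "g \<in> carrier S.V" and eq: "f v = g v"
  have ev: "S.evJ (S.Fv f) v = S.evJ (S.Fv g) v"
    unfolding point_eval[OF f, symmetric] point_eval[OF g, symmetric] by (rule eq)
  have "f = S.fV (S.Fv f)" by (rule S.fV_Fv[OF f, symmetric])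
  also have "S.Fv f = S.Fv g"
    by (rule evJ_injective[OF S.Fv_point[OF f] S.Fv_point[OF g] ev])
  also have "S.fV (S.Fv g) = g" by (rule S.fV_Fv[OF g])
  finally show "f = g" .
qed

lemma point_mult:
  assumes f: "f \<in> carrier S.V" and g: "g \<in> carrier S.V"
  shows "f \<otimes>\<^bsub>S.V\<^esub> g \<in> carrier S.V" "(f \<otimes>\<^bsub>S.V\<^esub> g) v = f v + g v"
proof -
  note P = S.Fv_point[OF f] S.Fv_point[OF g]
  have C: "S.L.is_point (S.L.conv (S.Fv f) (S.Fv g))" by (rule S.L.conv_point[OF P])
  show m: "f \<otimes>\<^bsub>S.V\<^esub> g \<in> carrier S.V" unfolding S.Fv_mult[OF f g] by (rule S.fV_point[OF C])
  have "S.L.prim (map_vec J v)" using v S.Lie_iff by blast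
  note c = S.L.conv_prim[OF this P]
  have "(f \<otimes>\<^bsub>S.V\<^esub> g) v = S.evJ (S.Fv (f \<otimes>\<^bsub>S.V\<^esub> g)) v" by (rule point_eval[OF m])
  also have "S.Fv (f \<otimes>\<^bsub>S.V\<^esub> g) = S.L.conv (S.Fv f) (S.Fv g)" by (simp only: S.Fv_mult[OF f g] S.Fv_fV[OF C])
  finally show "(f \<otimes>\<^bsub>S.V\<^esub> g) v = f v + g v"
    by (simp only: point_eval[OF f] point_eval[OF g] S.evJ_def c)
qed

lemma one_point: "\<one>\<^bsub>S.V\<^esub> \<in> carrier S.V" "\<one>\<^bsub>S.V\<^esub> v = 0"
proof -
  have F0: "S.L.is_point (vec nn (cnt S.HL))" using S.L.cnt_point by simp
  show V: "\<one>\<^bsub>S.V\<^esub> \<in> carrier S.V" unfolding S.V_one by (rule S.fV_point[OF F0])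
  have "S.L.conv (vec nn (cnt S.HL)) (vec nn (cnt S.HL)) = vec nn (cnt S.HL)"
    by (rule S.L.conv_one[OF S.L.is_point_carrier[OF F0]])
  then have "\<one>\<^bsub>S.V\<^esub> \<otimes>\<^bsub>S.V\<^esub> \<one>\<^bsub>S.V\<^esub> = \<one>\<^bsub>S.V\<^esub>"
    unfolding S.Fv_mult[OF V V] unfolding S.V_one S.Fv_fV[OF F0] by (simp only:)
  then have "\<one>\<^bsub>S.V\<^esub> v = \<one>\<^bsub>S.V\<^esub> v + \<one>\<^bsub>S.V\<^esub> v" using point_mult(2)[OF V V] by (simp only:)
  then show "\<one>\<^bsub>S.V\<^esub> v = 0" by (metis add_cancel_right_right)
qed

text \<open>An automorphism over K fixes the image of A, so composing with it preserves linearity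
  over A as well as the ring structure.\<close>

lemma compose_point:
  fixes h :: "'l \<Rightarrow> 'l"
  assumes h: "\<And>x y. h (x + y) = h x + h y" "\<And>x y. h (x * y) = h x * h y" "\<And>a. h (\<iota> a) = \<iota> a"
    and f: "f \<in> carrier S.V"
  shows "compose (elts H) h f \<in> carrier S.V" "compose (elts H) h f v = h (f v)"
proof -
  have h1: "h 1 = 1" using h(3)[of 1] by simp
  have fs: "f (s \<cdot>\<^sub>v x) = J s * f x" if "x \<in> elts H" for s x
    using f that by (auto simp: points_def)
  have fh: "f \<in> Ring.ring_hom (coord_ring H) ring_of_type_algebra" using f by (simp add: points_def)
  have m: "f (x \<otimes>\<^bsub>coord_ring H\<^esub> y) = f x * f y" if "x \<in> elts H" "y \<in> elts H" for x y
    using ring_hom_mult[OF fh, of x y] that by (simp add: ring_of_type_algebra_def)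
  have o: "f \<one>\<^bsub>coord_ring H\<^esub> = 1" using ring_hom_one[OF fh] by (simp add: ring_of_type_algebra_def)
  have cl: "x \<otimes>\<^bsub>coord_ring H\<^esub> y \<in> elts H" if "x \<in> elts H" "y \<in> elts H" for x y
    using S.A.m_closed[of x y] that by simp
  have cl1: "\<one>\<^bsub>coord_ring H\<^esub> \<in> elts H" using S.A.one_closed by simp
  have hs: "h (J s) = J s" for s by (simp add: J_def h(3))
  have "compose (elts H) h f \<in> Ring.ring_hom (coord_ring H) ring_of_type_algebra"
    by (rule ring_hom_memI)
      (simp_all add: compose_def ring_of_type_algebra_def m o cl cl1 S.point_add[OF f] h(1,2) h1)
  then show "compose (elts H) h f \<in> carrier S.V"
    by (simp add: points_def compose_def fs h(2) hs)
  show "compose (elts H) h f v = h (f v)" by (rule compose_eq[OF vc])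
qed

lemma lead_inj: "hasse_root x \<Longrightarrow> hasse_root y \<Longrightarrow> lead x = lead y \<Longrightarrow> x = y"
  using lead_bij by (auto simp: bij_betw_def inj_on_def)

lemma lead_root: "hasse_root x \<Longrightarrow> lead x ^ (p ^ Suc c') = \<beta> * lead x"
  using lead_bij by (auto simp: bij_betw_def)

lemma zero_root: "hasse_root 0" "lead 0 = 0"
proof -
  show z: "hasse_root 0"
    unfolding hasse_root_def using prime_gt_0_nat[OF p] by (simp add: power_0_left del: sum.lessThan_Suc)
  have "lead 0 = lead 0 + lead 0" using lead_add[OF z z] by (simp only: add_0_left)
  then show "lead 0 = 0" by (metis add_cancel_right_right)
qed

lemma v_nonzero: "v \<noteq> 0\<^sub>v nn"
proof
  assume v0: "v = 0\<^sub>v nn"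
  have V0: "V 0 = v" using vc by simp
  have "\<forall>k<nn. (\<Sum>i<Suc c'. (if i = 0 then 1 else 0) * V i $ k) = 0"
  proof (intro allI impI)
    fix k assume k: "k < nn"
    have "(\<Sum>i<Suc c'. (if i = 0 then 1 else 0) * V i $ k) = V 0 $ k"
      by (subst sum.lessThan_Suc_shift) simp
    also have "\<dots> = 0" unfolding V0 v0 using k by simp
    finally show "(\<Sum>i<Suc c'. (if i = 0 then 1 else 0) * V i $ k) = 0" .
  qed
  from indep[OF this, of 0] show False by simp
qed

lemma point_surj:
  assumes x: "hasse_root x" shows "\<exists>f\<in>carrier S.V. f v = x"
proof (cases "x = 0")
  case True
  then show ?thesis using one_point by blast
next
  case False
  obtain F where F: "S.L.is_point F" "S.evJ F v \<noteq> 0" using exists_nonzero_point[OF v v_nonzero] by blast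
  define f where "f = S.fV F"
  have f: "f \<in> carrier S.V" unfolding f_def by (rule S.fV_point[OF F(1)])
  have fv: "f v \<noteq> 0" using F vc by (simp add: f_def S.fV_def)
  have hr: "hasse_root (f v)" by (rule point_hasse_root[OF f])
  have l0: "lead (f v) \<noteq> 0" "lead x \<noteq> 0"
    using lead_inj[OF hr zero_root(1)] lead_inj[OF x zero_root(1)] zero_root(2) fv False by auto
  have ld: "lead y ^ d = \<beta>" if "hasse_root y" "lead y \<noteq> 0" for y
  proof -
    have "lead y ^ Suc d = \<beta> * lead y" using lead_root[OF that(1)] dq by simp
    then show ?thesis using that(2) by simp
  qed
  \<comment> \<open>Both leading coefficients are d-th roots of \<beta>, so their quotient is a d-th
    root of unity and is realized by an automorphism moving w to z w.\<close>
  define z where "z = lead x / lead (f v)"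
  have z: "z ^ d = 1" using ld[OF hr l0(1)] ld[OF x l0(2)] \<alpha>0 by (simp add: z_def power_divide)
  obtain h where h: "\<And>x y. h (x + y) = h x + h y" "\<And>x y. h (x * y) = h x * h y" "\<And>a. h (\<iota> a) = \<iota> a"
    "h w = \<kappa> z * w" using tame_automorphism[OF z] by blast
  note C = compose_point[of h, OF h(1-3) f]
  have "lead (h (f v)) = lead x"
    using hom_hasse_root(2)[of h, OF h(1-3) hr z h(4)] l0 by (simp add: z_def)
  then have "h (f v) = x" by (rule lead_inj[OF hom_hasse_root(1)[of h, OF h(1-3) hr] x])
  then show ?thesis using C by auto
qed

theorem galois_points:
  "(\<forall>g\<in>wild_inertia \<iota>. \<forall>P\<in>carrier S.V. galois_act \<iota> H g P = P) \<and>
    theta \<iota> d \<in> epi (tame_inertia \<iota>) (units_of (finite_subfield (p ^ Suc c'))) \<and>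
    (\<exists>s. vectorspace (finite_subfield (p ^ Suc c')) (with_smult S.V s) \<and>
         vectorspace.fin_dim (finite_subfield (p ^ Suc c')) (with_smult S.V s) \<and>
         vectorspace.dim (finite_subfield (p ^ Suc c')) (with_smult S.V s) = 1 \<and>
         (\<forall>\<tau>\<in>carrier (tame_inertia \<iota>). \<forall>g\<in>\<tau>. \<forall>P\<in>carrier S.V.
            galois_act \<iota> H g P = s (theta \<iota> d \<tau>) P))"
proof -
  obtain b where b: "b ^ d = \<beta>" using nth_root_exists[OF d] by blast
  have b0: "b \<noteq> 0" using b \<alpha>0 d by (auto simp: power_0_left)
  have bq: "b ^ (p ^ Suc c') = \<beta> * b" unfolding dq[symmetric] using b by simp
  \<comment> \<open>Since b^q = \<beta> b, division by b turns the equation t^q = \<beta> t of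
    leading coefficients into t^q = t.\<close>
  define l where "l f = lead (f v) / b" for f :: "'k fps vec \<Rightarrow> 'l"
  have l_root: "l f ^ (p ^ Suc c') = l f" if "f \<in> carrier S.V" for f
    using lead_root[OF point_hasse_root[OF that]] bq \<alpha>0 by (simp add: l_def power_divide)
  have l_inj: "f = g" if "f \<in> carrier S.V" "g \<in> carrier S.V" "l f = l g" for f g
  proof -
    have "lead (f v) = lead (g v)" using that(3) b0 by (simp add: l_def)
    then show ?thesis using lead_inj point_hasse_root point_inj that by blast
  qed
  have bij: "bij_betw l (carrier S.V) {t. t ^ (p ^ Suc c') = t}"
  proof (rule bij_betw_imageI)
    show "inj_on l (carrier S.V)" using l_inj by (auto simp: inj_on_def)
    show "l ` carrier S.V = {t. t ^ (p ^ Suc c') = t}"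
    proof
      show "l ` carrier S.V \<subseteq> {t. t ^ (p ^ Suc c') = t}" using l_root by blast
      show "{t. t ^ (p ^ Suc c') = t} \<subseteq> l ` carrier S.V"
      proof
        fix t :: 'k assume "t \<in> {t. t ^ (p ^ Suc c') = t}"
        then have "t ^ (p ^ Suc c') = t" by blast
        then have "(t * b) ^ (p ^ Suc c') = \<beta> * (t * b)"
          by (simp only: power_mult_distrib bq mult.left_commute)
        then have "t * b \<in> {t. t ^ (p ^ Suc c') = \<beta> * t}" by (rule CollectI)
        then have "t * b \<in> lead ` {x. hasse_root x}" by (simp only: bij_betw_imp_surj_on[OF lead_bij])
        then obtain x where x: "t * b = lead x" "x \<in> {x. hasse_root x}" by (rule imageE)
        then have "hasse_root x" by (simp only: mem_Collect_eq)
        from point_surj[OF this] obtain f where f: "f \<in> carrier S.V" "f v = x" by (rule bexE)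
        have "t = l f" unfolding l_def f(2) x(1)[symmetric] using b0 by simp
        then show "t \<in> l ` carrier S.V" by (rule image_eqI[OF _ f(1)])
      qed
    qed
  qed
  \<comment> \<open>Scalar multiplication is transported from k along l; for scalars in F_q the
    product stays in the image of l.\<close>
  define s where "s a f = inv_into (carrier S.V) l (a * l f)" for a f
  have s: "s a f \<in> carrier S.V" "l (s a f) = a * l f"
    if "a ^ (p ^ Suc c') = a" "f \<in> carrier S.V" for a f
  proof -
    have "(a * l f) ^ (p ^ Suc c') = a * l f" by (simp only: power_mult_distrib that(1) l_root[OF that(2)])
    then have "a * l f \<in> l ` carrier S.V" using bij by (simp add: bij_betw_def)
    then show "s a f \<in> carrier S.V" "l (s a f) = a * l f"
      unfolding s_def by (rule inv_into_into, rule f_inv_into_f)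
  qed
  have act: "galois_act \<iota> H g f \<in> carrier S.V" "l (galois_act \<iota> H g f) = z * l f"
    if g: "tame_char g z" and f: "f \<in> carrier S.V" for g z f
  proof -
    have G: "g \<in> carrier Gal" and z: "z ^ d = 1" and gw: "galois_ext \<iota> g w = \<kappa> z * w"
      using g galois_ext_hom(4)[OF _ w_SS] by (auto simp: tame_char_def)
    note C = compose_point[of "galois_ext \<iota> g", OF galois_ext_hom(1-3)[OF G] f]
    show "galois_act \<iota> H g f \<in> carrier S.V" unfolding galois_act_def by (rule C(1))
    show "l (galois_act \<iota> H g f) = z * l f"
      unfolding galois_act_def l_def C(2)
      using hom_hasse_root(2)[of "galois_ext \<iota> g", OF galois_ext_hom(1-3)[OF G] point_hasse_root[OF f] z gw]
      by simp
  qed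
  \<comment> \<open>A wild element has tame character 1, so it does not change l, which is
    injective.\<close>
  have wild: "galois_act \<iota> H g P = P" if "g \<in> wild_inertia \<iota>" "P \<in> carrier S.V" for g P
    using act[OF wild_tame_char[OF that(1)] that(2)] l_inj that(2) by simp
  have tame: "galois_act \<iota> H g P = s (theta \<iota> d \<tau>) P"
    if t: "\<tau> \<in> carrier (tame_inertia \<iota>)" "g \<in> \<tau>" and P: "P \<in> carrier S.V" for \<tau> g P
  proof -
    note g = theta_tame_char[OF t]
    have q: "theta \<iota> d \<tau> ^ (p ^ Suc c') = theta \<iota> d \<tau>" using g root_iff by (simp add: tame_char_def)
    show ?thesis by (rule l_inj) (use act[OF g P] s[OF q P] in simp_all)
  qed
  have add: "l (f \<otimes>\<^bsub>S.V\<^esub> g) = l f + l g" if "f \<in> carrier S.V" "g \<in> carrier S.V" for f g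
    using point_mult(2)[OF that] lead_add[OF point_hasse_root[OF that(1)] point_hasse_root[OF that(2)]]
    by (simp add: l_def add_divide_distrib)
  have one: "l \<one>\<^bsub>S.V\<^esub> = 0" by (simp add: l_def one_point(2) zero_root(2))
  note line = transported_line[where l = l and s = s and M = S.V and c = "Suc c'",
      OF char_k p bij point_mult(1) add one_point(1) one s]
  show ?thesis
  proof (intro conjI ballI exI[of _ s])
    show "galois_act \<iota> H g P = P" if "g \<in> wild_inertia \<iota>" "P \<in> carrier S.V" for g P
      by (rule wild[OF that])
    show "galois_act \<iota> H g P = s (theta \<iota> d \<tau>) P"
      if "\<tau> \<in> carrier (tame_inertia \<iota>)" "g \<in> \<tau>" "P \<in> carrier S.V" for \<tau> g P
      by (rule tame[OF that])
    show "theta \<iota> d \<in> epi (tame_inertia \<iota>) (units_of (finite_subfield (p ^ Suc c')))" by (rule theta_epi)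
    show "vectorspace (finite_subfield (p ^ Suc c')) (with_smult S.V s)" by (rule line(1))
    show "vectorspace.fin_dim (finite_subfield (p ^ Suc c')) (with_smult S.V s)" by (rule line(2))
    show "vectorspace.dim (finite_subfield (p ^ Suc c')) (with_smult S.V s) = 1" by (rule line(3))
  qed
qed

end

lemma alg_closure_char:
  assumes "is_alg_closure (\<iota> :: 'k::field fls \<Rightarrow> 'l::alg_closed_field)"
  shows "CHAR('l) = CHAR('k)"
proof -
  interpret field_hom \<iota> using assms by (simp add: is_alg_closure_def)
  have iff: "(of_nat m :: 'l) = 0 \<longleftrightarrow> (of_nat m :: 'k) = 0" for m
  proof -
    have "(of_nat m :: 'l) = \<iota> (of_nat m)" by (simp add: hom_distribs)
    also have "\<dots> = \<iota> (fls_const (of_nat m))" by (simp add: fls_of_nat)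
    finally show ?thesis by simp
  qed
  show ?thesis
    by (rule CHAR_eqI) (auto simp: iff of_nat_eq_0_iff_char_dvd)
qed

theorem proposition1p5:
  fixes \<iota> :: "'k::alg_closed_field fls \<Rightarrow> 'l::alg_closed_field"
    and p c :: nat
    and G :: "'k fps bt"
    and V :: "('k fps vec \<Rightarrow> 'l) monoid"
  assumes "CHAR('k) = p" and "p > 0"
    and "is_alg_closure \<iota>"
    and "barsotti_tate p G"
    and "connected_bt G"
    and "hw_cyclic p G"
    and "hasse_invariant p G = 1"
    and "c = bt_dim (serre_dual p G)"
    and "V = points (\<lambda>a. \<iota> (fps_to_fls a)) (lvl G 1)"
  shows "(\<forall>g\<in>wild_inertia \<iota>. \<forall>P\<in>carrier V. galois_act \<iota> (lvl G 1) g P = P) \<and>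
    theta \<iota> (p ^ c - 1) \<in> epi (tame_inertia \<iota>) (units_of (finite_subfield (p ^ c))) \<and>
    (\<exists>s. vectorspace (finite_subfield (p ^ c)) (with_smult V s) \<and>
         vectorspace.fin_dim (finite_subfield (p ^ c)) (with_smult V s) \<and>
         vectorspace.dim (finite_subfield (p ^ c)) (with_smult V s) = 1 \<and>
         (\<forall>\<tau>\<in>carrier (tame_inertia \<iota>). \<forall>g\<in>\<tau>. \<forall>P\<in>carrier V.
            galois_act \<iota> (lvl G 1) g P = s (theta \<iota> (p ^ c - 1) \<tau>) P))"
proof -
  have pr: "Factorial_Ring.prime p" using assms(1,2) prime_CHAR_semidom by blast
  have chl: "CHAR('l) = p" using alg_closure_char[OF assms(3)] assms(1) by simp
  interpret laurent \<iota> p by unfold_locales (use assms(3) chl pr in auto)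
  define H where "H = lvl G 1"
  have gs: "comm_group_scheme H" using assms(4) unfolding barsotti_tate_def H_def by blast
  interpret S: lie_setup J H p
  proof (rule lie_setup.intro)
    show "bialg_points J H" by (rule bialg_points.intro[OF Jh.comm_ring_hom_axioms bialg_ids_group_scheme[OF gs]])
    show "lie_setup_axioms J p" by (rule lie_setup_axioms.intro[OF chl pr]) (simp add: J_zero_iff)
  qed
  obtain v a where va: "v \<in> S.Lie \<and> c \<ge> 1 \<and>
    (\<forall>x\<in>S.Lie. \<exists>b. \<forall>k<rnk H. x $ k = (\<Sum>i<c. b i * (v [^]\<^bsub>coord_ring H\<^esub> (p ^ i)) $ k)) \<and>
    (\<forall>b. (\<forall>k<rnk H. (\<Sum>i<c. b i * (v [^]\<^bsub>coord_ring H\<^esub> (p ^ i)) $ k) = 0) \<longrightarrow> (\<forall>i<c. b i = 0)) \<and>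
    (\<forall>k<rnk H. (v [^]\<^bsub>coord_ring H\<^esub> (p ^ c)) $ k = (\<Sum>i<c. a i * (v [^]\<^bsub>coord_ring H\<^esub> (p ^ i)) $ k)) \<and>
    a 0 \<noteq> 0 \<and> subdegree (a 0) = 1"
    by (rule exE[OF S.hasse_normal_form[OF H_def assms(6,7,8)]], erule exE, rule that)
  note v = va[THEN conjunct1] and va1 = va[THEN conjunct2]
  note c1 = va1[THEN conjunct1] and va2 = va1[THEN conjunct2]
  note expd = va2[THEN conjunct1] and va3 = va2[THEN conjunct2]
  note ind = va3[THEN conjunct1] and va4 = va3[THEN conjunct2]
  note rel = va4[THEN conjunct1] and a0 = va4[THEN conjunct2, THEN conjunct1] va4[THEN conjunct2, THEN conjunct2]
  obtain c' where c': "c = Suc c'" using c1 by (cases c) auto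
  have ex: "F [^]\<^bsub>S.L.pts\<^esub> p = \<one>\<^bsub>S.L.pts\<^esub>" if "S.L.is_point F" for F
    using bt_points_exponent[OF Jh.comm_ring_hom_axioms assms(2,4), of F] that unfolding H_def by simp
  interpret D: hw_data \<iota> p H c' v a
  proof (intro hw_data.intro hw_data_axioms.intro laurent_axioms S.lie_setup_axioms ex v a0(1))
    show "connected_space (zariski (coord_ring H))" using assms(5) by (simp add: connected_bt_def H_def)
    show "\<exists>b. \<forall>k<rnk H. x $ k = (\<Sum>i<Suc c'. b i * (v [^]\<^bsub>coord_ring H\<^esub> (p ^ i)) $ k)" if "x \<in> S.Lie" for x
      using expd[unfolded c', rule_format, OF that] .
    show "b i = 0" if "\<forall>k<rnk H. (\<Sum>i<Suc c'. b i * (v [^]\<^bsub>coord_ring H\<^esub> (p ^ i)) $ k) = 0" "i < Suc c'" for b i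
      using ind[unfolded c'] that by blast
    show "(v [^]\<^bsub>coord_ring H\<^esub> (p ^ Suc c')) $ k = (\<Sum>i<Suc c'. a i * (v [^]\<^bsub>coord_ring H\<^esub> (p ^ i)) $ k)"
      if "k < rnk H" for k
      using rel[unfolded c', rule_format, OF that] .
  qed
  \<comment> \<open>Division by pi, exact for the indices in use by
    \<open>coefficients_vanish\<close>; \<open>\<alpha> 0\<close> is a unit because a_0 has order
    1.\<close>
  define \<alpha> where "\<alpha> i = fps_shift 1 (a i)" for i
  have a\<alpha>: "a i = fps_X * \<alpha> i" if "i < Suc c'" for i
    using fps_cutoff_factor[of 1 "a i"] D.coefficients_vanish[OF that] by (simp add: \<alpha>_def)
  have \<alpha>0: "fps_nth (\<alpha> 0) 0 \<noteq> 0" using a0 by (metis \<alpha>_def add_0 fps_shift_nth nth_subdegree_nonzero)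
  define d where "d = p ^ c - 1"
  have "p ^ c > 1" by (rule one_less_power[OF prime_gt_1_nat[OF pr]]) (use c1 in simp)
  then have d: "d > 0" "Suc d = p ^ Suc c'" by (simp_all add: d_def c')
  obtain w where w: "w ^ d = \<iota> fls_X" using nth_root_exists[OF d(1)] by blast
  interpret R: ramified \<iota> p d by unfold_locales (rule d(1))
  interpret Q: hw_points \<iota> p H c' v a d \<alpha> w
    by unfold_locales (use d \<alpha>0 w a\<alpha> in \<open>simp_all add: R.root_pi_def\<close>)
  have V: "V = points J H" unfolding assms(9) H_def J_def[abs_def] ..
  show ?thesis
    using Q.galois_points unfolding V H_def[symmetric] c' d_def[unfolded c'] .
qed

end
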